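(* Let $1\le t<\min(d,N-d)$ and $w=(t+1,\dots,d,N-t+1,\dots,N)$. Then the determinantal variety $D_t(\mathbb{C})$ (identified with the opposite cell $Y(w)\subseteq X(w)$) is $L_w$-stable and is a spherical $L_w$-variety.
   Context: Everything is over $\mathbb{C}$; $d,N$ are positive integers with $d<N$. $G_{d,N}$ is the Grassmannian of $d$-dimensional subspaces of $\mathbb{C}^N$ with its left $GL_N$-action, embedded in $\mathbb{P}(\bigwedge^d\mathbb{C}^N)$ by the Plücker embedding. $B$ (resp. $B^-$) is the group of upper (resp. lower) triangular matrices in $GL_N$. For $w=(\ell_1<\dots<\ell_d)$ with $1\le\ell_1$, $\ell_d\le N$, the Schubert variety is $X(w)=\overline{B[e_{\ell_1}\wedge\cdots\wedge e_{\ell_d}]}$ with reduced structure. $Q_w\supseteq B$ is the stabilizer of $X(w)$ in $GL_N$ under left multiplication and $L_w$ is its Levi part (the block diagonal Levi subgroup containing the diagonal torus). Let $e_{id}=e_1\wedge\cdots\wedge e_d$. The opposite big cell $B^-[e_{id}]$ is a dense open subset of $G_{d,N}$, identified with the space $M_{N-d,d}(\mathbb{C})$ of $(N-d)\times d$ matrices by sending a matrix $A$ to the column span of the $N\times d$ matrix with upper block the $d\times d$ identity and lower block $A$. The opposite cell in $X(w)$ is $Y(w)=B^-[e_{id}]\cap X(w)$. The determinantal variety $D_t(\mathbb{C})\subseteq M_{N-d,d}(\mathbb{C})$ is the set of matrices of rank $\le t$; under the identification of $M_{N-d,d}(\mathbb{C})$ with $B^-[e_{id}]$ that sends a matrix $A$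 to the column span of the $N\times d$ matrix with upper block the $d\times d$ identity and lower block $A$, $D_t(\mathbb{C})=Y(w)$ for $w=(t+1,\dots,d,N-t+1,\dots,N)$, and here $L_w=GL_d\times GL_{N-d}$. For a connected reductive group $G$ with Borel subgroup $B_G$, an irreducible $G$-variety is a spherical $G$-variety if it is normal and has an open dense $B_G$-orbit. *)

theory Defs
  imports
    "HOL-Analysis.Abstract_Topology"
    "HOL-Algebra.Group_Action"
    "HOL-Algebra.Solvable_Groups"
    "Jordan_Normal_Form.DL_Rank"
    "Jordan_Normal_Form.DL_Submatrix"
begin

section \<open>Polynomial functions and Zariski topologies\<close>

text \<open>The \<open>\<complex>\<close>-algebra of functions generated by a set of coordinate functions.  Over the
  infinite field \<open>\<complex>\<close>, with the usual coordinates, these are the polynomial functions.\<close>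

inductive_set function_algebra :: "('a \<Rightarrow> complex) set \<Rightarrow> ('a \<Rightarrow> complex) set"
  for C :: "('a \<Rightarrow> complex) set" where
  const: "(\<lambda>_. c) \<in> function_algebra C"
| coord: "f \<in> C \<Longrightarrow> f \<in> function_algebra C"
| add: "f \<in> function_algebra C \<Longrightarrow> g \<in> function_algebra C \<Longrightarrow> (\<lambda>x. f x + g x) \<in> function_algebra C"
| mult: "f \<in> function_algebra C \<Longrightarrow> g \<in> function_algebra C \<Longrightarrow> (\<lambda>x. f x * g x) \<in> function_algebra C"

definition mat_coords :: "nat \<Rightarrow> nat \<Rightarrow> (complex mat \<Rightarrow> complex) set" where
  "mat_coords m n = {\<lambda>A. A $$ (i, j) | i j. i < m \<and> j < n}"

definition zariski_mat :: "nat \<Rightarrow> nat \<Rightarrow> complex mat topology" where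
  "zariski_mat m n = topology_generated_by
     {{A \<in> carrier_mat m n. f A \<noteq> 0} | f. f \<in> function_algebra (mat_coords m n)}"

definition irreducible_space :: "'a topology \<Rightarrow> bool" where
  "irreducible_space X \<longleftrightarrow> topspace X \<noteq> {} \<and>
     (\<forall>C D. closedin X C \<and> closedin X D \<and> C \<union> D = topspace X \<longrightarrow> C = topspace X \<or> D = topspace X)"

section \<open>Normal affine varieties\<close>

definition function_ring :: "'a set \<Rightarrow> ('a \<Rightarrow> complex) set \<Rightarrow> ('a \<Rightarrow> complex) ring" where
  "function_ring V F = \<lparr>
     carrier = (\<lambda>f. restrict f V) ` F,
     monoid.mult = (\<lambda>f g. \<lambda>x\<in>V. f x * g x),
     one = (\<lambda>x\<in>V. 1),
     zero = (\<lambda>x\<in>V. 0),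
     add = (\<lambda>f g. \<lambda>x\<in>V. f x + g x)\<rparr>"

definition coordinate_ring :: "nat \<Rightarrow> nat \<Rightarrow> complex mat set \<Rightarrow> (complex mat \<Rightarrow> complex) ring" where
  "coordinate_ring m n V = function_ring V (function_algebra (mat_coords m n))"

text \<open>A domain is integrally closed if every fraction \<open>a / b\<close> satisfying a monic equation
  \<open>(a / b)\<^sup>n + (\<Sum>i<n. c\<^sub>i (a / b)\<^sup>i) = 0\<close> lies in the ring.  The equation is written
  after multiplication by \<open>b\<^sup>n\<close>, which is an equivalent identity because \<open>R\<close> is a domain.\<close>

definition integrally_closed_domain :: "('a, 'b) ring_scheme \<Rightarrow> bool" where
  "integrally_closed_domain R \<longleftrightarrow> domain R \<and>
     (\<forall>a \<in> carrier R. \<forall>b \<in> carrier R - {\<zero>\<^bsub>R\<^esub>}. \<forall>(n :: nat) c.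
        c \<in> {..<n} \<rightarrow> carrier R \<longrightarrow>
        a [^]\<^bsub>R\<^esub> n \<oplus>\<^bsub>R\<^esub> (\<Oplus>\<^bsub>R\<^esub>i\<in>{..<n}. c i \<otimes>\<^bsub>R\<^esub> (a [^]\<^bsub>R\<^esub> i \<otimes>\<^bsub>R\<^esub> b [^]\<^bsub>R\<^esub> (n - i))) = \<zero>\<^bsub>R\<^esub> \<longrightarrow>
        (\<exists>r \<in> carrier R. a = r \<otimes>\<^bsub>R\<^esub> b))"

definition irreducible_affine_variety :: "nat \<Rightarrow> nat \<Rightarrow> complex mat set \<Rightarrow> bool" where
  "irreducible_affine_variety m n V \<longleftrightarrow>
     closedin (zariski_mat m n) V \<and> irreducible_space (subtopology (zariski_mat m n) V)"

definition normal_affine_variety :: "nat \<Rightarrow> nat \<Rightarrow> complex mat set \<Rightarrow> bool" where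
  "normal_affine_variety m n V \<longleftrightarrow>
     irreducible_affine_variety m n V \<and> integrally_closed_domain (coordinate_ring m n V)"

section \<open>Linear algebraic groups\<close>

definition GL :: "nat \<Rightarrow> complex mat monoid" where
  "GL N = units_of (ring_mat TYPE(complex) N ())"

abbreviation GL_sub :: "nat \<Rightarrow> complex mat set \<Rightarrow> complex mat monoid" where
  "GL_sub N H \<equiv> GL N\<lparr>carrier := H\<rparr>"

definition zariski_GL :: "nat \<Rightarrow> complex mat topology" where
  "zariski_GL N = subtopology (zariski_mat N N) (carrier (GL N))"

definition connected_algebraic_subgroup :: "nat \<Rightarrow> complex mat set \<Rightarrow> bool" where
  "connected_algebraic_subgroup N H \<longleftrightarrow>
     subgroup H (GL N) \<and> closedin (zariski_GL N) H \<and> connectedin (zariski_GL N) H"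

definition unipotent :: "nat \<Rightarrow> complex mat \<Rightarrow> bool" where
  "unipotent N u \<longleftrightarrow> u \<in> carrier_mat N N \<and> (\<exists>k. (u - 1\<^sub>m N) ^\<^sub>m k = 0\<^sub>m N N)"

text \<open>The unipotent radical is trivial.\<close>

definition connected_reductive :: "nat \<Rightarrow> complex mat set \<Rightarrow> bool" where
  "connected_reductive N G \<longleftrightarrow> connected_algebraic_subgroup N G \<and>
     (\<forall>U. U \<lhd> GL_sub N G \<and> connected_algebraic_subgroup N U \<and> (\<forall>u\<in>U. unipotent N u) \<longrightarrow> U = {1\<^sub>m N})"

definition connected_solvable_subgroup :: "nat \<Rightarrow> complex mat set \<Rightarrow> complex mat set \<Rightarrow> bool" where
  "connected_solvable_subgroup N G H \<longleftrightarrow>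
     H \<subseteq> G \<and> connected_algebraic_subgroup N H \<and> solvable (GL_sub N H)"

definition borel_subgroup :: "nat \<Rightarrow> complex mat set \<Rightarrow> complex mat set \<Rightarrow> bool" where
  "borel_subgroup N G H \<longleftrightarrow> connected_solvable_subgroup N G H \<and>
     (\<forall>K. connected_solvable_subgroup N G K \<and> H \<subseteq> K \<longrightarrow> K = H)"

section \<open>Spherical varieties\<close>

text \<open>Coordinates on \<open>GL\<^sub>N \<times> M\<^sub>m\<^sub>,\<^sub>n\<close>; the function \<open>1 / det\<close> is regular on \<open>GL\<^sub>N\<close>.\<close>

definition GL_mat_coords :: "nat \<Rightarrow> nat \<Rightarrow> nat \<Rightarrow> (complex mat \<times> complex mat \<Rightarrow> complex) set" where
  "GL_mat_coords N m n =
     (\<lambda>f. f \<circ> fst) ` (insert (\<lambda>g. inverse (det g)) (mat_coords N N)) \<union> (\<lambda>f. f \<circ> snd) ` mat_coords m n"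

definition algebraic_action ::
  "nat \<Rightarrow> complex mat set \<Rightarrow> nat \<Rightarrow> nat \<Rightarrow> complex mat set \<Rightarrow> (complex mat \<Rightarrow> complex mat \<Rightarrow> complex mat) \<Rightarrow> bool"
  where
  "algebraic_action N G m n V \<phi> \<longleftrightarrow> group_action (GL_sub N G) V \<phi> \<and>
     (\<forall>i<m. \<forall>j<n. \<exists>f \<in> function_algebra (GL_mat_coords N m n).
        \<forall>g\<in>G. \<forall>A\<in>V. \<phi> g A $$ (i, j) = f (g, A))"

text \<open>All Borel subgroups of \<open>G\<close> are conjugate, so the choice of the Borel subgroup is immaterial.\<close>

definition spherical_variety ::
  "nat \<Rightarrow> complex mat set \<Rightarrow> nat \<Rightarrow> nat \<Rightarrow> complex mat set \<Rightarrow> (complex mat \<Rightarrow> complex mat \<Rightarrow> complex mat) \<Rightarrow> bool"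
  where
  "spherical_variety N G m n V \<phi> \<longleftrightarrow>
     connected_reductive N G \<and>
     irreducible_affine_variety m n V \<and>
     algebraic_action N G m n V \<phi> \<and>
     normal_affine_variety m n V \<and>
     (\<exists>H. borel_subgroup N G H \<and>
        (\<exists>x\<in>V. openin (subtopology (zariski_mat m n) V) (orbit (GL_sub N H) \<phi> x) \<and>
               (subtopology (zariski_mat m n) V) closure_of (orbit (GL_sub N H) \<phi> x) = V))"

section \<open>Grassmannians and Schubert varieties\<close>

definition grassmannian :: "nat \<Rightarrow> nat \<Rightarrow> complex vec set set" where
  "grassmannian d N = {W. subspace class_ring W (module_vec TYPE(complex) N) \<and>
     vectorspace.dim class_ring ((module_vec TYPE(complex) N)\<lparr>carrier := W\<rparr>) = d}"

definition gr_action :: "nat \<Rightarrow> nat \<Rightarrow> complex mat \<Rightarrow> complex vec set \<Rightarrow> complex vec set" where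
  "gr_action d N g = (\<lambda>W\<in>grassmannian d N. (\<lambda>v. g *\<^sub>v v) ` W)"

text \<open>Coordinates on \<open>\<And>\<^sup>d \<complex>\<^sup>N\<close> are indexed by the \<open>d\<close>-element sets of row indices.
  The Pluecker vector of the column span of \<open>A\<close> consists of the maximal minors of \<open>A\<close>.\<close>

definition pluecker_index :: "nat \<Rightarrow> nat \<Rightarrow> nat set set" where
  "pluecker_index d N = {I. I \<subseteq> {..<N} \<and> card I = d}"

definition pluecker :: "nat \<Rightarrow> nat \<Rightarrow> complex mat \<Rightarrow> nat set \<Rightarrow> complex" where
  "pluecker d N A = (\<lambda>I\<in>pluecker_index d N. det (submatrix A I {..<d}))"

definition homogeneous_polynomials :: "nat \<Rightarrow> nat \<Rightarrow> ((nat set \<Rightarrow> complex) \<Rightarrow> complex) set" where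
  "homogeneous_polynomials d N = {f \<in> function_algebra ((\<lambda>I p. p I) ` pluecker_index d N).
     \<exists>k. \<forall>c p. f (\<lambda>I. c * p I) = c ^ k * f p}"

text \<open>The topology induced from the Zariski topology of \<open>\<P>(\<And>\<^sup>d \<complex>\<^sup>N)\<close>.  Any two choices of
  \<open>A\<close> for the same \<open>W\<close> have proportional Pluecker vectors, so the choice does not affect
  the condition \<open>f \<noteq> 0\<close>.\<close>

definition zariski_gr :: "nat \<Rightarrow> nat \<Rightarrow> complex vec set topology" where
  "zariski_gr d N = topology_generated_by
     {{W \<in> grassmannian d N. \<exists>A \<in> carrier_mat N d.
         vec_space.col_space N A = W \<and> f (pluecker d N A) \<noteq> 0} | f. f \<in> homogeneous_polynomials d N}"

definition upper_borel :: "nat \<Rightarrow> complex mat set" where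
  "upper_borel N = {g \<in> carrier (GL N). upper_triangular g}"

definition lower_borel :: "nat \<Rightarrow> complex mat set" where
  "lower_borel N = {g \<in> carrier (GL N). upper_triangular (transpose_mat g)}"

text \<open>Tuples \<open>w\<close> have entries in \<open>1, \<dots>, N\<close>, whereas matrix and vector indices start at \<open>0\<close>.\<close>

definition coordinate_point :: "nat \<Rightarrow> nat list \<Rightarrow> complex vec set" where
  "coordinate_point N w = vec_space.col_space N (mat_of_cols N (map (\<lambda>l. unit_vec N (l - 1)) w))"

definition schubert_variety :: "nat \<Rightarrow> nat \<Rightarrow> nat list \<Rightarrow> complex vec set set" where
  "schubert_variety d N w = zariski_gr d N closure_of
     orbit (GL_sub N (upper_borel N)) (gr_action d N) (coordinate_point N w)"

definition opposite_big_cell :: "nat \<Rightarrow> nat \<Rightarrow> complex vec set set" where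
  "opposite_big_cell d N =
     orbit (GL_sub N (lower_borel N)) (gr_action d N) (coordinate_point N [1..<d + 1])"

definition opposite_cell :: "nat \<Rightarrow> nat \<Rightarrow> nat list \<Rightarrow> complex vec set set" where
  "opposite_cell d N w = opposite_big_cell d N \<inter> schubert_variety d N w"

definition schubert_stabilizer :: "nat \<Rightarrow> nat \<Rightarrow> nat list \<Rightarrow> complex mat set" where
  "schubert_stabilizer d N w = stabilizer (GL N) (\<lambda>g Z. gr_action d N g ` Z) (schubert_variety d N w)"

text \<open>A subgroup \<open>Q\<close> containing the upper triangular matrices is block upper triangular.  Its block
  boundaries are the \<open>k\<close> such that every element of \<open>Q\<close> vanishes in rows \<open>\<ge> k\<close> and columns
  \<open>< k\<close>; the block diagonal Levi subgroup vanishes outside the corresponding diagonal blocks.\<close>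

definition block_boundaries :: "nat \<Rightarrow> complex mat set \<Rightarrow> nat set" where
  "block_boundaries N Q = {k. 0 < k \<and> k < N \<and> (\<forall>g\<in>Q. \<forall>i j. k \<le> i \<and> i < N \<and> j < k \<longrightarrow> g $$ (i, j) = 0)}"

definition block_diagonal_levi :: "nat \<Rightarrow> complex mat set \<Rightarrow> complex mat set" where
  "block_diagonal_levi N Q = {g \<in> Q. \<forall>k \<in> block_boundaries N Q. \<forall>i<N. \<forall>j<N.
     (i < k) \<noteq> (j < k) \<longrightarrow> g $$ (i, j) = 0}"

definition schubert_levi :: "nat \<Rightarrow> nat \<Rightarrow> nat list \<Rightarrow> complex mat set" where
  "schubert_levi d N w = block_diagonal_levi N (schubert_stabilizer d N w)"

section \<open>Determinantal varieties\<close>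

definition determinantal_variety :: "nat \<Rightarrow> nat \<Rightarrow> nat \<Rightarrow> complex mat set" where
  "determinantal_variety m n t = {A \<in> carrier_mat m n. vec_space.rank m A \<le> t}"

definition cell_chart :: "nat \<Rightarrow> nat \<Rightarrow> complex mat \<Rightarrow> complex vec set" where
  "cell_chart d N A = vec_space.col_space N (1\<^sub>m d @\<^sub>r A)"

text \<open>The action on the Grassmannian, transported to a set \<open>V\<close> of matrices along the chart.\<close>

definition cell_action :: "nat \<Rightarrow> nat \<Rightarrow> complex mat set \<Rightarrow> complex mat \<Rightarrow> complex mat \<Rightarrow> complex mat" where
  "cell_action d N V g =
     (\<lambda>A\<in>V. the_inv_into (carrier_mat (N - d) d) (cell_chart d N) (gr_action d N g (cell_chart d N A)))"

end

theory Submission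
  imports
    Defs
    "HOL-Computational_Algebra.Fundamental_Theorem_Algebra"
    "Jordan_Normal_Form.Schur_Decomposition"
begin

text \<open>Write \<open>m = N - d\<close>. A matrix of size \<open>m \<times> d\<close> has rank at most \<open>t\<close> if and only if it is a
  product \<open>X Y\<close> with \<open>X\<close> of size \<open>m \<times> t\<close> and \<open>Y\<close> of size \<open>t \<times> d\<close>. This parametrization by an
  affine space makes the determinantal variety irreducible, and it reduces normality to
  invariant theory: pulling back along \<open>(X, Y) \<mapsto> X Y\<close> identifies the coordinate ring with the
  algebra generated by the entries of \<open>X Y\<close> inside the polynomial ring in the entries of \<open>X\<close> and
  \<open>Y\<close>.

  By the first fundamental theorem (\<open>invariant_in_entry_algebra\<close>) this algebra consists of all
  polynomials annihilated by the derivations that come from the action \<open>(X, Y) \<mapsto> (X g\<inverse>, g Y)\<close> of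
  \<open>GL\<^sub>t\<close>. It is proved with the Casimir operator \<open>C\<close> of \<open>gl\<^sub>t\<close> acting on the entries of \<open>X\<close>. On
  invariants, \<open>C\<close> equals the sum of the operators "apply a second order operator, then multiply
  by the corresponding entry of \<open>X Y\<close>", so \<open>C f\<close> lies in the algebra of the entries by induction
  on the degree. By positivity of the Fischer inner product, an invariant killed by \<open>C\<close> is
  constant. A linear relation between the iterates \<open>C\<^sup>i f\<close> then expresses \<open>f\<close> itself by the
  entries. Now let a fraction \<open>a / b\<close> be integral over the coordinate ring. The polynomial ring
  is integrally closed (\<open>polyfun_integrally_closed\<close>), so \<open>a = s b\<close> for a polynomial \<open>s\<close>; a
  derivation that kills \<open>a\<close> and \<open>b\<close> kills \<open>s\<close>, hence \<open>s\<close> comes from the coordinate ring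
  (\<open>determinantal_normal\<close>).

  The Levi group consists of the block diagonal matrices \<open>diag (g\<^sub>1, g\<^sub>2)\<close>, which act on the
  chart by \<open>A \<mapsto> g\<^sub>2 A g\<^sub>1\<inverse>\<close>. A normal subgroup of unipotent matrices in it is trivial by a
  computation with traces (\<open>pattern_group_reductive\<close>). Its upper triangular matrices form a
  Borel subgroup (\<open>borel_of_levi\<close>): they are solvable, and a larger subgroup contains a copy of
  \<open>SL\<^sub>2\<close>. Gaussian elimination starting in the lower left corner shows that a matrix of rank at
  most \<open>t\<close> whose first \<open>t\<close> corner minors do not vanish is in the Borel orbit of a fixed
  antidiagonal matrix; so this orbit is open, and it is dense because the variety is
  irreducible.

  It remains to recognize the Schubert variety, its stabilizer and its intersection with the
  big cell. The Schubert variety is the set of subspaces spanned by the columns of an \<open>N \<times> d\<close>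
  matrix whose lower \<open>m\<close> rows have rank at most \<open>t\<close> (\<open>schubert_variety_rank_locus\<close>). This set is
  closed, as it is described by the vanishing of Pluecker coordinates. Its general points lie in
  the big cell, where it is the determinantal variety, and the dense Borel orbit there is
  contained in the Borel orbit of \<open>e\<^sub>w\<close>. Coordinate subspaces show that only block upper
  triangular matrices preserve it, so that the Levi group is the one considered above.\<close>

section \<open>Polynomial functions\<close>

lemma fa_uminus: "f \<in> function_algebra C \<Longrightarrow> (\<lambda>x. - f x) \<in> function_algebra C"
  using function_algebra.mult[OF function_algebra.const[of "-1"], of f C] by simp

lemma fa_diff:
  "f \<in> function_algebra C \<Longrightarrow> g \<in> function_algebra C \<Longrightarrow> (\<lambda>x. f x - g x) \<in> function_algebra C"
  using function_algebra.add[OF _ fa_uminus, of f C g] by simp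

lemma fa_sum: "(\<And>i. i \<in> I \<Longrightarrow> f i \<in> function_algebra C) \<Longrightarrow> (\<lambda>x. \<Sum>i\<in>I. f i x) \<in> function_algebra C"
  by (induction I rule: infinite_finite_induct)
     (simp_all add: function_algebra.const function_algebra.add)

lemma fa_prod: "(\<And>i. i \<in> I \<Longrightarrow> f i \<in> function_algebra C) \<Longrightarrow> (\<lambda>x. \<Prod>i\<in>I. f i x) \<in> function_algebra C"
  by (induction I rule: infinite_finite_induct)
     (simp_all add: function_algebra.const function_algebra.mult)

lemma fa_subst:
  assumes "f \<in> function_algebra C" and "\<And>c. c \<in> C \<Longrightarrow> (\<lambda>u. c (\<phi> u)) \<in> function_algebra D"
  shows "(\<lambda>u. f (\<phi> u)) \<in> function_algebra D"
  using assms(1) by induction (auto intro: function_algebra.intros assms(2))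

lemma fa_eqI:
  assumes "f \<in> function_algebra C" and "\<And>c. c \<in> C \<Longrightarrow> c x = c y"
  shows "f x = f y"
  using assms(1) by induction (auto simp: assms(2))

lemma fa_along_polynomial_curve:
  assumes "f \<in> function_algebra C" and "\<And>c. c \<in> C \<Longrightarrow> \<exists>p. \<forall>\<tau>. c (\<phi> \<tau>) = poly p \<tau>"
  shows "\<exists>p. \<forall>\<tau>. f (\<phi> \<tau>) = poly p \<tau>"
  using assms(1)
proof induction
  case (const c)
  show ?case by (rule exI[of _ "[:c:]"]) simp
next
  case (add f g)
  then obtain p q where "\<forall>\<tau>. f (\<phi> \<tau>) = poly p \<tau>" "\<forall>\<tau>. g (\<phi> \<tau>) = poly q \<tau>" by blast
  then show ?case by (intro exI[of _ "p + q"]) simp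
next
  case (mult f g)
  then obtain p q where "\<forall>\<tau>. f (\<phi> \<tau>) = poly p \<tau>" "\<forall>\<tau>. g (\<phi> \<tau>) = poly q \<tau>" by blast
  then show ?case by (intro exI[of _ "p * q"]) simp
qed (rule assms(2))

abbreviation polyfun :: "'v set \<Rightarrow> (('v \<Rightarrow> complex) \<Rightarrow> complex) set" where
  "polyfun V \<equiv> function_algebra ((\<lambda>v u. u v) ` V)"

lemma polyfun_coord: "v \<in> V \<Longrightarrow> (\<lambda>u. u v) \<in> polyfun V"
  by (rule function_algebra.coord) blast

lemma polyfun_line:
  assumes "f \<in> polyfun V"
  shows "\<exists>p. \<forall>\<tau>. f (\<lambda>v. u v + \<tau> * w v) = poly p \<tau>"
proof (rule fa_along_polynomial_curve[OF assms])
  fix c :: "('a \<Rightarrow> complex) \<Rightarrow> complex" assume "c \<in> (\<lambda>v u. u v) ` V"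
  then obtain v where "c = (\<lambda>u. u v)" by blast
  then show "\<exists>p. \<forall>\<tau>. c (\<lambda>v. u v + \<tau> * w v) = poly p \<tau>"
    by (intro exI[of _ "[:u v, w v:]"]) simp
qed

text \<open>Restriction to the line through two points where \<open>f\<close>, respectively \<open>g\<close>, does not vanish
  reduces this to polynomials in one variable.\<close>

lemma polyfun_mult_nonzero:
  assumes f: "f \<in> polyfun V" and g: "g \<in> polyfun V" and "f a \<noteq> 0" and "g b \<noteq> 0"
  shows "\<exists>u. f u \<noteq> 0 \<and> g u \<noteq> 0"
proof -
  define l where "l = (\<lambda>\<tau> v. a v + \<tau> * (b v - a v))"
  obtain p q where p: "\<forall>\<tau>. f (l \<tau>) = poly p \<tau>" and q: "\<forall>\<tau>. g (l \<tau>) = poly q \<tau>"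
    using polyfun_line[OF f, of a "\<lambda>v. b v - a v"] polyfun_line[OF g, of a "\<lambda>v. b v - a v"]
    unfolding l_def by blast
  have "l 0 = a" "l 1 = b" unfolding l_def by auto
  then have "p \<noteq> 0" "q \<noteq> 0" using p q assms by (metis poly_0)+
  then have "p * q \<noteq> 0" by simp
  then obtain \<tau> where "poly (p * q) \<tau> \<noteq> 0" using poly_all_0_iff_0 by blast
  then show ?thesis using p q by (intro exI[of _ "l \<tau>"]) simp
qed

lemma polyfun_mult_eq_0:
  assumes "f \<in> polyfun V" "g \<in> polyfun V" "\<And>u. f u * g u = 0" "g b \<noteq> 0"
  shows "f u = 0"
  using polyfun_mult_nonzero[OF assms(1,2)] assms(3,4) by (metis mult_eq_0_iff)

section \<open>Zariski topologies\<close>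

text \<open>A generating family closed under intersections is a base. For the Zariski topologies this
  is how open sets are reduced to the nonvanishing loci of single functions.\<close>

lemma generated_topology_base:
  assumes "\<And>a b. a \<in> \<B> \<Longrightarrow> b \<in> \<B> \<Longrightarrow> a \<inter> b \<in> \<B>"
    and "openin (topology_generated_by \<B>) U" and "x \<in> U"
  shows "\<exists>b\<in>\<B>. x \<in> b \<and> b \<subseteq> U"
proof -
  have "generate_topology_on \<B> U" using assms(2) by (rule openin_topology_generated_by)
  then show ?thesis using assms(3)
  proof (induction arbitrary: x)
    case (Int a b)
    then obtain b1 b2 where "b1 \<in> \<B>" "x \<in> b1" "b1 \<subseteq> a" "b2 \<in> \<B>" "x \<in> b2" "b2 \<subseteq> b" by (metis IntE)
    then show ?case using assms(1)[of b1 b2] by (intro bexI[of _ "b1 \<inter> b2"]) auto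
  next
    case (UN K)
    then show ?case by (meson Sup_upper UnionE subset_trans)
  qed auto
qed

lemma topspace_zariski_mat [simp]: "topspace (zariski_mat m n) = carrier_mat m n"
proof -
  have "carrier_mat m n = {A \<in> carrier_mat m n. (\<lambda>_. 1 :: complex) A \<noteq> 0}" by simp
  then have "carrier_mat m n \<in> {{A \<in> carrier_mat m n. f A \<noteq> 0} | f. f \<in> function_algebra (mat_coords m n)}"
    by (intro CollectI exI[of _ "\<lambda>_. 1"] conjI function_algebra.const)
  then show ?thesis unfolding zariski_mat_def topology_generated_by_topspace by auto
qed

lemma openin_zariski_mat_basic:
  "f \<in> function_algebra (mat_coords m n) \<Longrightarrow> openin (zariski_mat m n) {A \<in> carrier_mat m n. f A \<noteq> 0}"
  unfolding zariski_mat_def by (rule topology_generated_by_Basis) blast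

lemma zariski_mat_base:
  assumes "openin (zariski_mat m n) U" "A \<in> U"
  shows "\<exists>f \<in> function_algebra (mat_coords m n). f A \<noteq> 0 \<and> {B \<in> carrier_mat m n. f B \<noteq> 0} \<subseteq> U"
proof -
  let ?B = "{{A \<in> carrier_mat m n. f A \<noteq> 0} | f. f \<in> function_algebra (mat_coords m n)}"
  have "a \<inter> b \<in> ?B" if a: "a \<in> ?B" and b: "b \<in> ?B" for a b
  proof -
    obtain f g where "f \<in> function_algebra (mat_coords m n)" "g \<in> function_algebra (mat_coords m n)"
      and "a = {A \<in> carrier_mat m n. f A \<noteq> 0}" "b = {A \<in> carrier_mat m n. g A \<noteq> 0}" using a b by blast
    then show ?thesis
      by (intro CollectI exI[of _ "\<lambda>A. f A * g A"]) (auto intro: function_algebra.mult)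
  qed
  from generated_topology_base[OF this assms(1)[unfolded zariski_mat_def] assms(2)] show ?thesis
    by blast
qed

lemma mat_coord_fa:
  "i < m \<Longrightarrow> j < n \<Longrightarrow> (\<lambda>A. A $$ (i, j)) \<in> function_algebra (mat_coords m n)"
  unfolding mat_coords_def by (rule function_algebra.coord) blast

lemma closedin_zariski_mat_zeros:
  assumes "V \<subseteq> carrier_mat m n"
    and "\<And>A. A \<in> carrier_mat m n - V \<Longrightarrow>
          \<exists>f \<in> function_algebra (mat_coords m n). f A \<noteq> 0 \<and> (\<forall>B\<in>V. f B = 0)"
  shows "closedin (zariski_mat m n) V"
proof -
  have "openin (zariski_mat m n) (carrier_mat m n - V)"
  proof (subst openin_subopen, intro ballI)
    fix A assume A: "A \<in> carrier_mat m n - V"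
    then obtain f where "f \<in> function_algebra (mat_coords m n)" "f A \<noteq> 0" "\<forall>B\<in>V. f B = 0"
      using assms(2) by blast
    then show "\<exists>T. openin (zariski_mat m n) T \<and> A \<in> T \<and> T \<subseteq> carrier_mat m n - V"
      using A by (intro exI[of _ "{A \<in> carrier_mat m n. f A \<noteq> 0}"]) (auto intro: openin_zariski_mat_basic)
  qed
  then show ?thesis using assms(1) unfolding closedin_def by simp
qed

text \<open>The image of a nonempty principal open subset of an affine space under a polynomial map is
  irreducible: two nonempty open sets pull back to the nonvanishing loci of nonzero polynomials,
  and a product of nonzero polynomials is nonzero.\<close>

lemma irreducible_parametrized:
  fixes \<pi> :: "('v \<Rightarrow> complex) \<Rightarrow> complex mat"
  assumes \<pi>: "\<And>i j. i < m \<Longrightarrow> j < n \<Longrightarrow> (\<lambda>u. \<pi> u $$ (i, j)) \<in> polyfun P"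
    and h: "h \<in> polyfun P" "h a \<noteq> 0"
    and V: "V = \<pi> ` {u. h u \<noteq> 0}" "V \<subseteq> carrier_mat m n"
  shows "irreducible_space (subtopology (zariski_mat m n) V)"
proof -
  let ?T = "subtopology (zariski_mat m n) V"
  have top: "topspace ?T = V" using V by auto
  have pull: "(\<lambda>u. f (\<pi> u)) \<in> polyfun P" if "f \<in> function_algebra (mat_coords m n)" for f
    using that by (rule fa_subst) (auto simp: mat_coords_def intro: \<pi>)
  have meet: "S1 \<inter> S2 \<noteq> {}" if op: "openin ?T S1" "openin ?T S2" and ne: "S1 \<noteq> {}" "S2 \<noteq> {}" for S1 S2
  proof -
    have nb: "\<exists>f \<in> polyfun P. (\<exists>u. f u \<noteq> 0) \<and> (\<forall>u. h u \<noteq> 0 \<and> f u \<noteq> 0 \<longrightarrow> \<pi> u \<in> S)"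
      if op: "openin ?T S" and ne: "S \<noteq> {}" for S
    proof -
      obtain U where U: "openin (zariski_mat m n) U" "S = U \<inter> V" using op unfolding openin_subtopology by blast
      obtain A where A: "A \<in> S" using ne by blast
      obtain f where f: "f \<in> function_algebra (mat_coords m n)" "f A \<noteq> 0"
          "{B \<in> carrier_mat m n. f B \<noteq> 0} \<subseteq> U" using zariski_mat_base[OF U(1)] A U by blast
      obtain u where u: "A = \<pi> u" "h u \<noteq> 0" using A U(2) V by blast
      show ?thesis
        by (rule bexI[OF _ pull[OF f(1)]]) (use f u U V in blast)
    qed
    obtain f1 u1 where f1: "f1 \<in> polyfun P" "f1 u1 \<noteq> 0" "\<forall>u. h u \<noteq> 0 \<and> f1 u \<noteq> 0 \<longrightarrow> \<pi> u \<in> S1"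
      using nb[OF op(1) ne(1)] by (elim bexE conjE exE)
    obtain f2 u2 where f2: "f2 \<in> polyfun P" "f2 u2 \<noteq> 0" "\<forall>u. h u \<noteq> 0 \<and> f2 u \<noteq> 0 \<longrightarrow> \<pi> u \<in> S2"
      using nb[OF op(2) ne(2)] by (elim bexE conjE exE)
    obtain u12 where u12: "f1 u12 \<noteq> 0" "f2 u12 \<noteq> 0"
      using polyfun_mult_nonzero[of f1 P f2 u1 u2] f1 f2 by blast
    have "\<exists>u. f1 u * f2 u \<noteq> 0 \<and> h u \<noteq> 0"
      by (rule polyfun_mult_nonzero[where V = P and f = "\<lambda>u. f1 u * f2 u" and g = h and a = u12 and b = a])
         (use u12 f1 f2 h in \<open>auto intro: function_algebra.mult\<close>)
    then obtain u where "f1 u * f2 u \<noteq> 0" "h u \<noteq> 0" by (elim exE conjE)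
    then show ?thesis using f1(3) f2(3) by auto
  qed
  show ?thesis unfolding irreducible_space_def
  proof (intro conjI allI impI)
    show "topspace ?T \<noteq> {}" using top V(1) h(2) by blast
    fix C D assume CD: "closedin ?T C \<and> closedin ?T D \<and> C \<union> D = topspace ?T"
    show "C = topspace ?T \<or> D = topspace ?T"
    proof (rule ccontr)
      assume *: "\<not> ?thesis"
      have sub: "C \<subseteq> topspace ?T" "D \<subseteq> topspace ?T" using CD closedin_subset by blast+
      have "(topspace ?T - C) \<inter> (topspace ?T - D) \<noteq> {}"
        by (rule meet) (use CD * sub in \<open>auto simp: closedin_def\<close>)
      then show False using CD by blast
    qed
  qed
qed

lemma irreducible_imp_connected:
  assumes "irreducible_space X" shows "connected_space X"
proof (rule ccontr)
  assume "\<not> connected_space X"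
  then obtain C D where "closedin X C" "closedin X D" "topspace X \<subseteq> C \<union> D" "C \<inter> D = {}" "C \<noteq> {}" "D \<noteq> {}"
    unfolding connected_space_closedin by blast
  moreover have "C \<subseteq> topspace X" "D \<subseteq> topspace X" using calculation closedin_subset by blast+
  ultimately show False using assms unfolding irreducible_space_def
    by (metis Int_absorb1 Int_absorb2 Un_subset_iff subset_antisym)
qed

lemma irreducible_open_dense:
  assumes "irreducible_space X" "openin X U" "U \<noteq> {}"
  shows "X closure_of U = topspace X"
proof -
  have U: "U \<subseteq> topspace X" using assms(2) openin_subset by blast
  have 1: "closedin X (X closure_of U)" by simp
  have 2: "closedin X (topspace X - U)" using assms(2) by blast
  have "X closure_of U \<union> (topspace X - U) = topspace X"
    using closure_of_subset[OF U] closedin_subset[OF 1] by blast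
  then have "X closure_of U = topspace X \<or> topspace X - U = topspace X"
    using assms(1) 1 2 unfolding irreducible_space_def by blast
  then show ?thesis using assms(3) U by blast
qed

section \<open>Partial derivatives of polynomial functions\<close>

text \<open>The derivative along the coordinate \<open>v\<close>. For a polynomial function, fixing the other
  coordinates leaves a polynomial in one variable, which is determined by its values.\<close>

definition pd :: "'v \<Rightarrow> (('v \<Rightarrow> complex) \<Rightarrow> complex) \<Rightarrow> ('v \<Rightarrow> complex) \<Rightarrow> complex" where
  "pd v f u = poly (pderiv (THE p. \<forall>\<tau>. f (u(v := \<tau>)) = poly p \<tau>)) (u v)"

lemma pd_eqI:
  assumes "\<And>\<tau>. f (u(v := \<tau>)) = poly p \<tau>"
  shows "pd v f u = poly (pderiv p) (u v)"
proof -
  have "(THE p. \<forall>\<tau>. f (u(v := \<tau>)) = poly p \<tau>) = p"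
  proof (rule the_equality)
    fix q assume "\<forall>\<tau>. f (u(v := \<tau>)) = poly q \<tau>"
    then have "poly q = poly p" using assms by auto
    then show "q = p" using poly_eq_poly_eq_iff by blast
  qed (use assms in blast)
  then show ?thesis unfolding pd_def by simp
qed

lemma polyfun_axis:
  fixes f :: "('v \<Rightarrow> complex) \<Rightarrow> complex"
  assumes "f \<in> polyfun V"
  obtains p where "\<And>\<tau>. f (u(v := \<tau>)) = poly p \<tau>"
proof -
  have "\<exists>p. \<forall>\<tau>. f (u(v := \<tau>)) = poly p \<tau>"
  proof (rule fa_along_polynomial_curve[OF assms])
    fix c :: "('v \<Rightarrow> complex) \<Rightarrow> complex" assume "c \<in> (\<lambda>v u. u v) ` V"
    then obtain w where "c = (\<lambda>u. u w)" by blast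
    then show "\<exists>p. \<forall>\<tau>. c (u(v := \<tau>)) = poly p \<tau>"
      by (intro exI[of _ "if w = v then [:0, 1:] else [:u w:]"]) simp
  qed
  then show ?thesis using that by blast
qed

lemma pd_const [simp]: "pd v (\<lambda>_. c) = (\<lambda>_. 0)"
proof
  show "pd v (\<lambda>_. c) u = 0" for u using pd_eqI[of "\<lambda>_. c" u v "[:c:]"] by simp
qed

lemma pd_coord: "pd v (\<lambda>u. u w) = (\<lambda>_. if v = w then 1 else 0)"
proof
  show "pd v (\<lambda>u. u w) u = (if v = w then 1 else 0)" for u
    using pd_eqI[of "\<lambda>u. u w" u v "if v = w then [:0, 1:] else [:u w:]"] by (simp add: pderiv_pCons)
qed

lemma pd_add:
  assumes "f \<in> polyfun V" "g \<in> polyfun V"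
  shows "pd v (\<lambda>u. f u + g u) = (\<lambda>u. pd v f u + pd v g u)"
proof
  fix u
  obtain p where p: "\<And>\<tau>. f (u(v := \<tau>)) = poly p \<tau>" by (rule polyfun_axis[OF assms(1), of u v]) (rule that)
  obtain q where q: "\<And>\<tau>. g (u(v := \<tau>)) = poly q \<tau>" by (rule polyfun_axis[OF assms(2), of u v]) (rule that)
  show "pd v (\<lambda>u. f u + g u) u = pd v f u + pd v g u"
    using pd_eqI[of f, OF p] pd_eqI[of g, OF q] pd_eqI[of "\<lambda>u. f u + g u" u v "p + q"] p q
    by (simp add: pderiv_add)
qed

lemma pd_mult:
  assumes "f \<in> polyfun V" "g \<in> polyfun V"
  shows "pd v (\<lambda>u. f u * g u) = (\<lambda>u. pd v f u * g u + f u * pd v g u)"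
proof
  fix u
  obtain p where p: "\<And>\<tau>. f (u(v := \<tau>)) = poly p \<tau>" by (rule polyfun_axis[OF assms(1), of u v]) (rule that)
  obtain q where q: "\<And>\<tau>. g (u(v := \<tau>)) = poly q \<tau>" by (rule polyfun_axis[OF assms(2), of u v]) (rule that)
  have "poly p (u v) = f u" "poly q (u v) = g u" using p[of "u v"] q[of "u v"] by auto
  then show "pd v (\<lambda>u. f u * g u) u = pd v f u * g u + f u * pd v g u"
    using pd_eqI[of f, OF p] pd_eqI[of g, OF q] pd_eqI[of "\<lambda>u. f u * g u" u v "p * q"] p q
    by (simp add: pderiv_mult mult.commute)
qed

lemma pd_polyfun: "f \<in> polyfun V \<Longrightarrow> pd v f \<in> polyfun V"
proof (induction rule: function_algebra.induct)
  case (coord f)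
  then obtain w where "f = (\<lambda>u. u w)" by blast
  then show ?case by (simp add: pd_coord function_algebra.const)
next
  case (mult f g)
  then show ?case by (simp add: pd_mult[OF mult.hyps] function_algebra.add function_algebra.mult)
qed (simp_all add: function_algebra.const pd_add function_algebra.add)

lemma pd_cmult: "f \<in> polyfun V \<Longrightarrow> pd v (\<lambda>u. c * f u) = (\<lambda>u. c * pd v f u)"
  using pd_mult[OF function_algebra.const, of f V v c] by simp

lemma pd_sum:
  assumes "\<And>i. i \<in> I \<Longrightarrow> f i \<in> polyfun V"
  shows "pd v (\<lambda>u. \<Sum>i\<in>I. f i u) = (\<lambda>u. \<Sum>i\<in>I. pd v (f i) u)"
  using assms by (induction I rule: infinite_finite_induct) (simp_all add: pd_add[OF _ fa_sum, of _ V])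

lemma pd_commute: "f \<in> polyfun V \<Longrightarrow> pd v (pd w f) = pd w (pd v f)"
proof (induction rule: function_algebra.induct)
  case (coord f)
  then obtain x where "f = (\<lambda>u. u x)" by blast
  then show ?case by (simp add: pd_coord)
next
  case (add f g)
  then show ?case by (simp add: pd_add[OF add.hyps] pd_add[OF pd_polyfun[OF add.hyps(1)] pd_polyfun[OF add.hyps(2)]])
next
  case (mult f g)
  note [intro] = mult.hyps pd_polyfun[OF mult.hyps(1)] pd_polyfun[OF mult.hyps(2)]
  have "pd a (pd b (\<lambda>u. f u * g u)) =
      (\<lambda>u. pd a (pd b f) u * g u + pd b f u * pd a g u + (pd a f u * pd b g u + f u * pd a (pd b g) u))" for a b
  proof -
    have "pd a (pd b (\<lambda>u. f u * g u)) = pd a (\<lambda>u. pd b f u * g u + f u * pd b g u)"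
      by (subst pd_mult[of f V g b]) auto
    also have "\<dots> = (\<lambda>u. pd a (\<lambda>u. pd b f u * g u) u + pd a (\<lambda>u. f u * pd b g u) u)"
      by (rule pd_add) (auto intro: function_algebra.mult)
    also have "pd a (\<lambda>u. pd b f u * g u) = (\<lambda>u. pd a (pd b f) u * g u + pd b f u * pd a g u)"
      by (rule pd_mult) auto
    also have "pd a (\<lambda>u. f u * pd b g u) = (\<lambda>u. pd a f u * pd b g u + f u * pd a (pd b g) u)"
      by (rule pd_mult) auto
    finally show ?thesis .
  qed
  then show ?case using mult.IH by (auto simp: algebra_simps)
qed simp

lemma pd_eq_0_imp_indep:
  assumes "f \<in> polyfun V" "\<And>u. pd v f u = 0"
  shows "f (u(v := a)) = f u"
proof -
  obtain p where p: "\<And>\<tau>. f (u(v := \<tau>)) = poly p \<tau>" by (rule polyfun_axis[OF assms(1), of u v]) (rule that)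
  have "poly (pderiv p) x = 0" for x
    using pd_eqI[of f "u(v := x)" v p] p assms(2) by simp
  then have "pderiv p = 0" using poly_all_0_iff_0 by blast
  then have "degree p = 0" by (simp add: pderiv_eq_0_iff)
  then have "poly p a = poly p (u v)" by (metis degree_eq_zeroE poly_const_conv)
  then show ?thesis using p[of a] p[of "u v"] by simp
qed

lemma pd_eq_0_imp_indep_set:
  assumes f: "f \<in> polyfun V" and "\<And>v u. v \<in> W \<Longrightarrow> pd v f u = 0" and "finite W"
  shows "f (\<lambda>v. if v \<in> W then a v else u v) = f u"
  using assms(3,2)
proof (induction W)
  case (insert w W)
  have "(\<lambda>v. if v \<in> insert w W then a v else u v) = (\<lambda>v. if v \<in> W then a v else u v)(w := a w)"
    by auto
  then show ?case using pd_eq_0_imp_indep[OF f, of w] insert by simp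
qed simp

text \<open>Polynomial functions of degree at most \<open>k\<close>. A bound is enough for inductions on the degree
  and for finite dimension.\<close>

inductive polydeg :: "'v set \<Rightarrow> nat \<Rightarrow> (('v \<Rightarrow> complex) \<Rightarrow> complex) \<Rightarrow> bool" for V where
  const: "polydeg V k (\<lambda>_. c)"
| add: "polydeg V k f \<Longrightarrow> polydeg V k g \<Longrightarrow> polydeg V k (\<lambda>u. f u + g u)"
| coord_mult: "polydeg V k f \<Longrightarrow> v \<in> V \<Longrightarrow> polydeg V (Suc k) (\<lambda>u. u v * f u)"

lemma polydeg_polyfun: "polydeg V k f \<Longrightarrow> f \<in> polyfun V"
  by (induction rule: polydeg.induct)
     (auto intro: function_algebra.intros polyfun_coord)

lemma polydeg_Suc: "polydeg V k f \<Longrightarrow> polydeg V (Suc k) f"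
  by (induction rule: polydeg.induct) (auto intro: polydeg.intros)

lemma polydeg_mono: "polydeg V k f \<Longrightarrow> k \<le> l \<Longrightarrow> polydeg V l f"
  by (rotate_tac, induction l rule: dec_induct) (auto intro: polydeg_Suc)

lemma polydeg_cmult: "polydeg V k f \<Longrightarrow> polydeg V k (\<lambda>u. c * f u)"
proof (induction rule: polydeg.induct)
  case (coord_mult k f v)
  then have "polydeg V (Suc k) (\<lambda>u. u v * (c * f u))" by (intro polydeg.coord_mult)
  then show ?case by (simp add: mult.left_commute)
qed (auto simp: distrib_left intro: polydeg.intros)

lemma polydeg_sum: "(\<And>i. i \<in> I \<Longrightarrow> polydeg V k (f i)) \<Longrightarrow> polydeg V k (\<lambda>u. \<Sum>i\<in>I. f i u)"
  by (induction I rule: infinite_finite_induct) (simp_all add: polydeg.intros)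

lemma polydeg_mult: "polydeg V k f \<Longrightarrow> polydeg V l g \<Longrightarrow> polydeg V (k + l) (\<lambda>u. f u * g u)"
proof (induction rule: polydeg.induct)
  case (const k c)
  then show ?case using polydeg_mono[OF polydeg_cmult[of V l g c], of "k + l"] by simp
next
  case (add k f h)
  then show ?case by (simp add: distrib_right polydeg.add)
next
  case (coord_mult k f v)
  then have "polydeg V (Suc (k + l)) (\<lambda>u. u v * (f u * g u))" by (intro polydeg.coord_mult)
  then show ?case by (simp add: mult.assoc)
qed

lemma polyfun_polydeg: "f \<in> polyfun V \<Longrightarrow> \<exists>k. polydeg V k f"
proof (induction rule: function_algebra.induct)
  case (coord f)
  then obtain v where v: "v \<in> V" "f = (\<lambda>u. u v)" by blast
  then have "polydeg V (Suc 0) (\<lambda>u. u v * 1)" by (intro polydeg.intros)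
  then show ?case using v by auto
next
  case (add f g)
  then obtain k l where "polydeg V k f" "polydeg V l g" by blast
  then have "polydeg V (max k l) f" "polydeg V (max k l) g" by (auto intro: polydeg_mono)
  then show ?case by (blast intro: polydeg.add)
qed (blast intro: polydeg.intros polydeg_mult)+

lemma pd_polydeg: "polydeg V k f \<Longrightarrow> polydeg V (k - 1) (pd v f)"
proof (induction rule: polydeg.induct)
  case (const k c)
  then show ?case by (simp add: polydeg.const)
next
  case (add k f g)
  then show ?case by (simp add: pd_add[OF polydeg_polyfun polydeg_polyfun, of V k f k g] polydeg.add)
next
  case (coord_mult k f w)
  have eq: "pd v (\<lambda>u. u w * f u) = (\<lambda>u. (if v = w then 1 else 0) * f u + u w * pd v f u)"
    by (subst pd_mult[OF polyfun_coord[OF coord_mult.hyps(2)] polydeg_polyfun[OF coord_mult.hyps(1)]])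
       (simp add: pd_coord)
  have "polydeg V k (\<lambda>u. u w * pd v f u)"
  proof (cases k)
    case 0
    \<comment> \<open>here \<open>k - 1 = k\<close> in the induction hypothesis, so constants are treated separately\<close>
    have "polydeg V l f \<Longrightarrow> l = 0 \<Longrightarrow> pd v f = (\<lambda>_. 0)" for f l
      by (induction rule: polydeg.induct) (auto simp: pd_add[OF polydeg_polyfun polydeg_polyfun])
    then have "pd v f = (\<lambda>_. 0)" using coord_mult.hyps(1) 0 by blast
    then show ?thesis by (simp add: polydeg.const)
  next
    case (Suc l)
    then show ?thesis using polydeg.coord_mult[OF coord_mult.IH coord_mult.hyps(2)] by simp
  qed
  then show ?case unfolding eq using polydeg_cmult[OF coord_mult.hyps(1)] by (simp add: polydeg.add)
qed

lemma polydeg_0: "polydeg V 0 f \<Longrightarrow> \<exists>c. f = (\<lambda>_. c)"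
proof -
  have "polydeg V l f \<Longrightarrow> l = 0 \<Longrightarrow> \<exists>c. f = (\<lambda>_. c)" for l
    by (induction rule: polydeg.induct) auto
  then show "polydeg V 0 f \<Longrightarrow> ?thesis" by blast
qed

lemma pd_polydeg_0: "polydeg V 0 f \<Longrightarrow> pd v f = (\<lambda>_. 0)"
  using polydeg_0 by fastforce

section \<open>Linear dependence\<close>

text \<open>Fewer homogeneous linear equations than unknowns have a nonzero solution. Stated for
  arbitrary finite index sets, as the equations below are indexed by rows, monomials or disjoint
  unions.\<close>

lemma underdetermined_system:
  fixes a :: "'e \<Rightarrow> 'k \<Rightarrow> complex"
  assumes "finite E" "finite K" "card E < card K"
  shows "\<exists>c. (\<exists>k\<in>K. c k \<noteq> 0) \<and> (\<forall>e\<in>E. (\<Sum>k\<in>K. a e k * c k) = 0)"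
  using assms
proof (induction E arbitrary: a K)
  case empty
  then have "K \<noteq> {}" by auto
  then show ?case by (intro exI[of _ "\<lambda>_. 1"]) auto
next
  case (insert e E)
  show ?case
  proof (cases "\<forall>k\<in>K. a e k = 0")
    case True
    obtain c where c: "\<exists>k\<in>K. c k \<noteq> 0" "\<forall>e\<in>E. (\<Sum>k\<in>K. a e k * c k) = 0"
      using insert.IH[of K a] insert.prems insert.hyps by auto
    then show ?thesis using True by (intro exI[of _ c]) auto
  next
    case False
    then obtain k0 where k0: "k0 \<in> K" "a e k0 \<noteq> 0" by blast
    let ?K = "K - {k0}"
    have "card E < card ?K" using insert k0 by simp
    then obtain c where c: "\<exists>k\<in>?K. c k \<noteq> 0"
        "\<forall>e'\<in>E. (\<Sum>k\<in>?K. (a e' k - a e' k0 * a e k / a e k0) * c k) = 0"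
      using insert.IH[of ?K "\<lambda>e' k. a e' k - a e' k0 * a e k / a e k0"] insert.prems by auto
    \<comment> \<open>Gaussian elimination: the equation \<open>e\<close> is solved for the unknown \<open>k0\<close>\<close>
    define d where "d = c(k0 := - (\<Sum>k\<in>?K. a e k * c k) / a e k0)"
    have split: "(\<Sum>k\<in>K. a e' k * d k) = a e' k0 * d k0 + (\<Sum>k\<in>?K. a e' k * c k)" for e'
    proof -
      have "(\<Sum>k\<in>K. a e' k * d k) = a e' k0 * d k0 + (\<Sum>k\<in>?K. a e' k * d k)"
        using sum.remove[OF insert.prems(1) k0(1)] by blast
      also have "(\<Sum>k\<in>?K. a e' k * d k) = (\<Sum>k\<in>?K. a e' k * c k)"
        by (rule sum.cong) (auto simp: d_def)
      finally show ?thesis .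
    qed
    have "(\<Sum>k\<in>K. a e' k * d k) = 0" if "e' \<in> insert e E" for e'
    proof (cases "e' = e")
      case True
      then show ?thesis unfolding split using k0 by (simp add: d_def)
    next
      case False
      then have "(\<Sum>k\<in>?K. a e' k * c k) - (\<Sum>k\<in>?K. a e' k0 * a e k / a e k0 * c k) = 0"
        using that c(2) by (simp add: left_diff_distrib sum_subtractf)
      also have "(\<Sum>k\<in>?K. a e' k0 * a e k / a e k0 * c k) = a e' k0 / a e k0 * (\<Sum>k\<in>?K. a e k * c k)"
        by (simp add: sum_distrib_left mult.assoc)
      finally show ?thesis unfolding split by (simp add: d_def)
    qed
    moreover have "\<exists>k\<in>K. d k \<noteq> 0" using c(1) by (auto simp: d_def)
    ultimately show ?thesis by blast
  qed
qed

fun monomials :: "'v set \<Rightarrow> nat \<Rightarrow> (('v \<Rightarrow> complex) \<Rightarrow> complex) set" where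
  "monomials V 0 = {\<lambda>_. 1}"
| "monomials V (Suc k) = monomials V k \<union> (\<lambda>(v, f) u. u v * f u) ` (V \<times> monomials V k)"

lemma finite_monomials: "finite V \<Longrightarrow> finite (monomials V k)"
  by (induction k) auto

lemma monomials_mono: "monomials V 0 \<subseteq> monomials V k"
  by (induction k) auto

lemma polydeg_monomials:
  assumes "finite V" "polydeg V k f"
  shows "\<exists>a. \<forall>u. f u = (\<Sum>m\<in>monomials V k. a m * m u)"
  using assms(2)
proof (induction rule: polydeg.induct)
  case (const k c)
  have "(\<Sum>m\<in>monomials V k. (if m = (\<lambda>_. 1) then c else 0) * m u) = c" for u
    using monomials_mono[of V k] finite_monomials[OF assms(1), of k]
    by (subst sum.remove[of _ "\<lambda>_. 1"]) auto
  then show ?case by (intro exI[of _ "\<lambda>m. if m = (\<lambda>_. 1) then c else 0"]) simp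
next
  case (add k f g)
  then obtain a b where "\<forall>u. f u = (\<Sum>m\<in>monomials V k. a m * m u)" "\<forall>u. g u = (\<Sum>m\<in>monomials V k. b m * m u)"
    by blast
  then show ?case by (intro exI[of _ "\<lambda>m. a m + b m"]) (simp add: distrib_right sum.distrib)
next
  case (coord_mult k f v)
  then obtain a where a: "\<forall>u. f u = (\<Sum>m\<in>monomials V k. a m * m u)" by blast
  \<comment> \<open>the products \<open>u v * m u\<close> are collected by their value, as different \<open>m\<close> are not assumed to
    give different products\<close>
  let ?s = "\<lambda>m u. u v * m u :: complex"
  let ?M = "monomials V (Suc k)"
  define b where "b = (\<lambda>m. \<Sum>m'\<in>{m' \<in> monomials V k. ?s m' = m}. a m')"
  have "u v * f u = (\<Sum>m\<in>?M. b m * m u)" for u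
  proof -
    have "(\<Sum>m\<in>?M. b m * m u) = (\<Sum>m\<in>?M. \<Sum>m'\<in>{m' \<in> monomials V k. ?s m' = m}. a m' * ?s m' u)"
      unfolding b_def sum_distrib_right by (intro sum.cong) auto
    also have "\<dots> = (\<Sum>m'\<in>monomials V k. a m' * ?s m' u)"
      by (rule sum.group) (use assms(1) finite_monomials coord_mult.hyps in \<open>auto simp del: monomials.simps(1)\<close>)
    also have "\<dots> = u v * f u" using a by (simp add: sum_distrib_left mult.left_commute)
    finally show ?thesis by simp
  qed
  then show ?case by blast
qed

text \<open>Polynomial functions of bounded degree form a finite-dimensional space, hence an infinite
  sequence of them satisfies a linear relation.\<close>

lemma polydeg_dependent:
  assumes "finite V" "\<And>i. polydeg V k (g i)"
  shows "\<exists>c (M::nat). (\<exists>i\<le>M. c i \<noteq> 0) \<and> (\<forall>u. (\<Sum>i\<le>M. c i * g i u) = (0::complex))"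
proof -
  let ?B = "monomials V k"
  have "\<forall>i. \<exists>a. \<forall>u. g i u = (\<Sum>m\<in>?B. a m * m u)" using polydeg_monomials assms by blast
  then obtain a where a: "\<And>i u. g i u = (\<Sum>m\<in>?B. a i m * m u)" by metis
  obtain c where c: "\<exists>i\<in>{..card ?B}. c i \<noteq> 0" "\<forall>m\<in>?B. (\<Sum>i\<in>{..card ?B}. a i m * c i) = 0"
    using underdetermined_system[of ?B "{..card ?B}" "\<lambda>m i. a i m"] finite_monomials[OF assms(1)] by auto
  have "(\<Sum>i\<le>card ?B. c i * g i u) = 0" for u
  proof -
    have "(\<Sum>i\<le>card ?B. c i * g i u) = (\<Sum>i\<le>card ?B. \<Sum>m\<in>?B. a i m * c i * m u)"
      by (simp add: a sum_distrib_left mult_ac)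
    also have "\<dots> = (\<Sum>m\<in>?B. (\<Sum>i\<le>card ?B. a i m * c i) * m u)"
      by (subst sum.swap) (simp add: sum_distrib_right)
    also have "\<dots> = 0" using c(2) by simp
    finally show ?thesis .
  qed
  then show ?thesis using c(1) by (intro exI[of _ c] exI[of _ "card ?B"]) auto
qed

section \<open>Polarization operators and the Fischer form\<close>

text \<open>The polarization operator that replaces one factor \<open>b i\<close> by \<open>a i\<close> in all possible ways. It
  is the derivation through which an elementary matrix acts on functions.\<close>

definition pol :: "nat \<Rightarrow> (nat \<Rightarrow> 'v) \<Rightarrow> (nat \<Rightarrow> 'v) \<Rightarrow> (('v \<Rightarrow> complex) \<Rightarrow> complex) \<Rightarrow> ('v \<Rightarrow> complex) \<Rightarrow> complex"
  where "pol k a b f u = (\<Sum>i<k. u (a i) * pd (b i) f u)"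

lemma pol_polyfun:
  assumes "\<And>i. i < k \<Longrightarrow> a i \<in> V" "f \<in> polyfun V"
  shows "pol k a b f \<in> polyfun V"
proof -
  have "(\<lambda>u. \<Sum>i<k. u (a i) * pd (b i) f u) \<in> polyfun V"
    by (intro fa_sum function_algebra.mult polyfun_coord pd_polyfun) (use assms in auto)
  then show ?thesis unfolding pol_def[abs_def] .
qed

lemma pol_polydeg:
  assumes "\<And>i. i < k \<Longrightarrow> a i \<in> V" "polydeg V l f"
  shows "polydeg V l (pol k a b f)"
proof (cases l)
  case 0
  then have "pol k a b f = (\<lambda>_. 0)" using pd_polydeg_0[of V f] assms(2) by (simp add: pol_def[abs_def])
  then show ?thesis by (simp add: polydeg.const)
next
  case (Suc l')
  have "polydeg V l (\<lambda>u. u (a i) * pd (b i) f u)" if "i < k" for i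
    using polydeg.coord_mult[OF pd_polydeg[OF assms(2)] assms(1)[OF that], of "b i"] Suc by simp
  then have "polydeg V l (\<lambda>u. \<Sum>i<k. u (a i) * pd (b i) f u)" by (intro polydeg_sum) auto
  then show ?thesis unfolding pol_def[abs_def] .
qed

lemma pol_const: "pol k a b (\<lambda>_. c) = (\<lambda>_. 0)"
  by (simp add: pol_def[abs_def])

lemma pol_add:
  assumes "f \<in> polyfun V" "g \<in> polyfun V"
  shows "pol k a b (\<lambda>u. f u + g u) = (\<lambda>u. pol k a b f u + pol k a b g u)"
  by (simp add: pol_def[abs_def] pd_add[OF assms] distrib_left sum.distrib)

lemma pol_cmult:
  assumes "f \<in> polyfun V"
  shows "pol k a b (\<lambda>u. c * f u) = (\<lambda>u. c * pol k a b f u)"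
  by (simp add: pol_def[abs_def] pd_cmult[OF assms] sum_distrib_left mult.left_commute)

lemma pol_sum:
  assumes "\<And>i. i \<in> I \<Longrightarrow> f i \<in> polyfun V"
  shows "pol k a b (\<lambda>u. \<Sum>i\<in>I. f i u) = (\<lambda>u. \<Sum>i\<in>I. pol k a b (f i) u)"
  using assms
proof (induction I rule: infinite_finite_induct)
  case (insert x F)
  then show ?case using pol_add[OF _ fa_sum, of "f x" V F f k a b] by simp
qed (simp_all add: pol_const)

lemma pol_mult:
  assumes "f \<in> polyfun V" "g \<in> polyfun V"
  shows "pol k a b (\<lambda>u. f u * g u) = (\<lambda>u. pol k a b f u * g u + f u * pol k a b g u)"
  by (simp add: pol_def[abs_def] pd_mult[OF assms] distrib_left sum.distrib sum_distrib_left sum_distrib_right mult_ac)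

lemma pd_pol:
  assumes "\<And>i. i < k \<Longrightarrow> a i \<in> V" "f \<in> polyfun V"
  shows "pd v (pol k a b f) = (\<lambda>u. (\<Sum>i<k. (if v = a i then pd (b i) f u else 0)) + pol k a b (pd v f) u)"
proof -
  have "pd v (pol k a b f) = (\<lambda>u. \<Sum>i<k. pd v (\<lambda>u. u (a i) * pd (b i) f u) u)"
    unfolding pol_def[abs_def]
    by (rule pd_sum[of _ _ V]) (use assms in \<open>auto intro!: function_algebra.mult polyfun_coord pd_polyfun\<close>)
  also have "\<dots> = (\<lambda>u. \<Sum>i<k. (if v = a i then pd (b i) f u else 0) + u (a i) * pd (b i) (pd v f) u)"
  proof (intro ext sum.cong refl)
    fix u i assume "i \<in> {..<k}"
    then have "a i \<in> V" using assms(1) by simp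
    then show "pd v (\<lambda>u. u (a i) * pd (b i) f u) u =
        (if v = a i then pd (b i) f u else 0) + u (a i) * pd (b i) (pd v f) u"
      by (subst pd_mult[OF polyfun_coord[of "a i" V] pd_polyfun[OF assms(2)]])
         (auto simp: pd_coord pd_commute[OF assms(2), of v])
  qed
  finally show ?thesis by (simp add: sum.distrib pol_def)
qed

text \<open>For \<open>u\<close> vanishing on \<open>W\<close> this is, up to the factor \<open>k!\<close>, the Fischer inner product of the
  parts of degree \<open>k\<close> in the variables of \<open>W\<close>, the other variables being parameters with the
  values given by \<open>u\<close>. The recursion sums over \<open>k\<close>-tuples of variables rather than over
  monomials, which keeps the proof of adjointness short.\<close>

fun fischer :: "'v set \<Rightarrow> nat \<Rightarrow> (('v \<Rightarrow> complex) \<Rightarrow> complex) \<Rightarrow> (('v \<Rightarrow> complex) \<Rightarrow> complex) \<Rightarrow> ('v \<Rightarrow> complex) \<Rightarrow> complex"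
  where
  "fischer W 0 f g u = f u * cnj (g u)"
| "fischer W (Suc k) f g u = (\<Sum>v\<in>W. fischer W k (pd v f) (pd v g) u)"

lemma fischer_add_left:
  assumes "f \<in> polyfun V" "g \<in> polyfun V"
  shows "fischer W k (\<lambda>u. f u + g u) h u = fischer W k f h u + fischer W k g h u"
  using assms by (induction k arbitrary: f g h)
     (simp_all add: distrib_right pd_add[of _ V] sum.distrib pd_polyfun)

lemma fischer_zero_left: "fischer W k (\<lambda>_. 0) h u = 0"
  by (induction k arbitrary: h) simp_all

lemma fischer_sum_left:
  assumes "\<And>i. i \<in> I \<Longrightarrow> f i \<in> polyfun V"
  shows "fischer W k (\<lambda>u. \<Sum>i\<in>I. f i u) h u = (\<Sum>i\<in>I. fischer W k (f i) h u)"
  using assms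
proof (induction I rule: infinite_finite_induct)
  case (insert x F)
  then show ?case using fischer_add_left[OF _ fa_sum, of "f x" V F f W k h u] by simp
qed (simp_all add: fischer_zero_left)

lemma fischer_cnj: "cnj (fischer W k f g u) = fischer W k g f u"
  by (induction k arbitrary: f g) (simp_all add: mult.commute)

lemma fischer_sum_right:
  assumes "\<And>i. i \<in> I \<Longrightarrow> f i \<in> polyfun V"
  shows "fischer W k h (\<lambda>u. \<Sum>i\<in>I. f i u) u = (\<Sum>i\<in>I. fischer W k h (f i) u)"
proof -
  have "cnj (fischer W k h (\<lambda>u. \<Sum>i\<in>I. f i u) u) = cnj (\<Sum>i\<in>I. fischer W k h (f i) u)"
    by (simp only: fischer_cnj cnj_sum fischer_sum_left[where V = V, OF assms])
  then show ?thesis by (simp only: complex_cnj_cancel_iff)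
qed

lemma fischer_self: "Re (fischer W k f f u) \<ge> 0 \<and> Im (fischer W k f f u) = 0"
  by (induction k arbitrary: f) (simp_all add: sum_nonneg)

lemma fischer_sum_eq_0:
  assumes "finite I" "(\<Sum>i\<in>I. fischer W k (f i) (f i) u) = 0" "i \<in> I"
  shows "fischer W k (f i) (f i) u = 0"
proof -
  have "(\<Sum>i\<in>I. Re (fischer W k (f i) (f i) u)) = 0" using assms(2) by (metis Re_sum zero_complex.sel(1))
  then have "Re (fischer W k (f i) (f i) u) = 0"
    using assms(1,3) sum_nonneg_eq_0_iff[of I "\<lambda>i. Re (fischer W k (f i) (f i) u)"] fischer_self by blast
  then show ?thesis using fischer_self[of W k "f i" u] by (simp add: complex_eq_iff)
qed

text \<open>In the Fischer inner product, multiplication by a variable is adjoint to differentiation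
  by it. The factor \<open>Suc k\<close> stems from the missing normalization.\<close>

lemma fischer_adjoint:
  assumes W: "finite W" "W \<subseteq> V" "\<And>v. v \<in> W \<Longrightarrow> u v = 0" and w: "w \<in> W"
    and "f \<in> polyfun V" "g \<in> polyfun V"
  shows "fischer W (Suc k) (\<lambda>u. u w * f u) g u = of_nat (Suc k) * fischer W k f (pd w g) u"
  using assms(5,6)
proof (induction k arbitrary: f g)
  case (0 f g)
  have "fischer W (Suc 0) (\<lambda>u. u w * f u) g u = (\<Sum>v\<in>W. (if v = w then 1 else 0) * f u * cnj (pd v g u))"
    using 0 W w by (auto simp: pd_mult[OF polyfun_coord[of w V]] pd_coord intro!: sum.cong)
  also have "\<dots> = (\<Sum>v\<in>W. if v = w then f u * cnj (pd v g u) else 0)" by (rule sum.cong) auto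
  finally show ?case using W(1) w by simp
next
  case (Suc k f g)
  have wV: "(\<lambda>u. u w) \<in> polyfun V" using w W(2) by (intro polyfun_coord) auto
  have step: "fischer W (Suc k) (pd v (\<lambda>u. u w * f u)) (pd v g) u =
     (if v = w then fischer W (Suc k) f (pd v g) u else 0)
      + of_nat (Suc k) * fischer W k (pd v f) (pd w (pd v g)) u" for v
  proof -
    have eq: "pd v (\<lambda>u. u w * f u) = (\<lambda>u. (if v = w then 1 else 0) * f u + u w * pd v f u)"
      using pd_mult[OF wV Suc.prems(1), of v] by (simp add: pd_coord)
    have "fischer W (Suc k) (pd v (\<lambda>u. u w * f u)) (pd v g) u =
        fischer W (Suc k) (\<lambda>u. (if v = w then 1 else 0) * f u) (pd v g) u
        + fischer W (Suc k) (\<lambda>u. u w * pd v f u) (pd v g) u"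
      unfolding eq
      by (rule fischer_add_left[where V = V])
         (use Suc.prems wV in \<open>auto intro!: function_algebra.mult function_algebra.const pd_polyfun\<close>)
    also have "fischer W (Suc k) (\<lambda>u. u w * pd v f u) (pd v g) u =
        of_nat (Suc k) * fischer W k (pd v f) (pd w (pd v g)) u"
      by (rule Suc.IH) (use Suc.prems in \<open>auto intro: pd_polyfun\<close>)
    finally show ?thesis by (simp add: fischer_zero_left)
  qed
  have "fischer W (Suc (Suc k)) (\<lambda>u. u w * f u) g u =
      (\<Sum>v\<in>W. fischer W (Suc k) (pd v (\<lambda>u. u w * f u)) (pd v g) u)"
    by (rule fischer.simps(2))
  also have "\<dots> = fischer W (Suc k) f (pd w g) u
      + of_nat (Suc k) * (\<Sum>v\<in>W. fischer W k (pd v f) (pd w (pd v g)) u)"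
    unfolding step sum.distrib sum_distrib_left using W(1) w by simp
  also have "(\<Sum>v\<in>W. fischer W k (pd v f) (pd w (pd v g)) u) = fischer W (Suc k) f (pd w g) u"
    by (simp add: pd_commute[OF Suc.prems(2), of w])
  finally show ?case by (simp add: algebra_simps)
qed

text \<open>Hence the polarization operators \<open>\<Sum> a\<^sub>i \<partial>/\<partial>b\<^sub>i\<close> and \<open>\<Sum> b\<^sub>i \<partial>/\<partial>a\<^sub>i\<close> are adjoint, just as
  \<open>E\<^sub>p\<^sub>q\<close> and \<open>E\<^sub>q\<^sub>p\<close> are.\<close>

lemma fischer_pol_adjoint:
  assumes W: "finite W" "W \<subseteq> V" "\<And>v. v \<in> W \<Longrightarrow> u v = 0"
    and ab: "\<And>i. i < l \<Longrightarrow> a i \<in> W" "\<And>i. i < l \<Longrightarrow> b i \<in> W"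
    and f: "f \<in> polyfun V" and g: "g \<in> polyfun V"
  shows "fischer W k (pol l a b f) g u = fischer W k f (pol l b a g) u"
proof (cases k)
  case 0
  then show ?thesis using ab W(3) by (simp add: pol_def)
next
  case (Suc k')
  have one: "fischer W k (\<lambda>u. u (c i) * pd (d i) h u) h' u = of_nat k * fischer W k' (pd (d i) h) (pd (c i) h') u"
    if "h \<in> polyfun V" "h' \<in> polyfun V" "c i \<in> W" for h h' c d and i :: nat
    unfolding Suc by (rule fischer_adjoint[OF W]) (use that in \<open>auto intro: pd_polyfun\<close>)
  have aV: "\<And>i. i < l \<Longrightarrow> a i \<in> V" "\<And>i. i < l \<Longrightarrow> b i \<in> V" using ab W(2) by auto
  have "fischer W k (pol l a b f) g u = (\<Sum>i<l. fischer W k (\<lambda>u. u (a i) * pd (b i) f u) g u)"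
    unfolding pol_def[abs_def]
    by (rule fischer_sum_left[of _ _ V]) (use aV f in \<open>auto intro!: function_algebra.mult polyfun_coord pd_polyfun\<close>)
  also have "\<dots> = (\<Sum>i<l. of_nat k * fischer W k' (pd (b i) f) (pd (a i) g) u)"
    by (rule sum.cong) (use one[OF f g, of a _ b] ab in auto)
  also have "\<dots> = (\<Sum>i<l. fischer W k f (\<lambda>u. u (b i) * pd (a i) g u) u)"
  proof (rule sum.cong[OF refl])
    fix i assume "i \<in> {..<l}"
    then have "fischer W k (\<lambda>u. u (b i) * pd (a i) g u) f u = of_nat k * fischer W k' (pd (a i) g) (pd (b i) f) u"
      using one[OF g f, of b i a] ab by auto
    then have "cnj (fischer W k (\<lambda>u. u (b i) * pd (a i) g u) f u) = of_nat k * cnj (fischer W k' (pd (a i) g) (pd (b i) f) u)"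
      by simp
    then show "of_nat k * fischer W k' (pd (b i) f) (pd (a i) g) u = fischer W k f (\<lambda>u. u (b i) * pd (a i) g u) u"
      by (simp add: fischer_cnj)
  qed
  also have "\<dots> = fischer W k f (pol l b a g) u"
    unfolding pol_def[abs_def]
    by (rule fischer_sum_right[symmetric, of _ _ V])
       (use aV g in \<open>auto intro!: function_algebra.mult polyfun_coord pd_polyfun\<close>)
  finally show ?thesis .
qed

text \<open>The form is positive definite: if all \<open>k\<close>-th derivatives vanish where the variables of \<open>W\<close>
  do, then by induction on the degree the first derivatives along \<open>W\<close> vanish identically, and
  \<open>f\<close> is determined by its values at the points where \<open>W\<close> vanishes.\<close>

lemma fischer_definite:
  assumes W: "finite W" and "polydeg V l f"
    and "\<And>k u. (\<And>v. v \<in> W \<Longrightarrow> u v = 0) \<Longrightarrow> fischer W k f f u = 0"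
  shows "f = (\<lambda>_. 0)"
proof -
  have "polydeg V l f \<Longrightarrow> (\<forall>k u. (\<forall>v\<in>W. u v = 0) \<longrightarrow> fischer W k f f u = 0) \<Longrightarrow> f = (\<lambda>_. 0)" for f
  proof (induction l arbitrary: f)
    case 0
    then obtain c where "f = (\<lambda>_. c)" using polydeg_0 by blast
    moreover have "fischer W 0 f f (\<lambda>_. 0) = 0" using 0(2) by (simp del: fischer.simps)
    ultimately show ?case by simp
  next
    case (Suc l)
    have pd0: "pd v f = (\<lambda>_. 0)" if "v \<in> W" for v
    proof (rule Suc.IH)
      show "polydeg V l (pd v f)" using pd_polydeg[OF Suc.prems(1)] by simp
      show "\<forall>k u. (\<forall>v\<in>W. u v = 0) \<longrightarrow> fischer W k (pd v f) (pd v f) u = 0"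
      proof (intro allI impI)
        fix k u assume "\<forall>v\<in>W. u v = (0::complex)"
        then have "fischer W (Suc k) f f u = 0" using Suc.prems(2) by blast
        then have "(\<Sum>v\<in>W. fischer W k (pd v f) (pd v f) u) = 0" by simp
        from fischer_sum_eq_0[OF W this that] show "fischer W k (pd v f) (pd v f) u = 0" .
      qed
    qed
    show ?case
    proof
      fix u
      have "f (\<lambda>v. if v \<in> W then 0 else u v) = f u"
        by (rule pd_eq_0_imp_indep_set[OF polydeg_polyfun[OF Suc.prems(1)] _ W]) (simp add: pd0)
      moreover have "fischer W 0 f f (\<lambda>v. if v \<in> W then 0 else u v) = 0"
        using Suc.prems(2) by (simp del: fischer.simps)
      ultimately show "f u = 0" by simp
    qed
  qed
  then show ?thesis using assms(2,3) by blast
qed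

text \<open>The form of \<open>f\<close> with the sum of the Euler operators applied to \<open>f\<close> is, by adjointness, a
  positive multiple of the sum of the squares of the first derivatives of \<open>f\<close> along \<open>W\<close>. So if
  the Euler operators of a partition of \<open>W\<close> kill \<open>f\<close>, then \<open>f\<close> does not depend on \<open>W\<close>.\<close>

lemma euler_eq_0_imp_indep:
  fixes a :: "nat \<Rightarrow> nat \<Rightarrow> 'v"
  assumes f: "f \<in> polyfun V" and W: "W = (\<lambda>(p, i). a p i) ` ({..<s} \<times> {..<l})" "W \<subseteq> V"
    and inj: "inj_on (\<lambda>(p, i). a p i) ({..<s} \<times> {..<l})"
    and e: "\<And>p. p < s \<Longrightarrow> pol l (a p) (a p) f = (\<lambda>_. 0)"
  shows "v \<in> W \<Longrightarrow> pd v f = (\<lambda>_. 0)"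
proof -
  assume v: "v \<in> W"
  have fin: "finite W" unfolding W(1) by simp
  obtain d where d: "polydeg V d f" using polyfun_polydeg[OF f] by blast
  have aW: "a p i \<in> W" if "p < s" "i < l" for p i unfolding W(1) using that by force
  show "pd v f = (\<lambda>_. 0)"
  proof (rule fischer_definite[OF fin pd_polydeg[OF d]])
    fix k u assume u: "\<And>v. v \<in> W \<Longrightarrow> u v = (0::complex)"
    have "0 = (\<Sum>p<s. fischer W (Suc k) (pol l (a p) (a p) f) f u)" using e by (simp add: fischer_zero_left)
    also have "\<dots> = (\<Sum>p<s. \<Sum>i<l. fischer W (Suc k) (\<lambda>u. u (a p i) * pd (a p i) f u) f u)"
      unfolding pol_def[abs_def]
      by (intro sum.cong refl fischer_sum_left[of _ _ V])
         (use aW W(2) f in \<open>auto intro!: function_algebra.mult polyfun_coord pd_polyfun\<close>)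
    also have "\<dots> = (\<Sum>p<s. \<Sum>i<l. of_nat (Suc k) * fischer W k (pd (a p i) f) (pd (a p i) f) u)"
      by (intro sum.cong refl fischer_adjoint[OF fin W(2) u]) (use aW f in \<open>auto intro: pd_polyfun\<close>)
    also have "\<dots> = of_nat (Suc k) * (\<Sum>p<s. \<Sum>i<l. fischer W k (pd (a p i) f) (pd (a p i) f) u)"
      by (simp add: sum_distrib_left)
    also have "(\<Sum>p<s. \<Sum>i<l. fischer W k (pd (a p i) f) (pd (a p i) f) u) = (\<Sum>v\<in>W. fischer W k (pd v f) (pd v f) u)"
      unfolding W(1) by (subst sum.reindex[OF inj]) (simp add: sum.cartesian_product case_prod_unfold)
    finally have "(\<Sum>v\<in>W. fischer W k (pd v f) (pd v f) u) = 0" by (metis mult_eq_0_iff of_nat_neq_0)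
    from fischer_sum_eq_0[OF fin this v] show "fischer W k (pd v f) (pd v f) u = 0" .
  qed
qed

section \<open>The first fundamental theorem for pairs of matrices\<close>

text \<open>The coordinates of a pair \<open>(X, Y)\<close> of matrices: \<open>LeftVar i p\<close> is the entry \<open>X\<^sub>i\<^sub>p\<close>, and
  \<open>RightVar p j\<close> is the entry \<open>Y\<^sub>p\<^sub>j\<close>.\<close>

datatype fvar = LeftVar nat nat | RightVar nat nat

locale factor_pair =
  fixes m t n :: nat
begin

definition LV :: "fvar set" where "LV = (\<lambda>(p, i). LeftVar i p) ` ({..<t} \<times> {..<m})"
definition RV :: "fvar set" where "RV = (\<lambda>(p, j). RightVar p j) ` ({..<t} \<times> {..<n})"
definition PV :: "fvar set" where "PV = LV \<union> RV"

definition entry :: "nat \<Rightarrow> nat \<Rightarrow> (fvar \<Rightarrow> complex) \<Rightarrow> complex" where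
  "entry i j u = (\<Sum>p<t. u (LeftVar i p) * u (RightVar p j))"

definition entry_algebra :: "((fvar \<Rightarrow> complex) \<Rightarrow> complex) set" where
  "entry_algebra = function_algebra {entry i j | i j. i < m \<and> j < n}"

abbreviation EL :: "nat \<Rightarrow> nat \<Rightarrow> ((fvar \<Rightarrow> complex) \<Rightarrow> complex) \<Rightarrow> (fvar \<Rightarrow> complex) \<Rightarrow> complex" where
  "EL p q \<equiv> pol m (\<lambda>i. LeftVar i p) (\<lambda>i. LeftVar i q)"

abbreviation ER :: "nat \<Rightarrow> nat \<Rightarrow> ((fvar \<Rightarrow> complex) \<Rightarrow> complex) \<Rightarrow> (fvar \<Rightarrow> complex) \<Rightarrow> complex" where
  "ER p q \<equiv> pol n (\<lambda>j. RightVar p j) (\<lambda>j. RightVar q j)"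

text \<open>Invariance under the Lie algebra of \<open>GL\<^sub>t\<close> acting by \<open>(X, Y) \<mapsto> (X g\<inverse>, g Y)\<close>: the
  elementary matrix \<open>E\<^sub>p\<^sub>q\<close> acts on functions by \<open>ER q p - EL p q\<close>.\<close>

definition invariant :: "((fvar \<Rightarrow> complex) \<Rightarrow> complex) \<Rightarrow> bool" where
  "invariant f \<longleftrightarrow> f \<in> polyfun PV \<and> (\<forall>p<t. \<forall>q<t. EL p q f = ER q p f)"

definition contraction :: "nat \<Rightarrow> nat \<Rightarrow> ((fvar \<Rightarrow> complex) \<Rightarrow> complex) \<Rightarrow> (fvar \<Rightarrow> complex) \<Rightarrow> complex" where
  "contraction i j f u = (\<Sum>p<t. pd (LeftVar i p) (pd (RightVar p j) f) u)"

definition casimir :: "((fvar \<Rightarrow> complex) \<Rightarrow> complex) \<Rightarrow> (fvar \<Rightarrow> complex) \<Rightarrow> complex" where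
  "casimir f u = (\<Sum>p<t. \<Sum>q<t. EL p q (EL q p f) u)"

lemma LeftVar_PV [simp]: "LeftVar i p \<in> PV \<longleftrightarrow> i < m \<and> p < t"
  unfolding PV_def LV_def RV_def by auto

lemma RightVar_PV [simp]: "RightVar p j \<in> PV \<longleftrightarrow> p < t \<and> j < n"
  unfolding PV_def LV_def RV_def by auto

lemma finite_LV: "finite LV" and finite_RV: "finite RV" and finite_PV: "finite PV"
  unfolding PV_def LV_def RV_def by auto

lemma EL_polyfun: "p < t \<Longrightarrow> f \<in> polyfun PV \<Longrightarrow> EL p q f \<in> polyfun PV"
  by (rule pol_polyfun) auto

lemma ER_polyfun: "p < t \<Longrightarrow> f \<in> polyfun PV \<Longrightarrow> ER p q f \<in> polyfun PV"
  by (rule pol_polyfun) auto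

lemma entry_polyfun: "i < m \<Longrightarrow> j < n \<Longrightarrow> entry i j \<in> polyfun PV"
  unfolding entry_def[abs_def]
  by (intro fa_sum function_algebra.mult polyfun_coord) auto

lemma entry_algebra_polyfun: "f \<in> entry_algebra \<Longrightarrow> f \<in> polyfun PV"
  unfolding entry_algebra_def using fa_subst[of f _ "\<lambda>u. u"] entry_polyfun by blast

lemma pd_left_EL:
  assumes "f \<in> polyfun PV" "p < t" "i < m"
  shows "pd (LeftVar i r) (EL p q f) =
    (\<lambda>u. (if r = p then pd (LeftVar i q) f u else 0) + EL p q (pd (LeftVar i r) f) u)"
proof -
  have "(\<Sum>i'<m. if LeftVar i r = LeftVar i' p then pd (LeftVar i' q) f u else 0)
      = (if r = p then pd (LeftVar i q) f u else 0)" for u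
  proof (cases "r = p")
    case True
    then have "(\<Sum>i'<m. if LeftVar i r = LeftVar i' p then pd (LeftVar i' q) f u else 0)
      = (\<Sum>i'<m. if i' = i then pd (LeftVar i' q) f u else 0)" by (intro sum.cong) auto
    then show ?thesis using assms(3) True by simp
  qed simp
  then show ?thesis
    by (subst pd_pol[of m _ PV f]) (use assms in auto)
qed

lemma pd_right_EL:
  assumes "f \<in> polyfun PV" "p < t"
  shows "pd (RightVar r j) (EL p q f) = EL p q (pd (RightVar r j) f)"
  by (subst pd_pol[of m _ PV f]) (use assms in auto)

lemma pd_right_ER:
  assumes "f \<in> polyfun PV" "p < t" "j < n"
  shows "pd (RightVar r j) (ER p q f) =
    (\<lambda>u. (if r = p then pd (RightVar q j) f u else 0) + ER p q (pd (RightVar r j) f) u)"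
proof -
  have "(\<Sum>j'<n. if RightVar r j = RightVar p j' then pd (RightVar q j') f u else 0)
      = (if r = p then pd (RightVar q j) f u else 0)" for u
  proof (cases "r = p")
    case True
    then have "(\<Sum>j'<n. if RightVar r j = RightVar p j' then pd (RightVar q j') f u else 0)
      = (\<Sum>j'<n. if j' = j then pd (RightVar q j') f u else 0)" by (intro sum.cong) auto
    then show ?thesis using assms(3) True by simp
  qed simp
  then show ?thesis
    by (subst pd_pol[of n _ PV f]) (use assms in auto)
qed

lemma pd_left_ER:
  assumes "f \<in> polyfun PV" "p < t"
  shows "pd (LeftVar i r) (ER p q f) = ER p q (pd (LeftVar i r) f)"
  by (subst pd_pol[of n _ PV f]) (use assms in auto)

lemma contraction_polyfun: "f \<in> polyfun PV \<Longrightarrow> contraction i j f \<in> polyfun PV"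
  unfolding contraction_def[abs_def] by (intro fa_sum pd_polyfun) auto

lemma contraction_EL:
  assumes f: "f \<in> polyfun PV" and pq: "p < t" and ij: "i < m"
  shows "contraction i j (EL p q f) = (\<lambda>u. pd (LeftVar i q) (pd (RightVar p j) f) u + EL p q (contraction i j f) u)"
proof
  fix u
  have "contraction i j (EL p q f) u = (\<Sum>r<t. pd (LeftVar i r) (EL p q (pd (RightVar r j) f)) u)"
    unfolding contraction_def using pd_right_EL[OF f pq] by simp
  also have "\<dots> = (\<Sum>r<t. (if r = p then pd (LeftVar i q) (pd (RightVar r j) f) u else 0)
      + EL p q (pd (LeftVar i r) (pd (RightVar r j) f)) u)"
    by (subst pd_left_EL[OF pd_polyfun[OF f] pq ij]) simp
  also have "\<dots> = pd (LeftVar i q) (pd (RightVar p j) f) u + (\<Sum>r<t. EL p q (pd (LeftVar i r) (pd (RightVar r j) f)) u)"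
    using pq by (simp add: sum.distrib)
  also have "(\<Sum>r<t. EL p q (pd (LeftVar i r) (pd (RightVar r j) f)) u) = EL p q (contraction i j f) u"
    unfolding contraction_def[abs_def]
    by (subst pol_sum[where V = PV]) (auto intro: pd_polyfun f)
  finally show "contraction i j (EL p q f) u = pd (LeftVar i q) (pd (RightVar p j) f) u + EL p q (contraction i j f) u" .
qed

lemma contraction_ER:
  assumes f: "f \<in> polyfun PV" and pq: "q < t" and ij: "j < n"
  shows "contraction i j (ER q p f) = (\<lambda>u. pd (LeftVar i q) (pd (RightVar p j) f) u + ER q p (contraction i j f) u)"
proof
  fix u
  have "contraction i j (ER q p f) u = (\<Sum>r<t. pd (RightVar r j) (pd (LeftVar i r) (ER q p f)) u)"
    unfolding contraction_def using pd_commute[OF ER_polyfun[OF pq f]] by simp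
  also have "\<dots> = (\<Sum>r<t. pd (RightVar r j) (ER q p (pd (LeftVar i r) f)) u)"
    using pd_left_ER[OF f pq] by simp
  also have "\<dots> = (\<Sum>r<t. (if r = q then pd (RightVar p j) (pd (LeftVar i r) f) u else 0)
      + ER q p (pd (RightVar r j) (pd (LeftVar i r) f)) u)"
    by (subst pd_right_ER[OF pd_polyfun[OF f] pq ij]) simp
  also have "\<dots> = pd (LeftVar i q) (pd (RightVar p j) f) u + (\<Sum>r<t. ER q p (pd (LeftVar i r) (pd (RightVar r j) f)) u)"
    using pq by (simp add: sum.distrib pd_commute[OF f, of "RightVar _ _"])
  also have "(\<Sum>r<t. ER q p (pd (LeftVar i r) (pd (RightVar r j) f)) u) = ER q p (contraction i j f) u"
    unfolding contraction_def[abs_def]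
    by (subst pol_sum[where V = PV]) (auto intro: pd_polyfun f)
  finally show "contraction i j (ER q p f) u = pd (LeftVar i q) (pd (RightVar p j) f) u + ER q p (contraction i j f) u" .
qed

text \<open>The operators \<open>\<Sum>\<^sub>p \<partial>\<^sup>2/\<partial>X\<^sub>i\<^sub>p\<partial>Y\<^sub>p\<^sub>j\<close> have the same commutator with \<open>EL p q\<close> as with
  \<open>ER q p\<close>. They are the constant coefficient operators dual to the entries of \<open>X Y\<close>.\<close>

lemma contraction_invariant:
  assumes "invariant f" "i < m" "j < n"
  shows "invariant (contraction i j f)"
  unfolding invariant_def
proof (intro conjI allI impI)
  have f: "f \<in> polyfun PV" using assms(1) unfolding invariant_def by blast
  show "contraction i j f \<in> polyfun PV" by (rule contraction_polyfun[OF f])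
  fix p q assume "p < t" "q < t"
  then have "contraction i j (EL p q f) = contraction i j (ER q p f)"
    using assms(1) unfolding invariant_def by simp
  then show "EL p q (contraction i j f) = ER q p (contraction i j f)"
    unfolding contraction_EL[OF f \<open>p < t\<close> assms(2)] contraction_ER[OF f \<open>q < t\<close> assms(3)]
    by (auto simp: fun_eq_iff)
qed

lemma EL_entry:
  assumes "i < m" "j < n" "p < t" "q < t"
  shows "EL p q (entry i j) = (\<lambda>u. u (LeftVar i p) * u (RightVar q j))"
proof
  fix u
  have "pd (LeftVar k q) (entry i j) u = (if k = i then u (RightVar q j) else 0)" for k
  proof -
    have "pd (LeftVar k q) (entry i j) u =
      (\<Sum>r<t. pd (LeftVar k q) (\<lambda>u. u (LeftVar i r) * u (RightVar r j)) u)"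
      unfolding entry_def[abs_def]
      by (subst pd_sum[where V = PV]) (use assms in \<open>auto intro!: function_algebra.mult polyfun_coord\<close>)
    also have "\<dots> = (\<Sum>r<t. if r = q then if k = i then u (RightVar q j) else 0 else 0)"
    proof (rule sum.cong[OF refl])
      fix r assume "r \<in> {..<t}"
      then show "pd (LeftVar k q) (\<lambda>u. u (LeftVar i r) * u (RightVar r j)) u =
          (if r = q then if k = i then u (RightVar q j) else 0 else 0)"
        by (subst pd_mult[OF polyfun_coord[of _ PV] polyfun_coord[of _ PV]]) (use assms in \<open>auto simp: pd_coord\<close>)
    qed
    finally show ?thesis using assms by simp
  qed
  then have "EL p q (entry i j) u = (\<Sum>k<m. if k = i then u (LeftVar k p) * u (RightVar q j) else 0)"
    unfolding pol_def by (intro sum.cong) auto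
  then show "EL p q (entry i j) u = u (LeftVar i p) * u (RightVar q j)" using assms by simp
qed

lemma ER_entry:
  assumes "i < m" "j < n" "p < t" "q < t"
  shows "ER q p (entry i j) = (\<lambda>u. u (LeftVar i p) * u (RightVar q j))"
proof
  fix u
  have "pd (RightVar p k) (entry i j) u = (if k = j then u (LeftVar i p) else 0)" for k
  proof -
    have "pd (RightVar p k) (entry i j) u =
      (\<Sum>r<t. pd (RightVar p k) (\<lambda>u. u (LeftVar i r) * u (RightVar r j)) u)"
      unfolding entry_def[abs_def]
      by (subst pd_sum[where V = PV]) (use assms in \<open>auto intro!: function_algebra.mult polyfun_coord\<close>)
    also have "\<dots> = (\<Sum>r<t. if r = p then if k = j then u (LeftVar i p) else 0 else 0)"
    proof (rule sum.cong[OF refl])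
      fix r assume "r \<in> {..<t}"
      then show "pd (RightVar p k) (\<lambda>u. u (LeftVar i r) * u (RightVar r j)) u =
          (if r = p then if k = j then u (LeftVar i p) else 0 else 0)"
        by (subst pd_mult[OF polyfun_coord[of _ PV] polyfun_coord[of _ PV]]) (use assms in \<open>auto simp: pd_coord\<close>)
    qed
    finally show ?thesis using assms by simp
  qed
  then have "ER q p (entry i j) u = (\<Sum>k<n. if k = j then u (LeftVar i p) * u (RightVar q k) else 0)"
    unfolding pol_def by (intro sum.cong) auto
  then show "ER q p (entry i j) u = u (LeftVar i p) * u (RightVar q j)" using assms by simp
qed

lemma entry_algebra_invariant: "f \<in> entry_algebra \<Longrightarrow> invariant f"
  unfolding entry_algebra_def
proof (induction rule: function_algebra.induct)
  case (const c)
  show ?case unfolding invariant_def by (simp add: pol_const function_algebra.const)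
next
  case (coord f)
  then obtain i j where "i < m" "j < n" "f = entry i j" by blast
  then show ?case unfolding invariant_def by (simp add: EL_entry ER_entry entry_polyfun)
next
  case (add f g)
  then have fg: "f \<in> polyfun PV" "g \<in> polyfun PV" unfolding invariant_def by auto
  then show ?case using add.IH unfolding invariant_def
    by (auto simp: pol_add[OF fg] intro: function_algebra.add)
next
  case (mult f g)
  then have fg: "f \<in> polyfun PV" "g \<in> polyfun PV" unfolding invariant_def by auto
  then show ?case using mult.IH unfolding invariant_def
    by (auto simp: pol_mult[OF fg] intro: function_algebra.mult)
qed

lemma casimir_polydeg: "polydeg PV k f \<Longrightarrow> polydeg PV k (casimir f)"
  unfolding casimir_def[abs_def] by (intro polydeg_sum pol_polydeg) auto

lemma casimir_add:
  assumes "f \<in> polyfun PV" "g \<in> polyfun PV"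
  shows "casimir (\<lambda>u. f u + g u) = (\<lambda>u. casimir f u + casimir g u)"
proof -
  have "EL p q (EL q p (\<lambda>u. f u + g u)) = (\<lambda>u. EL p q (EL q p f) u + EL p q (EL q p g) u)"
    if "p < t" "q < t" for p q
    using that assms by (simp add: pol_add[of _ PV] EL_polyfun)
  then show ?thesis unfolding casimir_def[abs_def] by (simp add: sum.distrib)
qed

lemma casimir_cmult:
  assumes "f \<in> polyfun PV"
  shows "casimir (\<lambda>u. c * f u) = (\<lambda>u. c * casimir f u)"
proof -
  have "EL p q (EL q p (\<lambda>u. c * f u)) = (\<lambda>u. c * EL p q (EL q p f) u)" if "p < t" "q < t" for p q
    using that assms by (simp add: pol_cmult[of _ PV] EL_polyfun)
  then show ?thesis unfolding casimir_def[abs_def] by (simp add: sum_distrib_left)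
qed

text \<open>On an invariant, the inner factor \<open>EL q p\<close> may be replaced by \<open>ER p q\<close>, which commutes
  with the derivatives along \<open>X\<close> in \<open>EL p q\<close>. The product is then normally ordered and, after
  exchanging sums, contracts the entries of \<open>X Y\<close> with the dual second order operators.\<close>

lemma casimir_invariant:
  assumes "invariant f"
  shows "casimir f = (\<lambda>u. \<Sum>i<m. \<Sum>j<n. entry i j u * contraction i j f u)"
proof
  fix u
  have f: "f \<in> polyfun PV" and inv: "\<And>p q. p < t \<Longrightarrow> q < t \<Longrightarrow> EL p q f = ER q p f"
    using assms unfolding invariant_def by auto
  have ER: "EL p q (ER p q f) u =
      (\<Sum>i<m. \<Sum>j<n. u (LeftVar i p) * u (RightVar p j) * pd (LeftVar i q) (pd (RightVar q j) f) u)"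
    if "p < t" for p q
    unfolding pol_def[of m] pd_left_ER[OF f that] unfolding pol_def
    by (simp add: sum_distrib_left mult.assoc pd_commute[OF f, of "RightVar _ _"])
  have "casimir f u = (\<Sum>p<t. \<Sum>q<t. EL p q (ER p q f) u)"
    unfolding casimir_def by (intro sum.cong refl) (simp add: inv)
  also have "\<dots> = (\<Sum>p<t. \<Sum>q<t. \<Sum>i<m. \<Sum>j<n.
      u (LeftVar i p) * u (RightVar p j) * pd (LeftVar i q) (pd (RightVar q j) f) u)"
    by (intro sum.cong refl) (simp add: ER)
  also have "\<dots> = (\<Sum>p<t. \<Sum>i<m. \<Sum>q<t. \<Sum>j<n.
      u (LeftVar i p) * u (RightVar p j) * pd (LeftVar i q) (pd (RightVar q j) f) u)"
    by (rule sum.cong[OF refl], rule sum.swap)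
  also have "\<dots> = (\<Sum>i<m. \<Sum>p<t. \<Sum>q<t. \<Sum>j<n.
      u (LeftVar i p) * u (RightVar p j) * pd (LeftVar i q) (pd (RightVar q j) f) u)"
    by (rule sum.swap)
  also have "\<dots> = (\<Sum>i<m. \<Sum>p<t. \<Sum>j<n. \<Sum>q<t.
      u (LeftVar i p) * u (RightVar p j) * pd (LeftVar i q) (pd (RightVar q j) f) u)"
    by (rule sum.cong[OF refl], rule sum.cong[OF refl], rule sum.swap)
  also have "\<dots> = (\<Sum>i<m. \<Sum>j<n. \<Sum>p<t. \<Sum>q<t.
      u (LeftVar i p) * u (RightVar p j) * pd (LeftVar i q) (pd (RightVar q j) f) u)"
    by (rule sum.cong[OF refl], rule sum.swap)
  also have "\<dots> = (\<Sum>i<m. \<Sum>j<n. entry i j u * contraction i j f u)"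
    unfolding entry_def contraction_def sum_product by simp
  finally show "casimir f u = (\<Sum>i<m. \<Sum>j<n. entry i j u * contraction i j f u)" .
qed

text \<open>The form of \<open>casimir f\<close> with \<open>f\<close> is \<open>\<Sum>\<^sub>p\<^sub>q \<parallel>EL q p f\<parallel>\<^sup>2\<close>, because \<open>EL p q\<close> and \<open>EL q p\<close>
  are adjoint. So the Euler operators of the columns of \<open>X\<close> kill \<open>f\<close>, by invariance those of the
  rows of \<open>Y\<close> do as well, and \<open>f\<close> depends on no variable.\<close>

lemma casimir_eq_0_imp_const:
  assumes inv: "invariant f" and "casimir f = (\<lambda>_. 0)"
  shows "\<exists>c. f = (\<lambda>_. c)"
proof -
  have f: "f \<in> polyfun PV" using inv unfolding invariant_def by auto
  have LVsub: "LV \<subseteq> PV" "RV \<subseteq> PV" unfolding PV_def by auto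
  have E0: "EL p p f = (\<lambda>_. 0)" if p: "p < t" for p
  proof -
    obtain d where d: "polydeg PV d f" using polyfun_polydeg[OF f] by blast
    have dE: "polydeg PV d (EL p p f)" by (rule pol_polydeg) (use p d in auto)
    show ?thesis
    proof (rule fischer_definite[OF finite_LV dE])
      fix k u assume u: "\<And>v. v \<in> LV \<Longrightarrow> u v = (0::complex)"
      have LV: "LeftVar i p \<in> LV" if "i < m" "p < t" for i p unfolding LV_def using that by force
      have "0 = fischer LV k (casimir f) f u" using assms(2) by (simp add: fischer_zero_left)
      also have "\<dots> = (\<Sum>p<t. \<Sum>q<t. fischer LV k (EL p q (EL q p f)) f u)"
        unfolding casimir_def[abs_def]
        by (subst fischer_sum_left[where V = PV], use f in \<open>auto intro!: fa_sum EL_polyfun\<close>,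
            intro sum.cong refl fischer_sum_left[where V = PV], use f in \<open>auto intro!: EL_polyfun\<close>)
      also have "\<dots> = (\<Sum>p<t. \<Sum>q<t. fischer LV k (EL q p f) (EL q p f) u)"
        by (intro sum.cong refl fischer_pol_adjoint[OF finite_LV LVsub(1) u])
           (use f in \<open>auto intro: EL_polyfun LV\<close>)
      also have "\<dots> = (\<Sum>(p, q)\<in>{..<t} \<times> {..<t}. fischer LV k (EL q p f) (EL q p f) u)"
        by (rule sum.cartesian_product)
      finally have "(\<Sum>pq\<in>{..<t} \<times> {..<t}. fischer LV k (EL (snd pq) (fst pq) f) (EL (snd pq) (fst pq) f) u) = 0"
        by (simp add: case_prod_unfold)
      from fischer_sum_eq_0[OF _ this, of "(p, p)"] p
      show "fischer LV k (EL p p f) (EL p p f) u = 0" by simp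
    qed
  qed
  have "ER p p f = (\<lambda>_. 0)" if "p < t" for p using E0[OF that] inv that unfolding invariant_def by metis
  then have R: "pd v f = (\<lambda>_. 0)" if "v \<in> RV" for v
    by (intro euler_eq_0_imp_indep[OF f RV_def LVsub(2) _ _ that]) (auto simp: inj_on_def)
  have L: "pd v f = (\<lambda>_. 0)" if "v \<in> LV" for v
    using E0 by (intro euler_eq_0_imp_indep[OF f LV_def LVsub(1) _ _ that]) (auto simp: inj_on_def)
  have "f u = f (\<lambda>_. 0)" for u
  proof -
    have "f (\<lambda>v. if v \<in> PV then u v else 0) = f (\<lambda>_. 0)"
      by (rule pd_eq_0_imp_indep_set[OF f _ finite_PV]) (use L R PV_def in auto)
    moreover have "f (\<lambda>v. if v \<in> PV then u v else 0) = f u"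
      by (rule fa_eqI[OF f]) auto
    ultimately show ?thesis by simp
  qed
  then show ?thesis by blast
qed

lemma casimir_vanishes_at_0: "casimir f (\<lambda>_. 0) = 0"
  unfolding casimir_def pol_def by simp

text \<open>The image of the Casimir operator consists of functions vanishing at the origin, so the
  only constant in it is \<open>0\<close> and the previous lemma can be iterated.\<close>

lemma casimir_funpow_eq_0:
  assumes "invariant f" "\<And>k. invariant ((casimir ^^ k) f)" "(casimir ^^ k) f = (\<lambda>_. 0)"
  shows "\<exists>c. f = (\<lambda>_. c)"
  using assms(3)
proof (induction k)
  case (Suc k)
  then have "casimir ((casimir ^^ k) f) = (\<lambda>_. 0)" by simp
  then obtain c where c: "(casimir ^^ k) f = (\<lambda>_. c)" using casimir_eq_0_imp_const[OF assms(2)] by blast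
  show ?case
  proof (cases k)
    case 0
    then show ?thesis using c by auto
  next
    case (Suc k')
    then have "c = 0" using c casimir_vanishes_at_0[of "(casimir ^^ k') f"] by simp
    then show ?thesis using Suc.IH c by simp
  qed
qed auto

text \<open>The first fundamental theorem. By induction on the degree, the Casimir operator maps
  invariants of degree at most \<open>k\<close> into the algebra of the entries, because the contractions
  lower the degree by two. The iterates of the operator on \<open>f\<close> satisfy a linear relation; its
  part from the lowest exponent on, shifted to exponent \<open>0\<close>, is constant by the previous lemma,
  and this expresses \<open>f\<close> by a constant and by higher iterates, which lie in the algebra.\<close>

theorem invariant_in_entry_algebra:
  assumes "invariant f" shows "f \<in> entry_algebra"
proof -
  have "polydeg PV k f \<Longrightarrow> invariant f \<Longrightarrow> f \<in> entry_algebra" for k f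
  proof (induction k arbitrary: f rule: less_induct)
    case (less k f)
    note const_R = function_algebra.const[of _ "{entry i j | i j. i < m \<and> j < n}", folded entry_algebra_def]
    show ?case
    proof (cases k)
      case 0
      then show ?thesis using polydeg_0 less.prems(1) const_R by blast
    next
      case (Suc l)
      have cas: "casimir g \<in> entry_algebra" if g: "polydeg PV k g" "invariant g" for g
      proof -
        have con: "contraction i j g \<in> entry_algebra" if "i < m" "j < n" for i j
        proof (rule less.IH[of l])
          show "l < k" using Suc by simp
          have "polydeg PV (k - 1 - 1) (contraction i j g)"
            unfolding contraction_def[abs_def] by (intro polydeg_sum pd_polydeg g(1))
          then show "polydeg PV l (contraction i j g)" by (rule polydeg_mono) (simp add: Suc)
          show "invariant (contraction i j g)" by (rule contraction_invariant[OF g(2) that])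
        qed
        have "entry i j \<in> entry_algebra" if "i < m" "j < n" for i j
          unfolding entry_algebra_def by (rule function_algebra.coord) (use that in blast)
        then show ?thesis using con unfolding casimir_invariant[OF g(2)] entry_algebra_def
          by (intro fa_sum function_algebra.mult) auto
      qed
      define g where "g = (\<lambda>i. (casimir ^^ i) f)"
      have g: "polydeg PV k (g i) \<and> invariant (g i)" for i
        by (induction i) (use less.prems casimir_polydeg cas entry_algebra_invariant in \<open>auto simp: g_def\<close>)
      have gR: "g (Suc i) \<in> entry_algebra" for i using cas[of "g i"] g by (simp add: g_def)
      from polydeg_dependent[of PV k g, OF finite_PV conjunct1[OF g]]
      obtain c and M :: nat where cM: "(\<exists>i\<le>M. c i \<noteq> 0) \<and> (\<forall>u. (\<Sum>i\<le>M. c i * g i u) = 0)"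
        by (elim exE)
      then have c: "\<exists>i\<le>M. c i \<noteq> 0" "\<And>u. (\<Sum>i\<le>M. c i * g i u) = 0" by auto
      \<comment> \<open>the lowest exponent that occurs in the relation; dividing by this power of the operator
        leaves \<open>h\<close>\<close>
      define i0 where "i0 = (LEAST i. c i \<noteq> 0)"
      have i0: "c i0 \<noteq> 0" unfolding i0_def by (rule LeastI_ex) (use c(1) in blast)
      have i0M: "i0 \<le> M" using c(1) Least_le[of "\<lambda>i. c i \<noteq> 0"] le_trans unfolding i0_def by blast
      have c0: "c i = 0" if "i < i0" for i using that not_less_Least unfolding i0_def by blast
      define h where "h = (\<lambda>u. \<Sum>i\<le>M - i0. c (i + i0) * g i u)"
      have lin: "(casimir ^^ k) (\<lambda>u. \<Sum>i\<in>I. a i * g i u) = (\<lambda>u. \<Sum>i\<in>I. a i * g (i + k) u)"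
        if "finite I" for k I a
      proof (induction k)
        case (Suc k)
        have pg: "g i \<in> polyfun PV" for i using g unfolding invariant_def by blast
        have "casimir (\<lambda>u. \<Sum>i\<in>I. a i * g (i + k) u) = (\<lambda>u. \<Sum>i\<in>I. a i * g (i + Suc k) u)"
          using that
        proof induction
          case empty
          then show ?case by (auto simp: casimir_def[abs_def] pol_const)
        next
          case (insert x F)
          have "casimir (\<lambda>u. a x * g (x + k) u + (\<Sum>i\<in>F. a i * g (i + k) u)) =
              (\<lambda>u. a x * casimir (g (x + k)) u + casimir (\<lambda>u. \<Sum>i\<in>F. a i * g (i + k) u) u)"
            by (subst casimir_add)
               (auto simp: casimir_cmult[OF pg] intro!: fa_sum function_algebra.mult function_algebra.const pg)
          then show ?case using insert by (simp add: g_def)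
        qed
        then show ?case using Suc by simp
      qed simp
      have hinv: "invariant ((casimir ^^ k) h)" for k
      proof -
        have "(casimir ^^ k) h = (\<lambda>u. \<Sum>i\<le>M - i0. c (i + i0) * g (i + k) u)"
          unfolding h_def by (rule lin) simp
        moreover have "invariant (\<lambda>u. \<Sum>i\<in>I. a i * g' i u)" if "\<And>i. invariant (g' i)" "finite I"
          for a g' and I :: "nat set"
        proof -
          have pg: "g' i \<in> polyfun PV" for i using that unfolding invariant_def by blast
          have inv: "EL p q (g' i) = ER q p (g' i)" if "p < t" "q < t" for p q i
            using \<open>\<And>i. invariant (g' i)\<close> that unfolding invariant_def by blast
          have cg: "(\<lambda>u. a i * g' i u) \<in> polyfun PV" for i
            by (intro function_algebra.mult function_algebra.const pg)
          show ?thesis unfolding invariant_def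
            by (auto intro!: fa_sum cg simp: pol_sum[where V = PV, OF cg] pol_cmult[OF pg] inv)
        qed
        ultimately show ?thesis using g by simp
      qed
      have "(casimir ^^ i0) h = (\<lambda>u. \<Sum>i\<le>M - i0. c (i + i0) * g (i + i0) u)"
        unfolding h_def by (rule lin) simp
      also have "\<dots> = (\<lambda>u. \<Sum>i\<in>{i0..M}. c i * g i u)"
      proof
        fix u
        have "(\<Sum>i\<in>{0 + i0..M - i0 + i0}. c i * g i u) = (\<Sum>i\<in>{0..M - i0}. c (i + i0) * g (i + i0) u)"
          by (rule sum.shift_bounds_cl_nat_ivl)
        then show "(\<Sum>i\<le>M - i0. c (i + i0) * g (i + i0) u) = (\<Sum>i\<in>{i0..M}. c i * g i u)"
          using i0M by (simp add: atMost_atLeast0)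
      qed
      also have "\<dots> = (\<lambda>u. \<Sum>i\<le>M. c i * g i u)"
        by (intro ext sum.mono_neutral_left) (auto simp: c0)
      finally have "(casimir ^^ i0) h = (\<lambda>_. 0)" using c(2) by simp
      then obtain e where e: "h = (\<lambda>_. e)" using casimir_funpow_eq_0[OF hinv[of 0, simplified] hinv] by blast
      have "f u = inverse (c i0) * (e - (\<Sum>i<M - i0. c (Suc i + i0) * g (Suc i) u))" for u
      proof -
        have "e = (\<Sum>i\<le>M - i0. c (i + i0) * g i u)" using fun_cong[OF e[unfolded h_def], of u] by simp
        also have "\<dots> = c i0 * f u + (\<Sum>i<M - i0. c (Suc i + i0) * g (Suc i) u)"
          by (subst sum.atMost_shift) (simp add: g_def)
        finally show ?thesis using i0 by (simp add: field_simps)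
      qed
      then have "f = (\<lambda>u. inverse (c i0) * (e - (\<Sum>i<M - i0. c (Suc i + i0) * g (Suc i) u)))" by blast
      also have "\<dots> \<in> entry_algebra"
        using gR unfolding entry_algebra_def
        by (intro function_algebra.mult fa_diff fa_sum function_algebra.const) auto
      finally show ?thesis .
    qed
  qed
  then show ?thesis using polyfun_polydeg assms unfolding invariant_def by blast
qed

end

section \<open>Polynomial rings are integrally closed\<close>

lemma poly_eq_if_eq_nonzero:
  fixes p q :: "complex poly"
  assumes "\<And>x. x \<noteq> 0 \<Longrightarrow> poly p x = poly q x"
  shows "p = q"
proof -
  have "poly ([:0, 1:] * (p - q)) = poly 0" using assms by (auto simp: fun_eq_iff)
  then have "[:0, 1:] * (p - q) = 0" using poly_eq_poly_eq_iff by blast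
  then show ?thesis by simp
qed

text \<open>The integral equation for \<open>A / B\<close> shows that a root of \<open>B\<close> is a root of \<open>A\<close>; cancelling
  the common linear factor preserves the equation and lowers the degree of \<open>B\<close>.\<close>

lemma univariate_integrally_closed:
  fixes A B :: "complex poly"
  assumes "B \<noteq> 0" "n > 0" "A ^ n + (\<Sum>i<n. c i * (A ^ i * B ^ (n - i))) = 0"
  shows "B dvd A"
  using assms
proof (induction "degree B" arbitrary: A B rule: less_induct)
  case less
  show ?case
  proof (cases "degree B = 0")
    case True
    then have "is_unit B" using less.prems(1) is_unit_iff_degree by blast
    then show ?thesis by (rule unit_imp_dvd)
  next
    case False
    then obtain z where z: "poly B z = 0" using fundamental_theorem_of_algebra constant_degree by metis
    have "poly (A ^ n + (\<Sum>i<n. c i * (A ^ i * B ^ (n - i)))) z = 0" using less.prems(3) by simp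
    moreover have "poly (\<Sum>i<n. c i * (A ^ i * B ^ (n - i))) z = 0"
      unfolding poly_sum using z by (intro sum.neutral) auto
    ultimately have "poly A z = 0" using less.prems(2) by (simp add: power_0_left)
    define Z where "Z = [:-z, 1:]"
    obtain A' where A': "A = Z * A'"
      using \<open>poly A z = 0\<close> poly_eq_0_iff_dvd unfolding Z_def by (metis dvdE)
    obtain B' where B': "B = Z * B'" using z poly_eq_0_iff_dvd unfolding Z_def by (metis dvdE)
    have nz: "B' \<noteq> 0" using less.prems(1) B' by auto
    have Z: "Z \<noteq> 0" "degree Z = 1" unfolding Z_def by auto
    then have deg: "degree B' < degree B" unfolding B' using nz by (subst degree_mult_eq) auto
    have "Z ^ n * (A' ^ n + (\<Sum>i<n. c i * (A' ^ i * B' ^ (n - i)))) =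
        A ^ n + (\<Sum>i<n. c i * (A ^ i * B ^ (n - i)))"
    proof -
      have t: "Z ^ n * (c i * (A' ^ i * B' ^ (n - i))) = c i * (A ^ i * B ^ (n - i))" if "i < n" for i
      proof -
        have "Z ^ n = Z ^ i * Z ^ (n - i)" using that by (simp flip: power_add)
        then show ?thesis unfolding A' B' power_mult_distrib by (simp only: mult_ac)
      qed
      show ?thesis unfolding distrib_left sum_distrib_left
        by (simp add: t) (simp add: A' power_mult_distrib)
    qed
    then have "A' ^ n + (\<Sum>i<n. c i * (A' ^ i * B' ^ (n - i))) = 0" using less.prems(3) Z(1) by simp
    then have "B' dvd A'" using less.hyps[OF deg nz less.prems(2)] by blast
    then show ?thesis unfolding A' B' by (rule mult_dvd_mono[OF dvd_refl])
  qed
qed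

text \<open>Polynomials in one more variable whose coefficients are polynomial functions of \<open>u\<close>. The
  uniform bound on the degrees ensures that only finitely many coefficient functions occur.\<close>

definition polyfam :: "'v set \<Rightarrow> (('v \<Rightarrow> complex) \<Rightarrow> complex poly) \<Rightarrow> bool" where
  "polyfam V p \<longleftrightarrow> (\<exists>K. \<forall>u. degree (p u) \<le> K) \<and> (\<forall>i. (\<lambda>u. coeff (p u) i) \<in> polyfun V)"

lemma polyfam_const: "polyfam V (\<lambda>_. p)"
  unfolding polyfam_def by (auto intro: function_algebra.const)

lemma polyfam_pCons:
  assumes "a \<in> polyfun V" "b \<in> polyfun V"
  shows "polyfam V (\<lambda>u. [:a u, b u:])"
  unfolding polyfam_def
proof (intro conjI allI)
  show "\<exists>K. \<forall>u. degree [:a u, b u:] \<le> K" by (rule exI[of _ 1]) simp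
  fix i
  show "(\<lambda>u. coeff [:a u, b u:] i) \<in> polyfun V"
    by (cases i; cases "i - 1") (use assms in \<open>auto simp: coeff_pCons intro: function_algebra.const\<close>)
qed

lemma polyfam_add:
  assumes "polyfam V p" "polyfam V q"
  shows "polyfam V (\<lambda>u. p u + q u)"
proof -
  obtain K L where "\<forall>u. degree (p u) \<le> K" "\<forall>u. degree (q u) \<le> L" using assms unfolding polyfam_def by blast
  then have "\<forall>u. degree (p u + q u) \<le> max K L" by (meson degree_add_le max.coboundedI1 max.coboundedI2)
  then show ?thesis using assms unfolding polyfam_def by (auto intro: function_algebra.add)
qed

lemma polyfam_mult:
  assumes "polyfam V p" "polyfam V q"
  shows "polyfam V (\<lambda>u. p u * q u)"
proof -
  obtain K L where "\<forall>u. degree (p u) \<le> K" "\<forall>u. degree (q u) \<le> L" using assms unfolding polyfam_def by blast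
  then have "\<forall>u. degree (p u * q u) \<le> K + L" by (meson add_mono degree_mult_le le_trans)
  then show ?thesis using assms unfolding polyfam_def
    by (auto simp: coeff_mult intro!: fa_sum function_algebra.mult)
qed

lemma polyfam_sum:
  assumes "\<And>i. i \<in> I \<Longrightarrow> polyfam V (p i)"
  shows "polyfam V (\<lambda>u. \<Sum>i\<in>I. p i u)"
  using assms by (induction I rule: infinite_finite_induct) (simp_all add: polyfam_const polyfam_add)

lemma polyfun_polyfam:
  fixes \<phi> :: "('v \<Rightarrow> complex) \<Rightarrow> complex \<Rightarrow> 'v \<Rightarrow> complex"
  assumes "f \<in> polyfun V"
    and "\<And>v. v \<in> V \<Longrightarrow> \<exists>p. polyfam V p \<and> (\<forall>u \<tau>. \<phi> u \<tau> v = poly (p u) \<tau>)"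
  shows "\<exists>p. polyfam V p \<and> (\<forall>u \<tau>. f (\<phi> u \<tau>) = poly (p u) \<tau>)"
  using assms(1)
proof induction
  case (const c)
  show ?case by (rule exI[of _ "\<lambda>_. [:c:]"]) (simp add: polyfam_const)
next
  case (coord f)
  then show ?case using assms(2) by blast
next
  case (add f g)
  then obtain p q where "polyfam V p" "\<forall>u \<tau>. f (\<phi> u \<tau>) = poly (p u) \<tau>"
      "polyfam V q" "\<forall>u \<tau>. g (\<phi> u \<tau>) = poly (q u) \<tau>" by blast
  then show ?case by (intro exI[of _ "\<lambda>u. p u + q u"]) (simp add: polyfam_add)
next
  case (mult f g)
  then obtain p q where "polyfam V p" "\<forall>u \<tau>. f (\<phi> u \<tau>) = poly (p u) \<tau>"
      "polyfam V q" "\<forall>u \<tau>. g (\<phi> u \<tau>) = poly (q u) \<tau>" by blast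
  then show ?case by (intro exI[of _ "\<lambda>u. p u * q u"]) (simp add: polyfam_mult)
qed

lemma polyfun_line_polyfam:
  assumes "f \<in> polyfun V"
  shows "\<exists>p. polyfam V p \<and> (\<forall>u \<tau>. f (\<lambda>v. u v + \<tau> * w v) = poly (p u) \<tau>)"
proof (rule polyfun_polyfam[OF assms])
  fix v assume v: "v \<in> V"
  show "\<exists>p. polyfam V p \<and> (\<forall>u \<tau>. u v + \<tau> * w v = poly (p u) \<tau>)"
    by (rule exI[of _ "\<lambda>u. [:u v, w v:]"])
       (use polyfam_pCons[OF polyfun_coord[OF v] function_algebra.const] in auto)
qed

text \<open>Homogeneity gives \<open>h (u + \<tau> w) = \<tau>\<^sup>k h (w + \<tau>\<inverse> u)\<close>. So the coefficients of \<open>q\<close> are those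
  of the polynomial on the line through \<open>w\<close> in direction \<open>u\<close>, in reverse order, and the top one
  is \<open>h w\<close>.\<close>

lemma homogeneous_line_degree:
  fixes q :: "complex poly"
  assumes h: "h \<in> polyfun V" "\<And>\<sigma> u. h (\<lambda>v. \<sigma> * u v) = \<sigma> ^ k * h u"
    and q: "\<And>\<tau>. h (\<lambda>v. u v + \<tau> * w v) = poly q \<tau>"
  shows "degree q \<le> k" "coeff q k = h w"
proof -
  obtain r where r: "\<And>\<sigma>. h (\<lambda>v. w v + \<sigma> * u v) = poly r \<sigma>" using polyfun_line[OF h(1)] by metis
  let ?e = "degree r"
  \<comment> \<open>the identity \<open>q(\<tau>) = \<tau>\<^sup>k r(\<tau>\<inverse>)\<close> without negative exponents\<close>
  have "monom 1 ?e * q = monom 1 k * reflect_poly r"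
  proof (rule poly_eq_if_eq_nonzero)
    fix \<tau> :: complex assume \<tau>: "\<tau> \<noteq> 0"
    have "poly q \<tau> = h (\<lambda>v. \<tau> * (w v + inverse \<tau> * u v))"
      unfolding q[symmetric] using \<tau> by (intro arg_cong[of _ _ h] ext) (simp add: field_simps)
    also have "\<dots> = \<tau> ^ k * poly r (inverse \<tau>)" by (simp add: h(2) r)
    finally show "poly (monom 1 ?e * q) \<tau> = poly (monom 1 k * reflect_poly r) \<tau>"
      using \<tau> by (simp add: poly_monom poly_reflect_poly_nz)
  qed
  then have c: "coeff (monom 1 ?e * q) (?e + j) = coeff (monom 1 k * reflect_poly r) (?e + j)" for j by simp
  have "coeff q j = 0" if "j > k" for j using c[of j] that by (simp add: coeff_monom_mult coeff_reflect_poly)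
  then show "degree q \<le> k" by (simp add: degree_le)
  have "coeff q k = coeff r 0" using c[of k] by (simp add: coeff_monom_mult coeff_reflect_poly)
  also have "\<dots> = h w" using r[of 0] by (simp add: poly_0_coeff_0)
  finally show "coeff q k = h w" .
qed

text \<open>A direction \<open>w\<close> in which the top homogeneous part of \<open>f\<close> does not vanish: on all lines in
  this direction \<open>f\<close> has the same degree and the same leading coefficient.\<close>

lemma line_with_constant_leading_coeff:
  assumes f: "f \<in> polyfun V" and "f u0 \<noteq> 0"
  shows "\<exists>w p c D. c \<noteq> 0 \<and> polyfam V p \<and> (\<forall>u \<tau>. f (\<lambda>v. u v + \<tau> * w v) = poly (p u) \<tau>)
    \<and> (\<forall>u. degree (p u) = D \<and> coeff (p u) D = c)"
proof -
  have "\<exists>p. polyfam V p \<and> (\<forall>u \<tau>. f (\<lambda>v. \<tau> * u v) = poly (p u) \<tau>)"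
  proof (rule polyfun_polyfam[OF f])
    fix v assume v: "v \<in> V"
    show "\<exists>p. polyfam V p \<and> (\<forall>u \<tau>. \<tau> * u v = poly (p u) \<tau>)"
      by (rule exI[of _ "\<lambda>u. [:0, u v:]"])
         (use polyfam_pCons[OF function_algebra.const polyfun_coord[OF v], of 0] in auto)
  qed
  then obtain P where P: "polyfam V P" "\<And>u \<tau>. f (\<lambda>v. \<tau> * u v) = poly (P u) \<tau>" by blast
  obtain K where K: "\<And>u. degree (P u) \<le> K" using P(1) unfolding polyfam_def by blast
  define h where "h = (\<lambda>k u. coeff (P u) k)"
  have h: "h k \<in> polyfun V" for k using P(1) unfolding polyfam_def h_def by blast
  have hom: "h k (\<lambda>v. \<sigma> * u v) = \<sigma> ^ k * h k u" for k \<sigma> u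
  proof -
    have "poly (P (\<lambda>v. \<sigma> * u v)) = poly (pcompose (P u) [:0, \<sigma>:])"
    proof
      fix \<tau>
      have "poly (P (\<lambda>v. \<sigma> * u v)) \<tau> = f (\<lambda>v. (\<tau> * \<sigma>) * u v)"
        unfolding P(2)[symmetric] by (simp add: mult.assoc)
      then show "poly (P (\<lambda>v. \<sigma> * u v)) \<tau> = poly (pcompose (P u) [:0, \<sigma>:]) \<tau>"
        by (simp add: P(2) poly_pcompose)
    qed
    then have "P (\<lambda>v. \<sigma> * u v) = pcompose (P u) [:0, \<sigma>:]" using poly_eq_poly_eq_iff by blast
    then show ?thesis unfolding h_def by (simp add: coeff_pcompose_linear)
  qed
  have sum: "f u = (\<Sum>k\<le>K. h k u)" for u
  proof -
    have "f u = (\<Sum>k\<le>degree (P u). coeff (P u) k)" using P(2)[of 1 u] by (simp add: poly_altdef)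
    also have "\<dots> = (\<Sum>k\<le>K. coeff (P u) k)"
      by (rule sum.mono_neutral_left) (use K in \<open>auto intro: coeff_eq_0\<close>)
    finally show ?thesis by (simp add: h_def)
  qed
  \<comment> \<open>the degree of \<open>f\<close>; \<open>h k\<close> is its homogeneous part of degree \<open>k\<close>\<close>
  define D where "D = Max {k. k \<le> K \<and> (\<exists>u. h k u \<noteq> 0)}"
  have ne: "{k. k \<le> K \<and> (\<exists>u. h k u \<noteq> 0)} \<noteq> {}"
  proof
    assume *: "{k. k \<le> K \<and> (\<exists>u. h k u \<noteq> 0)} = {}"
    have "f u0 = 0" unfolding sum by (rule sum.neutral) (use * in auto)
    then show False using assms(2) by simp
  qed
  have fin: "finite {k. k \<le> K \<and> (\<exists>u. h k u \<noteq> 0)}" by simp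
  have DK: "D \<le> K" "\<exists>u. h D u \<noteq> 0" using Max_in[OF fin ne] unfolding D_def by auto
  have above: "h k u = 0" if "k \<le> K" "k > D" for k u
  proof (rule ccontr)
    assume "h k u \<noteq> 0"
    then have "k \<le> D" unfolding D_def using that(1) by (intro Max_ge[OF fin]) blast
    then show False using that(2) by simp
  qed
  obtain w where w: "h D w \<noteq> 0" using DK(2) by blast
  have "\<forall>k. \<exists>p. polyfam V p \<and> (\<forall>u \<tau>. h k (\<lambda>v. u v + \<tau> * w v) = poly (p u) \<tau>)"
    using polyfun_line_polyfam[OF h] by (intro allI)
  from choice[OF this]
  obtain q where "\<forall>k. polyfam V (q k) \<and> (\<forall>u \<tau>. h k (\<lambda>v. u v + \<tau> * w v) = poly (q k u) \<tau>)"
    by (elim exE)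
  then have q: "\<And>k. polyfam V (q k)" "\<And>k u \<tau>. h k (\<lambda>v. u v + \<tau> * w v) = poly (q k u) \<tau>"
    by auto
  define p where "p = (\<lambda>u. \<Sum>k\<le>D. q k u)"
  have dq: "degree (q k u) \<le> k" "coeff (q k u) k = h k w" for k u
    using homogeneous_line_degree[OF h hom q(2), of k u] by auto
  have degp: "degree (p u) \<le> D" for u
    unfolding p_def by (rule degree_sum_le) (use dq(1) in \<open>auto intro: le_trans\<close>)
  have cp: "coeff (p u) D = h D w" for u
  proof -
    have "coeff (p u) D = (\<Sum>k\<le>D. coeff (q k u) D)" unfolding p_def by (rule coeff_sum)
    also have "\<dots> = (\<Sum>k\<le>D. if k = D then h D w else 0)"
    proof (rule sum.cong[OF refl])
      fix k assume "k \<in> {..D}"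
      then show "coeff (q k u) D = (if k = D then h D w else 0)"
        using dq[where k = k and u = u] by (auto intro!: coeff_eq_0)
    qed
    finally show ?thesis by simp
  qed
  have "degree (p u) = D" for u using degp[of u] cp[of u] w le_degree[of "p u" D] by simp
  moreover have "f (\<lambda>v. u v + \<tau> * w v) = poly (p u) \<tau>" for u \<tau>
  proof -
    have "f (\<lambda>v. u v + \<tau> * w v) = (\<Sum>k\<le>D. h k (\<lambda>v. u v + \<tau> * w v))"
      unfolding sum by (rule sum.mono_neutral_right) (use DK above in auto)
    then show ?thesis by (simp add: q(2) p_def poly_sum)
  qed
  moreover have "polyfam V p" unfolding p_def by (rule polyfam_sum) (rule q(1))
  ultimately show ?thesis using w cp by blast
qed

text \<open>Polynomial division by a family with constant leading coefficient introduces no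
  denominators depending on \<open>u\<close>.\<close>

lemma polyfam_div:
  assumes G: "polyfam V G" "\<And>u. degree (G u) = D" "\<And>u. coeff (G u) D = c" "c \<noteq> 0"
    and F: "polyfam V F"
  shows "polyfam V (\<lambda>u. F u div G u)"
proof -
  have G0: "G u \<noteq> 0" for u using G(3,4) by (metis coeff_0)
  have "polyfam V F \<Longrightarrow> (\<And>u. degree (F u) < K) \<Longrightarrow> polyfam V (\<lambda>u. F u div G u)" for K F
  proof (induction K arbitrary: F)
    case (Suc K)
    show ?case
    proof (cases "K < D")
      case True
      then have "degree (F u) < degree (G u)" for u using Suc.prems(2)[of u] G(2)[of u] by simp
      then show ?thesis by (simp add: div_poly_less polyfam_const)
    next
      case False
      define m where "m = (\<lambda>u. monom (coeff (F u) K / c) (K - D))"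
      have "polyfam V (\<lambda>u. [:coeff (F u) K / c, 0:] * monom 1 (K - D))"
        using Suc.prems(1) unfolding polyfam_def[of V F]
        by (intro polyfam_mult polyfam_const polyfam_pCons)
           (auto simp: divide_inverse intro: function_algebra.mult function_algebra.const)
      then have m: "polyfam V m" unfolding m_def by (simp add: smult_monom)
      define F' where "F' = (\<lambda>u. F u + [:-1:] * (m u * G u))"
      have F': "polyfam V F'" unfolding F'_def by (intro polyfam_add polyfam_mult polyfam_const m G(1) Suc.prems(1))
      have F'_eq: "F' u = F u - m u * G u" for u unfolding F'_def by simp
      have div_eq: "F u div G u = m u + F' u div G u" for u
      proof -
        have "F u div G u = (F' u + m u * G u) div G u" by (simp add: F'_eq)
        then show ?thesis using div_mult_self1[OF G0[of u], of "F' u" "m u"] by simp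
      qed
      have deg_mG: "degree (m u * G u) \<le> K" for u
      proof -
        have "degree (m u * G u) \<le> degree (m u) + D" using degree_mult_le[of "m u" "G u"] G(2) by simp
        also have "degree (m u) \<le> K - D" unfolding m_def by (rule degree_monom_le)
        finally show ?thesis using False by simp
      qed
      have c0: "coeff (F' u) K = 0" for u
      proof -
        have "coeff (m u * G u) K = coeff (F u) K / c * coeff (G u) (K - (K - D))"
          unfolding m_def coeff_monom_mult using False by simp
        then show ?thesis using False G(3,4) by (simp add: F'_eq)
      qed
      have dF': "degree (F' u) \<le> K" for u
        unfolding F'_eq using Suc.prems(2)[of u] deg_mG[of u] by (intro degree_diff_le) auto
      show ?thesis
      proof (cases "K = 0")
        case True
        then have "F' u = 0" for u using dF'[of u] c0[of u] by (metis le_zero_eq leading_coeff_0_iff)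
        then show ?thesis using m by (simp add: div_eq)
      next
        case False
        have "degree (F' u) < K" for u
          using dF'[of u] c0[of u] False by (metis degree_0 gr0I le_neq_implies_less leading_coeff_0_iff)
        then show ?thesis unfolding div_eq using Suc.IH[OF F'] m by (intro polyfam_add) auto
      qed
    qed
  qed simp
  moreover obtain K where "\<And>u. degree (F u) \<le> K" using F unfolding polyfam_def by blast
  then have "\<And>u. degree (F u) < Suc K" by (simp add: less_Suc_eq_le)
  ultimately show ?thesis using F by blast
qed

text \<open>On every line in a direction with constant leading coefficient for \<open>b\<close>, the claim is the
  case of one variable. The quotients on these lines fit together to a polynomial function since
  the division by \<open>b\<close> can be carried out uniformly. Evaluating them at the base points gives
  \<open>s\<close>.\<close>

theorem polyfun_integrally_closed:
  assumes a: "a \<in> polyfun V" and b: "b \<in> polyfun V" and nz: "b u0 \<noteq> 0"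
    and c: "\<And>i. i < n \<Longrightarrow> c i \<in> polyfun V" and n: "n > 0"
    and eq: "\<And>u. a u ^ n + (\<Sum>i<n. c i u * (a u ^ i * b u ^ (n - i))) = 0"
  shows "\<exists>s \<in> polyfun V. \<forall>u. a u = s u * b u"
proof -
  have "\<exists>w p c D. c \<noteq> 0 \<and> polyfam V p \<and> (\<forall>u \<tau>. b (\<lambda>v. u v + \<tau> * w v) = poly (p u) \<tau>)
    \<and> (\<forall>u. degree (p u) = D \<and> coeff (p u) D = c)"
    by (rule line_with_constant_leading_coeff[OF b, of u0]) (fact nz)
  then obtain w B l D where wB: "l \<noteq> 0 \<and> polyfam V B \<and> (\<forall>u \<tau>. b (\<lambda>v. u v + \<tau> * w v) = poly (B u) \<tau>)
    \<and> (\<forall>u. degree (B u) = D \<and> coeff (B u) D = l)" by (elim exE)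
  then have B: "l \<noteq> 0" "polyfam V B" "\<And>u \<tau>. b (\<lambda>v. u v + \<tau> * w v) = poly (B u) \<tau>"
      "\<And>u. degree (B u) = D" "\<And>u. coeff (B u) D = l" by auto
  obtain A where A: "polyfam V A" "\<And>u \<tau>. a (\<lambda>v. u v + \<tau> * w v) = poly (A u) \<tau>"
    using polyfun_line_polyfam[OF a] by blast
  define s where "s = (\<lambda>u. coeff (A u div B u) 0)"
  have s: "s \<in> polyfun V"
    using polyfam_div[OF B(2,4,5,1) A(1)] unfolding polyfam_def s_def by blast
  have "a u = s u * b u" for u
  proof -
    have "\<forall>i<n. \<exists>C. \<forall>\<tau>. c i (\<lambda>v. u v + \<tau> * w v) = poly C \<tau>" using polyfun_line c by blast
    then obtain C where C: "\<And>i \<tau>. i < n \<Longrightarrow> c i (\<lambda>v. u v + \<tau> * w v) = poly (C i) \<tau>" by metis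
    have B0: "B u \<noteq> 0" using B(1,5) by (metis coeff_0)
    have "poly (A u ^ n + (\<Sum>i<n. C i * (A u ^ i * B u ^ (n - i)))) \<tau> = 0" for \<tau>
    proof -
      have "(\<Sum>i<n. c i (\<lambda>v. u v + \<tau> * w v) * (a (\<lambda>v. u v + \<tau> * w v) ^ i * b (\<lambda>v. u v + \<tau> * w v) ^ (n - i)))
          = poly (\<Sum>i<n. C i * (A u ^ i * B u ^ (n - i))) \<tau>"
        unfolding poly_sum by (intro sum.cong) (auto simp: C A(2) B(3))
      then show ?thesis using eq[of "\<lambda>v. u v + \<tau> * w v"] by (simp add: A(2))
    qed
    then have "A u ^ n + (\<Sum>i<n. C i * (A u ^ i * B u ^ (n - i))) = 0"
      using poly_all_0_iff_0 by blast
    then have "B u dvd A u" by (rule univariate_integrally_closed[OF B0 n])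
    then have "A u = (A u div B u) * B u" by simp
    then have "poly (A u) 0 = poly (A u div B u) 0 * poly (B u) 0" by (metis poly_mult)
    then show ?thesis using A(2)[of u 0] B(3)[of u 0] by (simp add: s_def poly_0_coeff_0)
  qed
  then show ?thesis using s by blast
qed

section \<open>Rank, factorizations and minors\<close>

lemma det_nonzero_iff_kernel:
  fixes f :: "nat \<times> nat \<Rightarrow> complex"
  shows "det (mat s s f) \<noteq> 0 \<longleftrightarrow> (\<forall>v. (\<forall>p<s. (\<Sum>q<s. f (p, q) * v q) = 0) \<longrightarrow> (\<forall>q<s. v q = 0))"
proof -
  have car: "mat s s f \<in> carrier_mat s s" by simp
  have prod: "mat s s f *\<^sub>v vec s v = vec s (\<lambda>p. \<Sum>q<s. f (p, q) * v q)" for v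
    by (rule eq_vecI) (auto simp: scalar_prod_def atLeast0LessThan)
  have "det (mat s s f) = 0 \<longleftrightarrow> (\<exists>v. v \<in> carrier_vec s \<and> v \<noteq> 0\<^sub>v s \<and> mat s s f *\<^sub>v v = 0\<^sub>v s)"
    using det_0_iff_vec_prod_zero_field[OF car] by blast
  also have "\<dots> \<longleftrightarrow> (\<exists>v. (\<exists>q<s. v q \<noteq> 0) \<and> (\<forall>p<s. (\<Sum>q<s. f (p, q) * v q) = 0))"
  proof
    assume "\<exists>v. v \<in> carrier_vec s \<and> v \<noteq> 0\<^sub>v s \<and> mat s s f *\<^sub>v v = 0\<^sub>v s"
    then obtain v where v: "v \<in> carrier_vec s" "v \<noteq> 0\<^sub>v s" "mat s s f *\<^sub>v v = 0\<^sub>v s" by blast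
    have "v = vec s (\<lambda>q. v $ q)" using v(1) by auto
    then have "vec s (\<lambda>p. \<Sum>q<s. f (p, q) * v $ q) = 0\<^sub>v s" using prod[of "\<lambda>q. v $ q"] v(3) by simp
    then have eq: "vec s (\<lambda>p. \<Sum>q<s. f (p, q) * v $ q) $ p = 0\<^sub>v s $ p" for p by simp
    have "(\<Sum>q<s. f (p, q) * v $ q) = 0" if "p < s" for p using eq[of p] that by simp
    moreover have "\<exists>q<s. v $ q \<noteq> 0"
    proof (rule ccontr)
      assume "\<not> ?thesis"
      then have "v = 0\<^sub>v s" using v(1) by (intro eq_vecI) auto
      then show False using v(2) by blast
    qed
    ultimately show "\<exists>v. (\<exists>q<s. v q \<noteq> 0) \<and> (\<forall>p<s. (\<Sum>q<s. f (p, q) * v q) = 0)"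
      by (intro exI[of _ "\<lambda>q. v $ q"]) simp
  next
    assume "\<exists>v. (\<exists>q<s. v q \<noteq> 0) \<and> (\<forall>p<s. (\<Sum>q<s. f (p, q) * v q) = 0)"
    then obtain v q where v: "q < s" "v q \<noteq> 0" "\<forall>p<s. (\<Sum>q<s. f (p, q) * v q) = 0" by blast
    have "mat s s f *\<^sub>v vec s v = 0\<^sub>v s" unfolding prod using v(3) by auto
    moreover have "vec s v \<noteq> 0\<^sub>v s" using v(1,2) by (metis index_vec index_zero_vec(1))
    ultimately show "\<exists>v. v \<in> carrier_vec s \<and> v \<noteq> 0\<^sub>v s \<and> mat s s f *\<^sub>v v = 0\<^sub>v s"
      by (intro exI[of _ "vec s v"]) auto
  qed
  finally show ?thesis by blast
qed

text \<open>\<open>A\<close> is the product of an \<open>m \<times> t\<close> and a \<open>t \<times> n\<close> matrix. This is the form in which bounds on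
  ranks are used.\<close>

definition factors :: "nat \<Rightarrow> nat \<Rightarrow> nat \<Rightarrow> complex mat \<Rightarrow> bool" where
  "factors m n t A \<longleftrightarrow> (\<exists>x y. \<forall>i<m. \<forall>j<n. A $$ (i, j) = (\<Sum>p<t. x i p * y p j))"

lemma factorsI: "(\<And>i j. i < m \<Longrightarrow> j < n \<Longrightarrow> A $$ (i, j) = (\<Sum>p<t. x i p * y p j)) \<Longrightarrow> factors m n t A"
  unfolding factors_def by (rule exI[of _ x], rule exI[of _ y]) simp

lemma factors_mono:
  assumes "factors m n s A" "s \<le> t" shows "factors m n t A"
proof -
  obtain x y where xy: "\<forall>i<m. \<forall>j<n. A $$ (i, j) = (\<Sum>p<s. x i p * y p j)"
    using assms(1) unfolding factors_def by blast
  have "A $$ (i, j) = (\<Sum>p<t. (if p < s then x i p else 0) * y p j)" if "i < m" "j < n" for i j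
  proof -
    have "A $$ (i, j) = (\<Sum>p<s. (if p < s then x i p else 0) * y p j)" using xy that by simp
    also have "\<dots> = (\<Sum>p<t. (if p < s then x i p else 0) * y p j)"
      by (rule sum.mono_neutral_left) (use assms(2) in auto)
    finally show ?thesis .
  qed
  then show ?thesis by (rule factorsI)
qed

lemma factors_through_columns:
  assumes "finite L" "card L \<le> t" "\<And>i j. i < m \<Longrightarrow> j < n \<Longrightarrow> A $$ (i, j) = (\<Sum>l\<in>L. c i l * y l j)"
  shows "factors m n t A"
proof -
  obtain h where h: "bij_betw h {0..<card L} L" using ex_bij_betw_nat_finite[OF assms(1)] by blast
  have "A $$ (i, j) = (\<Sum>p<card L. c i (h p) * y (h p) j)" if "i < m" "j < n" for i j
    unfolding assms(3)[OF that] using sum.reindex_bij_betw[OF h, of "\<lambda>l. c i l * y l j"]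
    by (simp add: atLeast0LessThan)
  then have "factors m n (card L) A" by (rule factorsI[where x = "\<lambda>i p. c i (h p)" and y = "\<lambda>p j. y (h p) j"])
  then show ?thesis using assms(2) by (rule factors_mono)
qed

text \<open>A maximal independent set of columns spans all columns, which is a factorization;
  conversely the columns of a product \<open>X Y\<close> satisfy the linear relations between the columns of
  \<open>Y\<close>.\<close>

lemma rank_le_iff_factors:
  assumes A: "A \<in> carrier_mat m n"
  shows "vec_space.rank m A \<le> t \<longleftrightarrow> factors m n t A"
proof -
  interpret vec_space "TYPE(complex)" m .
  let ?P = "\<lambda>T. T \<subseteq> set (cols A) \<and> lin_indpt T"
  have "lin_indpt {}" by (metis empty_iff finite_lin_indpt2 empty_subsetI finite.emptyI)
  then obtain S where S: "maximal S ?P" "finite S"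
    using maximal_exists_superset[of "set (cols A)" ?P "{}"] by auto
  have rank: "rank A = card S" by (rule rank_card_indpt[OF A S(1)])
  have Sc: "S \<subseteq> set (cols A)" "lin_indpt S" using S(1) unfolding maximal_def by auto
  have colsV: "set (cols A) \<subseteq> carrier_vec m" using A cols_dim by blast
  then have SV: "S \<subseteq> carrier_vec m" using Sc by blast
  show ?thesis
  proof
    assume le: "rank A \<le> t"
    have "\<exists>a. \<forall>i<m. A $$ (i, j) = (\<Sum>s\<in>S. s $ i * a s)" if j: "j < n" for j
    proof -
      have cj: "col A j \<in> set (cols A)" using A j by (simp add: cols_def)
      have "col A j \<in> span S"
      proof (cases "col A j \<in> S")
        case True
        then show ?thesis using SV span_mem by auto
      next
        case False
        have "lin_dep (S \<union> {col A j})"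
        proof (rule ccontr)
          assume "\<not> lin_dep (S \<union> {col A j})"
          then have "?P (S \<union> {col A j})" using Sc(1) cj by blast
          moreover have "S \<subseteq> S \<union> {col A j}" by blast
          ultimately have "S = S \<union> {col A j}" using S(1) unfolding maximal_def by metis
          then show False using False by blast
        qed
        then show ?thesis
          using lin_dep_iff_in_span[of S "col A j"] SV Sc(2) False cj colsV by auto
      qed
      then obtain a where a: "lincomb a S = col A j"
        using finite_in_span[OF S(2), of "col A j"] SV by auto
      have "A $$ (i, j) = (\<Sum>s\<in>S. s $ i * a s)" if i: "i < m" for i
      proof -
        have "A $$ (i, j) = lincomb a S $ i" unfolding a using A i j by simp
        also have "\<dots> = (\<Sum>s\<in>S. a s * s $ i)" by (rule lincomb_index[OF i SV])
        finally show ?thesis by (simp add: mult.commute)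
      qed
      then show ?thesis by blast
    qed
    then obtain a where "\<And>j i. j < n \<Longrightarrow> i < m \<Longrightarrow> A $$ (i, j) = (\<Sum>s\<in>S. s $ i * a j s)" by metis
    then have a: "\<And>i j. i < m \<Longrightarrow> j < n \<Longrightarrow> A $$ (i, j) = (\<Sum>s\<in>S. (\<lambda>i s. s $ i) i s * (\<lambda>s j. a j s) s j)" by simp
    show "factors m n t A"
    proof -
      obtain h where h: "bij_betw h {0..<card S} S" using ex_bij_betw_nat_finite[OF S(2)] by blast
      have "A $$ (i, j) = (\<Sum>p<card S. h p $ i * a j (h p))" if "i < m" "j < n" for i j
        unfolding a[OF that] using sum.reindex_bij_betw[OF h, of "\<lambda>l. l $ i * a j l"]
        by (simp add: atLeast0LessThan)
      then have "factors m n (card S) A"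
        by (rule factorsI[where x = "\<lambda>i p. h p $ i" and y = "\<lambda>p j. a j (h p)"])
      then show ?thesis by (rule factors_mono) (use le rank in simp)
    qed
  next
    assume "factors m n t A"
    then obtain x y where xy: "\<And>i j. i < m \<Longrightarrow> j < n \<Longrightarrow> A $$ (i, j) = (\<Sum>p<t. x i p * y p j)"
      unfolding factors_def by blast
    show "rank A \<le> t"
    proof (rule ccontr)
      assume "\<not> rank A \<le> t"
      then have card: "card {..<t} < card S" using rank by simp
      have "\<exists>j<n. s = col A j" if "s \<in> S" for s
      proof -
        have "s \<in> set (cols A)" using that Sc(1) by blast
        then show ?thesis using A by (auto simp: cols_def)
      qed
      then obtain J where J: "\<And>s. s \<in> S \<Longrightarrow> J s < n \<and> s = col A (J s)" by metis
      have "\<exists>c. (\<exists>s\<in>S. c s \<noteq> 0) \<and> (\<forall>p\<in>{..<t}. (\<Sum>s\<in>S. y p (J s) * c s) = 0)"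
        by (rule underdetermined_system[OF _ S(2) card]) simp
      then obtain c s0 where c: "s0 \<in> S" "c s0 \<noteq> 0" "\<And>p. p < t \<Longrightarrow> (\<Sum>s\<in>S. y p (J s) * c s) = 0" by auto
      have "lincomb c S = 0\<^sub>v m"
      proof (rule eq_vecI)
        show "dim_vec (lincomb c S) = dim_vec (0\<^sub>v m)" using lincomb_dim[OF S(2) SV] by simp
        fix i assume "i < dim_vec (0\<^sub>v m)"
        then have i: "i < m" by simp
        have "lincomb c S $ i = (\<Sum>s\<in>S. c s * s $ i)" by (rule lincomb_index[OF i SV])
        also have "\<dots> = (\<Sum>s\<in>S. \<Sum>p<t. x i p * (y p (J s) * c s))"
        proof (rule sum.cong[OF refl])
          fix s assume s: "s \<in> S"
          have "s $ i = A $$ (i, J s)" using J[OF s] A i by (metis carrier_matD index_col)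
          then show "c s * s $ i = (\<Sum>p<t. x i p * (y p (J s) * c s))"
            using xy[OF i, of "J s"] J[OF s] by (simp add: sum_distrib_left mult_ac)
        qed
        also have "\<dots> = (\<Sum>p<t. x i p * (\<Sum>s\<in>S. y p (J s) * c s))"
          by (subst sum.swap) (simp add: sum_distrib_left)
        finally show "lincomb c S $ i = 0\<^sub>v m $ i" using c(3) i by simp
      qed
      then have "lin_dep S" using lin_dep_crit[of S S s0 c, OF S(2) order_refl] c(1,2) by auto
      then show False using Sc(2) by blast
    qed
  qed
qed

text \<open>The block with rows \<open>K\<close> and columns \<open>L\<close> has independent columns. Sets of indices instead
  of submatrices avoid enumerations when a row or a column is added or exchanged.\<close>

definition nonsing :: "complex mat \<Rightarrow> nat set \<Rightarrow> nat set \<Rightarrow> bool" where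
  "nonsing A K L \<longleftrightarrow> (\<forall>v. (\<forall>i\<in>K. (\<Sum>l\<in>L. A $$ (i, l) * v l) = 0) \<longrightarrow> (\<forall>l\<in>L. v l = 0))"

lemma nonsingD:
  "nonsing A K L \<Longrightarrow> (\<And>i. i \<in> K \<Longrightarrow> (\<Sum>l\<in>L. A $$ (i, l) * v l) = 0) \<Longrightarrow> l \<in> L \<Longrightarrow> v l = 0"
  unfolding nonsing_def by blast

text \<open>A square nonsingular block that cannot be extended spans all columns: the column \<open>j\<close> is
  combined from the columns in \<open>L\<close> on the rows in \<open>K\<close>, with unique coefficients, and the kernel
  vector showing that the block extended by the row \<open>i\<close> is singular has the same coefficients up
  to a factor.\<close>

lemma maximal_nonsing_block_factors:
  assumes K: "K \<subseteq> {..<m}" "L \<subseteq> {..<n}" "card K = card L" and ns: "nonsing A K L"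
    and max: "\<And>i j. i < m \<Longrightarrow> j < n \<Longrightarrow> i \<notin> K \<Longrightarrow> j \<notin> L \<Longrightarrow> \<not> nonsing A (insert i K) (insert j L)"
  shows "factors m n (card L) A"
proof -
  have fin: "finite K" "finite L" using K finite_subset by blast+
  have "\<exists>y. \<forall>i<m. A $$ (i, j) = (\<Sum>l\<in>L. A $$ (i, l) * y l)" if j: "j < n" for j
  proof (cases "j \<in> L")
    case True
    have "A $$ (i, j) = (\<Sum>l\<in>L. A $$ (i, l) * (if l = j then 1 else 0))" for i
    proof -
      have "(\<Sum>l\<in>L. A $$ (i, l) * (if l = j then 1 else 0)) = (\<Sum>l\<in>L. if l = j then A $$ (i, l) else 0)"
        by (rule sum.cong) auto
      then show ?thesis using True fin by simp
    qed
    then show ?thesis by (intro exI[of _ "\<lambda>l. if l = j then 1 else 0"]) simp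
  next
    case False
    have "\<exists>v. (\<exists>l\<in>insert j L. v l \<noteq> 0) \<and> (\<forall>i\<in>K. (\<Sum>l\<in>insert j L. A $$ (i, l) * v l) = 0)"
      by (rule underdetermined_system) (use fin K False in auto)
    then obtain v where v: "\<exists>l\<in>insert j L. v l \<noteq> 0" "\<And>i. i \<in> K \<Longrightarrow> (\<Sum>l\<in>insert j L. A $$ (i, l) * v l) = 0"
      by blast
    have vj: "v j \<noteq> 0" if v: "\<exists>l\<in>insert j L. v l \<noteq> 0" "\<And>i. i \<in> K \<Longrightarrow> (\<Sum>l\<in>insert j L. A $$ (i, l) * v l) = 0" for v
    proof
      assume "v j = 0"
      then have "\<forall>i\<in>K. (\<Sum>l\<in>L. A $$ (i, l) * v l) = 0" using v(2) fin False by auto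
      then have "\<forall>l\<in>L. v l = 0" using ns unfolding nonsing_def by blast
      then show False using v(1) \<open>v j = 0\<close> by auto
    qed
    have vj0: "v j \<noteq> 0" by (rule vj[OF v])
    have row: "(\<Sum>l\<in>insert j L. A $$ (i, l) * v l) = 0" if i: "i < m" for i
    proof (cases "i \<in> K")
      case True
      then show ?thesis by (rule v(2))
    next
      case iK: False
      then obtain v' where v': "\<And>i'. i' \<in> insert i K \<Longrightarrow> (\<Sum>l\<in>insert j L. A $$ (i', l) * v' l) = 0"
          "\<exists>l\<in>insert j L. v' l \<noteq> 0"
        using max[OF i j iK False] unfolding nonsing_def by blast
      have v'j: "v' j \<noteq> 0" by (rule vj[OF v'(2)]) (use v'(1) in blast)
      \<comment> \<open>the solution is unique up to a factor, because the block \<open>K \<times> L\<close> is nonsingular\<close>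
      have "\<forall>l\<in>L. v' j * v l - v j * v' l = 0"
      proof -
        have "(\<Sum>l\<in>L. A $$ (i', l) * (v' j * v l - v j * v' l)) = 0" if i': "i' \<in> K" for i'
        proof -
          have e1: "A $$ (i', j) * v j + (\<Sum>l\<in>L. A $$ (i', l) * v l) = 0"
            using v(2)[OF i'] fin False by simp
          have e2: "A $$ (i', j) * v' j + (\<Sum>l\<in>L. A $$ (i', l) * v' l) = 0"
            using v'(1)[of i'] i' fin False by simp
          have "(\<Sum>l\<in>L. A $$ (i', l) * (v' j * v l - v j * v' l))
              = v' j * (\<Sum>l\<in>L. A $$ (i', l) * v l) - v j * (\<Sum>l\<in>L. A $$ (i', l) * v' l)"
            by (simp add: sum_distrib_left sum_subtractf right_diff_distrib mult_ac)
          also have "(\<Sum>l\<in>L. A $$ (i', l) * v l) = - (A $$ (i', j) * v j)" using e1 by (simp add: eq_neg_iff_add_eq_0 add.commute)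
          also have "(\<Sum>l\<in>L. A $$ (i', l) * v' l) = - (A $$ (i', j) * v' j)" using e2 by (simp add: eq_neg_iff_add_eq_0 add.commute)
          finally show ?thesis by simp
        qed
        then show ?thesis using ns unfolding nonsing_def by (elim allE[of _ "\<lambda>l. v' j * v l - v j * v' l"]) blast
      qed
      then have scaled: "v l = v j / v' j * v' l" if "l \<in> insert j L" for l
        using that v'j by (cases "l = j") (auto simp: field_simps)
      have "(\<Sum>l\<in>insert j L. A $$ (i, l) * v l) = (\<Sum>l\<in>insert j L. v j / v' j * (A $$ (i, l) * v' l))"
      proof (rule sum.cong[OF refl])
        fix l assume "l \<in> insert j L"
        then show "A $$ (i, l) * v l = v j / v' j * (A $$ (i, l) * v' l)" using scaled by (metis mult.left_commute)
      qed
      also have "\<dots> = v j / v' j * (\<Sum>l\<in>insert j L. A $$ (i, l) * v' l)" by (simp only: sum_distrib_left)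
      finally show ?thesis using v'(1)[of i] by simp
    qed
    have "A $$ (i, j) = (\<Sum>l\<in>L. A $$ (i, l) * (- v l / v j))" if "i < m" for i
    proof -
      have "A $$ (i, j) * v j + (\<Sum>l\<in>L. A $$ (i, l) * v l) = 0" using row[OF that] fin False by simp
      then have "A $$ (i, j) = - (\<Sum>l\<in>L. A $$ (i, l) * v l) / v j" using vj0 by (simp add: field_simps eq_neg_iff_add_eq_0)
      then show ?thesis by (simp add: sum_divide_distrib sum_negf[symmetric])
    qed
    then show ?thesis by (intro exI[of _ "\<lambda>l. - v l / v j"]) simp
  qed
  then obtain y where "\<And>j i. j < n \<Longrightarrow> i < m \<Longrightarrow> A $$ (i, j) = (\<Sum>l\<in>L. A $$ (i, l) * y j l)" by metis
  then show ?thesis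
    by (intro factors_through_columns[OF fin(2) order_refl, where c = "\<lambda>i l. A $$ (i, l)" and y = "\<lambda>l j. y j l"]) auto
qed

text \<open>The version with a prescribed block to start from is used for the stabilizer, where the
  block has to contain a given column.\<close>

lemma nonsing_block_extension:
  assumes "\<not> factors m n t A" and K0: "K\<^sub>0 \<subseteq> {..<m}" "L\<^sub>0 \<subseteq> {..<n}" "card K\<^sub>0 = card L\<^sub>0" "card L\<^sub>0 \<le> Suc t"
    and "nonsing A K\<^sub>0 L\<^sub>0"
  shows "\<exists>K L. K \<subseteq> {..<m} \<and> L \<subseteq> {..<n} \<and> L\<^sub>0 \<subseteq> L \<and> card K = Suc t \<and> card L = Suc t \<and> nonsing A K L"
proof -
  have "\<exists>K L. K \<subseteq> {..<m} \<and> L \<subseteq> {..<n} \<and> L\<^sub>0 \<subseteq> L \<and> card K = s \<and> card L = s \<and> nonsing A K L"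
    if "card L\<^sub>0 \<le> s" "s \<le> Suc t" for s
    using that
  proof (induction s rule: dec_induct)
    case base
    show ?case by (rule exI[of _ K\<^sub>0], rule exI[of _ L\<^sub>0]) (use assms in auto)
  next
    case (step s)
    then have "s \<le> Suc t" by simp
    from step.IH[OF this] obtain K L where KL: "K \<subseteq> {..<m}" "L \<subseteq> {..<n}" "L\<^sub>0 \<subseteq> L" "card K = s" "card L = s" "nonsing A K L"
      by (elim exE conjE)
    have "\<not> factors m n (card L) A" using assms(1) factors_mono step.prems KL(5) by auto
    then obtain i j where ij: "i < m" "j < n" "i \<notin> K" "j \<notin> L" "nonsing A (insert i K) (insert j L)"
      using maximal_nonsing_block_factors[OF KL(1,2) _ KL(6)] KL(4,5) by auto
    have "finite K" "finite L" using KL(1,2) finite_subset by blast+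
    then have "card (insert i K) = Suc s" "card (insert j L) = Suc s" using ij KL(4,5) by auto
    moreover have "insert i K \<subseteq> {..<m}" "insert j L \<subseteq> {..<n}" "L\<^sub>0 \<subseteq> insert j L" using KL(1-3) ij by auto
    ultimately show ?case using ij(5) by blast
  qed
  then show ?thesis using K0(4) by blast
qed

lemma not_factors_imp_nonsing:
  assumes "\<not> factors m n t A"
  shows "\<exists>K L. K \<subseteq> {..<m} \<and> L \<subseteq> {..<n} \<and> card K = Suc t \<and> card L = Suc t \<and> nonsing A K L"
proof -
  have "nonsing A {} {}" by (simp add: nonsing_def)
  then show ?thesis using nonsing_block_extension[OF assms, of "{}" "{}"] by auto
qed

lemma nonsing_imp_det:
  assumes ns: "nonsing A K L" and \<kappa>: "bij_betw \<kappa> {..<s} K" and \<mu>: "bij_betw \<mu> {..<s} L"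
  shows "det (mat s s (\<lambda>(p, q). A $$ (\<kappa> p, \<mu> q))) \<noteq> 0"
  unfolding det_nonzero_iff_kernel
proof (intro allI impI)
  fix v q
  assume v: "\<forall>p<s. (\<Sum>q<s. (case (p, q) of (p, q) \<Rightarrow> A $$ (\<kappa> p, \<mu> q)) * v q) = 0" and q: "q < s"
  define v' where "v' = (\<lambda>l. v (the_inv_into {..<s} \<mu> l))"
  have v': "v' (\<mu> q) = v q" if "q < s" for q
    unfolding v'_def using that \<mu> by (simp add: bij_betw_def the_inv_into_f_f)
  have "(\<Sum>l\<in>L. A $$ (i, l) * v' l) = 0" if i: "i \<in> K" for i
  proof -
    obtain p where p: "p < s" "i = \<kappa> p" using i \<kappa> by (auto simp: bij_betw_def)
    have "(\<Sum>l\<in>L. A $$ (i, l) * v' l) = (\<Sum>q<s. A $$ (i, \<mu> q) * v' (\<mu> q))"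
      by (rule sum.reindex_bij_betw[OF \<mu>, symmetric])
    then show ?thesis using v p v' by simp
  qed
  then have "\<forall>l\<in>L. v' l = 0" using ns unfolding nonsing_def by blast
  then show "v q = 0" using v'[OF q] q \<mu> by (auto simp: bij_betw_def)
qed

lemma det_factors_0:
  assumes "factors m n t A" "\<And>p. p < s \<Longrightarrow> \<kappa> p < m" "\<And>q. q < s \<Longrightarrow> \<mu> q < n" "t < s"
  shows "det (mat s s (\<lambda>(p, q). A $$ (\<kappa> p, \<mu> q))) = 0"
proof -
  obtain x y where xy: "\<And>i j. i < m \<Longrightarrow> j < n \<Longrightarrow> A $$ (i, j) = (\<Sum>p<t. x i p * y p j)"
    using assms(1) unfolding factors_def by blast
  have "\<exists>v. (\<exists>q\<in>{..<s}. v q \<noteq> 0) \<and> (\<forall>r\<in>{..<t}. (\<Sum>q\<in>{..<s}. y r (\<mu> q) * v q) = 0)"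
    by (rule underdetermined_system) (use assms(4) in auto)
  then obtain v where v: "\<exists>q<s. v q \<noteq> 0" "\<And>r. r < t \<Longrightarrow> (\<Sum>q<s. y r (\<mu> q) * v q) = 0" by auto
  have "(\<Sum>q<s. A $$ (\<kappa> p, \<mu> q) * v q) = 0" if p: "p < s" for p
  proof -
    have "(\<Sum>q<s. A $$ (\<kappa> p, \<mu> q) * v q) = (\<Sum>q<s. \<Sum>r<t. x (\<kappa> p) r * (y r (\<mu> q) * v q))"
      using xy assms(2)[OF p] assms(3) by (intro sum.cong) (auto simp: sum_distrib_right mult.assoc)
    also have "\<dots> = (\<Sum>r<t. x (\<kappa> p) r * (\<Sum>q<s. y r (\<mu> q) * v q))"
      by (subst sum.swap) (simp add: sum_distrib_left)
    finally show ?thesis using v(2) by simp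
  qed
  then show ?thesis using det_nonzero_iff_kernel[of s "\<lambda>(p, q). A $$ (\<kappa> p, \<mu> q)"] v(1) by auto
qed

lemma fa_det:
  assumes "\<And>p q. p < s \<Longrightarrow> q < s \<Longrightarrow> (\<lambda>u. g u p q) \<in> function_algebra C"
  shows "(\<lambda>u. det (mat s s (\<lambda>(p, q). g u p q))) \<in> function_algebra C"
proof -
  have "(\<lambda>u. \<Sum>\<sigma>\<in>{\<sigma>. \<sigma> permutes {0..<s}}. signof \<sigma> * (\<Prod>i = 0..<s. g u i (\<sigma> i))) \<in> function_algebra C"
    by (intro fa_sum function_algebra.mult function_algebra.const fa_prod assms)
       (auto simp: permutes_in_image)
  moreover have "det (mat s s (\<lambda>(p, q). g u p q)) =
      (\<Sum>\<sigma>\<in>{\<sigma>. \<sigma> permutes {0..<s}}. signof \<sigma> * (\<Prod>i = 0..<s. g u i (\<sigma> i)))" for u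
    by (subst det_def'[of _ s]) (auto intro!: sum.cong prod.cong simp: permutes_in_image)
  ultimately show ?thesis by simp
qed

section \<open>Determinantal varieties are irreducible and normal\<close>

context factor_pair
begin

definition product :: "(fvar \<Rightarrow> complex) \<Rightarrow> complex mat" where
  "product u = mat m n (\<lambda>(i, j). entry i j u)"

lemma determinantal_variety_factors:
  "determinantal_variety m n t = {A \<in> carrier_mat m n. factors m n t A}"
  unfolding determinantal_variety_def using rank_le_iff_factors by blast

lemma determinantal_variety_range: "determinantal_variety m n t = range product"
proof
  show "range product \<subseteq> determinantal_variety m n t"
    unfolding determinantal_variety_factors factors_def
  proof clarsimp
    fix u
    show "product u \<in> carrier_mat m n \<and>
      (\<exists>x y. \<forall>i<m. \<forall>j<n. product u $$ (i, j) = (\<Sum>p<t. x i p * y p j))"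
      by (rule conjI, simp add: product_def, rule exI[of _ "\<lambda>i p. u (LeftVar i p)"],
          rule exI[of _ "\<lambda>p j. u (RightVar p j)"], simp add: product_def entry_def)
  qed
  show "determinantal_variety m n t \<subseteq> range product"
  proof
    fix A assume "A \<in> determinantal_variety m n t"
    then obtain x y where A: "A \<in> carrier_mat m n"
        and xy: "\<And>i j. i < m \<Longrightarrow> j < n \<Longrightarrow> A $$ (i, j) = (\<Sum>p<t. x i p * y p j)"
      unfolding determinantal_variety_factors factors_def by blast
    have "A = product (\<lambda>v. case v of LeftVar i p \<Rightarrow> x i p | RightVar p j \<Rightarrow> y p j)"
      by (rule eq_matI) (use A xy in \<open>auto simp: product_def entry_def\<close>)
    then show "A \<in> range product" by blast
  qed
qed

text \<open>The minors of size \<open>t + 1\<close> cut out the matrices that factor through \<open>t\<close>.\<close>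

lemma determinantal_closed: "closedin (zariski_mat m n) (determinantal_variety m n t)"
proof (rule closedin_zariski_mat_zeros)
  show "determinantal_variety m n t \<subseteq> carrier_mat m n" unfolding determinantal_variety_def by blast
  fix A assume "A \<in> carrier_mat m n - determinantal_variety m n t"
  then have "\<not> factors m n t A" unfolding determinantal_variety_factors by blast
  from not_factors_imp_nonsing[OF this] obtain K L where KL: "K \<subseteq> {..<m}" "L \<subseteq> {..<n}" "card K = Suc t" "card L = Suc t" "nonsing A K L"
    by (elim exE conjE)
  have fin: "finite K" "finite L" using KL finite_subset by blast+
  obtain \<kappa> where \<kappa>: "bij_betw \<kappa> {..<Suc t} K"
    using ex_bij_betw_nat_finite[OF fin(1)] KL(3) by (auto simp: atLeast0LessThan)
  obtain \<mu> where \<mu>: "bij_betw \<mu> {..<Suc t} L"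
    using ex_bij_betw_nat_finite[OF fin(2)] KL(4) by (auto simp: atLeast0LessThan)
  have \<kappa>m: "\<kappa> p < m" if "p < Suc t" for p using \<kappa> KL(1) that by (auto simp: bij_betw_def)
  have \<mu>n: "\<mu> q < n" if "q < Suc t" for q using \<mu> KL(2) that by (auto simp: bij_betw_def)
  let ?f = "\<lambda>B. det (mat (Suc t) (Suc t) (\<lambda>(p, q). B $$ (\<kappa> p, \<mu> q)))"
  have "?f \<in> function_algebra (mat_coords m n)"
    by (rule fa_det) (use \<kappa>m \<mu>n mat_coord_fa in auto)
  moreover have "?f A \<noteq> 0" by (rule nonsing_imp_det[OF KL(5) \<kappa> \<mu>])
  moreover have "\<forall>B\<in>determinantal_variety m n t. ?f B = 0"
    unfolding determinantal_variety_factors using det_factors_0[of m n t _ "Suc t" \<kappa> \<mu>] \<kappa>m \<mu>n by blast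
  ultimately show "\<exists>f\<in>function_algebra (mat_coords m n). f A \<noteq> 0 \<and> (\<forall>B\<in>determinantal_variety m n t. f B = 0)"
    by (intro bexI[of _ ?f] conjI)
qed

lemma determinantal_irreducible:
  "irreducible_affine_variety m n (determinantal_variety m n t)"
  unfolding irreducible_affine_variety_def
proof
  show "irreducible_space (subtopology (zariski_mat m n) (determinantal_variety m n t))"
  proof (rule irreducible_parametrized)
    show "(\<lambda>u. product u $$ (i, j)) \<in> polyfun PV" if "i < m" "j < n" for i j
      using entry_polyfun[OF that] that by (simp add: product_def)
    show "(\<lambda>_. 1) \<in> polyfun PV" by (rule function_algebra.const)
    show "determinantal_variety m n t = product ` {u. 1 \<noteq> (0::complex)}"
      by (simp add: determinantal_variety_range)
    show "determinantal_variety m n t \<subseteq> carrier_mat m n" unfolding determinantal_variety_def by blast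
  qed simp
qed (rule determinantal_closed)

lemma pullback_entry_algebra:
  "f \<in> function_algebra (mat_coords m n) \<Longrightarrow> (\<lambda>u. f (product u)) \<in> entry_algebra"
  unfolding entry_algebra_def
proof (erule fa_subst)
  fix c assume "c \<in> mat_coords m n"
  then obtain i j where "i < m" "j < n" "c = (\<lambda>A. A $$ (i, j))" unfolding mat_coords_def by blast
  then have "(\<lambda>u. c (product u)) = entry i j" by (auto simp: product_def)
  then show "(\<lambda>u. c (product u)) \<in> function_algebra {entry i j |i j. i < m \<and> j < n}"
    using \<open>i < m\<close> \<open>j < n\<close> by (auto intro!: function_algebra.coord)
qed

lemma entry_algebra_pullback:
  "g \<in> entry_algebra \<Longrightarrow> \<exists>f \<in> function_algebra (mat_coords m n). \<forall>u. g u = f (product u)"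
  unfolding entry_algebra_def
proof (induction rule: function_algebra.induct)
  case (const c)
  show ?case by (rule bexI[of _ "\<lambda>_. c"]) (auto intro: function_algebra.const)
next
  case (coord g)
  then obtain i j where "i < m" "j < n" "g = entry i j" by blast
  then show ?case
    by (intro bexI[of _ "\<lambda>A. A $$ (i, j)"]) (auto simp: product_def intro: mat_coord_fa)
next
  case (add g h)
  then obtain f f' where "f \<in> function_algebra (mat_coords m n)" "\<forall>u. g u = f (product u)"
      "f' \<in> function_algebra (mat_coords m n)" "\<forall>u. h u = f' (product u)" by blast
  then show ?case by (intro bexI[of _ "\<lambda>A. f A + f' A"]) (auto intro: function_algebra.add)
next
  case (mult g h)
  then obtain f f' where "f \<in> function_algebra (mat_coords m n)" "\<forall>u. g u = f (product u)"
      "f' \<in> function_algebra (mat_coords m n)" "\<forall>u. h u = f' (product u)" by blast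
  then show ?case by (intro bexI[of _ "\<lambda>A. f A * f' A"]) (auto intro: function_algebra.mult)
qed

text \<open>The algebra of the entries is stable under division in the polynomial ring, because
  invariance is: a derivation killing \<open>a = s b\<close> and \<open>b\<close> kills \<open>s\<close>.\<close>

lemma entry_algebra_division:
  assumes a: "a \<in> entry_algebra" and b: "b \<in> entry_algebra" and nz: "b u0 \<noteq> 0"
    and s: "s \<in> polyfun PV" and eq: "\<And>u. a u = s u * b u"
  shows "s \<in> entry_algebra"
proof (rule invariant_in_entry_algebra)
  have ib: "invariant b" and ia: "invariant a" using a b entry_algebra_invariant by auto
  have pb: "b \<in> polyfun PV" using b by (rule entry_algebra_polyfun)
  have a_eq: "a = (\<lambda>u. s u * b u)" using eq by blast
  show "invariant s" unfolding invariant_def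
  proof (intro conjI allI impI s ext)
    fix p q u assume pq: "p < t" "q < t"
    have "EL p q a = ER q p a" "EL p q b = ER q p b" using ia ib pq unfolding invariant_def by auto
    then have "(EL p q s v - ER q p s v) * b v = 0" for v
      unfolding a_eq pol_mult[OF s pb] by (auto simp: fun_eq_iff algebra_simps)
    moreover have "(\<lambda>v. EL p q s v - ER q p s v) \<in> polyfun PV"
      using pq s by (intro fa_diff EL_polyfun ER_polyfun)
    ultimately have "EL p q s u - ER q p s u = 0"
      by (intro polyfun_mult_eq_0[where f = "\<lambda>v. EL p q s v - ER q p s v", OF _ pb _ nz]) auto
    then show "EL p q s u = ER q p s u" by simp
  qed
qed

end

section \<open>Rings of functions\<close>

lemma function_ring_simps:
  "carrier (function_ring V F) = (\<lambda>f. restrict f V) ` F"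
  "monoid.mult (function_ring V F) = (\<lambda>f g. \<lambda>x\<in>V. f x * g x)"
  "one (function_ring V F) = (\<lambda>x\<in>V. 1)"
  "zero (function_ring V F) = (\<lambda>x\<in>V. 0)"
  "add (function_ring V F) = (\<lambda>f g. \<lambda>x\<in>V. f x + g x)"
  by (simp_all add: function_ring_def)

lemma function_ring_carrier_extensional: "a \<in> carrier (function_ring V F) \<Longrightarrow> (\<lambda>x\<in>V. a x) = a"
  by (auto simp: function_ring_simps)

lemma function_ring_cring: "cring (function_ring V (function_algebra C))"
proof -
  let ?R = "function_ring V (function_algebra C)"
  have one: "\<one>\<^bsub>?R\<^esub> \<in> carrier ?R" and zero: "\<zero>\<^bsub>?R\<^esub> \<in> carrier ?R"
    unfolding function_ring_simps by (auto intro: function_algebra.const)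
  have add: "a \<oplus>\<^bsub>?R\<^esub> b \<in> carrier ?R" and mult: "a \<otimes>\<^bsub>?R\<^esub> b \<in> carrier ?R"
    if a: "a \<in> carrier ?R" and b: "b \<in> carrier ?R" for a b
  proof -
    obtain f g where fg: "f \<in> function_algebra C" "g \<in> function_algebra C" "a = restrict f V" "b = restrict g V"
      using a b unfolding function_ring_simps by blast
    have "a \<oplus>\<^bsub>?R\<^esub> b = restrict (\<lambda>x. f x + g x) V" "a \<otimes>\<^bsub>?R\<^esub> b = restrict (\<lambda>x. f x * g x) V"
      unfolding function_ring_simps fg by auto
    then show "a \<oplus>\<^bsub>?R\<^esub> b \<in> carrier ?R" "a \<otimes>\<^bsub>?R\<^esub> b \<in> carrier ?R"
      using imageI[OF function_algebra.add[OF fg(1,2)], of "\<lambda>f. restrict f V"]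
        imageI[OF function_algebra.mult[OF fg(1,2)], of "\<lambda>f. restrict f V"]
      by (simp_all add: function_ring_simps(1))
  qed
  have neg: "\<exists>b\<in>carrier ?R. b \<oplus>\<^bsub>?R\<^esub> a = \<zero>\<^bsub>?R\<^esub>" if a: "a \<in> carrier ?R" for a
  proof -
    obtain f where f: "f \<in> function_algebra C" "a = restrict f V" using a unfolding function_ring_simps by blast
    show ?thesis
      by (rule bexI[of _ "restrict (\<lambda>x. - f x) V"])
         (use f fa_uminus[OF f(1)] in \<open>auto simp: function_ring_simps\<close>)
  qed
  have ext: "(\<lambda>x\<in>V. a x) = a" if "a \<in> carrier ?R" for a using that by (rule function_ring_carrier_extensional)
  show ?thesis
  proof (rule cringI)
    show "abelian_group ?R"
    proof (rule abelian_groupI)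
      show "\<zero>\<^bsub>?R\<^esub> \<oplus>\<^bsub>?R\<^esub> a = a" if "a \<in> carrier ?R" for a
      proof -
        have "\<zero>\<^bsub>?R\<^esub> \<oplus>\<^bsub>?R\<^esub> a = (\<lambda>x\<in>V. a x)" by (auto simp: function_ring_simps fun_eq_iff)
        then show ?thesis using ext[OF that] by simp
      qed
    qed (use add zero neg in \<open>auto simp: function_ring_simps(5) fun_eq_iff\<close>)
    show "comm_monoid ?R"
    proof (rule comm_monoidI)
      show "\<one>\<^bsub>?R\<^esub> \<otimes>\<^bsub>?R\<^esub> a = a" if "a \<in> carrier ?R" for a
      proof -
        have "\<one>\<^bsub>?R\<^esub> \<otimes>\<^bsub>?R\<^esub> a = (\<lambda>x\<in>V. a x)" by (auto simp: function_ring_simps fun_eq_iff)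
        then show ?thesis using ext[OF that] by simp
      qed
    qed (use mult one in \<open>auto simp: function_ring_simps(2) fun_eq_iff\<close>)
    show "(x \<oplus>\<^bsub>?R\<^esub> y) \<otimes>\<^bsub>?R\<^esub> z = x \<otimes>\<^bsub>?R\<^esub> z \<oplus>\<^bsub>?R\<^esub> y \<otimes>\<^bsub>?R\<^esub> z" for x y z
      by (auto simp: function_ring_simps fun_eq_iff distrib_right)
  qed
qed

lemma function_ring_pow:
  fixes k :: nat
  assumes "a \<in> carrier (function_ring V (function_algebra C))" "x \<in> V"
  shows "(a [^]\<^bsub>function_ring V (function_algebra C)\<^esub> k) x = a x ^ k"
  using assms(2) by (induction k) (simp_all add: function_ring_simps nat_pow_def)

lemma function_ring_finsum:
  assumes "finite I" "\<And>i. i \<in> I \<Longrightarrow> f i \<in> carrier (function_ring V (function_algebra C))" "x \<in> V"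
  shows "(finsum (function_ring V (function_algebra C)) f I) x = (\<Sum>i\<in>I. f i x)"
proof -
  interpret cring "function_ring V (function_algebra C)" by (rule function_ring_cring)
  show ?thesis using assms
  proof (induction I)
    case (insert i I)
    have "finsum (function_ring V (function_algebra C)) f (insert i I)
        = f i \<oplus>\<^bsub>function_ring V (function_algebra C)\<^esub> finsum (function_ring V (function_algebra C)) f I"
      by (rule finsum_insert) (use insert in auto)
    then show ?case using insert by (simp add: function_ring_simps)
  qed (simp add: function_ring_simps)
qed

context factor_pair
begin

lemma coordinate_ring_domain: "domain (coordinate_ring m n (determinantal_variety m n t))"
proof -
  let ?R = "coordinate_ring m n (determinantal_variety m n t)"
  interpret cring ?R unfolding coordinate_ring_def by (rule function_ring_cring)
  have in_V: "product u \<in> determinantal_variety m n t" for u unfolding determinantal_variety_range by blast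
  show ?thesis
  proof
    show "\<one>\<^bsub>?R\<^esub> \<noteq> \<zero>\<^bsub>?R\<^esub>"
      using in_V[of undefined] by (auto simp: coordinate_ring_def function_ring_simps fun_eq_iff)
    fix a b assume ab: "a \<otimes>\<^bsub>?R\<^esub> b = \<zero>\<^bsub>?R\<^esub>" "a \<in> carrier ?R" "b \<in> carrier ?R"
    obtain f g where f: "f \<in> function_algebra (mat_coords m n)" "a = restrict f (determinantal_variety m n t)"
        and g: "g \<in> function_algebra (mat_coords m n)" "b = restrict g (determinantal_variety m n t)"
      using ab(2,3) unfolding coordinate_ring_def function_ring_simps by blast
    have pf: "(\<lambda>u. f (product u)) \<in> polyfun PV" and pg: "(\<lambda>u. g (product u)) \<in> polyfun PV"
      using pullback_entry_algebra f g entry_algebra_polyfun by blast+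
    have zero: "f (product u) * g (product u) = 0" for u
      using fun_cong[OF ab(1), of "product u"] in_V[of u] f g
      by (simp add: coordinate_ring_def function_ring_simps)
    show "a = \<zero>\<^bsub>?R\<^esub> \<or> b = \<zero>\<^bsub>?R\<^esub>"
    proof (rule disjCI)
      assume "b \<noteq> \<zero>\<^bsub>?R\<^esub>"
      then have "\<not> (\<forall>A \<in> determinantal_variety m n t. g A = 0)"
        using g(2) by (auto simp: coordinate_ring_def function_ring_simps)
      then obtain A where "A \<in> determinantal_variety m n t" "g A \<noteq> 0" by blast
      then obtain u0 where u0: "g (product u0) \<noteq> 0" unfolding determinantal_variety_range by blast
      have "f (product u) = 0" for u
        by (rule polyfun_mult_eq_0[where f = "\<lambda>u. f (product u)", OF pf pg zero u0])
      then have "f A = 0" if "A \<in> determinantal_variety m n t" for A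
        using that unfolding determinantal_variety_range by blast
      then show "a = \<zero>\<^bsub>?R\<^esub>" using f(2) by (auto simp: coordinate_ring_def function_ring_simps fun_eq_iff)
    qed
  qed
qed

text \<open>The integral equation is pulled back to the polynomial ring, where it gives \<open>a = s b\<close> with
  a polynomial \<open>s\<close> in the entries of the factors. This \<open>s\<close> is a polynomial in the entries of the
  product, hence a regular function.\<close>

theorem determinantal_normal: "normal_affine_variety m n (determinantal_variety m n t)"
  unfolding normal_affine_variety_def integrally_closed_domain_def
proof (intro conjI determinantal_irreducible coordinate_ring_domain ballI allI impI)
  let ?V = "determinantal_variety m n t"
  let ?R = "coordinate_ring m n ?V"
  note R_def = coordinate_ring_def[of m n ?V]
  interpret cring ?R unfolding R_def by (rule function_ring_cring)
  have in_V: "product u \<in> ?V" for u unfolding determinantal_variety_range by blast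
  fix a b and k :: nat and c
  assume a: "a \<in> carrier ?R" and b: "b \<in> carrier ?R - {\<zero>\<^bsub>?R\<^esub>}" and c: "c \<in> {..<k} \<rightarrow> carrier ?R"
    and eq: "a [^]\<^bsub>?R\<^esub> k \<oplus>\<^bsub>?R\<^esub> (\<Oplus>\<^bsub>?R\<^esub>i\<in>{..<k}. c i \<otimes>\<^bsub>?R\<^esub> (a [^]\<^bsub>?R\<^esub> i \<otimes>\<^bsub>?R\<^esub> b [^]\<^bsub>?R\<^esub> (k - i))) = \<zero>\<^bsub>?R\<^esub>"
  have bR: "b \<in> carrier ?R" using b by blast
  have cR: "c i \<in> carrier ?R" if "i < k" for i using c that by auto
  have pull: "(\<lambda>u. e (product u)) \<in> entry_algebra" if e: "e \<in> carrier ?R" for e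
  proof -
    obtain f where f: "f \<in> function_algebra (mat_coords m n)" "e = restrict f ?V"
      using e unfolding R_def function_ring_simps by blast
    then have "(\<lambda>u. e (product u)) = (\<lambda>u. f (product u))" using in_V by auto
    then show ?thesis using pullback_entry_algebra[OF f(1)] by simp
  qed
  have pa: "(\<lambda>u. a (product u)) \<in> entry_algebra" and pb: "(\<lambda>u. b (product u)) \<in> entry_algebra"
    using pull a bR by blast+
  have pc: "(\<lambda>u. c i (product u)) \<in> polyfun PV" if "i < k" for i
    using pull[OF cR[OF that]] by (rule entry_algebra_polyfun)
  have eval: "a (product u) ^ k + (\<Sum>i<k. c i (product u) * (a (product u) ^ i * b (product u) ^ (k - i))) = 0" for u
  proof -
    have closed: "c i \<otimes>\<^bsub>?R\<^esub> (a [^]\<^bsub>?R\<^esub> i \<otimes>\<^bsub>?R\<^esub> b [^]\<^bsub>?R\<^esub> (k - i)) \<in> carrier ?R" if "i \<in> {..<k}" for i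
      using a bR cR that by (intro m_closed nat_pow_closed) auto
    have "(\<Oplus>\<^bsub>?R\<^esub>i\<in>{..<k}. c i \<otimes>\<^bsub>?R\<^esub> (a [^]\<^bsub>?R\<^esub> i \<otimes>\<^bsub>?R\<^esub> b [^]\<^bsub>?R\<^esub> (k - i))) (product u)
        = (\<Sum>i<k. (c i \<otimes>\<^bsub>?R\<^esub> (a [^]\<^bsub>?R\<^esub> i \<otimes>\<^bsub>?R\<^esub> b [^]\<^bsub>?R\<^esub> (k - i))) (product u))"
      using closed unfolding R_def by (intro function_ring_finsum in_V) auto
    also have "\<dots> = (\<Sum>i<k. c i (product u) * (a (product u) ^ i * b (product u) ^ (k - i)))"
    proof (rule sum.cong[OF refl])
      fix i
      show "(c i \<otimes>\<^bsub>?R\<^esub> (a [^]\<^bsub>?R\<^esub> i \<otimes>\<^bsub>?R\<^esub> b [^]\<^bsub>?R\<^esub> (k - i))) (product u)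
          = c i (product u) * (a (product u) ^ i * b (product u) ^ (k - i))"
        using function_ring_pow[of a ?V "mat_coords m n" "product u" i] in_V a bR
          function_ring_pow[of b ?V "mat_coords m n" "product u" "k - i"]
        unfolding R_def by (simp add: function_ring_simps(2))
    qed
    finally show ?thesis
      using fun_cong[OF eq, of "product u"] function_ring_pow[of a ?V "mat_coords m n" "product u" k] in_V a
      unfolding R_def by (simp add: function_ring_simps(4,5))
  qed
  have k: "k > 0"
  proof (rule ccontr)
    assume "\<not> k > 0"
    then show False using eval[of undefined] by simp
  qed
  obtain f where f: "b = restrict f ?V" using bR unfolding R_def function_ring_simps by blast
  have "b \<noteq> \<zero>\<^bsub>?R\<^esub>" using b by blast
  then have "\<not> (\<forall>A \<in> ?V. f A = 0)"
    unfolding f by (auto simp: R_def function_ring_simps)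
  then obtain A where "A \<in> ?V" "b A \<noteq> 0" unfolding f by auto
  then obtain u0 where u0: "b (product u0) \<noteq> 0" unfolding determinantal_variety_range by blast
  have "\<exists>s \<in> polyfun PV. \<forall>u. a (product u) = s u * b (product u)"
    by (rule polyfun_integrally_closed[where a = "\<lambda>u. a (product u)" and b = "\<lambda>u. b (product u)"
          and c = "\<lambda>i u. c i (product u)" and n = k,
          OF entry_algebra_polyfun[OF pa] entry_algebra_polyfun[OF pb] u0 pc k eval])
  then obtain s where s: "s \<in> polyfun PV" "\<And>u. a (product u) = s u * b (product u)" by blast
  have "s \<in> entry_algebra"
    by (rule entry_algebra_division[where a = "\<lambda>u. a (product u)" and b = "\<lambda>u. b (product u)",
          OF pa pb u0 s])
  then obtain r where r: "r \<in> function_algebra (mat_coords m n)" "\<And>u. s u = r (product u)"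
    using entry_algebra_pullback by blast
  have "a = restrict r ?V \<otimes>\<^bsub>?R\<^esub> b"
  proof
    fix A
    show "a A = (restrict r ?V \<otimes>\<^bsub>?R\<^esub> b) A"
    proof (cases "A \<in> ?V")
      case True
      then obtain u where "A = product u" unfolding determinantal_variety_range by blast
      then show ?thesis using s(2)[of u] r(2)[of u] in_V by (simp add: R_def function_ring_simps)
    next
      case False
      then show ?thesis using a by (auto simp: R_def function_ring_simps)
    qed
  qed
  moreover have "restrict r ?V \<in> carrier ?R" using r(1) unfolding R_def function_ring_simps by blast
  ultimately show "\<exists>r\<in>carrier ?R. a = r \<otimes>\<^bsub>?R\<^esub> b" by blast
qed

end

section \<open>Groups of matrices with prescribed zeros\<close>

lemma mat_mult_entry:
  "A \<in> carrier_mat m k \<Longrightarrow> B \<in> carrier_mat k n \<Longrightarrow> i < m \<Longrightarrow> j < n \<Longrightarrow>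
    (A * B) $$ (i, j) = (\<Sum>l<k. A $$ (i, l) * B $$ (l, j))"
  by (auto simp: scalar_prod_def atLeast0LessThan)

lemma GL_carrier: "g \<in> carrier (GL N) \<longleftrightarrow> g \<in> carrier_mat N N \<and> det g \<noteq> 0"
proof -
  have "carrier (GL N) = Units (ring_mat TYPE(complex) N ())" by (simp add: GL_def units_of_carrier)
  moreover have "g \<in> carrier_mat N N" if "g \<in> Units (ring_mat TYPE(complex) N ())"
    using that by (simp add: Units_def ring_mat_simps)
  ultimately show ?thesis
    using unit_imp_det_non_zero[of g N "()"] det_non_zero_imp_unit[of g N "()"] by metis
qed

lemma GL_mult [simp]: "x \<otimes>\<^bsub>GL N\<^esub> y = x * y"
  by (simp add: GL_def units_of_mult ring_mat_simps)

lemma GL_one [simp]: "\<one>\<^bsub>GL N\<^esub> = 1\<^sub>m N"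
  by (simp add: GL_def units_of_one ring_mat_simps)

lemma GL_group: "group (GL N)"
proof -
  interpret ring "ring_mat TYPE(complex) N ()" by (rule ring_mat)
  show ?thesis unfolding GL_def by (rule units_group)
qed

lemma GL_carrier_mat: "g \<in> carrier (GL N) \<Longrightarrow> g \<in> carrier_mat N N"
  by (simp add: GL_carrier)

lemma GL_inv:
  assumes "g \<in> carrier (GL N)"
  shows "inv\<^bsub>GL N\<^esub> g \<in> carrier_mat N N" "g * inv\<^bsub>GL N\<^esub> g = 1\<^sub>m N" "inv\<^bsub>GL N\<^esub> g * g = 1\<^sub>m N"
proof -
  interpret group "GL N" by (rule GL_group)
  show "inv\<^bsub>GL N\<^esub> g \<in> carrier_mat N N" using inv_closed[OF assms] by (rule GL_carrier_mat)
  show "g * inv\<^bsub>GL N\<^esub> g = 1\<^sub>m N" "inv\<^bsub>GL N\<^esub> g * g = 1\<^sub>m N" using r_inv[OF assms] l_inv[OF assms] by auto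
qed

lemma GL_I_inverse:
  assumes "g \<in> carrier_mat N N" "h \<in> carrier_mat N N" "g * h = 1\<^sub>m N"
  shows "g \<in> carrier (GL N)"
proof -
  have "det g * det h = 1" using det_mult[OF assms(1,2)] assms(3) by simp
  then show ?thesis using assms(1) by (auto simp: GL_carrier)
qed

lemma GL_inv_eqI:
  assumes "g \<in> carrier (GL N)" "h \<in> carrier_mat N N" "g * h = 1\<^sub>m N"
  shows "inv\<^bsub>GL N\<^esub> g = h"
proof -
  have "inv\<^bsub>GL N\<^esub> g = inv\<^bsub>GL N\<^esub> g * (g * h)" using assms(3) GL_inv(1)[OF assms(1)] by simp
  also have "\<dots> = (inv\<^bsub>GL N\<^esub> g * g) * h"
    using GL_inv(1)[OF assms(1)] GL_carrier_mat[OF assms(1)] assms(2) by (simp add: assoc_mult_mat)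
  finally show ?thesis using GL_inv(3)[OF assms(1)] assms(2) by simp
qed

definition pattern_group :: "nat \<Rightarrow> (nat \<Rightarrow> nat \<Rightarrow> bool) \<Rightarrow> complex mat set" where
  "pattern_group N P = {g \<in> carrier (GL N). \<forall>i<N. \<forall>j<N. \<not> P i j \<longrightarrow> g $$ (i, j) = 0}"

lemma pattern_groupD: "g \<in> pattern_group N P \<Longrightarrow> i < N \<Longrightarrow> j < N \<Longrightarrow> \<not> P i j \<Longrightarrow> g $$ (i, j) = 0"
  unfolding pattern_group_def by blast

lemma pattern_group_GL: "g \<in> pattern_group N P \<Longrightarrow> g \<in> carrier (GL N)"
  unfolding pattern_group_def by blast

text \<open>For a reflexive and transitive relation \<open>P\<close>, the vectors supported on \<open>{i. P i j}\<close> form a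
  space that is mapped into itself by \<open>g\<close>. By dimension it is mapped onto itself, so it is
  stable under the inverse; the column \<open>j\<close> of the inverse lies in it.\<close>

lemma pattern_group_inverse:
  assumes P_trans: "\<And>i j k. P i j \<Longrightarrow> P j k \<Longrightarrow> P i k" and P_refl: "\<And>i. P i i"
    and g: "g \<in> pattern_group N P"
  shows "inv\<^bsub>GL N\<^esub> g \<in> pattern_group N P"
proof -
  have gGL: "g \<in> carrier (GL N)" and gc: "g \<in> carrier_mat N N"
    using g by (auto simp: pattern_group_def GL_carrier)
  interpret group "GL N" by (rule GL_group)
  let ?h = "inv\<^bsub>GL N\<^esub> g"
  note h = GL_inv[OF gGL]
  have ker: "x l = 0" if "l < N" "\<And>i. i < N \<Longrightarrow> (\<Sum>k<N. g $$ (i, k) * x k) = 0" for x l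
  proof -
    have "g = mat N N (\<lambda>(i, j). g $$ (i, j))" using gc by auto
    then have "det (mat N N (\<lambda>(i, j). g $$ (i, j))) \<noteq> 0" using gGL by (simp add: GL_carrier)
    then show ?thesis unfolding det_nonzero_iff_kernel using that by auto
  qed
  have "?h $$ (a, j) = 0" if aj: "a < N" "j < N" "\<not> P a j" for a j
  proof -
    \<comment> \<open>the vectors supported on \<open>D\<close> form a space stable under \<open>g\<close>, hence under the inverse of \<open>g\<close>\<close>
    define D where "D = {i. i < N \<and> P i j}"
    have D: "finite D" "j \<in> D" "D \<subseteq> {..<N}" unfolding D_def using P_refl aj by auto
    have stable: "g $$ (i, k) = 0" if "i < N" "i \<notin> D" "k \<in> D" for i k
      using that P_trans[of i k j] pattern_groupD[OF g, of i k] by (auto simp: D_def)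
    \<comment> \<open>solve \<open>g x = e\<^sub>j\<close> with \<open>x\<close> supported on \<open>D\<close>: the index \<open>N\<close> stands for a factor on the
      right-hand side, which makes the system homogeneous with one unknown more than equations\<close>
    have "\<exists>c. (\<exists>k\<in>insert N D. c k \<noteq> 0) \<and> (\<forall>i\<in>D. (\<Sum>k\<in>insert N D. (if k = N then if i = j then -1 else 0 else g $$ (i, k)) * c k) = 0)"
      by (rule underdetermined_system) (use D in \<open>auto simp: D_def\<close>)
    then obtain c where c: "\<exists>k\<in>insert N D. c k \<noteq> 0"
      "\<And>i. i \<in> D \<Longrightarrow> (\<Sum>k\<in>insert N D. (if k = N then if i = j then -1 else 0 else g $$ (i, k)) * c k) = 0" by blast
    have ND: "N \<notin> D" by (simp add: D_def)
    have c2: "(\<Sum>k\<in>D. g $$ (i, k) * c k) = (if i = j then c N else 0)" if i: "i \<in> D" for i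
    proof -
      have "(\<Sum>k\<in>D. (if k = N then if i = j then -1 else 0 else g $$ (i, k)) * c k) = (\<Sum>k\<in>D. g $$ (i, k) * c k)"
        using ND by (intro sum.cong) auto
      then show ?thesis using c(2)[OF i] ND D(1) by (simp split: if_splits)
    qed
    define x where "x = (\<lambda>k. if k \<in> D then c k else 0)"
    have gx: "(\<Sum>k<N. g $$ (i, k) * x k) = (if i = j then c N else 0)" if i: "i < N" for i
    proof -
      have "(\<Sum>k<N. g $$ (i, k) * x k) = (\<Sum>k\<in>D. g $$ (i, k) * c k)"
        using D by (intro sum.mono_neutral_cong_right) (auto simp: x_def)
      then show ?thesis using c2[of i] stable[OF i] D(2) by (cases "i \<in> D") auto
    qed
    have cN: "c N \<noteq> 0"
    proof
      assume "c N = 0"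
      have x0: "x l = 0" if "l < N" for l by (rule ker[OF that]) (simp add: gx \<open>c N = 0\<close>)
      have "c k = 0" if "k \<in> D" for k using x0[of k] that D(3) unfolding x_def by auto
      then show False using c(1) \<open>c N = 0\<close> by auto
    qed
    have "(?h $$ (a, j)) * c N = x a"
    proof -
      have "x a = (\<Sum>k<N. (1\<^sub>m N :: complex mat) $$ (a, k) * x k)" using aj(1) by (simp add: if_distrib[of "\<lambda>c. c * _"] cong: if_cong)
      also have "\<dots> = (\<Sum>k<N. (\<Sum>i<N. ?h $$ (a, i) * g $$ (i, k)) * x k)"
      proof (rule sum.cong[OF refl])
        fix k assume "k \<in> {..<N}"
        then have "(?h * g) $$ (a, k) = (\<Sum>i<N. ?h $$ (a, i) * g $$ (i, k))"
          using aj(1) by (intro mat_mult_entry[OF h(1) gc]) auto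
        then show "(1\<^sub>m N :: complex mat) $$ (a, k) * x k = (\<Sum>i<N. ?h $$ (a, i) * g $$ (i, k)) * x k"
          using h(3) by simp
      qed
      also have "\<dots> = (\<Sum>i<N. ?h $$ (a, i) * (\<Sum>k<N. g $$ (i, k) * x k))"
        by (simp add: sum_distrib_left sum_distrib_right mult.assoc) (rule sum.swap)
      also have "\<dots> = (\<Sum>i<N. if i = j then ?h $$ (a, i) * c N else 0)"
        by (rule sum.cong) (auto simp: gx)
      finally show ?thesis using aj(2) by simp
    qed
    moreover have "x a = 0" using aj(3) by (simp add: x_def D_def)
    ultimately show ?thesis using cN by simp
  qed
  then show ?thesis using inv_closed[OF gGL] unfolding pattern_group_def by blast
qed

lemma pattern_group_subgroup:
  assumes P_trans: "\<And>i j k. P i j \<Longrightarrow> P j k \<Longrightarrow> P i k" and P_refl: "\<And>i. P i i"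
  shows "subgroup (pattern_group N P) (GL N)"
proof -
  interpret group "GL N" by (rule GL_group)
  show ?thesis
  proof
    show "pattern_group N P \<subseteq> carrier (GL N)" unfolding pattern_group_def by blast
    show "\<one>\<^bsub>GL N\<^esub> \<in> pattern_group N P"
      unfolding pattern_group_def using P_refl by (auto simp: GL_carrier)
    show "inv\<^bsub>GL N\<^esub> g \<in> pattern_group N P" if "g \<in> pattern_group N P" for g
      by (rule pattern_group_inverse[OF P_trans P_refl that])
    fix g h assume gh: "g \<in> pattern_group N P" "h \<in> pattern_group N P"
    have c: "g \<in> carrier_mat N N" "h \<in> carrier_mat N N" using gh by (auto simp: pattern_group_def GL_carrier)
    have "(g * h) $$ (i, j) = 0" if "i < N" "j < N" "\<not> P i j" for i j
    proof -
      have "g $$ (i, k) * h $$ (k, j) = 0" if "k \<in> {..<N}" for k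
        using pattern_groupD[OF gh(1), of i k] pattern_groupD[OF gh(2), of k j] P_trans[of i k j]
          \<open>i < N\<close> \<open>j < N\<close> \<open>\<not> P i j\<close> that by auto
      then have "(\<Sum>k<N. g $$ (i, k) * h $$ (k, j)) = 0" by (intro sum.neutral ballI)
      then show ?thesis using mat_mult_entry[OF c \<open>i < N\<close> \<open>j < N\<close>] by simp
    qed
    moreover have "g \<otimes>\<^bsub>GL N\<^esub> h \<in> carrier (GL N)" using gh m_closed pattern_group_GL by blast
    ultimately show "g \<otimes>\<^bsub>GL N\<^esub> h \<in> pattern_group N P" unfolding pattern_group_def by simp
  qed
qed

text \<open>The group is a principal open subset of a linear space of matrices, hence irreducible.\<close>

lemma pattern_group_connected_algebraic:
  assumes P_trans: "\<And>i j k. P i j \<Longrightarrow> P j k \<Longrightarrow> P i k" and P_refl: "\<And>i. P i i"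
  shows "connected_algebraic_subgroup N (pattern_group N P)"
  unfolding connected_algebraic_subgroup_def
proof (intro conjI)
  show "subgroup (pattern_group N P) (GL N)" by (rule pattern_group_subgroup[OF P_trans P_refl])
  have sub: "pattern_group N P \<subseteq> carrier (GL N)" "carrier (GL N) \<subseteq> carrier_mat N N"
    by (auto simp: pattern_group_def GL_carrier)
  show "closedin (zariski_GL N) (pattern_group N P)"
  proof -
    let ?C = "{A :: complex mat. A \<in> carrier_mat N N \<and> (\<forall>i<N. \<forall>j<N. \<not> P i j \<longrightarrow> A $$ (i, j) = 0)}"
    have "closedin (zariski_mat N N) ?C"
    proof (rule closedin_zariski_mat_zeros)
      fix A assume "A \<in> carrier_mat N N - ?C"
      then obtain i j where "i < N" "j < N" "\<not> P i j" "A $$ (i, j) \<noteq> 0" by blast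
      then show "\<exists>f\<in>function_algebra (mat_coords N N). f A \<noteq> 0 \<and> (\<forall>B\<in>?C. f B = 0)"
        by (intro bexI[of _ "\<lambda>A. A $$ (i, j)"]) (auto intro: mat_coord_fa)
    qed blast
    moreover have "pattern_group N P = ?C \<inter> carrier (GL N)" using sub by (auto simp: pattern_group_def)
    ultimately show ?thesis unfolding zariski_GL_def closedin_subtopology by blast
  qed
  show "connectedin (zariski_GL N) (pattern_group N P)"
  proof -
    define \<pi> where "\<pi> = (\<lambda>u :: nat \<times> nat \<Rightarrow> complex. mat N N (\<lambda>(i, j). if P i j then u (i, j) else 0))"
    have \<pi>: "(\<lambda>u. \<pi> u $$ (i, j)) \<in> polyfun UNIV" if "i < N" "j < N" for i j
      using that polyfun_coord[of "(i, j)" UNIV] by (cases "P i j") (auto simp: \<pi>_def intro: function_algebra.const)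
    have "irreducible_space (subtopology (zariski_mat N N) (pattern_group N P))"
    proof (rule irreducible_parametrized[where h = "\<lambda>u. det (\<pi> u)" and a = "\<lambda>(i, j). if i = j then 1 else 0", OF \<pi>])
      have "(\<lambda>u. det (mat N N (\<lambda>(i, j). \<pi> u $$ (i, j)))) \<in> polyfun UNIV" by (rule fa_det) (rule \<pi>)
      moreover have "mat N N (\<lambda>(i, j). \<pi> u $$ (i, j)) = \<pi> u" for u by (auto simp: \<pi>_def)
      ultimately show "(\<lambda>u. det (\<pi> u)) \<in> polyfun UNIV" by simp
      have "\<pi> (\<lambda>(i, j). if i = j then 1 else 0) = 1\<^sub>m N" using P_refl by (auto simp: \<pi>_def)
      then show "det (\<pi> (\<lambda>(i, j). if i = j then 1 else 0)) \<noteq> 0" by simp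
      show "pattern_group N P = \<pi> ` {u. det (\<pi> u) \<noteq> 0}"
      proof
        show "pattern_group N P \<subseteq> \<pi> ` {u. det (\<pi> u) \<noteq> 0}"
        proof
          fix g assume g: "g \<in> pattern_group N P"
          then have "g \<in> carrier_mat N N" "det g \<noteq> 0" using sub by (auto simp: pattern_group_def GL_carrier)
          then have "g = \<pi> (\<lambda>ij. g $$ ij)" using pattern_groupD[OF g] by (intro eq_matI) (auto simp: \<pi>_def)
          then show "g \<in> \<pi> ` {u. det (\<pi> u) \<noteq> 0}" using \<open>det g \<noteq> 0\<close> by auto
        qed
      qed (auto simp: pattern_group_def GL_carrier \<pi>_def)
      show "pattern_group N P \<subseteq> carrier_mat N N" using sub by blast
    qed
    moreover have "subtopology (zariski_GL N) (pattern_group N P) = subtopology (zariski_mat N N) (pattern_group N P)"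
      unfolding zariski_GL_def subtopology_subtopology using sub(1) by (simp add: Int_absorb1)
    moreover have "topspace (zariski_GL N) = carrier (GL N)"
      unfolding zariski_GL_def using sub(2) by auto
    ultimately show ?thesis unfolding connectedin_def using irreducible_imp_connected sub(1) by simp
  qed
qed

section \<open>Triviality of the unipotent radical\<close>

definition mtrace :: "nat \<Rightarrow> complex mat \<Rightarrow> complex" where
  "mtrace N A = (\<Sum>i<N. A $$ (i, i))"

lemma mtrace_comm:
  assumes "A \<in> carrier_mat N N" "B \<in> carrier_mat N N"
  shows "mtrace N (A * B) = mtrace N (B * A)"
proof -
  have "mtrace N (A * B) = (\<Sum>i<N. \<Sum>l<N. A $$ (i, l) * B $$ (l, i))"
    unfolding mtrace_def by (intro sum.cong refl mat_mult_entry[OF assms]) auto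
  also have "\<dots> = (\<Sum>l<N. \<Sum>i<N. B $$ (l, i) * A $$ (i, l))"
    by (subst sum.swap) (simp add: mult.commute)
  also have "\<dots> = mtrace N (B * A)"
    unfolding mtrace_def by (intro sum.cong refl mat_mult_entry[OF assms(2,1), symmetric]) auto
  finally show ?thesis .
qed

lemma upper_triangular_pow:
  fixes B :: "complex mat"
  assumes "B \<in> carrier_mat N N" "upper_triangular B"
  shows "(\<forall>i<N. \<forall>j<i. (B ^\<^sub>m k) $$ (i, j) = 0) \<and> (\<forall>i<N. (B ^\<^sub>m k) $$ (i, i) = (B $$ (i, i)) ^ k)"
proof (induction k)
  case 0
  show ?case using assms(1) by auto
next
  case (Suc k)
  have c: "B ^\<^sub>m k \<in> carrier_mat N N" using assms(1) by simp
  have e: "(B ^\<^sub>m Suc k) $$ (i, j) = (\<Sum>l<N. (B ^\<^sub>m k) $$ (i, l) * B $$ (l, j))" if "i < N" "j < N" for i j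
    using mat_mult_entry[OF c assms(1) that] by simp
  have ut: "B $$ (i, j) = 0" if "i < N" "j < i" for i j
    using assms that by (auto simp: upper_triangular_def)
  have "(B ^\<^sub>m Suc k) $$ (i, j) = 0" if "i < N" "j < i" for i j
  proof -
    have "(B ^\<^sub>m k) $$ (i, l) * B $$ (l, j) = 0" if "l \<in> {..<N}" for l
      using Suc ut \<open>i < N\<close> \<open>j < i\<close> that by (cases "l < i") auto
    then have "(\<Sum>l<N. (B ^\<^sub>m k) $$ (i, l) * B $$ (l, j)) = 0" by (intro sum.neutral ballI)
    then show ?thesis using e[of i j] that by simp
  qed
  moreover have "(B ^\<^sub>m Suc k) $$ (i, i) = (B $$ (i, i)) ^ Suc k" if i: "i < N" for i
  proof -
    have "(B ^\<^sub>m Suc k) $$ (i, i) = (\<Sum>l<N. if l = i then (B ^\<^sub>m k) $$ (i, i) * B $$ (i, i) else 0)"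
      unfolding e[OF i i]
    proof (rule sum.cong[OF refl])
      fix l assume "l \<in> {..<N}"
      then show "(B ^\<^sub>m k) $$ (i, l) * B $$ (l, i) = (if l = i then (B ^\<^sub>m k) $$ (i, i) * B $$ (i, i) else 0)"
        using Suc ut i by (cases "l < i"; cases "l = i") auto
    qed
    then show ?thesis using Suc i by (simp add: mult.commute)
  qed
  ultimately show ?case by blast
qed

text \<open>A nilpotent matrix is similar to a triangular one with zero diagonal.\<close>

lemma nilpotent_mtrace:
  assumes A: "A \<in> carrier_mat N N" and "A ^\<^sub>m k = 0\<^sub>m N N"
  shows "mtrace N A = 0"
proof -
  obtain es where "char_poly A = (\<Prod>a\<leftarrow>es. [:- a, 1:])" using char_poly_factorized[OF A] by blast
  then obtain B where B: "B \<in> carrier_mat N N" "upper_triangular B" "similar_mat A B"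
    using schur_decomposition_exists[OF A] by blast
  then obtain P Q where wit: "similar_mat_wit A B P Q" unfolding similar_mat_def by blast
  note w = similar_mat_witD2[OF A wit]
  have "B ^\<^sub>m k = Q * (A ^\<^sub>m k) * P"
    using similar_mat_wit_pow_id[OF similar_mat_wit_sym[OF wit], of k] by simp
  then have Bk: "B ^\<^sub>m k = 0\<^sub>m N N" using assms(2) w by simp
  have "B $$ (i, i) = 0" if "i < N" for i
  proof -
    have "(B $$ (i, i)) ^ k = 0" using upper_triangular_pow[OF B(1,2), of k] Bk that by simp
    then show ?thesis by simp
  qed
  then have "mtrace N B = 0" unfolding mtrace_def by simp
  moreover have "mtrace N A = mtrace N B"
  proof -
    have "mtrace N A = mtrace N (P * (B * Q))" using w by (simp add: assoc_mult_mat)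
    also have "\<dots> = mtrace N ((B * Q) * P)" by (rule mtrace_comm) (use w in auto)
    also have "(B * Q) * P = B" using w by (simp add: assoc_mult_mat)
    finally show ?thesis .
  qed
  ultimately show ?thesis by simp
qed

lemma unipotent_mtrace:
  assumes "unipotent N u" shows "mtrace N u = of_nat N"
proof -
  obtain k where u: "u \<in> carrier_mat N N" "(u - 1\<^sub>m N) ^\<^sub>m k = 0\<^sub>m N N"
    using assms unfolding unipotent_def by blast
  have "mtrace N (u - 1\<^sub>m N) = 0" by (rule nilpotent_mtrace[OF _ u(2)]) (use u(1) in auto)
  moreover have "mtrace N (u - 1\<^sub>m N) = mtrace N u - of_nat N"
    unfolding mtrace_def using u(1) by (simp add: sum_subtractf)
  ultimately show ?thesis by simp
qed

text \<open>The matrix \<open>1 + e\<^sub>i \<rho>\<^sup>T\<close>, which adds a combination of all rows to the row \<open>i\<close>.\<close>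

definition row_transvection :: "nat \<Rightarrow> nat \<Rightarrow> (nat \<Rightarrow> complex) \<Rightarrow> complex mat" where
  "row_transvection N i \<rho> = mat N N (\<lambda>(p, q). (if p = q then 1 else 0) + (if p = i then \<rho> q else 0))"

lemma row_transvection_carrier [simp]: "row_transvection N i \<rho> \<in> carrier_mat N N"
  "dim_row (row_transvection N i \<rho>) = N" "dim_col (row_transvection N i \<rho>) = N"
  by (simp_all add: row_transvection_def)

lemma row_transvection_mult_left:
  assumes "A \<in> carrier_mat N n" "i < N" "p < N" "q < n"
  shows "(row_transvection N i \<rho> * A) $$ (p, q) = A $$ (p, q) + (if p = i then \<Sum>l<N. \<rho> l * A $$ (l, q) else 0)"
proof -
  have "(row_transvection N i \<rho> * A) $$ (p, q)
      = (\<Sum>l<N. ((if p = l then 1 else 0) + (if p = i then \<rho> l else 0)) * A $$ (l, q))"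
    using mat_mult_entry[OF row_transvection_carrier(1)[of N i \<rho>] assms(1,3,4)] assms(3)
    by (auto simp: row_transvection_def intro!: sum.cong)
  also have "\<dots> = (\<Sum>l<N. (if p = l then A $$ (l, q) else 0)) + (\<Sum>l<N. if p = i then \<rho> l * A $$ (l, q) else 0)"
    unfolding sum.distrib[symmetric] by (rule sum.cong) (auto simp: distrib_right)
  also have "(\<Sum>l<N. (if p = l then A $$ (l, q) else 0)) = A $$ (p, q)" using assms(3) by simp
  finally show ?thesis by simp
qed

lemma row_transvection_mult_right:
  assumes "A \<in> carrier_mat n N" "i < N" "p < n" "q < N"
  shows "(A * row_transvection N i \<rho>) $$ (p, q) = A $$ (p, q) + A $$ (p, i) * \<rho> q"
proof -
  have "(A * row_transvection N i \<rho>) $$ (p, q)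
      = (\<Sum>l<N. A $$ (p, l) * ((if l = q then 1 else 0) + (if l = i then \<rho> q else 0)))"
    using mat_mult_entry[OF assms(1) row_transvection_carrier(1)[of N i \<rho>] assms(3,4)] assms(4)
    by (auto simp: row_transvection_def intro!: sum.cong)
  also have "\<dots> = (\<Sum>l<N. (if l = q then A $$ (p, l) else 0)) + (\<Sum>l<N. if l = i then A $$ (p, l) * \<rho> q else 0)"
    unfolding sum.distrib[symmetric] by (rule sum.cong) (auto simp: distrib_left)
  finally show ?thesis using assms(2,4) by simp
qed

lemma row_transvection_add:
  assumes "i < N" "\<rho> i = 0"
  shows "row_transvection N i \<rho> * row_transvection N i \<sigma> = row_transvection N i (\<lambda>q. \<rho> q + \<sigma> q)"
proof (rule eq_matI)
  fix p q assume "p < dim_row (row_transvection N i (\<lambda>q. \<rho> q + \<sigma> q))" "q < dim_col (row_transvection N i (\<lambda>q. \<rho> q + \<sigma> q))"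
  then have pq: "p < N" "q < N" by auto
  show "(row_transvection N i \<rho> * row_transvection N i \<sigma>) $$ (p, q) = row_transvection N i (\<lambda>q. \<rho> q + \<sigma> q) $$ (p, q)"
    unfolding row_transvection_mult_right[OF row_transvection_carrier(1) assms(1) pq]
    using pq assms by (auto simp: row_transvection_def)
qed auto

lemma row_transvection_zero: "row_transvection N i (\<lambda>_. 0) = 1\<^sub>m N"
  by (rule eq_matI) (auto simp: row_transvection_def)

lemma row_transvection_GL:
  assumes "i < N" "\<rho> i = 0"
  shows "row_transvection N i \<rho> \<in> carrier (GL N)"
    and "inv\<^bsub>GL N\<^esub> (row_transvection N i \<rho>) = row_transvection N i (\<lambda>q. - \<rho> q)"
proof -
  have *: "row_transvection N i \<rho> * row_transvection N i (\<lambda>q. - \<rho> q) = 1\<^sub>m N"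
    using row_transvection_add[of i N \<rho> "\<lambda>q. - \<rho> q"] assms by (simp add: row_transvection_zero)
  show 1: "row_transvection N i \<rho> \<in> carrier (GL N)" by (rule GL_I_inverse[OF _ _ *]) auto
  show "inv\<^bsub>GL N\<^esub> (row_transvection N i \<rho>) = row_transvection N i (\<lambda>q. - \<rho> q)"
    by (rule GL_inv_eqI[OF 1 _ *]) auto
qed

lemma row_transvection_pattern:
  assumes "i < N" "\<rho> i = 0" "\<And>i. P i i" "\<And>q. q < N \<Longrightarrow> \<not> P i q \<Longrightarrow> \<rho> q = 0"
  shows "row_transvection N i \<rho> \<in> pattern_group N P"
  unfolding pattern_group_def
proof (intro CollectI conjI allI impI)
  show "row_transvection N i \<rho> \<in> carrier (GL N)"
    by (rule row_transvection_GL(1)[where \<rho> = \<rho>]) (fact assms(1), fact assms(2))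
  show "row_transvection N i \<rho> $$ (p, q) = 0" if "p < N" "q < N" "\<not> P p q" for p q
    using that assms(3,4) by (auto simp: row_transvection_def)
qed

text \<open>The trace detects one off-diagonal entry of \<open>u\<close>: conjugation of one of two factors \<open>u\<close> by
  \<open>g = 1 + E\<^sub>i\<^sub>j\<close> changes the trace of the product by the square of that entry, because the
  terms linear in \<open>E\<^sub>i\<^sub>j\<close> cancel.\<close>

lemma mtrace_conjugate:
  assumes u: "u \<in> carrier_mat N N" and ij: "i < N" "j < N" "i \<noteq> j"
  defines "g \<equiv> row_transvection N i (\<lambda>q. if q = j then 1 else 0)"
    and "g' \<equiv> row_transvection N i (\<lambda>q. - (if q = j then 1 else 0))"
  shows "mtrace N (u * (g * u * g')) = mtrace N (u * u) - (u $$ (j, i))\<^sup>2"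
proof -
  have c: "g \<in> carrier_mat N N" "g' \<in> carrier_mat N N" by (simp_all add: g_def g'_def)
  have ug: "(u * g) $$ (p, q) = u $$ (p, q) + u $$ (p, i) * (if q = j then 1 else 0)"
    and ug': "(u * g') $$ (p, q) = u $$ (p, q) - u $$ (p, i) * (if q = j then 1 else 0)"
    if "p < N" "q < N" for p q
    unfolding g_def g'_def using row_transvection_mult_right[OF u ij(1) that] by auto
  have ugc: "u * g \<in> carrier_mat N N" "u * g' \<in> carrier_mat N N" using u c by auto
  have "u * (g * u * g') = u * (g * (u * g'))" using assoc_mult_mat[OF c(1) u c(2)] by simp
  also have "\<dots> = (u * g) * (u * g')" using assoc_mult_mat[OF u c(1) ugc(2)] by simp
  finally have "mtrace N (u * (g * u * g')) = (\<Sum>p<N. \<Sum>l<N. (u * g) $$ (p, l) * (u * g') $$ (l, p))"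
    unfolding mtrace_def by (simp only:) (intro sum.cong refl mat_mult_entry[OF ugc], auto)
  also have "\<dots> = (\<Sum>p<N. \<Sum>l<N. u $$ (p, l) * u $$ (l, p) + (if l = j then u $$ (p, i) * u $$ (j, p) else 0)
      - (if p = j then u $$ (p, l) * u $$ (l, i) else 0)
      - (if p = j then if l = j then u $$ (j, i) * u $$ (j, i) else 0 else 0))"
    by (intro sum.cong refl) (auto simp: ug ug' algebra_simps)
  also have "\<dots> = (\<Sum>p<N. \<Sum>l<N. u $$ (p, l) * u $$ (l, p)) + (\<Sum>p<N. u $$ (p, i) * u $$ (j, p))
      - (\<Sum>l<N. u $$ (j, l) * u $$ (l, i)) - u $$ (j, i) * u $$ (j, i)"
  proof -
    have "(\<Sum>p<N. \<Sum>l<N. if p = j then u $$ (p, l) * u $$ (l, i) else 0)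
        = (\<Sum>p<N. if p = j then \<Sum>l<N. u $$ (j, l) * u $$ (l, i) else 0)" by (intro sum.cong) auto
    moreover have "(\<Sum>p<N. \<Sum>l<N. if p = j then if l = j then u $$ (j, i) * u $$ (j, i) else 0 else 0)
        = (\<Sum>p<N. if p = j then \<Sum>l<N. if l = j then u $$ (j, i) * u $$ (j, i) else 0 else 0)" by (intro sum.cong) auto
    ultimately show ?thesis using ij by (simp add: sum.distrib sum_subtractf)
  qed
  also have "(\<Sum>p<N. \<Sum>l<N. u $$ (p, l) * u $$ (l, p)) = mtrace N (u * u)"
    unfolding mtrace_def by (intro sum.cong refl mat_mult_entry[OF u u, symmetric]) auto
  finally show ?thesis by (simp add: power2_eq_square mult.commute)
qed

text \<open>Let \<open>u\<close> be in a normal subgroup of unipotent matrices. Then \<open>u u\<close> and \<open>u (g u g\<inverse>)\<close> are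
  unipotent, so they have the same trace \<open>N\<close>, and the trace formula above makes the off-diagonal
  entries of \<open>u\<close> vanish. A diagonal unipotent matrix is the identity.\<close>

lemma pattern_group_reductive:
  assumes P_refl: "\<And>i. P i i" and P_sym: "\<And>i j. P i j \<Longrightarrow> P j i" and P_trans: "\<And>i j k. P i j \<Longrightarrow> P j k \<Longrightarrow> P i k"
  shows "connected_reductive N (pattern_group N P)"
  unfolding connected_reductive_def
proof (intro conjI allI impI)
  let ?G = "GL_sub N (pattern_group N P)"
  show "connected_algebraic_subgroup N (pattern_group N P)"
    by (rule pattern_group_connected_algebraic[OF P_trans P_refl])
  have sg: "subgroup (pattern_group N P) (GL N)" by (rule pattern_group_subgroup[OF P_trans P_refl])
  interpret GL: group "GL N" by (rule GL_group)
  interpret G: group ?G by (rule GL.subgroup_imp_group[OF sg])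
  fix U assume U: "U \<lhd> ?G \<and> connected_algebraic_subgroup N U \<and> (\<forall>u\<in>U. unipotent N u)"
  interpret U: normal U ?G using U by blast
  have one: "1\<^sub>m N \<in> U" using U.one_closed by simp
  have "u = 1\<^sub>m N" if uU: "u \<in> U" for u
  proof -
    have uc: "u \<in> carrier_mat N N" using U uU unfolding unipotent_def by blast
    have uP: "u \<in> pattern_group N P" using U.subset uU by auto
    have uu: "u * u \<in> U" using U.m_closed[OF uU uU] by simp
    have off: "u $$ (j, i) = 0" if ij: "i < N" "j < N" "i \<noteq> j" for i j
    proof (cases "P i j")
      case False
      then show ?thesis using pattern_groupD[OF uP, of j i] ij P_sym by blast
    next
      case True
      let ?g = "row_transvection N i (\<lambda>q. if q = j then 1 else 0)"
      let ?g' = "row_transvection N i (\<lambda>q. - (if q = j then 1 else 0))"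
      have g: "?g \<in> pattern_group N P" by (rule row_transvection_pattern) (use ij P_refl True in auto)
      have "inv\<^bsub>?G\<^esub> ?g = ?g'"
        using GL.m_inv_consistent[OF sg g] row_transvection_GL(2)[of i N "\<lambda>q. if q = j then 1 else 0"] ij by simp
      moreover have "?g \<otimes>\<^bsub>?G\<^esub> u \<otimes>\<^bsub>?G\<^esub> inv\<^bsub>?G\<^esub> ?g \<in> U" by (rule U.inv_op_closed2) (use g uU in auto)
      ultimately have "?g * u * ?g' \<in> U" by simp
      then have "u * (?g * u * ?g') \<in> U" using U.m_closed[OF uU] by auto
      then have "mtrace N (u * (?g * u * ?g')) = of_nat N" "mtrace N (u * u) = of_nat N"
        using U uu unipotent_mtrace by blast+
      then have "(u $$ (j, i))\<^sup>2 = 0" using mtrace_conjugate[OF uc ij] by simp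
      then show ?thesis by simp
    qed
    obtain k where k: "(u - 1\<^sub>m N) ^\<^sub>m k = 0\<^sub>m N N" using U uU unfolding unipotent_def by blast
    have nc: "u - 1\<^sub>m N \<in> carrier_mat N N" using uc by auto
    have nut: "upper_triangular (u - 1\<^sub>m N)" using off uc by (auto simp: upper_triangular_def)
    have "u $$ (i, i) = 1" if "i < N" for i
    proof -
      have "((u - 1\<^sub>m N) $$ (i, i)) ^ k = 0" using upper_triangular_pow[OF nc nut, of k] k that by simp
      then show ?thesis using uc that by simp
    qed
    then show ?thesis using off uc by (intro eq_matI) auto
  qed
  then show "U = {1\<^sub>m N}" using one by blast
qed

section \<open>Solvable groups of triangular matrices\<close>

text \<open>A filtration of the triangular group: all of it for \<open>k = 0\<close>, the unipotent matrices for
  \<open>k = 1\<close>, and for larger \<open>k\<close> those that moreover vanish on the first \<open>k - 1\<close> superdiagonals.\<close>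

definition unitri :: "nat \<Rightarrow> nat \<Rightarrow> complex mat set" where
  "unitri N k = {g \<in> carrier (GL N). \<forall>i<N. \<forall>j<N. j < i + k \<longrightarrow> g $$ (i, j) = (if i = j then 1 else 0)}"

lemma unitriD: "g \<in> unitri N k \<Longrightarrow> i < N \<Longrightarrow> j < N \<Longrightarrow> j < i + k \<Longrightarrow> g $$ (i, j) = (if i = j then 1 else 0)"
  unfolding unitri_def by blast

lemma unitri_0: "unitri N 0 = pattern_group N (\<le>)"
  unfolding unitri_def pattern_group_def by (auto simp: not_le)

lemma unitri_mono: "k \<le> l \<Longrightarrow> unitri N l \<subseteq> unitri N k"
  unfolding unitri_def by auto

lemma unitri_upper: "g \<in> unitri N k \<Longrightarrow> i < N \<Longrightarrow> j < i \<Longrightarrow> g $$ (i, j) = 0"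
  using unitriD[of g N k i j] by auto

lemma unitri_inv_upper:
  assumes "g \<in> unitri N k" shows "inv\<^bsub>GL N\<^esub> g \<in> unitri N 0"
proof -
  have "g \<in> pattern_group N (\<le>)" using assms unitri_mono[of 0 k N] unitri_0 by auto
  then show ?thesis unfolding unitri_0 by (intro pattern_group_inverse) auto
qed

lemma unitri_subgroup: "subgroup (unitri N k) (GL N)"
proof -
  interpret group "GL N" by (rule GL_group)
  have delta: "(\<Sum>l<N. (if i = l then 1 else 0) * f l) = f i" if "i < N" for i and f :: "nat \<Rightarrow> complex"
  proof -
    have "(\<Sum>l<N. (if i = l then 1 else 0) * f l) = (\<Sum>l<N. if i = l then f l else 0)" by (rule sum.cong) auto
    then show ?thesis using that by simp
  qed
  show ?thesis
  proof
    show "unitri N k \<subseteq> carrier (GL N)" unfolding unitri_def by blast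
    show "\<one>\<^bsub>GL N\<^esub> \<in> unitri N k" unfolding unitri_def by (auto simp: GL_carrier)
  next
    fix g h assume gh: "g \<in> unitri N k" "h \<in> unitri N k"
    then have GL: "g \<in> carrier (GL N)" "h \<in> carrier (GL N)" unfolding unitri_def by auto
    have "(g * h) $$ (i, j) = (if i = j then 1 else 0)" if ij: "i < N" "j < N" "j < i + k" for i j
    proof -
      have "(g * h) $$ (i, j) = (\<Sum>l<N. g $$ (i, l) * h $$ (l, j))"
        by (rule mat_mult_entry[OF GL_carrier_mat[OF GL(1)] GL_carrier_mat[OF GL(2)] ij(1,2)])
      also have "\<dots> = (\<Sum>l<N. (if i = l then 1 else 0) * h $$ (l, j))"
      proof (rule sum.cong[OF refl])
        fix l assume l: "l \<in> {..<N}"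
        show "g $$ (i, l) * h $$ (l, j) = (if i = l then 1 else 0) * h $$ (l, j)"
        proof (cases "l < i + k")
          case True
          then show ?thesis using unitriD[OF gh(1) ij(1), of l] l by simp
        next
          case False
          then have "h $$ (l, j) = 0" using unitriD[OF gh(2), of l j] l ij by auto
          then show ?thesis by simp
        qed
      qed
      also have "\<dots> = h $$ (i, j)" by (rule delta[OF ij(1)])
      finally show ?thesis using unitriD[OF gh(2) ij] by simp
    qed
    then show "g \<otimes>\<^bsub>GL N\<^esub> h \<in> unitri N k" using m_closed[OF GL] unfolding unitri_def by simp
  next
    fix g assume g: "g \<in> unitri N k"
    then have GL: "g \<in> carrier (GL N)" unfolding unitri_def by auto
    let ?h = "inv\<^bsub>GL N\<^esub> g"
    have hU: "?h \<in> unitri N 0" by (rule unitri_inv_upper[OF g])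
    have "?h $$ (i, j) = (if i = j then 1 else 0)" if ij: "i < N" "j < N" "j < i + k" for i j
    proof -
      have "(if i = j then 1 else 0) = (g * ?h) $$ (i, j)" using GL_inv(2)[OF GL] ij by simp
      also have "\<dots> = (\<Sum>l<N. g $$ (i, l) * ?h $$ (l, j))"
        by (rule mat_mult_entry[OF GL_carrier_mat[OF GL] GL_inv(1)[OF GL] ij(1,2)])
      also have "\<dots> = (\<Sum>l<N. (if i = l then 1 else 0) * ?h $$ (l, j))"
      proof (rule sum.cong[OF refl])
        fix l assume l: "l \<in> {..<N}"
        show "g $$ (i, l) * ?h $$ (l, j) = (if i = l then 1 else 0) * ?h $$ (l, j)"
        proof (cases "l < i + k")
          case True
          then show ?thesis using unitriD[OF g ij(1), of l] l by simp
        next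
          case False
          then have "?h $$ (l, j) = 0" using unitri_upper[OF hU, of l j] l ij by auto
          then show ?thesis by simp
        qed
      qed
      also have "\<dots> = ?h $$ (i, j)" by (rule delta[OF ij(1)])
      finally show ?thesis by simp
    qed
    then show "?h \<in> unitri N k" using inv_closed[OF GL] unfolding unitri_def by simp
  qed
qed

text \<open>The products \<open>g h\<close> and \<open>h g\<close> agree on one more diagonal than \<open>g\<close> and \<open>h\<close> are known on. For
  \<open>k = 0\<close> only the diagonals multiply; for \<open>k > 0\<close> the difference is a commutator of two
  strictly triangular matrices.\<close>

lemma unitri_commutator:
  assumes g: "g \<in> unitri N k" and h: "h \<in> unitri N k"
  shows "g * h * inv\<^bsub>GL N\<^esub> g * inv\<^bsub>GL N\<^esub> h \<in> unitri N (Suc k)"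
proof -
  interpret group "GL N" by (rule GL_group)
  have GL: "g \<in> carrier (GL N)" "h \<in> carrier (GL N)" using g h unfolding unitri_def by auto
  note c = GL_carrier_mat[OF GL(1)] GL_carrier_mat[OF GL(2)]
  let ?r = "inv\<^bsub>GL N\<^esub> g * inv\<^bsub>GL N\<^esub> h"
  have hg: "h * g \<in> unitri N k" using subgroup.m_closed[OF unitri_subgroup h g] by simp
  have r_eq: "?r = inv\<^bsub>GL N\<^esub> (h * g)" using inv_mult_group[OF GL(2,1)] by simp
  have rU: "?r \<in> unitri N 0" unfolding r_eq by (rule unitri_inv_upper[OF hg])
  have hgGL: "h * g \<in> carrier (GL N)" using m_closed[OF GL(2,1)] by simp
  have hgr: "(h * g) * ?r = 1\<^sub>m N" unfolding r_eq by (rule GL_inv(2)[OF hgGL])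
  have rc: "?r \<in> carrier_mat N N" unfolding r_eq by (rule GL_inv(1)[OF hgGL])
  have com: "g * h * inv\<^bsub>GL N\<^esub> g * inv\<^bsub>GL N\<^esub> h = (g * h) * ?r"
    using c GL_inv(1)[OF GL(1)] GL_inv(1)[OF GL(2)] by (intro assoc_mult_mat) auto
  have diff: "(g * h) $$ (i, j) = (h * g) $$ (i, j)" if ij: "i < N" "j < N" "j < i + Suc k" for i j
  proof -
    have gh': "(x * y) $$ (i, j) = (\<Sum>l<N. x $$ (i, l) * y $$ (l, j))"
      if "x \<in> carrier_mat N N" "y \<in> carrier_mat N N" for x y
      using mat_mult_entry[OF that ij(1,2)] .
    show ?thesis
    proof (cases "k = 0")
      case True
      have "g $$ (i, l) * h $$ (l, j) = h $$ (i, l) * g $$ (l, j)" if "l < N" for l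
        using unitri_upper[OF g, of i l] unitri_upper[OF h, of i l] unitri_upper[OF g, of l j]
          unitri_upper[OF h, of l j] that ij True
        by (cases "l < i"; cases "j < l"; cases "j = i") auto
      then show ?thesis unfolding gh'[OF c] gh'[OF c(2,1)] by (intro sum.cong) auto
    next
      case False
      \<comment> \<open>write \<open>g = 1 + a\<close> and \<open>h = 1 + b\<close>; then \<open>g h - h g = a b - b a\<close>\<close>
      define a where "a = (\<lambda>i j. g $$ (i, j) - (if i = j then 1 else 0))"
      define b where "b = (\<lambda>i j. h $$ (i, j) - (if i = j then 1 else 0))"
      have ab0: "a i l = 0" "b i l = 0" if "i < N" "l < N" "l < i + k" for i l
        using unitriD[OF g that] unitriD[OF h that] by (auto simp: a_def b_def)
      have expand: "(\<Sum>l<N. x i l * y l j) = x' i j + y' i j + (if i = j then 1 else 0) + (\<Sum>l<N. x' i l * y' l j)"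
        if "\<And>i j. x i j = x' i j + (if i = j then 1 else 0)" "\<And>i j. y i j = y' i j + (if i = j then 1 else 0)"
        for x y x' y' :: "nat \<Rightarrow> nat \<Rightarrow> complex"
      proof -
        have "(\<Sum>l<N. x i l * y l j) = (\<Sum>l<N. x' i l * y' l j + (if l = j then x' i l else 0)
            + (if i = l then y' l j else 0) + (if i = l then if l = j then 1 else 0 else 0))"
          unfolding that by (intro sum.cong) (auto simp: algebra_simps)
        then show ?thesis using ij by (simp add: sum.distrib)
      qed
      have z: "(\<Sum>l<N. a i l * b l j) = 0" "(\<Sum>l<N. b i l * a l j) = 0"
        by (rule sum.neutral; use ab0[OF ij(1)] ab0[OF _ ij(2)] ij False in \<open>force simp: not_less\<close>)+
      have "(g * h) $$ (i, j) = a i j + b i j + (if i = j then 1 else 0)"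
        unfolding gh'[OF c] using expand[of "\<lambda>i j. g $$ (i, j)" a "\<lambda>i j. h $$ (i, j)" b] z by (simp add: a_def b_def)
      moreover have "(h * g) $$ (i, j) = b i j + a i j + (if i = j then 1 else 0)"
        unfolding gh'[OF c(2,1)] using expand[of "\<lambda>i j. h $$ (i, j)" b "\<lambda>i j. g $$ (i, j)" a] z by (simp add: a_def b_def)
      ultimately show ?thesis by simp
    qed
  qed
  have cc: "g * h \<in> carrier_mat N N" "h * g \<in> carrier_mat N N" using c by auto
  have "(g * h * ?r) $$ (i, j) = (if i = j then 1 else 0)" if ij: "i < N" "j < N" "j < i + Suc k" for i j
  proof -
    have "(g * h * ?r) $$ (i, j) = (\<Sum>l<N. (g * h) $$ (i, l) * ?r $$ (l, j))"
      by (rule mat_mult_entry[OF cc(1) rc ij(1,2)])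
    also have "\<dots> = (\<Sum>l<N. (h * g) $$ (i, l) * ?r $$ (l, j))"
    proof (rule sum.cong[OF refl])
      fix l assume l: "l \<in> {..<N}"
      show "(g * h) $$ (i, l) * ?r $$ (l, j) = (h * g) $$ (i, l) * ?r $$ (l, j)"
      proof (cases "l < i + Suc k")
        case True
        have "(g * h) $$ (i, l) = (h * g) $$ (i, l)" by (rule diff[OF ij(1) _ True]) (use l in simp)
        then show ?thesis by (rule arg_cong)
      next
        case False
        have "?r $$ (l, j) = 0" by (rule unitri_upper[OF rU]) (use False l ij in auto)
        then show ?thesis by (simp only: mult_zero_right)
      qed
    qed
    also have "\<dots> = ((h * g) * ?r) $$ (i, j)" by (rule mat_mult_entry[OF cc(2) rc ij(1,2), symmetric])
    finally show ?thesis unfolding hgr using ij by simp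
  qed
  moreover have "g * h * ?r \<in> carrier (GL N)"
    using m_closed[OF m_closed[OF GL] m_closed[OF inv_closed[OF GL(1)] inv_closed[OF GL(2)]]] by simp
  ultimately show ?thesis unfolding com unitri_def by blast
qed

lemma triangular_solvable:
  assumes K: "subgroup K (GL N)" "K \<subseteq> pattern_group N (\<le>)"
  shows "solvable (GL_sub N K)"
proof -
  let ?G = "GL_sub N K"
  interpret GL: group "GL N" by (rule GL_group)
  interpret G: group ?G by (rule GL.subgroup_imp_group[OF K(1)])
  have inv: "inv\<^bsub>?G\<^esub> x = inv\<^bsub>GL N\<^esub> x" if "x \<in> K" for x by (rule GL.m_inv_consistent[OF K(1) that])
  have sub: "(derived ?G ^^ k) K \<subseteq> unitri N k \<inter> K" for k
  proof (induction k)
    case 0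
    then show ?case using K(2) unitri_0 by auto
  next
    case (Suc k)
    let ?S = "(derived ?G ^^ k) K"
    have U: "subgroup (unitri N (Suc k) \<inter> K) ?G"
      by (rule GL.subgroup_incl[OF GL.subgroups_Inter_pair[OF unitri_subgroup K(1)] K(1)]) blast
    have "derived_set ?G ?S \<subseteq> unitri N (Suc k) \<inter> K"
    proof
      fix c assume "c \<in> derived_set ?G ?S"
      then obtain g h where gh: "g \<in> ?S" "h \<in> ?S" "c = g \<otimes>\<^bsub>?G\<^esub> h \<otimes>\<^bsub>?G\<^esub> inv\<^bsub>?G\<^esub> g \<otimes>\<^bsub>?G\<^esub> inv\<^bsub>?G\<^esub> h" by blast
      have ghU: "g \<in> unitri N k" "g \<in> K" "h \<in> unitri N k" "h \<in> K" using gh(1,2) Suc by auto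
      have "c \<in> K" unfolding gh(3)
        using G.m_closed[OF G.m_closed[OF G.m_closed[of g h] G.inv_closed[of g]] G.inv_closed[of h]] ghU by simp
      moreover have "c \<in> unitri N (Suc k)"
        unfolding gh(3) inv[OF ghU(2)] inv[OF ghU(4)] using unitri_commutator[OF ghU(1,3)] by simp
      ultimately show "c \<in> unitri N (Suc k) \<inter> K" by blast
    qed
    then have "derived ?G ?S \<subseteq> unitri N (Suc k) \<inter> K"
      unfolding derived_def by (rule G.generate_subgroup_incl[OF _ U])
    then show ?case by simp
  qed
  have "unitri N N = {1\<^sub>m N}"
  proof
    show "unitri N N \<subseteq> {1\<^sub>m N}"
    proof
      fix g assume g: "g \<in> unitri N N"
      then have gc: "g \<in> carrier_mat N N" unfolding unitri_def by (auto simp: GL_carrier)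
      have "g = 1\<^sub>m N" by (rule eq_matI) (use unitriD[OF g] gc in auto)
      then show "g \<in> {1\<^sub>m N}" by simp
    qed
    show "{1\<^sub>m N} \<subseteq> unitri N N" using subgroup.one_closed[OF unitri_subgroup, of N N] by simp
  qed
  then have "(derived ?G ^^ N) K \<subseteq> {1\<^sub>m N}" using sub[of N] by blast
  moreover have "1\<^sub>m N \<in> (derived ?G ^^ N) K"
    using subgroup.one_closed[OF G.exp_of_derived_is_subgroup[OF G.subgroup_self, of N]] by simp
  ultimately have "(derived ?G ^^ N) (carrier ?G) = {\<one>\<^bsub>?G\<^esub>}" by auto
  then show ?thesis using G.solvable_iff_trivial_derived_seq by blast
qed

text \<open>The embedding of \<open>GL\<^sub>2\<close> into \<open>GL\<^sub>N\<close> along the coordinates \<open>i\<close> and \<open>j\<close>.\<close>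

definition embed2 :: "nat \<Rightarrow> nat \<Rightarrow> nat \<Rightarrow> complex \<Rightarrow> complex \<Rightarrow> complex \<Rightarrow> complex \<Rightarrow> complex mat" where
  "embed2 N i j a b c d = mat N N (\<lambda>(p, q).
     if p = i then if q = i then a else if q = j then b else 0
     else if p = j then if q = i then c else if q = j then d else 0
     else if p = q then 1 else 0)"

lemma embed2_mult:
  assumes "i < N" "j < N" "i \<noteq> j"
  shows "embed2 N i j a b c d * embed2 N i j a' b' c' d'
    = embed2 N i j (a * a' + b * c') (a * b' + b * d') (c * a' + d * c') (c * b' + d * d')"
    (is "?A * ?B = ?C")
proof (rule eq_matI)
  fix p q assume "p < dim_row ?C" "q < dim_col ?C"
  then have pq: "p < N" "q < N" by (auto simp: embed2_def)
  have "(?A * ?B) $$ (p, q) = (\<Sum>l<N. ?A $$ (p, l) * ?B $$ (l, q))"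
    by (rule mat_mult_entry) (use pq in \<open>auto simp: embed2_def\<close>)
  also have "\<dots> = (\<Sum>l\<in>{i, j, p}. ?A $$ (p, l) * ?B $$ (l, q))"
    by (rule sum.mono_neutral_right) (use pq assms in \<open>auto simp: embed2_def\<close>)
  also have "{i, j, p} = (if p = i \<or> p = j then {i, j} else {i, j, p})" by auto
  also have "(\<Sum>l\<in>\<dots>. ?A $$ (p, l) * ?B $$ (l, q)) = ?C $$ (p, q)"
    using pq assms by (cases "p = i"; cases "p = j") (auto simp: embed2_def)
  finally show "(?A * ?B) $$ (p, q) = ?C $$ (p, q)" .
qed (auto simp: embed2_def)

lemma embed2_one: "i \<noteq> j \<Longrightarrow> embed2 N i j 1 0 0 1 = 1\<^sub>m N"
  by (rule eq_matI) (auto simp: embed2_def)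

lemma embed2_carrier [simp]: "embed2 N i j a b c d \<in> carrier_mat N N"
  by (simp add: embed2_def)

text \<open>All terms of the derived series contain the elementary matrices of \<open>SL\<^sub>2\<close>. The diagonal
  matrix \<open>h = diag (2, 1/2)\<close> is a product of elementary matrices, and an elementary matrix with
  parameter \<open>c\<close> is the commutator of \<open>h\<close>, or of its inverse, with the one with parameter
  \<open>c / 3\<close>.\<close>

lemma not_solvable_if_SL2:
  assumes K: "subgroup K (GL N)" and ij: "i < N" "j < N" "i \<noteq> j"
    and x: "\<And>c. embed2 N i j 1 c 0 1 \<in> K" and y: "\<And>c. embed2 N i j 1 0 c 1 \<in> K"
  shows "\<not> solvable (GL_sub N K)"
proof
  let ?G = "GL_sub N K"
  let ?e = "embed2 N i j"
  interpret GL: group "GL N" by (rule GL_group)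
  interpret G: group ?G by (rule GL.subgroup_imp_group[OF K(1)])
  note em = embed2_mult[OF ij]
  have KGL: "g \<in> carrier (GL N)" if "g \<in> K" for g using that subgroup.subset[OF K] by blast
  have inv_eq: "inv\<^bsub>?G\<^esub> (?e a b c d) = ?e a' b' c' d'"
    if "?e a b c d \<in> K" "?e a b c d * ?e a' b' c' d' = 1\<^sub>m N" for a b c d a' b' c' d'
    using GL.m_inv_consistent[OF K that(1)] GL_inv_eqI[OF KGL[OF that(1)] _ that(2)] by simp
  have "(\<forall>c. ?e 1 c 0 1 \<in> (derived ?G ^^ k) K) \<and> (\<forall>c. ?e 1 0 c 1 \<in> (derived ?G ^^ k) K)" for k
  proof (induction k)
    case 0
    then show ?case using x y by simp
  next
    case (Suc k)
    let ?S = "(derived ?G ^^ k) K"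
    have S: "subgroup ?S ?G" using G.exp_of_derived_is_subgroup[OF G.subgroup_self, of k] by simp
    have SK: "g \<in> K" if "g \<in> ?S" for g using subgroup.subset[OF S] that by auto
    have m: "g * h \<in> ?S" if "g \<in> ?S" "h \<in> ?S" for g h using subgroup.m_closed[OF S that] by simp
    \<comment> \<open>the product of the Weyl group element with parameter \<open>2\<close> and the inverse of the one with
      parameter \<open>1\<close>\<close>
    have hS: "?e 2 0 0 (1/2) \<in> ?S"
    proof -
      have "?e 1 2 0 1 * ?e 1 0 (-1/2) 1 * ?e 1 2 0 1 * (?e 1 (-1) 0 1 * ?e 1 0 1 1 * ?e 1 (-1) 0 1) \<in> ?S"
        using Suc m by simp
      then show ?thesis by (simp add: em)
    qed
    have hi: "inv\<^bsub>?G\<^esub> (?e 2 0 0 (1/2)) = ?e (1/2) 0 0 2"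
      by (rule inv_eq[OF SK[OF hS]]) (simp add: em embed2_one[OF ij(3)])
    have hiS: "?e (1/2) 0 0 2 \<in> ?S" using subgroup.m_inv_closed[OF S hS] hi by simp
    have hii: "inv\<^bsub>?G\<^esub> (?e (1/2) 0 0 2) = ?e 2 0 0 (1/2)"
      by (rule inv_eq[OF SK[OF hiS]]) (simp add: em embed2_one[OF ij(3)])
    have com: "g \<otimes>\<^bsub>?G\<^esub> h \<otimes>\<^bsub>?G\<^esub> inv\<^bsub>?G\<^esub> g \<otimes>\<^bsub>?G\<^esub> inv\<^bsub>?G\<^esub> h \<in> derived ?G ?S" if "g \<in> ?S" "h \<in> ?S" for g h
      by (subst derived_def, rule generate.incl, rule UN_I[of g], rule that(1), rule UN_I[of h], rule that(2),
          rule singletonI)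
    \<comment> \<open>conjugation by \<open>diag (2, 1/2)\<close> multiplies the parameter by \<open>4\<close>, so the commutator has
      \<open>(4 - 1) (c / 3) = c\<close>\<close>
    have "?e 1 c 0 1 \<in> derived ?G ?S" for c
    proof -
      have X: "?e 1 (c/3) 0 1 \<in> ?S" using Suc by blast
      have Xi: "inv\<^bsub>?G\<^esub> (?e 1 (c/3) 0 1) = ?e 1 (-c/3) 0 1"
        by (rule inv_eq[OF SK[OF X]]) (simp add: em embed2_one[OF ij(3)])
      show ?thesis using com[OF hS X] unfolding hi Xi by (simp add: em field_simps)
    qed
    moreover have "?e 1 0 c 1 \<in> derived ?G ?S" for c
    proof -
      have Y: "?e 1 0 (c/3) 1 \<in> ?S" using Suc by blast
      have Yi: "inv\<^bsub>?G\<^esub> (?e 1 0 (c/3) 1) = ?e 1 0 (-c/3) 1"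
        by (rule inv_eq[OF SK[OF Y]]) (simp add: em embed2_one[OF ij(3)])
      show ?thesis using com[OF hiS Y] unfolding hii Yi by (simp add: em field_simps)
    qed
    ultimately show ?case by simp
  qed
  then have all: "?e 1 1 0 1 \<in> (derived ?G ^^ k) K" for k by blast
  assume "solvable ?G"
  then obtain k where "(derived ?G ^^ k) (carrier ?G) = {\<one>\<^bsub>?G\<^esub>}"
    using G.solvable_iff_trivial_derived_seq by blast
  then have "?e 1 1 0 1 = 1\<^sub>m N" using all[of k] by simp
  then have "?e 1 1 0 1 $$ (i, j) = (1\<^sub>m N :: complex mat) $$ (i, j)" by simp
  then show False using ij by (simp add: embed2_def)
qed

section \<open>The standard Borel subgroup of a block diagonal group\<close>

definition diag :: "nat \<Rightarrow> (nat \<Rightarrow> complex) \<Rightarrow> complex mat" where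
  "diag N s = mat N N (\<lambda>(p, q). if p = q then s p else 0)"

lemma diag_carrier [simp]: "diag N s \<in> carrier_mat N N" "dim_row (diag N s) = N" "dim_col (diag N s) = N"
  by (simp_all add: diag_def)

lemma diag_mult_left:
  assumes "A \<in> carrier_mat N n" "p < N" "q < n"
  shows "(diag N s * A) $$ (p, q) = s p * A $$ (p, q)"
proof -
  have "(diag N s * A) $$ (p, q) = (\<Sum>l<N. diag N s $$ (p, l) * A $$ (l, q))"
    by (rule mat_mult_entry[OF diag_carrier(1) assms])
  also have "\<dots> = (\<Sum>l<N. if l = p then s p * A $$ (p, q) else 0)"
    by (rule sum.cong) (use assms(2) in \<open>auto simp: diag_def\<close>)
  finally show ?thesis using assms(2) by simp
qed

lemma diag_mult_right:
  assumes "A \<in> carrier_mat n N" "p < n" "q < N"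
  shows "(A * diag N s) $$ (p, q) = A $$ (p, q) * s q"
proof -
  have "(A * diag N s) $$ (p, q) = (\<Sum>l<N. A $$ (p, l) * diag N s $$ (l, q))"
    by (rule mat_mult_entry[OF assms(1) diag_carrier(1) assms(2,3)])
  also have "\<dots> = (\<Sum>l<N. if l = q then A $$ (p, q) * s q else 0)"
    by (rule sum.cong) (use assms(3) in \<open>auto simp: diag_def\<close>)
  finally show ?thesis using assms(3) by simp
qed

lemma diag_pattern:
  assumes "\<And>i. i < N \<Longrightarrow> s i \<noteq> 0" "\<And>i. P i i"
  shows "diag N s \<in> pattern_group N P"
proof -
  have "diag N s * diag N (\<lambda>i. inverse (s i)) = 1\<^sub>m N"
  proof (rule eq_matI)
    fix p q assume "p < dim_row (1\<^sub>m N :: complex mat)" "q < dim_col (1\<^sub>m N :: complex mat)"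
    then have pq: "p < N" "q < N" by auto
    show "(diag N s * diag N (\<lambda>i. inverse (s i))) $$ (p, q) = 1\<^sub>m N $$ (p, q)"
      unfolding diag_mult_left[OF diag_carrier(1) pq] using assms(1) pq by (auto simp: diag_def)
  qed auto
  then have "diag N s \<in> carrier (GL N)" by (intro GL_I_inverse) auto
  then show ?thesis unfolding pattern_group_def using assms(2) by (auto simp: diag_def)
qed

lemma row_transvection_conj_diag:
  assumes K: "subgroup K (GL N)" and R: "row_transvection N i \<rho> \<in> K" and D: "diag N s \<in> K"
    and s: "i < N" "\<And>p. p < N \<Longrightarrow> s p \<noteq> 0" "\<rho> i = 0"
  shows "row_transvection N i (\<lambda>q. \<rho> q * s q / s i) \<in> K"
proof -
  interpret group "GL N" by (rule GL_group)
  interpret K: subgroup K "GL N" by (rule K)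
  let ?R = "row_transvection N i \<rho>" and ?R' = "row_transvection N i (\<lambda>q. \<rho> q * s q / s i)" and ?D = "diag N s"
  have "?R * ?D = ?D * ?R'"
  proof (rule eq_matI)
    fix p q assume "p < dim_row (?D * ?R')" "q < dim_col (?D * ?R')"
    then have pq: "p < N" "q < N" by auto
    show "(?R * ?D) $$ (p, q) = (?D * ?R') $$ (p, q)"
      unfolding diag_mult_left[OF row_transvection_carrier(1) pq] diag_mult_right[OF row_transvection_carrier(1) pq]
      using pq s by (auto simp: row_transvection_def)
  qed auto
  then have "inv\<^bsub>GL N\<^esub> ?D \<otimes>\<^bsub>GL N\<^esub> (?R \<otimes>\<^bsub>GL N\<^esub> ?D) = inv\<^bsub>GL N\<^esub> ?D \<otimes>\<^bsub>GL N\<^esub> (?D \<otimes>\<^bsub>GL N\<^esub> ?R')" by simp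
  also have "\<dots> = ?R'"
    using GL_inv[OF K.mem_carrier[OF D]] by (simp add: assoc_mult_mat[of _ N N _ N _ N, symmetric])
  finally show ?thesis using K.m_closed[OF K.m_inv_closed[OF D] K.m_closed[OF R D]] by simp
qed

abbreviation levi_pattern :: "nat \<Rightarrow> nat \<Rightarrow> nat \<Rightarrow> bool" where
  "levi_pattern d i j \<equiv> ((i < d) = (j < d))"

abbreviation borel_pattern :: "nat \<Rightarrow> nat \<Rightarrow> nat \<Rightarrow> bool" where
  "borel_pattern d i j \<equiv> ((i < d) = (j < d)) \<and> i \<le> j"

text \<open>A subgroup of the block diagonal group that contains its triangular matrices and one
  further matrix \<open>g\<close> contains an elementary matrix below the diagonal. After row operations a
  column \<open>j\<close> of \<open>g\<close> is a multiple of the basis vector \<open>e\<^bsub>i0\<^esub>\<close> with \<open>j < i0\<close>. Then \<open>g\<close> conjugates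
  \<open>1 + E\<^sub>j\<^sub>k\<close> to the identity matrix with a multiple of the row \<open>k\<close> of \<open>g\<inverse>\<close> added to the row
  \<open>i0\<close>; for a suitable \<open>k > j\<close> this row has a nonzero entry to the left of the diagonal, and the
  torus isolates that entry.\<close>

lemma transvection_below_diagonal:
  assumes K: "subgroup K (GL N)" "K \<subseteq> pattern_group N (levi_pattern d)" "pattern_group N (borel_pattern d) \<subseteq> K"
    and g: "g \<in> K" "i < N" "j < i" "g $$ (i, j) \<noteq> 0"
  shows "\<exists>i l c. l < i \<and> i < N \<and> levi_pattern d i l \<and> c \<noteq> 0 \<and> row_transvection N i (\<lambda>q. if q = l then c else 0) \<in> K"
proof -
  interpret group "GL N" by (rule GL_group)
  interpret K: subgroup K "GL N" by (rule K)
  define I where "I = {i. i < N \<and> j < i \<and> g $$ (i, j) \<noteq> 0}"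
  define i0 where "i0 = Max I"
  have I: "finite I" "I \<noteq> {}" unfolding I_def using g by auto
  have i0: "i0 < N" "j < i0" "g $$ (i0, j) \<noteq> 0" using Max_in[OF I] unfolding i0_def I_def by auto
  have above: "g $$ (p, j) = 0" if "p < N" "i0 < p" for p
  proof (rule ccontr)
    assume "g $$ (p, j) \<noteq> 0"
    then have "p \<in> I" using that i0(2) unfolding I_def by simp
    then have "p \<le> i0" unfolding i0_def using Max_ge[OF I(1)] by blast
    then show False using that by simp
  qed
  define \<gamma> where "\<gamma> = g $$ (i0, j)"
  have jN: "j < N" using i0 by simp
  have gc: "g \<in> carrier_mat N N" using K.mem_carrier[OF g(1)] by (rule GL_carrier_mat)
  have gL: "g \<in> pattern_group N (levi_pattern d)" using g(1) K(2) by blast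
  have lev: "levi_pattern d i0 j" using pattern_groupD[OF gL i0(1) jN] i0(3) by blast
  \<comment> \<open>clear column \<open>j\<close> above its last nonzero entry by adding multiples of row \<open>i0\<close> to the rows above\<close>
  define \<beta> where "\<beta> = (\<lambda>p. if p < i0 then - g $$ (p, j) / \<gamma> else 0)"
  define b where "b = transpose_mat (row_transvection N i0 \<beta>)"
  have bc: "b \<in> carrier_mat N N" unfolding b_def by simp
  have bH: "b \<in> pattern_group N (borel_pattern d)"
  proof -
    have "row_transvection N i0 \<beta> \<in> carrier (GL N)"
      by (rule row_transvection_GL(1)[where \<rho> = \<beta>]) (use i0 in \<open>auto simp: \<beta>_def\<close>)
    then have "b \<in> carrier (GL N)" unfolding b_def GL_carrier by (auto simp: det_transpose[of _ N])
    moreover have "b $$ (p, q) = 0" if "p < N" "q < N" "\<not> borel_pattern d p q" for p q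
    proof -
      have "\<beta> p = 0" if "q = i0"
        using pattern_groupD[OF gL \<open>p < N\<close> jN] lev that \<open>\<not> borel_pattern d p q\<close> by (auto simp: \<beta>_def)
      then show ?thesis using that by (auto simp: b_def row_transvection_def)
    qed
    ultimately show ?thesis unfolding pattern_group_def by blast
  qed
  define g' where "g' = b * g"
  have g'K: "g' \<in> K" unfolding g'_def using K.m_closed[of b g] bH K(3) g(1) by auto
  have g'c: "g' \<in> carrier_mat N N" using K.mem_carrier[OF g'K] by (rule GL_carrier_mat)
  have g'col: "g' $$ (p, j) = (if p = i0 then \<gamma> else 0)" if p: "p < N" for p
  proof -
    have "g' = transpose_mat (transpose_mat g * row_transvection N i0 \<beta>)"
      unfolding g'_def b_def using gc by (simp add: transpose_mult[of _ N N _ N])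
    then have "g' $$ (p, j) = (transpose_mat g * row_transvection N i0 \<beta>) $$ (j, p)"
      using p jN gc by simp
    also have "\<dots> = g $$ (p, j) + g $$ (i0, j) * \<beta> p"
      using row_transvection_mult_right[of "transpose_mat g" N N i0 j p \<beta>] gc p jN i0(1) by simp
    finally show ?thesis using above[OF p] i0(3) by (cases "p < i0"; cases "p = i0") (auto simp: \<beta>_def \<gamma>_def)
  qed
  define r where "r = inv\<^bsub>GL N\<^esub> g'"
  note r = GL_inv[OF K.mem_carrier[OF g'K], folded r_def]
  have rK: "r \<in> K" unfolding r_def by (rule K.m_inv_closed[OF g'K])
  have rL: "r \<in> pattern_group N (levi_pattern d)" using rK K(2) by blast
  have rg: "(\<Sum>l<N. r $$ (k, l) * g' $$ (l, q)) = (if k = q then 1 else 0)" if "k < N" "q < N" for k q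
    using mat_mult_entry[OF r(1) g'c that] r(3) that by simp
  have r_i0: "r $$ (k, i0) = 0" if k: "k < N" "k \<noteq> j" for k
  proof -
    have "(\<Sum>l<N. r $$ (k, l) * g' $$ (l, j)) = (\<Sum>l<N. if l = i0 then r $$ (k, i0) * \<gamma> else 0)"
      by (rule sum.cong) (auto simp: g'col)
    then show ?thesis using rg[OF k(1) jN] k i0 by (simp add: \<gamma>_def)
  qed
  \<comment> \<open>otherwise the inverse would map the first \<open>i0 + 1\<close> basis vectors into the span of the first \<open>j + 1\<close>\<close>
  have "\<exists>k l. j < k \<and> k < N \<and> l < i0 \<and> r $$ (k, l) \<noteq> 0"
  proof (rule ccontr)
    assume no: "\<not> ?thesis"
    have z: "r $$ (k, l) = 0" if "j < k" "k < N" "l \<le> i0" for k l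
      using no r_i0[of k] that by (cases "l = i0") auto
    have "\<exists>c. (\<exists>l\<in>{..i0}. c l \<noteq> 0) \<and> (\<forall>k\<in>{..j}. (\<Sum>l\<in>{..i0}. r $$ (k, l) * c l) = 0)"
      by (rule underdetermined_system) (use i0 in auto)
    then obtain c l0 where c: "l0 \<le> i0" "c l0 \<noteq> 0" "\<And>k. k \<le> j \<Longrightarrow> (\<Sum>l\<le>i0. r $$ (k, l) * c l) = 0" by auto
    define x where "x = (\<lambda>l. if l \<le> i0 then c l else 0)"
    have "(\<Sum>l<N. (case (k, l) of (k, l) \<Rightarrow> r $$ (k, l)) * x l) = 0" if "k < N" for k
    proof -
      have "(\<Sum>l<N. r $$ (k, l) * x l) = (\<Sum>l\<le>i0. r $$ (k, l) * c l)"
        by (rule sum.mono_neutral_cong_right) (use i0 in \<open>auto simp: x_def\<close>)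
      also have "\<dots> = 0"
      proof (cases "k \<le> j")
        case False
        then show ?thesis using z that by (intro sum.neutral) auto
      qed (rule c(3))
      finally show ?thesis by simp
    qed
    moreover have "det (mat N N (\<lambda>(k, l). r $$ (k, l))) \<noteq> 0"
    proof -
      have "mat N N (\<lambda>(k, l). r $$ (k, l)) = r" using r(1) by auto
      then show ?thesis using K.mem_carrier[OF rK] by (simp add: GL_carrier)
    qed
    ultimately have "x l0 = 0" unfolding det_nonzero_iff_kernel using c(1) i0(1) by auto
    then show False using c(1,2) by (simp add: x_def)
  qed
  then obtain k l where kl: "j < k" "k < N" "l < i0" "r $$ (k, l) \<noteq> 0" by blast
  have lN: "l < N" using kl i0 by simp
  have lev_kl: "levi_pattern d k l" using pattern_groupD[OF rL kl(2) lN] kl(4) by blast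
  have lev_jk: "levi_pattern d j k" using lev lev_kl kl i0 by linarith
  have lev_i0l: "levi_pattern d i0 l" using lev lev_kl lev_jk by blast
  define \<rho> where "\<rho> = (\<lambda>q. \<gamma> * r $$ (k, q))"
  have \<rho>: "\<rho> i0 = 0" "\<rho> l \<noteq> 0" using r_i0[of k] kl i0(3) by (auto simp: \<rho>_def \<gamma>_def)
  define e where "e = row_transvection N j (\<lambda>q. if q = k then 1 else 0)"
  \<comment> \<open>\<open>j < k\<close>, so \<open>e = 1 + E\<^sub>j\<^sub>k\<close> is upper triangular\<close>
  have eK: "e \<in> K"
  proof -
    have "e \<in> pattern_group N (borel_pattern d)" unfolding e_def
      by (rule row_transvection_pattern) (use jN kl lev_jk in auto)
    then show ?thesis using K(3) by blast
  qed
  let ?R = "row_transvection N i0 \<rho>"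
  have "?R * g' = g' * e"
  proof (rule eq_matI)
    fix p q assume "p < dim_row (g' * e)" "q < dim_col (g' * e)"
    then have pq: "p < N" "q < N" using g'c by (auto simp: e_def)
    have "(\<Sum>l<N. \<rho> l * g' $$ (l, q)) = \<gamma> * (if k = q then 1 else 0)"
      unfolding \<rho>_def using rg[OF kl(2) pq(2)] by (simp add: mult.assoc sum_distrib_left[symmetric])
    then show "(?R * g') $$ (p, q) = (g' * e) $$ (p, q)"
      unfolding e_def row_transvection_mult_left[OF g'c i0(1) pq] row_transvection_mult_right[OF g'c jN pq]
      using g'col[OF pq(1)] by auto
  qed (use g'c in \<open>auto simp: e_def\<close>)
  then have "?R * (g' * r) = g' * e * r"
    using g'c r(1) by (simp add: assoc_mult_mat[of ?R N N g' N r N, symmetric])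
  then have "?R = g' * e * r" using r(2) by simp
  then have RK: "?R \<in> K" using K.m_closed[OF K.m_closed[OF g'K eK] rK] by simp
  \<comment> \<open>conjugation by this diagonal matrix doubles the coefficient at \<open>l\<close> only; the quotient of
    the two transvections keeps just this coefficient\<close>
  define s where "s = (\<lambda>q. if q = l then 2 else (1 :: complex))"
  have DK: "diag N s \<in> K" using diag_pattern[of N s "borel_pattern d"] K(3) by (auto simp: s_def)
  have "row_transvection N i0 (\<lambda>q. \<rho> q * s q / s i0) \<in> K"
    by (rule row_transvection_conj_diag[OF K(1) RK DK i0(1) _ \<rho>(1)]) (simp add: s_def)
  then have R2: "row_transvection N i0 (\<lambda>q. \<rho> q * s q) \<in> K" using kl(3) by (simp add: s_def)
  have Ri: "row_transvection N i0 (\<lambda>q. - \<rho> q) \<in> K"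
    using K.m_inv_closed[OF RK] row_transvection_GL(2)[of i0 N \<rho>] i0(1) \<rho>(1) by simp
  have "row_transvection N i0 (\<lambda>q. - \<rho> q) * row_transvection N i0 (\<lambda>q. \<rho> q * s q)
      = row_transvection N i0 (\<lambda>q. - \<rho> q + \<rho> q * s q)"
    by (rule row_transvection_add[of i0 N "\<lambda>q. - \<rho> q"]) (use i0(1) \<rho>(1) in auto)
  also have "(\<lambda>q. - \<rho> q + \<rho> q * s q) = (\<lambda>q. if q = l then \<rho> l else 0)" by (auto simp: s_def)
  finally have "row_transvection N i0 (\<lambda>q. if q = l then \<rho> l else 0) \<in> K" using K.m_closed[OF Ri R2] by simp
  then show ?thesis using kl(3) i0(1) lev_i0l \<rho>(2) by blast
qed

text \<open>For maximality: a connected solvable group containing the triangular matrices properly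
  would contain an elementary matrix below the diagonal, by conjugation with the torus all its
  multiples, and with the opposite ones a copy of \<open>SL\<^sub>2\<close>.\<close>

theorem borel_of_levi:
  "borel_subgroup N (pattern_group N (levi_pattern d)) (pattern_group N (borel_pattern d))"
  unfolding borel_subgroup_def
proof (intro conjI allI impI)
  let ?L = "pattern_group N (levi_pattern d)" and ?H = "pattern_group N (borel_pattern d)"
  have HL: "?H \<subseteq> ?L" unfolding pattern_group_def by auto
  have Hsub: "subgroup ?H (GL N)" by (rule pattern_group_subgroup) auto
  show "connected_solvable_subgroup N ?L ?H"
    unfolding connected_solvable_subgroup_def
  proof (intro conjI HL)
    show "connected_algebraic_subgroup N ?H" by (rule pattern_group_connected_algebraic) auto
    show "solvable (GL_sub N ?H)" by (rule triangular_solvable[OF Hsub]) (auto simp: pattern_group_def)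
  qed
  fix K assume K: "connected_solvable_subgroup N ?L K \<and> ?H \<subseteq> K"
  have Ks: "subgroup K (GL N)" "K \<subseteq> ?L" "?H \<subseteq> K" "solvable (GL_sub N K)"
    using K unfolding connected_solvable_subgroup_def connected_algebraic_subgroup_def by auto
  show "K = ?H"
  proof (rule ccontr)
    assume "K \<noteq> ?H"
    then obtain g where g: "g \<in> K" "g \<notin> ?H" using Ks(3) by blast
    have gL: "g \<in> ?L" using g(1) Ks(2) by blast
    then obtain i j where ij: "i < N" "j < N" "\<not> borel_pattern d i j" "g $$ (i, j) \<noteq> 0"
      using g(2) pattern_group_GL[OF gL] unfolding pattern_group_def by blast
    have "levi_pattern d i j" using pattern_groupD[OF gL ij(1,2)] ij(4) by blast
    then have "j < i" using ij(3) by simp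
    from transvection_below_diagonal[OF Ks(1-3) g(1) ij(1) this ij(4)]
    obtain i l c0 where il: "l < i" "i < N" "levi_pattern d i l" "c0 \<noteq> 0"
        "row_transvection N i (\<lambda>q. if q = l then c0 else 0) \<in> K" by blast
    have lN: "l < N" "i \<noteq> l" using il by auto
    have "embed2 N i l 1 c 0 1 \<in> K" for c
    proof (cases "c = 0")
      case True
      then show ?thesis using embed2_one[of i l N] lN subgroup.one_closed[OF Ks(1)] by simp
    next
      case False
      \<comment> \<open>the torus rescales the given parameter \<open>c0\<close> to \<open>c\<close>\<close>
      define s where "s = (\<lambda>q. if q = l then c / c0 else 1)"
      have s: "s p \<noteq> 0" for p using False il(4) by (simp add: s_def)
      have "diag N s \<in> K" using diag_pattern[of N s "borel_pattern d"] s Ks(3) by blast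
      from row_transvection_conj_diag[OF Ks(1) il(5) this il(2) s] lN
      have "row_transvection N i (\<lambda>q. (if q = l then c0 else 0) * s q / s i) \<in> K" by simp
      also have "row_transvection N i (\<lambda>q. (if q = l then c0 else 0) * s q / s i) = embed2 N i l 1 c 0 1"
        using lN il(4) by (intro eq_matI) (auto simp: row_transvection_def embed2_def s_def)
      finally show ?thesis .
    qed
    moreover have "embed2 N i l 1 0 c 1 \<in> K" for c
    proof -
      have "embed2 N i l 1 0 c 1 = row_transvection N l (\<lambda>q. if q = i then c else 0)"
        using lN il(1) by (intro eq_matI) (auto simp: row_transvection_def embed2_def)
      also have "\<dots> \<in> ?H" by (rule row_transvection_pattern) (use lN il in auto)
      finally show ?thesis using Ks(3) by blast
    qed
    ultimately show False using not_solvable_if_SL2[OF Ks(1) il(2) lN] Ks(4) by blast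
  qed
qed

section \<open>Points of the Grassmannian as column spaces\<close>

lemma col_space_image:
  fixes M :: "complex mat"
  assumes "M \<in> carrier_mat N d"
  shows "vec_space.col_space N M = (\<lambda>x. M *\<^sub>v x) ` carrier_vec d"
proof -
  interpret vec_space "TYPE(complex)" N .
  show ?thesis unfolding col_space_eq[OF assms] using assms by auto
qed

lemma mult_mat_vec_entry:
  "M \<in> carrier_mat N d \<Longrightarrow> i < N \<Longrightarrow> (M *\<^sub>v vec d v) $ i = (\<Sum>j<d. M $$ (i, j) * v j)"
  by (auto simp: scalar_prod_def atLeast0LessThan)

lemma square_det_kernel:
  assumes "P \<in> carrier_mat d d"
  shows "det P \<noteq> 0 \<longleftrightarrow> nonsing P {..<d} {..<d}"
proof -
  have "P = mat d d (\<lambda>(p, q). P $$ (p, q))" using assms by auto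
  then have "det P = det (mat d d (\<lambda>(p, q). P $$ (p, q)))" by simp
  then show ?thesis unfolding nonsing_def using det_nonzero_iff_kernel[of d "\<lambda>(p, q). P $$ (p, q)"] by auto
qed

lemma not_nonsing_imp_factors:
  assumes "\<not> nonsing M {..<N} {..<d}"
  shows "factors N d (d - 1) M"
proof -
  obtain v j0 where v: "\<And>i. i < N \<Longrightarrow> (\<Sum>l<d. M $$ (i, l) * v l) = 0" "j0 < d" "v j0 \<noteq> 0"
    using assms unfolding nonsing_def by auto
  let ?L = "{..<d} - {j0}"
  have M0: "M $$ (i, j0) = (\<Sum>l\<in>?L. M $$ (i, l) * (- v l / v j0))" if "i < N" for i
  proof -
    have "M $$ (i, j0) * v j0 + (\<Sum>l\<in>?L. M $$ (i, l) * v l) = 0"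
      using v(1)[OF that] sum.remove[of "{..<d}" j0 "\<lambda>l. M $$ (i, l) * v l"] v(2) by simp
    then have "M $$ (i, j0) = - (\<Sum>l\<in>?L. M $$ (i, l) * v l) / v j0"
      using v(3) by (simp add: field_simps eq_neg_iff_add_eq_0)
    then show ?thesis by (simp add: sum_divide_distrib sum_negf[symmetric])
  qed
  show ?thesis
  proof (rule factors_through_columns[where L = ?L and c = "\<lambda>i l. M $$ (i, l)"
        and y = "\<lambda>l j. if j = j0 then - v l / v j0 else if l = j then 1 else 0"])
    fix i j assume ij: "i < N" "j < d"
    show "M $$ (i, j) = (\<Sum>l\<in>?L. M $$ (i, l) * (if j = j0 then - v l / v j0 else if l = j then 1 else 0))"
    proof (cases "j = j0")
      case False
      then have "(\<Sum>l\<in>?L. M $$ (i, l) * (if l = j then 1 else 0)) = (\<Sum>l\<in>?L. if l = j then M $$ (i, j) else 0)"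
        by (intro sum.cong) auto
      then show ?thesis using False ij by simp
    qed (use M0[OF ij(1)] in simp)
  qed (use v(2) in auto)
qed

lemma nonsing_imp_not_factors:
  assumes "nonsing M {..<N} {..<d}" "s < d" shows "\<not> factors N d s M"
proof
  assume "factors N d s M"
  then obtain x y where xy: "\<And>i j. i < N \<Longrightarrow> j < d \<Longrightarrow> M $$ (i, j) = (\<Sum>p<s. x i p * y p j)"
    unfolding factors_def by blast
  have "\<exists>v. (\<exists>j\<in>{..<d}. v j \<noteq> 0) \<and> (\<forall>p\<in>{..<s}. (\<Sum>j\<in>{..<d}. y p j * v j) = 0)"
    by (rule underdetermined_system) (use assms(2) in auto)
  then obtain v where v: "\<exists>j<d. v j \<noteq> 0" "\<And>p. p < s \<Longrightarrow> (\<Sum>j<d. y p j * v j) = 0" by auto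
  have "(\<Sum>j<d. M $$ (i, j) * v j) = 0" if "i < N" for i
  proof -
    have "(\<Sum>j<d. M $$ (i, j) * v j) = (\<Sum>j<d. \<Sum>p<s. x i p * (y p j * v j))"
      using xy[OF that] by (intro sum.cong) (auto simp: sum_distrib_right mult.assoc)
    also have "\<dots> = (\<Sum>p<s. x i p * (\<Sum>j<d. y p j * v j))" by (subst sum.swap) (simp add: sum_distrib_left)
    finally show ?thesis using v(2) by simp
  qed
  then show False using assms(1) v(1) unfolding nonsing_def by auto
qed

lemma rank_full_iff_nonsing:
  assumes "M \<in> carrier_mat N d"
  shows "vec_space.rank N M = d \<longleftrightarrow> nonsing M {..<N} {..<d}"
proof
  assume r: "vec_space.rank N M = d"
  show "nonsing M {..<N} {..<d}"
  proof (rule ccontr)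
    assume n: "\<not> nonsing M {..<N} {..<d}"
    then have "d > 0" unfolding nonsing_def by auto
    moreover have "vec_space.rank N M \<le> d - 1"
      using rank_le_iff_factors[OF assms] not_nonsing_imp_factors[OF n] by blast
    ultimately show False using r by simp
  qed
next
  assume n: "nonsing M {..<N} {..<d}"
  have "vec_space.rank N M \<le> d" by (rule vec_space.rank_le_nc[OF assms])
  moreover have "\<not> vec_space.rank N M < d"
    using nonsing_imp_not_factors[OF n] rank_le_iff_factors[OF assms] by blast
  ultimately show "vec_space.rank N M = d" by simp
qed

lemma col_space_grassmannian:
  assumes M: "M \<in> carrier_mat N d"
  shows "vec_space.col_space N M \<in> grassmannian d N \<longleftrightarrow> nonsing M {..<N} {..<d}"
proof -
  interpret vec_space "TYPE(complex)" N .
  have "set (cols M) \<subseteq> carrier_vec N" using M cols_dim by blast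
  then have "subspace class_ring (col_space M) V" unfolding col_space_def by (intro span_is_subspace) simp
  then show ?thesis
    unfolding grassmannian_def using rank_full_iff_nonsing[OF M] by (simp add: rank_def col_space_def)
qed

text \<open>The columns are a maximal independent subset of the subspace; it exists because
  independent sets have at most \<open>N\<close> elements.\<close>

lemma grassmannian_col_space:
  assumes "W \<in> grassmannian d N"
  obtains M where "M \<in> carrier_mat N d" "nonsing M {..<N} {..<d}" "W = vec_space.col_space N M"
proof -
  interpret vec_space "TYPE(complex)" N .
  have W: "subspace class_ring W V" and dimW: "vectorspace.dim class_ring (vs W) = d"
    using assms unfolding grassmannian_def by auto
  have WV: "W \<subseteq> carrier_vec N" using W unfolding subspace_def submodule_def by auto
  let ?P = "\<lambda>S. S \<subseteq> W \<and> lin_indpt S"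
  have "\<exists>A. finite A \<and> maximal A ?P"
  proof (rule maximal_exists[where N = N and B = "{}"])
    show "finite A \<and> card A \<le> N" if "?P A" for A
      using li_le_dim[OF fin_dim, of A] that WV dim_is_n by auto
    show "{} \<subseteq> W \<and> lin_indpt {}" by (metis empty_iff finite_lin_indpt2 empty_subsetI finite.emptyI)
  qed
  then obtain S where S: "finite S" "maximal S ?P" by blast
  have SW: "S \<subseteq> W" "lin_indpt S" using S(2) unfolding maximal_def by auto
  then have SV: "S \<subseteq> carrier_vec N" using WV by blast
  have "span S = W"
  proof
    show "span S \<subseteq> W" using SW(1) W by (intro span_is_subset) (auto simp: subspace_def)
    show "W \<subseteq> span S"
    proof
      fix w assume w: "w \<in> W"
      show "w \<in> span S"
      proof (cases "w \<in> S")
        case True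
        then show ?thesis using SV span_mem by auto
      next
        case False
        have "lin_dep (S \<union> {w})"
        proof (rule ccontr)
          assume "\<not> lin_dep (S \<union> {w})"
          then have "?P (S \<union> {w})" using SW(1) w by blast
          moreover have "S \<subseteq> S \<union> {w}" by blast
          ultimately have "S = S \<union> {w}" using S(2) unfolding maximal_def by metis
          then show False using False by blast
        qed
        then show ?thesis using lin_dep_iff_in_span[of S w] SV SW(2) False w WV by auto
      qed
    qed
  qed
  obtain ws where ws: "set ws = S" "distinct ws" using finite_distinct_list[OF S(1)] by blast
  define M where "M = mat_of_cols N ws"
  have Mc: "M \<in> carrier_mat N (length ws)" unfolding M_def by simp
  have cols: "cols M = ws" unfolding M_def using ws SV by (intro cols_mat_of_cols) auto
  have "rank M = length ws" by (rule lin_indpt_full_rank[OF Mc]) (use cols ws SW in auto)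
  moreover have "rank M = d" unfolding rank_def cols ws(1) \<open>span S = W\<close> using dimW by simp
  ultimately have len: "length ws = d" by simp
  have "W = col_space M" unfolding col_space_def cols ws(1) \<open>span S = W\<close> ..
  moreover have "nonsing M {..<N} {..<d}" using rank_full_iff_nonsing[of M N d] Mc len \<open>rank M = d\<close> by simp
  ultimately show thesis using that[of M] Mc len by simp
qed

lemma col_space_mult_invertible:
  fixes M P :: "complex mat"
  assumes M: "M \<in> carrier_mat N d" and P: "P \<in> carrier_mat d d" "det P \<noteq> 0"
  shows "vec_space.col_space N (M * P) = vec_space.col_space N M"
proof -
  have MP: "M * P \<in> carrier_mat N d" using M P by simp
  have PGL: "P \<in> carrier (GL d)" using P by (simp add: GL_carrier)
  note Q = GL_inv[OF PGL]
  show ?thesis unfolding col_space_image[OF MP] col_space_image[OF M]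
  proof
    show "(*\<^sub>v) (M * P) ` carrier_vec d \<subseteq> (*\<^sub>v) M ` carrier_vec d"
    proof
      fix y assume "y \<in> (*\<^sub>v) (M * P) ` carrier_vec d"
      then obtain x where "x \<in> carrier_vec d" "y = (M * P) *\<^sub>v x" by blast
      then show "y \<in> (*\<^sub>v) M ` carrier_vec d" using M P by (intro image_eqI[of _ _ "P *\<^sub>v x"]) auto
    qed
    show "(*\<^sub>v) M ` carrier_vec d \<subseteq> (*\<^sub>v) (M * P) ` carrier_vec d"
    proof
      fix y assume "y \<in> (*\<^sub>v) M ` carrier_vec d"
      then obtain x where x: "x \<in> carrier_vec d" "y = M *\<^sub>v x" by blast
      let ?Q = "inv\<^bsub>GL d\<^esub> P"
      have "(M * P) *\<^sub>v (?Q *\<^sub>v x) = M *\<^sub>v (P *\<^sub>v (?Q *\<^sub>v x))" using M P x Q(1) by simp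
      also have "P *\<^sub>v (?Q *\<^sub>v x) = (P * ?Q) *\<^sub>v x" using P x Q(1) by simp
      also have "\<dots> = x" using Q(2) x by simp
      finally show "y \<in> (*\<^sub>v) (M * P) ` carrier_vec d" using x Q(1)
        by (intro image_eqI[of _ _ "?Q *\<^sub>v x"]) auto
    qed
  qed
qed

lemma col_space_eqD:
  fixes M M' :: "complex mat"
  assumes M: "M \<in> carrier_mat N d" and M': "M' \<in> carrier_mat N d" "nonsing M' {..<N} {..<d}"
    and eq: "vec_space.col_space N M' = vec_space.col_space N M"
  obtains P where "P \<in> carrier_mat d d" "det P \<noteq> 0" "M' = M * P"
proof -
  have "\<exists>x. x \<in> carrier_vec d \<and> M *\<^sub>v x = col M' j" if j: "j < d" for j
  proof -
    have "M' *\<^sub>v unit_vec d j = col M' j"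
    proof (rule eq_vecI)
      fix i assume "i < dim_vec (col M' j)"
      then have i: "i < N" using M'(1) by simp
      have "(M' *\<^sub>v unit_vec d j) $ i = (\<Sum>k<d. M' $$ (i, k) * (if k = j then 1 else 0))"
        unfolding unit_vec_def by (rule mult_mat_vec_entry[OF M'(1) i])
      also have "\<dots> = (\<Sum>k<d. if k = j then M' $$ (i, k) else 0)" by (rule sum.cong) auto
      finally show "(M' *\<^sub>v unit_vec d j) $ i = col M' j $ i" using M'(1) i j by simp
    qed (use M'(1) in auto)
    then have "col M' j \<in> vec_space.col_space N M'" unfolding col_space_image[OF M'(1)]
      by (intro image_eqI[of _ _ "unit_vec d j"]) auto
    then show ?thesis unfolding eq col_space_image[OF M] by force
  qed
  then obtain x where x: "\<And>j. j < d \<Longrightarrow> x j \<in> carrier_vec d \<and> M *\<^sub>v x j = col M' j" by metis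
  define P where "P = mat d d (\<lambda>(k, j). x j $ k)"
  have P: "P \<in> carrier_mat d d" unfolding P_def by simp
  have MP: "M' = M * P"
  proof (rule eq_matI)
    fix i j assume "i < dim_row (M * P)" "j < dim_col (M * P)"
    then have ij: "i < N" "j < d" using M P by auto
    have "M' $$ (i, j) = (M *\<^sub>v x j) $ i" using x[OF ij(2)] ij M' by simp
    also have "x j = vec d (\<lambda>k. x j $ k)" using x[OF ij(2)] by auto
    also have "(M *\<^sub>v \<dots>) $ i = (\<Sum>k<d. M $$ (i, k) * x j $ k)" by (rule mult_mat_vec_entry[OF M ij(1)])
    also have "\<dots> = (M * P) $$ (i, j)" unfolding mat_mult_entry[OF M P ij] using ij(2)
      by (intro sum.cong) (auto simp: P_def)
    finally show "M' $$ (i, j) = (M * P) $$ (i, j)" .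
  qed (use M M' P in auto)
  have "det P \<noteq> 0" unfolding square_det_kernel[OF P] nonsing_def
  proof (intro allI impI)
    fix v assume v: "\<forall>i\<in>{..<d}. (\<Sum>l\<in>{..<d}. P $$ (i, l) * v l) = 0"
    have "(\<Sum>j<d. M' $$ (i, j) * v j) = 0" if i: "i < N" for i
    proof -
      have "(\<Sum>j<d. M' $$ (i, j) * v j) = (\<Sum>j<d. \<Sum>k<d. M $$ (i, k) * (P $$ (k, j) * v j))"
        unfolding MP using mat_mult_entry[OF M P i] by (intro sum.cong) (auto simp: sum_distrib_right mult.assoc)
      also have "\<dots> = (\<Sum>k<d. M $$ (i, k) * (\<Sum>j<d. P $$ (k, j) * v j))"
        by (subst sum.swap) (simp add: sum_distrib_left)
      finally show ?thesis using v by simp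
    qed
    then show "\<forall>l\<in>{..<d}. v l = 0" using M'(2) unfolding nonsing_def by auto
  qed
  then show thesis using that P MP by blast
qed

lemma GL_mult_nonsing:
  assumes g: "g \<in> carrier (GL N)" and M: "M \<in> carrier_mat N d" "nonsing M {..<N} {..<d}"
  shows "nonsing (g * M) {..<N} {..<d}"
  unfolding nonsing_def
proof (intro allI impI)
  have gc: "g \<in> carrier_mat N N" by (rule GL_carrier_mat[OF g])
  fix v assume v: "\<forall>i\<in>{..<N}. (\<Sum>l\<in>{..<d}. (g * M) $$ (i, l) * v l) = 0"
  have gw: "(\<Sum>k<N. g $$ (i, k) * (\<Sum>l<d. M $$ (k, l) * v l)) = 0" if i: "i < N" for i
  proof -
    have "(\<Sum>l<d. (g * M) $$ (i, l) * v l) = (\<Sum>l<d. \<Sum>k<N. g $$ (i, k) * (M $$ (k, l) * v l))"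
      using mat_mult_entry[OF gc M(1) i] by (intro sum.cong) (auto simp: sum_distrib_right mult.assoc)
    also have "\<dots> = (\<Sum>k<N. g $$ (i, k) * (\<Sum>l<d. M $$ (k, l) * v l))"
      by (subst sum.swap) (simp add: sum_distrib_left)
    finally show ?thesis using v i by simp
  qed
  have ng: "nonsing g {..<N} {..<N}" using g square_det_kernel[OF gc] by (simp add: GL_carrier)
  have "(\<Sum>l<d. M $$ (k, l) * v l) = 0" if "k < N" for k
    by (rule nonsingD[OF ng, where v = "\<lambda>k. \<Sum>l<d. M $$ (k, l) * v l"]) (use gw that in auto)
  then show "\<forall>l\<in>{..<d}. v l = 0" using M(2) unfolding nonsing_def by auto
qed

lemma gr_action_col_space:
  assumes g: "g \<in> carrier (GL N)" and M: "M \<in> carrier_mat N d" "nonsing M {..<N} {..<d}"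
  shows "gr_action d N g (vec_space.col_space N M) = vec_space.col_space N (g * M)"
proof -
  have gc: "g \<in> carrier_mat N N" by (rule GL_carrier_mat[OF g])
  have gM: "g * M \<in> carrier_mat N d" using gc M by simp
  have "gr_action d N g (vec_space.col_space N M) = (\<lambda>v. g *\<^sub>v v) ` vec_space.col_space N M"
    unfolding gr_action_def using col_space_grassmannian[OF M(1)] M(2) by simp
  also have "\<dots> = vec_space.col_space N (g * M)"
    unfolding col_space_image[OF M(1)] col_space_image[OF gM] image_image
    using gc M(1) by (intro image_cong) auto
  finally show ?thesis .
qed

lemma gr_action_mult:
  assumes "g \<in> carrier (GL N)" "h \<in> carrier (GL N)" "W \<in> grassmannian d N"
  shows "gr_action d N (g * h) W = gr_action d N g (gr_action d N h W)"
proof -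
  obtain M where M: "M \<in> carrier_mat N d" "nonsing M {..<N} {..<d}" "W = vec_space.col_space N M"
    using grassmannian_col_space[OF assms(3)] .
  note gc = GL_carrier_mat[OF assms(1)] and hc = GL_carrier_mat[OF assms(2)]
  have gh: "g * h \<in> carrier (GL N)" using group.is_monoid[OF GL_group] monoid.m_closed assms(1,2) by force
  have hM: "h * M \<in> carrier_mat N d" using hc M(1) by simp
  show ?thesis unfolding M(3) gr_action_col_space[OF gh M(1,2)] gr_action_col_space[OF assms(2) M(1,2)]
      gr_action_col_space[OF assms(1) hM GL_mult_nonsing[OF assms(2) M(1,2)]]
    using gc hc M(1) by simp
qed

lemma gr_action_one: "W \<in> grassmannian d N \<Longrightarrow> gr_action d N (1\<^sub>m N) W = W"
proof -
  assume W: "W \<in> grassmannian d N"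
  then obtain M where M: "M \<in> carrier_mat N d" "nonsing M {..<N} {..<d}" "W = vec_space.col_space N M"
    using grassmannian_col_space by metis
  have "1\<^sub>m N \<in> carrier (GL N)" by (simp add: GL_carrier)
  then show ?thesis using gr_action_col_space[OF _ M(1,2)] M by simp
qed

section \<open>The chart of the opposite big cell\<close>

lemma sum_split_add: "(\<Sum>k<d + m. f k) = (\<Sum>k<d. f k) + (\<Sum>k<m. f (d + k))" for f :: "nat \<Rightarrow> complex"
  by (induction m) (simp_all add: add.assoc)

lemma append_one_entry:
  assumes "A \<in> carrier_mat m d" "i < d + m" "j < d"
  shows "(1\<^sub>m d @\<^sub>r A) $$ (i, j) = (if i < d then if i = j then 1 else 0 else A $$ (i - d, j))"
  using assms unfolding append_rows_def by (subst index_mat_four_block) auto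

lemma append_one_carrier: "A \<in> carrier_mat m d \<Longrightarrow> 1\<^sub>m d @\<^sub>r A \<in> carrier_mat (d + m) d"
  by (rule carrier_append_rows) auto

lemma append_one_nonsing:
  assumes "A \<in> carrier_mat m d"
  shows "nonsing (1\<^sub>m d @\<^sub>r A) {..<d + m} {..<d}"
  unfolding nonsing_def
proof (intro allI impI ballI)
  fix v l assume v: "\<forall>i\<in>{..<d + m}. (\<Sum>l\<in>{..<d}. (1\<^sub>m d @\<^sub>r A) $$ (i, l) * v l) = 0" and l: "l \<in> {..<d}"
  have "(\<Sum>k<d. (1\<^sub>m d @\<^sub>r A) $$ (l, k) * v k) = (\<Sum>k<d. if k = l then v k else 0)"
    using l by (intro sum.cong refl) (auto simp: append_one_entry[OF assms])
  then show "v l = 0" using v l by auto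
qed

lemma cell_chart_grassmannian: "A \<in> carrier_mat m d \<Longrightarrow> cell_chart d (d + m) A \<in> grassmannian d (d + m)"
  unfolding cell_chart_def using col_space_grassmannian[OF append_one_carrier] append_one_nonsing by blast

definition lower_rows :: "nat \<Rightarrow> nat \<Rightarrow> complex mat \<Rightarrow> complex mat" where
  "lower_rows d m M = mat m d (\<lambda>(i, j). M $$ (d + i, j))"

lemma lower_rows_carrier [simp]: "lower_rows d m M \<in> carrier_mat m d"
  by (simp add: lower_rows_def)

lemma lower_rows_append_one: "A \<in> carrier_mat m d \<Longrightarrow> lower_rows d m (1\<^sub>m d @\<^sub>r A) = A"
  by (rule eq_matI) (auto simp: lower_rows_def append_one_entry)

lemma lower_rows_mult:
  assumes "M \<in> carrier_mat (d + m) d" "P \<in> carrier_mat d d"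
  shows "lower_rows d m (M * P) = lower_rows d m M * P"
proof (rule eq_matI)
  fix i j assume "i < dim_row (lower_rows d m M * P)" "j < dim_col (lower_rows d m M * P)"
  then have ij: "i < m" "j < d" using assms by (auto simp: lower_rows_def)
  show "lower_rows d m (M * P) $$ (i, j) = (lower_rows d m M * P) $$ (i, j)"
    unfolding mat_mult_entry[OF lower_rows_carrier assms(2) ij]
    using mat_mult_entry[OF assms, of "d + i" j] ij by (simp add: lower_rows_def)
qed (use assms in \<open>auto simp: lower_rows_def\<close>)

lemma factors_mult_right:
  assumes "A \<in> carrier_mat m n" "B \<in> carrier_mat n k" "factors m n t A"
  shows "factors m k t (A * B)"
proof -
  obtain x y where xy: "\<And>i j. i < m \<Longrightarrow> j < n \<Longrightarrow> A $$ (i, j) = (\<Sum>p<t. x i p * y p j)"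
    using assms(3) unfolding factors_def by blast
  show ?thesis
  proof (rule factorsI[where x = x and y = "\<lambda>p j. \<Sum>l<n. y p l * B $$ (l, j)"])
    fix i j assume ij: "i < m" "j < k"
    have "(A * B) $$ (i, j) = (\<Sum>l<n. \<Sum>p<t. x i p * (y p l * B $$ (l, j)))"
      unfolding mat_mult_entry[OF assms(1,2) ij] using xy ij
      by (intro sum.cong) (auto simp: sum_distrib_right mult.assoc)
    also have "\<dots> = (\<Sum>p<t. x i p * (\<Sum>l<n. y p l * B $$ (l, j)))"
      by (subst sum.swap) (simp add: sum_distrib_left)
    finally show "(A * B) $$ (i, j) = (\<Sum>p<t. x i p * (\<Sum>l<n. y p l * B $$ (l, j)))" .
  qed
qed

lemma factors_mult_left:
  assumes "B \<in> carrier_mat k m" "A \<in> carrier_mat m n" "factors m n t A"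
  shows "factors k n t (B * A)"
proof -
  obtain x y where xy: "\<And>i j. i < m \<Longrightarrow> j < n \<Longrightarrow> A $$ (i, j) = (\<Sum>p<t. x i p * y p j)"
    using assms(3) unfolding factors_def by blast
  show ?thesis
  proof (rule factorsI[where x = "\<lambda>i p. \<Sum>l<m. B $$ (i, l) * x l p" and y = y])
    fix i j assume ij: "i < k" "j < n"
    have "(B * A) $$ (i, j) = (\<Sum>l<m. \<Sum>p<t. B $$ (i, l) * x l p * y p j)"
      unfolding mat_mult_entry[OF assms(1,2) ij] using xy ij
      by (intro sum.cong) (auto simp: sum_distrib_left mult.assoc)
    also have "\<dots> = (\<Sum>p<t. (\<Sum>l<m. B $$ (i, l) * x l p) * y p j)"
      by (subst sum.swap) (simp add: sum_distrib_right)
    finally show "(B * A) $$ (i, j) = (\<Sum>p<t. (\<Sum>l<m. B $$ (i, l) * x l p) * y p j)" .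
  qed
qed

text \<open>A basis matrix with invertible upper block \<open>P\<close> can be normalized to \<open>P = 1\<close> by column
  operations.\<close>

lemma col_space_cell:
  assumes M: "M \<in> carrier_mat (d + m) d" and P: "P \<in> carrier_mat d d" "det P \<noteq> 0"
    and top: "\<And>i j. i < d \<Longrightarrow> j < d \<Longrightarrow> M $$ (i, j) = P $$ (i, j)"
    and A: "A \<in> carrier_mat m d" "A * P = lower_rows d m M"
  shows "vec_space.col_space (d + m) M = cell_chart d (d + m) A"
proof -
  have "M = (1\<^sub>m d @\<^sub>r A) * P"
  proof (rule eq_matI)
    fix i j assume "i < dim_row ((1\<^sub>m d @\<^sub>r A) * P)" "j < dim_col ((1\<^sub>m d @\<^sub>r A) * P)"
    then have ij: "i < d + m" "j < d" using append_one_carrier[OF A(1)] P by auto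
    have e: "((1\<^sub>m d @\<^sub>r A) * P) $$ (i, j) = (\<Sum>l<d. (1\<^sub>m d @\<^sub>r A) $$ (i, l) * P $$ (l, j))"
      by (rule mat_mult_entry[OF append_one_carrier[OF A(1)] P(1) ij])
    show "M $$ (i, j) = ((1\<^sub>m d @\<^sub>r A) * P) $$ (i, j)"
    proof (cases "i < d")
      case True
      have "(\<Sum>l<d. (1\<^sub>m d @\<^sub>r A) $$ (i, l) * P $$ (l, j)) = (\<Sum>l<d. if l = i then P $$ (l, j) else 0)"
        using True by (intro sum.cong refl) (auto simp: append_one_entry[OF A(1)])
      then show ?thesis using e True top ij by simp
    next
      case False
      have "(\<Sum>l<d. (1\<^sub>m d @\<^sub>r A) $$ (i, l) * P $$ (l, j)) = (\<Sum>l<d. A $$ (i - d, l) * P $$ (l, j))"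
        using False ij by (intro sum.cong refl) (auto simp: append_one_entry[OF A(1)])
      also have "\<dots> = (A * P) $$ (i - d, j)" by (rule mat_mult_entry[OF A(1) P(1), symmetric]) (use False ij in auto)
      also have "\<dots> = M $$ (i, j)" unfolding A(2) using False ij by (simp add: lower_rows_def)
      finally show ?thesis using e by simp
    qed
  qed (use M P append_one_carrier[OF A(1)] in auto)
  then show ?thesis unfolding cell_chart_def
    using col_space_mult_invertible[OF append_one_carrier[OF A(1)] P] by simp
qed

lemma cell_chart_inj:
  assumes A: "A \<in> carrier_mat m d" and B: "B \<in> carrier_mat m d"
    and eq: "cell_chart d (d + m) A = cell_chart d (d + m) B"
  shows "A = B"
proof -
  note Ac = append_one_carrier[OF A] and Bc = append_one_carrier[OF B]
  obtain P where P: "P \<in> carrier_mat d d" "1\<^sub>m d @\<^sub>r A = (1\<^sub>m d @\<^sub>r B) * P"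
    using col_space_eqD[OF Bc Ac append_one_nonsing[OF A] eq[unfolded cell_chart_def]] by metis
  have "P = 1\<^sub>m d"
  proof (rule eq_matI)
    fix i j assume "i < dim_row (1\<^sub>m d :: complex mat)" "j < dim_col (1\<^sub>m d :: complex mat)"
    then have ij: "i < d" "j < d" by auto
    have "((1\<^sub>m d @\<^sub>r B) * P) $$ (i, j) = (\<Sum>l<d. (1\<^sub>m d @\<^sub>r B) $$ (i, l) * P $$ (l, j))"
      by (rule mat_mult_entry[OF Bc P(1)]) (use ij in auto)
    also have "\<dots> = (\<Sum>l<d. if l = i then P $$ (l, j) else 0)"
      using ij by (intro sum.cong refl) (auto simp: append_one_entry[OF B])
    finally show "P $$ (i, j) = 1\<^sub>m d $$ (i, j)"
      unfolding P(2)[symmetric] using ij append_one_entry[OF A, of i j] by simp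
  qed (use P in auto)
  then have "1\<^sub>m d @\<^sub>r A = 1\<^sub>m d @\<^sub>r B" using P(2) Bc by simp
  then show ?thesis using lower_rows_append_one[OF A] lower_rows_append_one[OF B] by metis
qed

section \<open>The action of the Levi subgroup on the cell\<close>

definition upper_block :: "nat \<Rightarrow> complex mat \<Rightarrow> complex mat" where
  "upper_block d g = mat d d (\<lambda>(i, j). g $$ (i, j))"

definition lower_block :: "nat \<Rightarrow> nat \<Rightarrow> complex mat \<Rightarrow> complex mat" where
  "lower_block d m g = mat m m (\<lambda>(i, j). g $$ (d + i, d + j))"

abbreviation levi :: "nat \<Rightarrow> nat \<Rightarrow> complex mat set" where
  "levi d m \<equiv> pattern_group (d + m) (levi_pattern d)"

abbreviation levi_borel :: "nat \<Rightarrow> nat \<Rightarrow> complex mat set" where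
  "levi_borel d m \<equiv> pattern_group (d + m) (borel_pattern d)"

text \<open>From \<open>diag (g\<^sub>1, g\<^sub>2) (1; A) = (g\<^sub>1; g\<^sub>2 A) = (1; g\<^sub>2 A g\<^sub>1\<inverse>) g\<^sub>1\<close> one reads off the
  action on the chart. The inverse of \<open>g\<^sub>1\<close> is taken as the upper block of the inverse of \<open>g\<close>.\<close>

definition levi_act :: "nat \<Rightarrow> nat \<Rightarrow> complex mat \<Rightarrow> complex mat \<Rightarrow> complex mat" where
  "levi_act d m g A = lower_block d m g * A * upper_block d (inv\<^bsub>GL (d + m)\<^esub> g)"

lemma block_carrier [simp]: "upper_block d g \<in> carrier_mat d d" "lower_block d m g \<in> carrier_mat m m"
  by (simp_all add: upper_block_def lower_block_def)

lemma levi_subgroup: "subgroup (levi d m) (GL (d + m))"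
  by (rule pattern_group_subgroup) auto

lemma levi_GL: "g \<in> levi d m \<Longrightarrow> g \<in> carrier (GL (d + m))"
  by (rule pattern_group_GL)

lemma levi_mat: "g \<in> levi d m \<Longrightarrow> g \<in> carrier_mat (d + m) (d + m)"
  by (rule GL_carrier_mat[OF levi_GL])

lemma levi_inv: "g \<in> levi d m \<Longrightarrow> inv\<^bsub>GL (d + m)\<^esub> g \<in> levi d m"
  by (rule subgroup.m_inv_closed[OF levi_subgroup])

lemma levi_mult: "g \<in> levi d m \<Longrightarrow> h \<in> levi d m \<Longrightarrow> g * h \<in> levi d m"
  using subgroup.m_closed[OF levi_subgroup, of g d m h] by simp

lemma levi_block_mult:
  assumes g: "g \<in> levi d m" and h: "h \<in> levi d m"
  shows "upper_block d (g * h) = upper_block d g * upper_block d h"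
    and "lower_block d m (g * h) = lower_block d m g * lower_block d m h"
proof -
  have e: "(g * h) $$ (i, j) = (\<Sum>l<d. g $$ (i, l) * h $$ (l, j)) + (\<Sum>l<m. g $$ (i, d + l) * h $$ (d + l, j))"
    if "i < d + m" "j < d + m" for i j
    using mat_mult_entry[OF levi_mat[OF g] levi_mat[OF h] that] by (simp add: sum_split_add)
  have z: "g $$ (i, d + l) = 0" if "i < d" "l < m" for i l using pattern_groupD[OF g, of i "d + l"] that by simp
  have z': "g $$ (d + i, l) = 0" if "i < m" "l < d" for i l using pattern_groupD[OF g, of "d + i" l] that by simp
  show "upper_block d (g * h) = upper_block d g * upper_block d h"
  proof (rule eq_matI)
    fix i j assume "i < dim_row (upper_block d g * upper_block d h)" "j < dim_col (upper_block d g * upper_block d h)"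
    then have ij: "i < d" "j < d" by (auto simp: upper_block_def)
    have "(upper_block d g * upper_block d h) $$ (i, j) = (\<Sum>l<d. upper_block d g $$ (i, l) * upper_block d h $$ (l, j))"
      by (rule mat_mult_entry[OF block_carrier(1) block_carrier(1) ij])
    then show "upper_block d (g * h) $$ (i, j) = (upper_block d g * upper_block d h) $$ (i, j)"
      using e[of i j] ij z by (simp add: upper_block_def)
  qed (auto simp: upper_block_def)
  show "lower_block d m (g * h) = lower_block d m g * lower_block d m h"
  proof (rule eq_matI)
    fix i j assume "i < dim_row (lower_block d m g * lower_block d m h)" "j < dim_col (lower_block d m g * lower_block d m h)"
    then have ij: "i < m" "j < m" by (auto simp: lower_block_def)
    have "(lower_block d m g * lower_block d m h) $$ (i, j) = (\<Sum>l<m. lower_block d m g $$ (i, l) * lower_block d m h $$ (l, j))"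
      by (rule mat_mult_entry[OF block_carrier(2) block_carrier(2) ij])
    then show "lower_block d m (g * h) $$ (i, j) = (lower_block d m g * lower_block d m h) $$ (i, j)"
      using e[of "d + i" "d + j"] ij z' by (simp add: lower_block_def)
  qed (auto simp: lower_block_def)
qed

lemma block_one: "upper_block d (1\<^sub>m (d + m)) = 1\<^sub>m d" "lower_block d m (1\<^sub>m (d + m)) = 1\<^sub>m m"
  by (auto simp: upper_block_def lower_block_def intro!: eq_matI)

lemma upper_block_inv:
  assumes g: "g \<in> levi d m"
  shows "upper_block d (inv\<^bsub>GL (d + m)\<^esub> g) * upper_block d g = 1\<^sub>m d"
    and "det (upper_block d g) \<noteq> 0"
proof -
  show *: "upper_block d (inv\<^bsub>GL (d + m)\<^esub> g) * upper_block d g = 1\<^sub>m d"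
    using levi_block_mult(1)[OF levi_inv[OF g] g] GL_inv(3)[OF levi_GL[OF g]] block_one(1) by simp
  have "det (upper_block d (inv\<^bsub>GL (d + m)\<^esub> g)) * det (upper_block d g) = 1"
    using det_mult[OF block_carrier(1) block_carrier(1), of d "inv\<^bsub>GL (d + m)\<^esub> g" g] * by simp
  then show "det (upper_block d g) \<noteq> 0" by auto
qed

lemma levi_act_carrier: "A \<in> carrier_mat m d \<Longrightarrow> levi_act d m g A \<in> carrier_mat m d"
  unfolding levi_act_def by (rule mult_carrier_mat[OF mult_carrier_mat[OF block_carrier(2)] block_carrier(1)])

lemma levi_act_mult:
  assumes g: "g \<in> levi d m" and h: "h \<in> levi d m" and A: "A \<in> carrier_mat m d"
  shows "levi_act d m (g * h) A = levi_act d m g (levi_act d m h A)"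
proof -
  interpret group "GL (d + m)" by (rule GL_group)
  let ?i = "\<lambda>g. inv\<^bsub>GL (d + m)\<^esub> g"
  have "?i (g * h) = ?i h * ?i g" using inv_mult_group[OF levi_GL[OF g] levi_GL[OF h]] by simp
  then have eq: "levi_act d m (g * h) A
      = (lower_block d m g * lower_block d m h) * A * (upper_block d (?i h) * upper_block d (?i g))"
    unfolding levi_act_def using levi_block_mult(2)[OF g h] levi_block_mult(1)[OF levi_inv[OF h] levi_inv[OF g]] by simp
  define a b c e where defs: "a = lower_block d m g" "b = lower_block d m h" "c = upper_block d (?i h)" "e = upper_block d (?i g)"
  have car: "a \<in> carrier_mat m m" "b \<in> carrier_mat m m" "c \<in> carrier_mat d d" "e \<in> carrier_mat d d"
    by (simp_all add: defs)
  have bA: "b * A \<in> carrier_mat m d" using car A by simp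
  have "a * b * A * (c * e) = a * (b * A) * (c * e)" using assoc_mult_mat[OF car(1,2) A] by simp
  also have "\<dots> = a * (b * A) * c * e"
    using assoc_mult_mat[of "a * (b * A)" m d c d e d] car bA by simp
  also have "\<dots> = a * (b * A * c) * e" using assoc_mult_mat[OF car(1) bA car(3)] by simp
  finally show ?thesis unfolding eq unfolding levi_act_def defs by simp
qed

lemma levi_act_one: "A \<in> carrier_mat m d \<Longrightarrow> levi_act d m (1\<^sub>m (d + m)) A = A"
proof -
  assume A: "A \<in> carrier_mat m d"
  interpret group "GL (d + m)" by (rule GL_group)
  have "inv\<^bsub>GL (d + m)\<^esub> (1\<^sub>m (d + m)) = 1\<^sub>m (d + m)" using inv_one by simp
  then show ?thesis unfolding levi_act_def using A by (simp add: block_one)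
qed

lemma levi_act_inv:
  assumes g: "g \<in> levi d m" and A: "A \<in> carrier_mat m d"
  shows "levi_act d m (inv\<^bsub>GL (d + m)\<^esub> g) (levi_act d m g A) = A"
    and "levi_act d m g (levi_act d m (inv\<^bsub>GL (d + m)\<^esub> g) A) = A"
  using levi_act_mult[OF levi_inv[OF g] g A] levi_act_mult[OF g levi_inv[OF g] A]
    GL_inv(2,3)[OF levi_GL[OF g]] levi_act_one[OF A] by auto

lemma levi_act_factors:
  assumes "A \<in> carrier_mat m d" "factors m d t A"
  shows "factors m d t (levi_act d m g A)"
  unfolding levi_act_def
  by (rule factors_mult_right[OF mult_carrier_mat[OF block_carrier(2) assms(1)] block_carrier(1)
        factors_mult_left[OF block_carrier(2) assms]])

lemma gr_action_chart:
  assumes g: "g \<in> levi d m" and A: "A \<in> carrier_mat m d"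
  shows "gr_action d (d + m) g (cell_chart d (d + m) A) = cell_chart d (d + m) (levi_act d m g A)"
proof -
  note gc = levi_mat[OF g] and Ac = append_one_carrier[OF A]
  have e: "(g * (1\<^sub>m d @\<^sub>r A)) $$ (i, j) = (\<Sum>l<d. g $$ (i, l) * (1\<^sub>m d @\<^sub>r A) $$ (l, j))
      + (\<Sum>l<m. g $$ (i, d + l) * (1\<^sub>m d @\<^sub>r A) $$ (d + l, j))" if "i < d + m" "j < d" for i j
    using mat_mult_entry[OF gc Ac that] by (simp add: sum_split_add)
  have "gr_action d (d + m) g (cell_chart d (d + m) A) = vec_space.col_space (d + m) (g * (1\<^sub>m d @\<^sub>r A))"
    unfolding cell_chart_def by (rule gr_action_col_space[OF levi_GL[OF g] Ac append_one_nonsing[OF A]])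
  also have "\<dots> = cell_chart d (d + m) (levi_act d m g A)"
  proof (rule col_space_cell[OF _ block_carrier(1) upper_block_inv(2)[OF g] _ levi_act_carrier[OF A]])
    show "g * (1\<^sub>m d @\<^sub>r A) \<in> carrier_mat (d + m) d" using gc Ac by simp
    fix i j assume ij: "i < d" "j < d"
    have "(\<Sum>l<d. g $$ (i, l) * (1\<^sub>m d @\<^sub>r A) $$ (l, j)) = (\<Sum>l<d. if l = j then g $$ (i, l) else 0)"
      using ij by (intro sum.cong refl) (auto simp: append_one_entry[OF A])
    moreover have "(\<Sum>l<m. g $$ (i, d + l) * (1\<^sub>m d @\<^sub>r A) $$ (d + l, j)) = 0"
      using pattern_groupD[OF g, of i] ij by (intro sum.neutral) auto
    ultimately show "(g * (1\<^sub>m d @\<^sub>r A)) $$ (i, j) = upper_block d g $$ (i, j)"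
      using e[of i j] ij by (simp add: upper_block_def)
  next
    have "levi_act d m g A * upper_block d g
        = (lower_block d m g * A) * (upper_block d (inv\<^bsub>GL (d + m)\<^esub> g) * upper_block d g)"
      unfolding levi_act_def
      by (rule assoc_mult_mat[OF mult_carrier_mat[OF block_carrier(2) A] block_carrier(1) block_carrier(1)])
    also have "\<dots> = lower_block d m g * A" unfolding upper_block_inv(1)[OF g] using A by simp
    also have "\<dots> = lower_rows d m (g * (1\<^sub>m d @\<^sub>r A))"
    proof (rule eq_matI)
      fix i j assume "i < dim_row (lower_rows d m (g * (1\<^sub>m d @\<^sub>r A)))" "j < dim_col (lower_rows d m (g * (1\<^sub>m d @\<^sub>r A)))"
      then have ij: "i < m" "j < d" by (auto simp: lower_rows_def)
      have "(\<Sum>l<d. g $$ (d + i, l) * (1\<^sub>m d @\<^sub>r A) $$ (l, j)) = 0"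
        using pattern_groupD[OF g, of "d + i"] ij by (intro sum.neutral) auto
      moreover have "(\<Sum>l<m. g $$ (d + i, d + l) * (1\<^sub>m d @\<^sub>r A) $$ (d + l, j)) = (\<Sum>l<m. lower_block d m g $$ (i, l) * A $$ (l, j))"
        using ij by (intro sum.cong refl) (auto simp: append_one_entry[OF A] lower_block_def)
      ultimately show "(lower_block d m g * A) $$ (i, j) = lower_rows d m (g * (1\<^sub>m d @\<^sub>r A)) $$ (i, j)"
        using e[of "d + i" j] ij mat_mult_entry[OF block_carrier(2) A ij] by (simp add: lower_rows_def)
    qed (use A in \<open>auto simp: lower_rows_def lower_block_def\<close>)
    finally show "levi_act d m g A * upper_block d g = lower_rows d m (g * (1\<^sub>m d @\<^sub>r A))" .
  qed
  finally show ?thesis .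
qed

abbreviation det_variety :: "nat \<Rightarrow> nat \<Rightarrow> nat \<Rightarrow> complex mat set" where
  "det_variety d m t \<equiv> determinantal_variety m d t"

lemma det_variety_iff: "A \<in> det_variety d m t \<longleftrightarrow> A \<in> carrier_mat m d \<and> factors m d t A"
  using factor_pair.determinantal_variety_factors by blast

lemma det_variety_carrier: "A \<in> det_variety d m t \<Longrightarrow> A \<in> carrier_mat m d"
  by (simp add: det_variety_iff)

lemma levi_act_det_variety: "A \<in> det_variety d m t \<Longrightarrow> levi_act d m g A \<in> det_variety d m t"
  using levi_act_carrier levi_act_factors by (simp add: det_variety_iff)

lemma cell_action_eq:
  assumes g: "g \<in> levi d m" and A: "A \<in> det_variety d m t"
  shows "cell_action d (d + m) (det_variety d m t) g A = levi_act d m g A"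
proof -
  have inj: "inj_on (cell_chart d (d + m)) (carrier_mat m d)"
    by (rule inj_onI) (rule cell_chart_inj)
  show ?thesis
    using A gr_action_chart[OF g det_variety_carrier[OF A]]
      the_inv_into_f_f[OF inj levi_act_carrier[OF det_variety_carrier[OF A]]]
    by (simp add: cell_action_def)
qed

lemma cell_action_group_action:
  "group_action (GL_sub (d + m) (levi d m)) (det_variety d m t) (cell_action d (d + m) (det_variety d m t))"
proof -
  let ?V = "det_variety d m t" and ?G = "GL_sub (d + m) (levi d m)"
  let ?\<phi> = "cell_action d (d + m) ?V"
  interpret GL: group "GL (d + m)" by (rule GL_group)
  interpret G: group ?G by (rule GL.subgroup_imp_group[OF levi_subgroup])
  have bij: "?\<phi> g \<in> Bij ?V" if g: "g \<in> levi d m" for g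
  proof -
    have "bij_betw (?\<phi> g) ?V ?V"
    proof (rule bij_betw_byWitness[where f' = "levi_act d m (inv\<^bsub>GL (d + m)\<^esub> g)"])
      show "\<forall>A\<in>?V. levi_act d m (inv\<^bsub>GL (d + m)\<^esub> g) (?\<phi> g A) = A"
        using cell_action_eq[OF g] levi_act_inv(1)[OF g] det_variety_carrier by simp
      show "\<forall>A\<in>?V. ?\<phi> g (levi_act d m (inv\<^bsub>GL (d + m)\<^esub> g) A) = A"
        using cell_action_eq[OF g levi_act_det_variety] levi_act_inv(2)[OF g] det_variety_carrier by simp
      show "?\<phi> g ` ?V \<subseteq> ?V" using cell_action_eq[OF g] levi_act_det_variety by auto
      show "levi_act d m (inv\<^bsub>GL (d + m)\<^esub> g) ` ?V \<subseteq> ?V" using levi_act_det_variety by auto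
    qed
    moreover have "?\<phi> g \<in> extensional ?V" by (simp add: cell_action_def)
    ultimately show ?thesis unfolding Bij_def by blast
  qed
  have "?\<phi> \<in> hom ?G (BijGroup ?V)"
  proof (rule homI)
    fix g assume "g \<in> carrier ?G"
    then show "?\<phi> g \<in> carrier (BijGroup ?V)" using bij by (simp add: BijGroup_def)
  next
    fix g h assume "g \<in> carrier ?G" "h \<in> carrier ?G"
    then have gh: "g \<in> levi d m" "h \<in> levi d m" by auto
    have "?\<phi> (g * h) = compose ?V (?\<phi> g) (?\<phi> h)"
    proof
      fix A
      show "?\<phi> (g * h) A = compose ?V (?\<phi> g) (?\<phi> h) A"
      proof (cases "A \<in> ?V")
        case True
        then show ?thesis
          using cell_action_eq[OF levi_mult[OF gh] True] cell_action_eq[OF gh(2) True]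
            cell_action_eq[OF gh(1) levi_act_det_variety[OF True]]
            levi_act_mult[OF gh det_variety_carrier[OF True]]
          by (simp add: compose_def)
      next
        case False
        then show ?thesis by (simp add: compose_def cell_action_def)
      qed
    qed
    then show "?\<phi> (g \<otimes>\<^bsub>?G\<^esub> h) = ?\<phi> g \<otimes>\<^bsub>BijGroup ?V\<^esub> ?\<phi> h"
      using bij[OF gh(1)] bij[OF gh(2)] by (simp add: BijGroup_def)
  qed
  then have "group_hom ?G (BijGroup ?V) ?\<phi>"
    unfolding group_hom_def group_hom_axioms_def using G.group_axioms group_BijGroup by blast
  then show ?thesis unfolding group_action_def .
qed

text \<open>Cramer's rule; it makes the action a polynomial expression in the entries of \<open>g\<close>, \<open>A\<close> and
  in \<open>1 / det g\<close>.\<close>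

lemma inverse_entry:
  assumes g: "g \<in> carrier (GL N)" and ij: "i < N" "j < N"
  shows "(inv\<^bsub>GL N\<^esub> g) $$ (i, j) = inverse (det g) * ((-1) ^ (j + i) *
    det (mat (N - 1) (N - 1) (\<lambda>(p, q). g $$ (if p < j then p else Suc p, if q < i then q else Suc q))))"
proof -
  have gc: "g \<in> carrier_mat N N" and dg: "det g \<noteq> 0" using g by (auto simp: GL_carrier)
  note adj = adj_mat[OF gc]
  have "inv\<^bsub>GL N\<^esub> g = inverse (det g) \<cdot>\<^sub>m adj_mat g"
  proof (rule GL_inv_eqI[OF g])
    show "inverse (det g) \<cdot>\<^sub>m adj_mat g \<in> carrier_mat N N" using adj(1) by simp
    show "g * (inverse (det g) \<cdot>\<^sub>m adj_mat g) = 1\<^sub>m N"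
      unfolding mult_smult_distrib[OF gc adj(1)] adj(2) using dg by (intro eq_matI) auto
  qed
  moreover have "adj_mat g $$ (i, j) = cofactor g j i" unfolding adj_mat_def using gc ij by simp
  moreover have "cofactor g j i = (-1) ^ (j + i) *
      det (mat (N - 1) (N - 1) (\<lambda>(p, q). g $$ (if p < j then p else Suc p, if q < i then q else Suc q)))"
    unfolding cofactor_def mat_delete_def using gc by simp
  ultimately show ?thesis using adj(1) ij by simp
qed

lemma cell_action_algebraic:
  "algebraic_action (d + m) (levi d m) m d (det_variety d m t) (cell_action d (d + m) (det_variety d m t))"
  unfolding algebraic_action_def
proof (intro conjI cell_action_group_action allI impI)
  fix i j assume ij: "i < m" "j < d"
  let ?C = "GL_mat_coords (d + m) m d"
  let ?N = "d + m"
  define inve where "inve = (\<lambda>l (gA :: complex mat \<times> complex mat). inverse (det (fst gA)) * ((-1) ^ (j + l) *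
    det (mat (?N - 1) (?N - 1) (\<lambda>(p, q). fst gA $$ (if p < j then p else Suc p, if q < l then q else Suc q)))))"
  have g_coord: "(\<lambda>gA. fst gA $$ (p, q)) \<in> function_algebra ?C" if "p < ?N" "q < ?N" for p q
    by (rule function_algebra.coord) (use that in \<open>auto simp: GL_mat_coords_def mat_coords_def comp_def intro!: image_eqI\<close>)
  have A_coord: "(\<lambda>gA. snd gA $$ (p, q)) \<in> function_algebra ?C" if "p < m" "q < d" for p q
    by (rule function_algebra.coord) (use that in \<open>auto simp: GL_mat_coords_def mat_coords_def comp_def intro!: image_eqI\<close>)
  have det_coord: "(\<lambda>gA. inverse (det (fst gA))) \<in> function_algebra ?C"
    by (rule function_algebra.coord) (auto simp: GL_mat_coords_def comp_def)
  have inve: "inve l \<in> function_algebra ?C" if "l < d" for l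
    unfolding inve_def
    by (intro function_algebra.mult det_coord function_algebra.const fa_det g_coord) (use that ij in auto)
  let ?f = "\<lambda>gA. \<Sum>l<d. (\<Sum>k<m. fst gA $$ (d + i, d + k) * snd gA $$ (k, l)) * inve l gA"
  have "?f \<in> function_algebra ?C"
    by (intro fa_sum function_algebra.mult g_coord A_coord inve) (use ij in auto)
  moreover have "\<forall>g\<in>levi d m. \<forall>A\<in>det_variety d m t.
      cell_action d (d + m) (det_variety d m t) g A $$ (i, j) = ?f (g, A)"
  proof (intro ballI)
    fix g A assume g: "g \<in> levi d m" and A: "A \<in> det_variety d m t"
    note Ac = det_variety_carrier[OF A]
    have lA: "lower_block d m g * A \<in> carrier_mat m d" by (rule mult_carrier_mat[OF block_carrier(2) Ac])
    have "levi_act d m g A $$ (i, j)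
        = (\<Sum>l<d. (lower_block d m g * A) $$ (i, l) * upper_block d (inv\<^bsub>GL ?N\<^esub> g) $$ (l, j))"
      unfolding levi_act_def by (rule mat_mult_entry[OF lA block_carrier(1) ij])
    also have "\<dots> = ?f (g, A)"
    proof (rule sum.cong[OF refl])
      fix l assume "l \<in> {..<d}"
      then have l: "l < d" by simp
      have "upper_block d (inv\<^bsub>GL ?N\<^esub> g) $$ (l, j) = inve l (g, A)"
        using inverse_entry[OF levi_GL[OF g], of l j] l ij by (simp add: upper_block_def inve_def)
      moreover have "(lower_block d m g * A) $$ (i, l) = (\<Sum>k<m. g $$ (d + i, d + k) * A $$ (k, l))"
        unfolding mat_mult_entry[OF block_carrier(2) Ac ij(1) l] using ij by (simp add: lower_block_def)
      ultimately show "(lower_block d m g * A) $$ (i, l) * upper_block d (inv\<^bsub>GL ?N\<^esub> g) $$ (l, j)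
          = (\<Sum>k<m. fst (g, A) $$ (d + i, d + k) * snd (g, A) $$ (k, l)) * inve l (g, A)" by simp
    qed
    finally show "cell_action d (d + m) (det_variety d m t) g A $$ (i, j) = ?f (g, A)"
      unfolding cell_action_eq[OF g A] .
  qed
  ultimately show "\<exists>f\<in>function_algebra ?C. \<forall>g\<in>levi d m. \<forall>A\<in>det_variety d m t.
      cell_action d (d + m) (det_variety d m t) g A $$ (i, j) = f (g, A)" by (intro bexI[of _ ?f])
qed

section \<open>The open orbit of the Borel subgroup\<close>

text \<open>The minor of the last \<open>k\<close> rows and the first \<open>k\<close> columns, up to a sign since the rows are
  listed from bottom to top. It is an eigenfunction of the Borel subgroup, which acts by upper
  triangular matrices on both sides.\<close>

definition corner_minor :: "nat \<Rightarrow> nat \<Rightarrow> complex mat \<Rightarrow> complex" where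
  "corner_minor m k A = det (mat k k (\<lambda>(i, j). A $$ (m - 1 - i, j)))"

text \<open>Gaussian elimination with pivots on the antidiagonal through the lower left corner. Each
  step subtracts a matrix of rank one that clears the next row from below and the next column
  from the left; the pivot is nonzero because otherwise the next corner minor would have size
  \<open>l + 1\<close> and rank at most \<open>l\<close>.\<close>

lemma rank_one_elimination:
  assumes A: "A \<in> carrier_mat m n" and "l \<le> t" "t \<le> m" "t \<le> n"
    and minors: "\<And>k. k < t \<Longrightarrow> corner_minor m (Suc k) A \<noteq> 0"
  shows "\<exists>a b. (\<forall>p<l. (\<forall>i<m. m - 1 - p < i \<longrightarrow> a p i = 0) \<and> a p (m - 1 - p) \<noteq> 0 \<and> (\<forall>j<p. b p j = 0) \<and> b p p \<noteq> 0)
    \<and> (\<forall>i<m. \<forall>j<n. m - l \<le> i \<or> j < l \<longrightarrow> A $$ (i, j) = (\<Sum>p<l. a p i * b p j))"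
  using assms(2)
proof (induction l)
  case 0
  show ?case using assms(3) by simp
next
  case (Suc l)
  have "l \<le> t" using Suc.prems by simp
  from Suc.IH[OF this] obtain a b :: "nat \<Rightarrow> nat \<Rightarrow> complex"
    where ab: "(\<forall>p<l. (\<forall>i<m. m - 1 - p < i \<longrightarrow> a p i = 0) \<and> a p (m - 1 - p) \<noteq> 0 \<and> (\<forall>j<p. b p j = 0) \<and> b p p \<noteq> 0)
      \<and> (\<forall>i<m. \<forall>j<n. m - l \<le> i \<or> j < l \<longrightarrow> A $$ (i, j) = (\<Sum>p<l. a p i * b p j))"
    by (elim exE)
  have shape: "(\<forall>i<m. m - 1 - p < i \<longrightarrow> a p i = 0) \<and> a p (m - 1 - p) \<noteq> 0 \<and> (\<forall>j<p. b p j = 0) \<and> b p p \<noteq> 0"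
    if "p < l" for p using ab that by blast
  have AR: "A $$ (i, j) = (\<Sum>p<l. a p i * b p j)" if "i < m" "j < n" "m - l \<le> i \<or> j < l" for i j
    using ab that by blast
  define R where "R = (\<lambda>i j. A $$ (i, j) - (\<Sum>p<l. a p i * b p j))"
  have R0: "R i j = 0" if "i < m" "j < n" "m - l \<le> i \<or> j < l" for i j
    using AR[OF that] by (simp add: R_def)
  have lt: "l < t" "l < m" "l < n" using Suc.prems assms(3,4) by auto
  define r where "r = m - 1 - l"
  have r: "r < m" "m - l = Suc r" using lt by (auto simp: r_def)
  have pivot: "R r l \<noteq> 0"
  proof
    assume "R r l = 0"
    have "A $$ (m - 1 - i, j) = (\<Sum>p<l. a p (m - 1 - i) * b p j)" if "i < Suc l" "j < Suc l" for i j
    proof -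
      have "R (m - 1 - i) j = 0"
      proof (cases "i = l \<and> j = l")
        case True
        then show ?thesis using \<open>R r l = 0\<close> by (simp add: r_def)
      next
        case False
        then show ?thesis using that lt by (intro R0) auto
      qed
      then show ?thesis by (simp add: R_def)
    qed
    then have "factors (Suc l) (Suc l) l (mat (Suc l) (Suc l) (\<lambda>(i, j). A $$ (m - 1 - i, j)))"
      by (intro factorsI[where x = "\<lambda>i p. a p (m - 1 - i)" and y = b]) simp
    then have "det (mat (Suc l) (Suc l) (\<lambda>(p, q). mat (Suc l) (Suc l) (\<lambda>(i, j). A $$ (m - 1 - i, j)) $$ (p, q))) = 0"
      by (rule det_factors_0[where \<kappa> = "\<lambda>p. p" and \<mu> = "\<lambda>q. q"]) auto
    moreover have "mat (Suc l) (Suc l) (\<lambda>(p, q). mat (Suc l) (Suc l) (\<lambda>(i, j). A $$ (m - 1 - i, j)) $$ (p, q))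
        = mat (Suc l) (Suc l) (\<lambda>(i, j). A $$ (m - 1 - i, j))" by (intro eq_matI) auto
    ultimately show False using minors[OF lt(1)] by (simp add: corner_minor_def)
  qed
  define a' where "a' = (\<lambda>p i. if p = l then R i l / R r l else a p i)"
  define b' where "b' = (\<lambda>p j. if p = l then R r j else b p j)"
  have sum': "(\<Sum>p<Suc l. a' p i * b' p j) = (\<Sum>p<l. a p i * b p j) + R i l / R r l * R r j" for i j
    by (simp add: a'_def b'_def)
  have shape': "(\<forall>i<m. m - 1 - p < i \<longrightarrow> a' p i = 0) \<and> a' p (m - 1 - p) \<noteq> 0 \<and> (\<forall>j<p. b' p j = 0) \<and> b' p p \<noteq> 0"
    if p: "p < Suc l" for p
  proof (cases "p = l")
    case True
    have "a' p i = 0" if "i < m" "m - 1 - p < i" for i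
      using R0[of i l] that True lt r by (simp add: a'_def)
    moreover have "b' p j = 0" if "j < p" for j using R0[of r j] that True lt r by (simp add: b'_def)
    ultimately show ?thesis using True pivot by (simp add: a'_def b'_def r_def)
  next
    case False
    then show ?thesis using shape[of p] p by (simp add: a'_def b'_def)
  qed
  have "A $$ (i, j) = (\<Sum>p<Suc l. a' p i * b' p j)" if ij: "i < m" "j < n" "m - Suc l \<le> i \<or> j < Suc l" for i j
  proof -
    have "R i j = R i l / R r l * R r j"
    proof (cases "m - l \<le> i \<or> j < l")
      case True
      then show ?thesis using R0[of i j] R0[of i l] R0[of r j] ij lt r by auto
    next
      case False
      then have "i = r \<or> j = l" using ij(3) r by auto
      then show ?thesis using pivot by auto
    qed
    moreover have "A $$ (i, j) = (\<Sum>p<l. a p i * b p j) + R i j" by (simp add: R_def)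
    ultimately show ?thesis unfolding sum' by simp
  qed
  note all = this
  show ?case by (rule exI[of _ a'], rule exI[of _ b']) (intro conjI allI impI shape' all; assumption)
qed

text \<open>A matrix of rank at most \<open>t\<close> with nonvanishing corner minors is completely eliminated
  after \<open>t\<close> steps: a remaining nonzero entry \<open>c\<close> would give a nonzero minor of size \<open>t + 1\<close>,
  namely the product of the pivots and \<open>c\<close>.\<close>

lemma corner_factorization:
  assumes A: "A \<in> carrier_mat m n" "factors m n t A" and t: "t \<le> m" "t \<le> n"
    and minors: "\<And>k. k < t \<Longrightarrow> corner_minor m (Suc k) A \<noteq> 0"
  obtains a b where
    "\<And>p i. p < t \<Longrightarrow> i < m \<Longrightarrow> m - 1 - p < i \<Longrightarrow> a p i = 0" "\<And>p. p < t \<Longrightarrow> a p (m - 1 - p) \<noteq> 0"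
    "\<And>p j. p < t \<Longrightarrow> j < p \<Longrightarrow> b p j = 0" "\<And>p. p < t \<Longrightarrow> b p p \<noteq> 0"
    "\<And>i j. i < m \<Longrightarrow> j < n \<Longrightarrow> A $$ (i, j) = (\<Sum>p<t. a p i * b p j)"
proof -
  have "\<exists>a b. (\<forall>p<t. (\<forall>i<m. m - 1 - p < i \<longrightarrow> a p i = 0) \<and> a p (m - 1 - p) \<noteq> 0 \<and> (\<forall>j<p. b p j = 0) \<and> b p p \<noteq> 0)
      \<and> (\<forall>i<m. \<forall>j<n. m - t \<le> i \<or> j < t \<longrightarrow> A $$ (i, j) = (\<Sum>p<t. a p i * b p j))"
    by (rule rank_one_elimination[OF A(1) order_refl t]) (rule minors)
  then obtain a b :: "nat \<Rightarrow> nat \<Rightarrow> complex" where ab: "(\<forall>p<t. (\<forall>i<m. m - 1 - p < i \<longrightarrow> a p i = 0) \<and> a p (m - 1 - p) \<noteq> 0 \<and> (\<forall>j<p. b p j = 0) \<and> b p p \<noteq> 0)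
      \<and> (\<forall>i<m. \<forall>j<n. m - t \<le> i \<or> j < t \<longrightarrow> A $$ (i, j) = (\<Sum>p<t. a p i * b p j))"
    by (elim exE)
  have shape: "(\<forall>i<m. m - 1 - p < i \<longrightarrow> a p i = 0) \<and> a p (m - 1 - p) \<noteq> 0 \<and> (\<forall>j<p. b p j = 0) \<and> b p p \<noteq> 0"
    if "p < t" for p using ab that by blast
  have AR: "A $$ (i, j) = (\<Sum>p<t. a p i * b p j)" if "i < m" "j < n" "m - t \<le> i \<or> j < t" for i j
    using ab that by blast
  have "A $$ (i, j) = (\<Sum>p<t. a p i * b p j)" if ij: "i < m" "j < n" for i j
  proof (rule ccontr)
    assume neq: "A $$ (i, j) \<noteq> (\<Sum>p<t. a p i * b p j)"
    have "\<not> (m - t \<le> i \<or> j < t)" using AR[OF ij] neq by blast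
    then have out: "i < m - t" "t \<le> j" by auto
    define c where "c = A $$ (i, j) - (\<Sum>p<t. a p i * b p j)"
    define \<kappa> where "\<kappa> = (\<lambda>k. if k < t then m - 1 - k else i)"
    define \<mu> where "\<mu> = (\<lambda>k. if k < t then k else j)"
    define Lo where "Lo = mat (Suc t) (Suc t) (\<lambda>(k, p). if p < t then a p (\<kappa> k) else if k = t then 1 else (0 :: complex))"
    define Up where "Up = mat (Suc t) (Suc t) (\<lambda>(p, k). if p < t then b p (\<mu> k) else if k = t then c else 0)"
    have car: "Lo \<in> carrier_mat (Suc t) (Suc t)" "Up \<in> carrier_mat (Suc t) (Suc t)" by (simp_all add: Lo_def Up_def)
    \<comment> \<open>the block bordered by the row \<open>i\<close> and the column \<open>j\<close> is a product of triangular matrices\<close>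
    have "mat (Suc t) (Suc t) (\<lambda>(k, l). A $$ (\<kappa> k, \<mu> l)) = Lo * Up"
    proof (rule eq_matI)
      fix k l assume "k < dim_row (Lo * Up)" "l < dim_col (Lo * Up)"
      then have kl: "k < Suc t" "l < Suc t" using car by auto
      have bounds: "\<kappa> k < m" "\<mu> l < n" using ij t kl by (auto simp: \<kappa>_def \<mu>_def)
      have "(Lo * Up) $$ (k, l) = (\<Sum>p<t. a p (\<kappa> k) * b p (\<mu> l)) + (if k = t \<and> l = t then c else 0)"
        unfolding mat_mult_entry[OF car kl] using kl by (simp add: Lo_def Up_def)
      also have "\<dots> = A $$ (\<kappa> k, \<mu> l)"
      proof (cases "k = t \<and> l = t")
        case True
        then show ?thesis by (simp add: \<kappa>_def \<mu>_def c_def)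
      next
        case False
        then have "m - t \<le> \<kappa> k \<or> \<mu> l < t" using kl t by (auto simp: \<kappa>_def \<mu>_def)
        then have "A $$ (\<kappa> k, \<mu> l) = (\<Sum>p<t. a p (\<kappa> k) * b p (\<mu> l))" by (rule AR[OF bounds])
        then show ?thesis by (simp only: False if_False add_0_right)
      qed
      finally show "mat (Suc t) (Suc t) (\<lambda>(k, l). A $$ (\<kappa> k, \<mu> l)) $$ (k, l) = (Lo * Up) $$ (k, l)" using kl by simp
    qed (use car in auto)
    then have "det (mat (Suc t) (Suc t) (\<lambda>(k, l). A $$ (\<kappa> k, \<mu> l))) = det Lo * det Up"
      using det_mult[OF car] by simp
    moreover have "det Up \<noteq> 0"
    proof -
      have "upper_triangular Up" using shape by (auto simp: upper_triangular_def Up_def \<mu>_def)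
      moreover have "c \<noteq> 0" using neq by (simp add: c_def)
      then have "0 \<notin> set (diag_mat Up)" using shape by (auto simp: diag_mat_def Up_def \<mu>_def split: if_splits)
      ultimately show ?thesis using upper_triangular_imp_det_eq_0_iff[OF car(2)] by simp
    qed
    moreover have "det Lo \<noteq> 0"
    proof -
      have Lt: "transpose_mat Lo \<in> carrier_mat (Suc t) (Suc t)" using car by simp
      have "upper_triangular (transpose_mat Lo)"
        unfolding upper_triangular_def
      proof (intro allI impI)
        fix p k assume "p < dim_row (transpose_mat Lo)" "k < p"
        then have pk: "p < Suc t" "k < p" using car by auto
        show "transpose_mat Lo $$ (p, k) = 0"
        proof (cases "p < t")
          case True
          then have "m - 1 - p < m - 1 - k" "m - 1 - k < m" using t pk by auto
          then show ?thesis using pk True shape[OF True] by (simp add: Lo_def \<kappa>_def)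
        next
          case False
          then show ?thesis using pk by (simp add: Lo_def)
        qed
      qed
      moreover have "0 \<notin> set (diag_mat (transpose_mat Lo))"
        using shape by (auto simp: diag_mat_def Lo_def \<kappa>_def split: if_splits)
      ultimately have "det (transpose_mat Lo) \<noteq> 0" using upper_triangular_imp_det_eq_0_iff[OF Lt] by simp
      then show ?thesis using det_transpose[OF car(1)] by simp
    qed
    moreover have "det (mat (Suc t) (Suc t) (\<lambda>(k, l). A $$ (\<kappa> k, \<mu> l))) = 0"
      by (rule det_factors_0[OF A(2)]) (use ij t in \<open>auto simp: \<kappa>_def \<mu>_def\<close>)
    ultimately show False by simp
  qed
  then show thesis using shape by (intro that[of a b]) blast+
qed

definition block_diag :: "nat \<Rightarrow> nat \<Rightarrow> complex mat \<Rightarrow> complex mat \<Rightarrow> complex mat" where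
  "block_diag d m U1 U2 = mat (d + m) (d + m) (\<lambda>(i, j).
     if i < d \<and> j < d then U1 $$ (i, j) else if d \<le> i \<and> d \<le> j then U2 $$ (i - d, j - d) else 0)"

lemma block_diag_borel:
  assumes "\<And>i j. i < d \<Longrightarrow> j < i \<Longrightarrow> U1 $$ (i, j) = 0" "\<And>i. i < d \<Longrightarrow> U1 $$ (i, i) \<noteq> 0"
    and "\<And>i j. i < m \<Longrightarrow> j < i \<Longrightarrow> U2 $$ (i, j) = 0" "\<And>i. i < m \<Longrightarrow> U2 $$ (i, i) \<noteq> 0"
  shows "block_diag d m U1 U2 \<in> levi_borel d m"
proof -
  let ?B = "block_diag d m U1 U2"
  have c: "?B \<in> carrier_mat (d + m) (d + m)" by (simp add: block_diag_def)
  have zero: "?B $$ (i, j) = 0" if "i < d + m" "j < d + m" "\<not> borel_pattern d i j" for i j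
    using that assms(1)[of i j] assms(3)[of "i - d" "j - d"] by (auto simp: block_diag_def)
  have "upper_triangular ?B" using zero c by (auto simp: upper_triangular_def)
  moreover have "0 \<notin> set (diag_mat ?B)"
    using assms(2,4) by (auto simp: diag_mat_def block_diag_def split: if_splits)
  ultimately have "det ?B \<noteq> 0" using upper_triangular_imp_det_eq_0_iff[OF c] by simp
  then show ?thesis using c zero by (auto simp: pattern_group_def GL_carrier)
qed

lemma block_diag_blocks:
  assumes "U1 \<in> carrier_mat d d" "U2 \<in> carrier_mat m m"
  shows "upper_block d (block_diag d m U1 U2) = U1" "lower_block d m (block_diag d m U1 U2) = U2"
  by (rule eq_matI; use assms in \<open>auto simp: upper_block_def lower_block_def block_diag_def\<close>)+

lemma levi_borel_levi: "levi_borel d m \<subseteq> levi d m"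
  unfolding pattern_group_def by auto

lemma levi_borel_subgroup: "subgroup (levi_borel d m) (GL (d + m))"
  by (rule pattern_group_subgroup) auto

text \<open>The base point of the open orbit: its nonzero entries are \<open>t\<close> ones on the antidiagonal
  through the lower left corner.\<close>

definition corner_matrix :: "nat \<Rightarrow> nat \<Rightarrow> nat \<Rightarrow> complex mat" where
  "corner_matrix d m t = mat m d (\<lambda>(i, j). if i + j = m - 1 \<and> j < t then 1 else 0)"

lemma corner_matrix_carrier [simp]: "corner_matrix d m t \<in> carrier_mat m d"
  by (simp add: corner_matrix_def)

lemma corner_matrix_det_variety: "corner_matrix d m t \<in> det_variety d m t"
proof -
  have "factors m d t (corner_matrix d m t)"
  proof (rule factorsI[where x = "\<lambda>i p. if i + p = m - 1 then 1 else 0" and y = "\<lambda>p j. if p = j then 1 else 0"])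
    fix i j assume ij: "i < m" "j < d"
    have "(\<Sum>p<t. (if i + p = m - 1 then 1 else 0) * (if p = j then 1 else (0 :: complex)))
        = (\<Sum>p<t. if p = j then if i + p = m - 1 then 1 else 0 else 0)" by (rule sum.cong) auto
    then show "corner_matrix d m t $$ (i, j)
        = (\<Sum>p<t. (if i + p = m - 1 then 1 else 0) * (if p = j then 1 else 0))"
      using ij by (auto simp: corner_matrix_def)
  qed
  then show ?thesis by (simp add: det_variety_iff)
qed

definition corner_product :: "nat \<Rightarrow> nat \<Rightarrow> complex mat \<Rightarrow> complex" where
  "corner_product m t A = (\<Prod>k<t. corner_minor m (Suc k) A)"

lemma corner_product_polynomial:
  assumes "t \<le> m" "t \<le> d"
  shows "corner_product m t \<in> function_algebra (mat_coords m d)"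
proof -
  have "(\<lambda>A. \<Prod>k<t. det (mat (Suc k) (Suc k) (\<lambda>(i, j). A $$ (m - 1 - i, j)))) \<in> function_algebra (mat_coords m d)"
    by (intro fa_prod fa_det mat_coord_fa) (use assms in auto)
  then show ?thesis unfolding corner_product_def[abs_def] corner_minor_def .
qed

lemma corner_product_corner_matrix:
  assumes "t \<le> m" "t \<le> d"
  shows "corner_product m t (corner_matrix d m t) \<noteq> 0"
proof -
  have "corner_minor m (Suc k) (corner_matrix d m t) = 1" if "k < t" for k
  proof -
    have "mat (Suc k) (Suc k) (\<lambda>(i, j). corner_matrix d m t $$ (m - 1 - i, j)) = 1\<^sub>m (Suc k)"
      using that assms by (intro eq_matI) (auto simp: corner_matrix_def)
    then show ?thesis unfolding corner_minor_def by simp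
  qed
  then show ?thesis unfolding corner_product_def by simp
qed

text \<open>The vectors \<open>a p\<close> produced by the elimination are, in reverse order, columns of an upper
  triangular matrix \<open>U2\<close>, and the vectors \<open>b p\<close> are rows of an upper triangular matrix \<open>U1\<close>;
  then \<open>A = U2 (corner_matrix d m t) U1\<close>.\<close>

lemma corner_product_orbit:
  assumes t: "t \<le> m" "t \<le> d" and A: "A \<in> det_variety d m t" "corner_product m t A \<noteq> 0"
  shows "\<exists>h \<in> levi_borel d m. A = levi_act d m h (corner_matrix d m t)"
proof -
  have Ac: "A \<in> carrier_mat m d" "factors m d t A" using A(1) by (auto simp: det_variety_iff)
  have minors: "corner_minor m (Suc k) A \<noteq> 0" if "k < t" for k
    using A(2) that unfolding corner_product_def by auto
  obtain a b :: "nat \<Rightarrow> nat \<Rightarrow> complex" where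
    ab: "\<And>p i. p < t \<Longrightarrow> i < m \<Longrightarrow> m - 1 - p < i \<Longrightarrow> a p i = 0" "\<And>p. p < t \<Longrightarrow> a p (m - 1 - p) \<noteq> 0"
      "\<And>p j. p < t \<Longrightarrow> j < p \<Longrightarrow> b p j = 0" "\<And>p. p < t \<Longrightarrow> b p p \<noteq> 0"
      "\<And>i j. i < m \<Longrightarrow> j < d \<Longrightarrow> A $$ (i, j) = (\<Sum>p<t. a p i * b p j)"
    using corner_factorization[OF Ac t minors] by blast
  \<comment> \<open>completed by unit vectors to square triangular matrices\<close>
  define U2 where "U2 = mat m m (\<lambda>(i, c). if m - 1 - c < t then a (m - 1 - c) i else if i = c then 1 else 0)"
  define U1 where "U1 = mat d d (\<lambda>(l, j). if l < t then b l j else if l = j then 1 else 0)"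
  have U: "U1 \<in> carrier_mat d d" "U2 \<in> carrier_mat m m" by (simp_all add: U1_def U2_def)
  have U1t: "U1 $$ (i, j) = 0" if "i < d" "j < i" for i j using that ab(3) by (auto simp: U1_def)
  have U1d: "U1 $$ (i, i) \<noteq> 0" if "i < d" for i using that ab(4) by (auto simp: U1_def)
  have U2t: "U2 $$ (i, j) = 0" if "i < m" "j < i" for i j
    using that ab(1)[of "m - 1 - j" i] by (auto simp: U2_def)
  have U2d: "U2 $$ (i, i) \<noteq> 0" if "i < m" for i using that ab(2)[of "m - 1 - i"] by (auto simp: U2_def)
  let ?g = "block_diag d m U1 (1\<^sub>m m)" and ?h = "block_diag d m (1\<^sub>m d) U2"
  have gB: "?g \<in> levi_borel d m" by (rule block_diag_borel) (use U1t U1d in auto)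
  have hB: "?h \<in> levi_borel d m" by (rule block_diag_borel) (use U2t U2d in auto)
  have gL: "?g \<in> levi d m" and hL: "?h \<in> levi d m" using gB hB levi_borel_levi by blast+
  let ?x = "corner_matrix d m t"
  interpret group "GL (d + m)" by (rule GL_group)
  have invinv: "inv\<^bsub>GL (d + m)\<^esub> (inv\<^bsub>GL (d + m)\<^esub> ?g) = ?g" using inv_inv[OF levi_GL[OF gL]] .
  have lg: "lower_block d m (inv\<^bsub>GL (d + m)\<^esub> ?g) = 1\<^sub>m m"
  proof -
    have "lower_block d m (inv\<^bsub>GL (d + m)\<^esub> ?g) * lower_block d m ?g = 1\<^sub>m m"
      using levi_block_mult(2)[OF levi_inv[OF gL] gL] GL_inv(3)[OF levi_GL[OF gL]] block_one(2) by simp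
    then show ?thesis using block_diag_blocks(2)[OF U(1), of "1\<^sub>m m" m] right_mult_one_mat[OF block_carrier(2)] by simp
  qed
  have act_g: "levi_act d m (inv\<^bsub>GL (d + m)\<^esub> ?g) ?x = ?x * U1"
    unfolding levi_act_def invinv lg using block_diag_blocks(1)[OF U(1), of "1\<^sub>m m" m]
      left_mult_one_mat[OF corner_matrix_carrier] by simp
  have uh: "upper_block d (inv\<^bsub>GL (d + m)\<^esub> ?h) = 1\<^sub>m d"
    using upper_block_inv(1)[OF hL] block_diag_blocks(1)[OF one_carrier_mat U(2), of d] right_mult_one_mat[OF block_carrier(1)] by simp
  have xU: "?x * U1 \<in> carrier_mat m d" by (rule mult_carrier_mat[OF corner_matrix_carrier U(1)])
  have UxU: "U2 * (?x * U1) \<in> carrier_mat m d" by (rule mult_carrier_mat[OF U(2) xU])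
  have act_h: "levi_act d m ?h (?x * U1) = U2 * (?x * U1)"
    unfolding levi_act_def uh using block_diag_blocks(2)[OF one_carrier_mat U(2), of d] right_mult_one_mat[OF UxU] by simp
  have "A = U2 * (?x * U1)"
  proof (rule eq_matI)
    fix i j assume "i < dim_row (U2 * (?x * U1))" "j < dim_col (U2 * (?x * U1))"
    then have ij: "i < m" "j < d" using U by auto
    have xU_e: "(?x * U1) $$ (c, j) = (if m - 1 - c < t then b (m - 1 - c) j else 0)" if c: "c < m" for c
    proof -
      have "(?x * U1) $$ (c, j) = (\<Sum>l<d. ?x $$ (c, l) * U1 $$ (l, j))"
        by (rule mat_mult_entry[OF corner_matrix_carrier U(1) c ij(2)])
      also have "\<dots> = (\<Sum>l<d. if l = m - 1 - c then if m - 1 - c < t then b (m - 1 - c) j else 0 else 0)"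
        using c ij(2) by (intro sum.cong refl) (auto simp: corner_matrix_def U1_def)
      finally show ?thesis using t by auto
    qed
    have "(U2 * (?x * U1)) $$ (i, j) = (\<Sum>c<m. U2 $$ (i, c) * (?x * U1) $$ (c, j))"
      by (rule mat_mult_entry[OF U(2) xU ij])
    also have "\<dots> = (\<Sum>c<m. if m - 1 - c < t then a (m - 1 - c) i * b (m - 1 - c) j else 0)"
      using ij by (intro sum.cong refl) (auto simp: xU_e U2_def)
    also have "\<dots> = (\<Sum>p<m. if p < t then a p i * b p j else 0)"
      by (rule sum.reindex_bij_witness[where i = "\<lambda>p. m - 1 - p" and j = "\<lambda>p. m - 1 - p"]) auto
    also have "\<dots> = (\<Sum>p<t. a p i * b p j)"
      using t by (intro sum.mono_neutral_cong_right) auto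
    finally show "A $$ (i, j) = (U2 * (?x * U1)) $$ (i, j)" using ab(5)[OF ij] by simp
  qed (use Ac U in auto)
  then have "A = levi_act d m (?h * inv\<^bsub>GL (d + m)\<^esub> ?g) ?x"
    using levi_act_mult[OF hL levi_inv[OF gL] corner_matrix_carrier, of t] act_g act_h by simp
  moreover have "?h * inv\<^bsub>GL (d + m)\<^esub> ?g \<in> levi_borel d m"
    using subgroup.m_closed[OF levi_borel_subgroup hB subgroup.m_inv_closed[OF levi_borel_subgroup gB]] by simp
  ultimately show ?thesis by (intro bexI[of _ "?h * inv\<^bsub>GL (d + m)\<^esub> ?g"])
qed

definition corner_orbit :: "nat \<Rightarrow> nat \<Rightarrow> nat \<Rightarrow> complex mat set" where
  "corner_orbit d m t = (\<lambda>h. levi_act d m h (corner_matrix d m t)) ` levi_borel d m"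

lemma corner_orbit_eq:
  "orbit (GL_sub (d + m) (levi_borel d m)) (cell_action d (d + m) (det_variety d m t)) (corner_matrix d m t)
    = corner_orbit d m t"
proof -
  have "orbit (GL_sub (d + m) (levi_borel d m)) (cell_action d (d + m) (det_variety d m t)) (corner_matrix d m t)
    = (\<lambda>h. cell_action d (d + m) (det_variety d m t) h (corner_matrix d m t)) ` levi_borel d m"
    unfolding orbit_def by auto
  also have "\<dots> = corner_orbit d m t"
    unfolding corner_orbit_def
    by (rule image_cong[OF HOL.refl]) (rule cell_action_eq[OF _ corner_matrix_det_variety], use levi_borel_levi in blast)
  finally show ?thesis .
qed

lemma corner_orbit_nonempty: "corner_matrix d m t \<in> corner_orbit d m t"
proof -
  have "1\<^sub>m (d + m) \<in> levi_borel d m" using subgroup.one_closed[OF levi_borel_subgroup] by simp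
  then show ?thesis unfolding corner_orbit_def
    by (intro image_eqI[of _ _ "1\<^sub>m (d + m)"]) (simp_all add: levi_act_one)
qed

lemma levi_act_polynomial:
  assumes "f \<in> function_algebra (mat_coords m d)"
  shows "\<exists>f' \<in> function_algebra (mat_coords m d). \<forall>A \<in> carrier_mat m d. f' A = f (levi_act d m g A)"
proof -
  define u where "u = upper_block d (inv\<^bsub>GL (d + m)\<^esub> g)"
  define \<phi> where "\<phi> = (\<lambda>A :: complex mat. mat m d (\<lambda>(i, j). \<Sum>l<d. (\<Sum>k<m. lower_block d m g $$ (i, k) * A $$ (k, l)) * u $$ (l, j)))"
  have "levi_act d m g A = \<phi> A" if A: "A \<in> carrier_mat m d" for A
  proof (rule eq_matI)
    fix i j assume "i < dim_row (\<phi> A)" "j < dim_col (\<phi> A)"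
    then have ij: "i < m" "j < d" by (auto simp: \<phi>_def)
    have lA: "lower_block d m g * A \<in> carrier_mat m d" by (rule mult_carrier_mat[OF block_carrier(2) A])
    have "levi_act d m g A $$ (i, j) = (\<Sum>l<d. (lower_block d m g * A) $$ (i, l) * u $$ (l, j))"
      unfolding levi_act_def u_def by (rule mat_mult_entry[OF lA block_carrier(1) ij])
    also have "\<dots> = \<phi> A $$ (i, j)"
      using ij mat_mult_entry[OF block_carrier(2) A ij(1)] by (simp add: \<phi>_def)
    finally show "levi_act d m g A $$ (i, j) = \<phi> A $$ (i, j)" .
  qed (use levi_act_carrier[OF A, of g] in \<open>auto simp: \<phi>_def\<close>)
  moreover have "(\<lambda>A. f (\<phi> A)) \<in> function_algebra (mat_coords m d)"
  proof (rule fa_subst[OF assms])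
    fix c assume "c \<in> mat_coords m d"
    then obtain i j where ij: "i < m" "j < d" "c = (\<lambda>A. A $$ (i, j))" unfolding mat_coords_def by blast
    have "(\<lambda>A. \<Sum>l<d. (\<Sum>k<m. lower_block d m g $$ (i, k) * A $$ (k, l)) * u $$ (l, j)) \<in> function_algebra (mat_coords m d)"
      by (intro fa_sum function_algebra.mult function_algebra.const mat_coord_fa) auto
    moreover have "(\<lambda>A. c (\<phi> A)) = (\<lambda>A. \<Sum>l<d. (\<Sum>k<m. lower_block d m g $$ (i, k) * A $$ (k, l)) * u $$ (l, j))"
      using ij by (auto simp: \<phi>_def)
    ultimately show "(\<lambda>A. c (\<phi> A)) \<in> function_algebra (mat_coords m d)" by simp
  qed
  ultimately show ?thesis by (intro bexI[of _ "\<lambda>A. f (\<phi> A)"]) auto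
qed

text \<open>The orbit is the union of the translates of the open set where the corner minors do not
  vanish.\<close>

lemma corner_orbit_open:
  assumes t: "t \<le> m" "t \<le> d"
  shows "openin (subtopology (zariski_mat m d) (det_variety d m t)) (corner_orbit d m t)"
proof (subst openin_subopen, intro ballI)
  let ?V = "det_variety d m t" and ?x = "corner_matrix d m t"
  fix B assume "B \<in> corner_orbit d m t"
  then obtain h where h: "h \<in> levi_borel d m" "B = levi_act d m h ?x" unfolding corner_orbit_def by blast
  have hL: "h \<in> levi d m" using h(1) levi_borel_levi by blast
  let ?h' = "inv\<^bsub>GL (d + m)\<^esub> h"
  obtain f where f: "f \<in> function_algebra (mat_coords m d)"
      "\<And>A. A \<in> carrier_mat m d \<Longrightarrow> f A = corner_product m t (levi_act d m ?h' A)"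
    using levi_act_polynomial[OF corner_product_polynomial[OF t], of ?h'] by blast
  let ?T = "{A \<in> carrier_mat m d. f A \<noteq> 0} \<inter> ?V"
  have BV: "B \<in> ?V" unfolding h(2) by (rule levi_act_det_variety[OF corner_matrix_det_variety])
  have "levi_act d m ?h' B = ?x" unfolding h(2) by (rule levi_act_inv(1)[OF hL corner_matrix_carrier])
  then have "B \<in> ?T" using BV det_variety_carrier[OF BV] f(2) corner_product_corner_matrix[OF t] by simp
  moreover have "?T \<subseteq> corner_orbit d m t"
  proof
    fix A assume "A \<in> ?T"
    then have A: "A \<in> carrier_mat m d" "f A \<noteq> 0" "A \<in> ?V" by auto
    then obtain k where k: "k \<in> levi_borel d m" "levi_act d m ?h' A = levi_act d m k ?x"
      using corner_product_orbit[OF t levi_act_det_variety[OF A(3), of ?h']] f(2) by auto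
    have kL: "k \<in> levi d m" using k(1) levi_borel_levi by blast
    have "A = levi_act d m h (levi_act d m k ?x)" using levi_act_inv(2)[OF hL A(1)] k(2) by simp
    also have "\<dots> = levi_act d m (h * k) ?x" by (rule levi_act_mult[OF hL kL corner_matrix_carrier, symmetric])
    finally show "A \<in> corner_orbit d m t" unfolding corner_orbit_def
      using subgroup.m_closed[OF levi_borel_subgroup h(1) k(1)] by auto
  qed
  moreover have "openin (subtopology (zariski_mat m d) ?V) ?T"
    using openin_zariski_mat_basic[OF f(1)] unfolding openin_subtopology by blast
  ultimately show "\<exists>T. openin (subtopology (zariski_mat m d) ?V) T \<and> B \<in> T \<and> T \<subseteq> corner_orbit d m t" by blast
qed

lemma corner_orbit_dense:
  assumes t: "t \<le> m" "t \<le> d"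
  shows "(subtopology (zariski_mat m d) (det_variety d m t)) closure_of (corner_orbit d m t) = det_variety d m t"
proof -
  have irr: "irreducible_space (subtopology (zariski_mat m d) (det_variety d m t))"
    using factor_pair.determinantal_irreducible unfolding irreducible_affine_variety_def by blast
  have "topspace (subtopology (zariski_mat m d) (det_variety d m t)) = det_variety d m t"
    using det_variety_carrier by auto
  moreover have "corner_orbit d m t \<noteq> {}" using corner_orbit_nonempty by blast
  ultimately show ?thesis using irreducible_open_dense[OF irr corner_orbit_open[OF t]] by simp
qed

theorem determinantal_spherical:
  assumes "t \<le> m" "t \<le> d"
  shows "spherical_variety (d + m) (levi d m) m d (det_variety d m t) (cell_action d (d + m) (det_variety d m t))"
  unfolding spherical_variety_def
proof (intro conjI)
  show "connected_reductive (d + m) (levi d m)" by (rule pattern_group_reductive) auto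
  show "irreducible_affine_variety m d (det_variety d m t)" by (rule factor_pair.determinantal_irreducible)
  show "algebraic_action (d + m) (levi d m) m d (det_variety d m t) (cell_action d (d + m) (det_variety d m t))"
    by (rule cell_action_algebraic)
  show "normal_affine_variety m d (det_variety d m t)" by (rule factor_pair.determinantal_normal)
  show "\<exists>H. borel_subgroup (d + m) (levi d m) H \<and> (\<exists>x\<in>det_variety d m t.
      openin (subtopology (zariski_mat m d) (det_variety d m t))
        (orbit (GL_sub (d + m) H) (cell_action d (d + m) (det_variety d m t)) x) \<and>
      subtopology (zariski_mat m d) (det_variety d m t) closure_of
        orbit (GL_sub (d + m) H) (cell_action d (d + m) (det_variety d m t)) x = det_variety d m t)"
    using borel_of_levi corner_orbit_open[OF assms] corner_orbit_dense[OF assms] corner_matrix_det_variety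
    by (intro exI[of _ "levi_borel d m"] conjI bexI[of _ "corner_matrix d m t"]) (simp_all add: corner_orbit_eq)
qed

section \<open>Pluecker coordinates\<close>

lemma pick_bij:
  assumes "finite I" "card I = d" shows "bij_betw (pick I) {..<d} I"
proof -
  have inj: "inj_on (pick I) {..<d}"
  proof (rule inj_onI)
    fix p q assume pq: "p \<in> {..<d}" "q \<in> {..<d}" and eq: "pick I p = pick I q"
    have "p = card {a \<in> I. a < pick I p}" using card_pick_le[of p I] pq(1) assms(2) by simp
    also have "\<dots> = q" using card_pick_le[of q I] pq(2) assms(2) eq by simp
    finally show "p = q" .
  qed
  have "pick I ` {..<d} \<subseteq> I" using pick_in_set_le assms(2) by auto
  moreover have "card (pick I ` {..<d}) = card I" using card_image[OF inj] assms(2) by simp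
  ultimately have "pick I ` {..<d} = I" using card_subset_eq[OF assms(1)] by blast
  then show ?thesis using inj unfolding bij_betw_def by blast
qed

lemma pluecker_index_finite: "I \<in> pluecker_index d N \<Longrightarrow> finite I"
  unfolding pluecker_index_def using finite_subset by blast

lemma pluecker_minor:
  assumes M: "M \<in> carrier_mat N d" and I: "I \<in> pluecker_index d N"
  shows "pluecker d N M I = det (mat d d (\<lambda>(p, q). M $$ (pick I p, q)))"
proof -
  have "{i. i < dim_row M \<and> i \<in> I} = I" using M I by (auto simp: pluecker_index_def)
  moreover have "card I = d" using I by (simp add: pluecker_index_def)
  moreover have "{j. j < dim_col M \<and> j \<in> {..<d}} = {..<d}" using M by auto
  moreover have "pick {..<d} q = q" if "q < d" for q
    using pick_reduce_set[of q d UNIV] that by (simp add: pick_UNIV lessThan_def)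
  ultimately have "submatrix M I {..<d} = mat d d (\<lambda>(p, q). M $$ (pick I p, q))"
    unfolding submatrix_def by (intro eq_matI) auto
  then show ?thesis using I by (simp add: pluecker_def)
qed

lemma pick_less: "I \<in> pluecker_index d N \<Longrightarrow> p < d \<Longrightarrow> pick I p < N"
  using pick_in_set_le[of p I] by (auto simp: pluecker_index_def)

text \<open>Pluecker coordinates are translated to the nonsingularity of sets of rows at once, since
  the arguments below exchange rows.\<close>

lemma pluecker_nonzero_iff:
  assumes M: "M \<in> carrier_mat N d" and I: "I \<in> pluecker_index d N"
  shows "pluecker d N M I \<noteq> 0 \<longleftrightarrow> nonsing M I {..<d}"
proof
  have bij: "bij_betw (pick I) {..<d} I" using I by (intro pick_bij pluecker_index_finite) (auto simp: pluecker_index_def)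
  show "nonsing M I {..<d} \<Longrightarrow> pluecker d N M I \<noteq> 0"
    unfolding pluecker_minor[OF assms] using nonsing_imp_det[OF _ bij, of M "{..<d}" "\<lambda>q. q"] by (simp add: bij_betw_def inj_on_def)
  assume "pluecker d N M I \<noteq> 0"
  then have *: "\<forall>v. (\<forall>p<d. (\<Sum>q<d. M $$ (pick I p, q) * v q) = 0) \<longrightarrow> (\<forall>q<d. v q = 0)"
    unfolding pluecker_minor[OF assms] using det_nonzero_iff_kernel[of d "\<lambda>(p, q). M $$ (pick I p, q)"] by simp
  have pin: "pick I p \<in> I" if "p < d" for p using bij that by (auto simp: bij_betw_def)
  show "nonsing M I {..<d}" unfolding nonsing_def using * pin by auto
qed

lemma pluecker_mult:
  assumes M: "M \<in> carrier_mat N d" and P: "P \<in> carrier_mat d d" and I: "I \<in> pluecker_index d N"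
  shows "pluecker d N (M * P) I = det P * pluecker d N M I"
proof -
  have MP: "M * P \<in> carrier_mat N d" by (rule mult_carrier_mat[OF M P])
  let ?S = "mat d d (\<lambda>(p, q). M $$ (pick I p, q))"
  have Sc: "?S \<in> carrier_mat d d" by simp
  have "mat d d (\<lambda>(p, q). (M * P) $$ (pick I p, q)) = ?S * P"
  proof (rule eq_matI)
    fix p q assume "p < dim_row (?S * P)" "q < dim_col (?S * P)"
    then have pq: "p < d" "q < d" using P by auto
    show "mat d d (\<lambda>(p, q). (M * P) $$ (pick I p, q)) $$ (p, q) = (?S * P) $$ (p, q)"
      unfolding mat_mult_entry[OF Sc P pq] using pq mat_mult_entry[OF M P pick_less[OF I pq(1)] pq(2)] by simp
  qed (use P in auto)
  then show ?thesis unfolding pluecker_minor[OF MP I] pluecker_minor[OF M I]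
    using det_mult[OF Sc P] by simp
qed

lemma homogeneous_mult:
  assumes "f \<in> homogeneous_polynomials d N" "g \<in> homogeneous_polynomials d N"
  shows "(\<lambda>p. f p * g p) \<in> homogeneous_polynomials d N"
proof -
  obtain k l where "\<forall>c p. f (\<lambda>I. c * p I) = c ^ k * f p" "\<forall>c p. g (\<lambda>I. c * p I) = c ^ l * g p"
    using assms unfolding homogeneous_polynomials_def by blast
  then have "\<forall>c p. f (\<lambda>I. c * p I) * g (\<lambda>I. c * p I) = c ^ (k + l) * (f p * g p)"
    by (simp add: power_add mult.left_commute mult.assoc)
  then show ?thesis using assms unfolding homogeneous_polynomials_def by (auto intro: function_algebra.mult)
qed

lemma homogeneous_one: "(\<lambda>_. 1) \<in> homogeneous_polynomials d N"
  unfolding homogeneous_polynomials_def by (auto intro: function_algebra.const exI[of _ 0])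

lemma homogeneous_coordinate: "I \<in> pluecker_index d N \<Longrightarrow> (\<lambda>p. p I) \<in> homogeneous_polynomials d N"
  unfolding homogeneous_polynomials_def by (auto intro: function_algebra.coord exI[of _ 1])

text \<open>A change of basis multiplies all Pluecker coordinates by the same determinant, so whether
  a homogeneous polynomial vanishes depends only on the subspace.\<close>

lemma homogeneous_pluecker_mult:
  assumes f: "f \<in> homogeneous_polynomials d N"
  shows "\<exists>k. \<forall>M \<in> carrier_mat N d. \<forall>P \<in> carrier_mat d d. f (pluecker d N (M * P)) = det P ^ k * f (pluecker d N M)"
proof -
  obtain k where k: "\<And>c p. f (\<lambda>I. c * p I) = c ^ k * f p" using f unfolding homogeneous_polynomials_def by blast
  have "f (pluecker d N (M * P)) = det P ^ k * f (pluecker d N M)" if M: "M \<in> carrier_mat N d" "P \<in> carrier_mat d d" for M P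
  proof -
    have "f (pluecker d N (M * P)) = f (\<lambda>I. det P * pluecker d N M I)"
      by (rule fa_eqI[of f "(\<lambda>I p. p I) ` pluecker_index d N"])
        (use f pluecker_mult[OF M] in \<open>auto simp: homogeneous_polynomials_def\<close>)
    then show ?thesis using k by simp
  qed
  then show ?thesis by blast
qed

section \<open>The Zariski topology of the Grassmannian\<close>

definition gr_basic :: "nat \<Rightarrow> nat \<Rightarrow> ((nat set \<Rightarrow> complex) \<Rightarrow> complex) \<Rightarrow> complex vec set set" where
  "gr_basic d N f = {W \<in> grassmannian d N. \<exists>A \<in> carrier_mat N d.
         vec_space.col_space N A = W \<and> f (pluecker d N A) \<noteq> 0}"

lemma gr_basic_iff:
  assumes f: "f \<in> homogeneous_polynomials d N" and M: "M \<in> carrier_mat N d" "nonsing M {..<N} {..<d}"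
  shows "vec_space.col_space N M \<in> gr_basic d N f \<longleftrightarrow> f (pluecker d N M) \<noteq> 0"
proof
  have Gr: "vec_space.col_space N M \<in> grassmannian d N" using col_space_grassmannian[OF M(1)] M(2) by simp
  show "f (pluecker d N M) \<noteq> 0 \<Longrightarrow> vec_space.col_space N M \<in> gr_basic d N f"
    unfolding gr_basic_def using M(1) Gr by blast
  assume "vec_space.col_space N M \<in> gr_basic d N f"
  then obtain A where A: "A \<in> carrier_mat N d" "vec_space.col_space N A = vec_space.col_space N M" "f (pluecker d N A) \<noteq> 0"
    unfolding gr_basic_def by blast
  have "nonsing A {..<N} {..<d}" using col_space_grassmannian[OF A(1)] Gr A(2) by simp
  then obtain P where P: "P \<in> carrier_mat d d" "A = M * P" using col_space_eqD[OF M(1) A(1)] A(2) by metis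
  obtain k where "f (pluecker d N (M * P)) = det P ^ k * f (pluecker d N M)"
    using homogeneous_pluecker_mult[OF f] M(1) P(1) by blast
  then show "f (pluecker d N M) \<noteq> 0" using A(3) P(2) by auto
qed

lemma gr_basic_Int:
  assumes f: "f \<in> homogeneous_polynomials d N" and g: "g \<in> homogeneous_polynomials d N"
  shows "gr_basic d N f \<inter> gr_basic d N g = gr_basic d N (\<lambda>p. f p * g p)"
proof (rule Set.set_eqI)
  fix W
  show "W \<in> gr_basic d N f \<inter> gr_basic d N g \<longleftrightarrow> W \<in> gr_basic d N (\<lambda>p. f p * g p)"
  proof (cases "W \<in> grassmannian d N")
    case True
    then obtain M where M: "M \<in> carrier_mat N d" "nonsing M {..<N} {..<d}" "W = vec_space.col_space N M"
      using grassmannian_col_space by metis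
    show ?thesis unfolding M(3)
      using gr_basic_iff[OF f M(1,2)] gr_basic_iff[OF g M(1,2)] gr_basic_iff[OF homogeneous_mult[OF f g] M(1,2)] by simp
  qed (auto simp: gr_basic_def)
qed

lemma zariski_gr_generated: "zariski_gr d N = topology_generated_by (gr_basic d N ` homogeneous_polynomials d N)"
  unfolding zariski_gr_def gr_basic_def[abs_def] Setcompr_eq_image by (rule HOL.refl)

lemma openin_gr_basic: "f \<in> homogeneous_polynomials d N \<Longrightarrow> openin (zariski_gr d N) (gr_basic d N f)"
  unfolding zariski_gr_generated by (rule topology_generated_by_Basis) blast

lemma zariski_gr_base:
  assumes "openin (zariski_gr d N) U" "W \<in> U"
  shows "\<exists>f \<in> homogeneous_polynomials d N. W \<in> gr_basic d N f \<and> gr_basic d N f \<subseteq> U"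
proof -
  have "a \<inter> b \<in> gr_basic d N ` homogeneous_polynomials d N"
    if "a \<in> gr_basic d N ` homogeneous_polynomials d N" "b \<in> gr_basic d N ` homogeneous_polynomials d N" for a b
    using that gr_basic_Int homogeneous_mult by auto
  then show ?thesis
    using generated_topology_base[of "gr_basic d N ` homogeneous_polynomials d N" U W] assms
    unfolding zariski_gr_generated by auto
qed

lemma topspace_zariski_gr [simp]: "topspace (zariski_gr d N) = grassmannian d N"
proof
  show "topspace (zariski_gr d N) \<subseteq> grassmannian d N"
    unfolding zariski_gr_generated topology_generated_by_topspace gr_basic_def by blast
  have "W \<in> gr_basic d N (\<lambda>_. 1)" if "W \<in> grassmannian d N" for W
    using that grassmannian_col_space[OF that] unfolding gr_basic_def by auto
  then show "grassmannian d N \<subseteq> topspace (zariski_gr d N)"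
    unfolding zariski_gr_generated topology_generated_by_topspace using homogeneous_one by blast
qed

section \<open>Subspaces whose lower rows have bounded rank\<close>

text \<open>The candidate for the Schubert variety: the subspaces whose projection to the last \<open>m\<close>
  coordinates has dimension at most \<open>t\<close>.\<close>

definition rank_locus :: "nat \<Rightarrow> nat \<Rightarrow> nat \<Rightarrow> complex vec set set" where
  "rank_locus d m t = {vec_space.col_space (d + m) M | M.
     M \<in> carrier_mat (d + m) d \<and> nonsing M {..<d + m} {..<d} \<and> factors m d t (lower_rows d m M)}"

lemma rank_locus_grassmannian: "rank_locus d m t \<subseteq> grassmannian d (d + m)"
  unfolding rank_locus_def using col_space_grassmannian by blast

lemma rank_locus_iff:
  assumes M: "M \<in> carrier_mat (d + m) d" "nonsing M {..<d + m} {..<d}"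
  shows "vec_space.col_space (d + m) M \<in> rank_locus d m t \<longleftrightarrow> factors m d t (lower_rows d m M)"
proof
  show "factors m d t (lower_rows d m M) \<Longrightarrow> vec_space.col_space (d + m) M \<in> rank_locus d m t"
    unfolding rank_locus_def using M by blast
  assume "vec_space.col_space (d + m) M \<in> rank_locus d m t"
  then obtain A where A: "A \<in> carrier_mat (d + m) d" "factors m d t (lower_rows d m A)"
      "vec_space.col_space (d + m) M = vec_space.col_space (d + m) A"
    unfolding rank_locus_def by blast
  obtain P where P: "P \<in> carrier_mat d d" "M = A * P" using col_space_eqD[OF A(1) M A(3)] by metis
  show "factors m d t (lower_rows d m M)"
    unfolding P(2) lower_rows_mult[OF A(1) P(1)] by (rule factors_mult_right[OF lower_rows_carrier P(1) A(2)])
qed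

text \<open>A set of \<open>d\<close> rows with more than \<open>t\<close> lower ones is singular: the upper rows together with
  the \<open>t\<close> rows of the right factor of the lower part give fewer than \<open>d\<close> equations for a kernel
  vector.\<close>

lemma many_lower_rows_dependent:
  assumes "factors m d t (lower_rows d m M)" and I: "I \<in> pluecker_index d (d + m)" "t < card (I - {..<d})"
  shows "\<not> nonsing M I {..<d}"
proof
  assume ns: "nonsing M I {..<d}"
  obtain x y where xy: "\<And>i j. i < m \<Longrightarrow> j < d \<Longrightarrow> lower_rows d m M $$ (i, j) = (\<Sum>p<t. x i p * y p j)"
    using assms(1) unfolding factors_def by blast
  have fin: "finite I" by (rule pluecker_index_finite[OF I(1)])
  let ?E = "(I \<inter> {..<d}) <+> {..<t}"
  define a where "a = (\<lambda>e k. case e of Inl i \<Rightarrow> M $$ (i, k) | Inr p \<Rightarrow> y p k)"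
  have "card I = card (I \<inter> {..<d}) + card (I - {..<d})" using fin by (metis card_Int_Diff)
  then have "card ?E < card {..<d}" using I fin by (simp add: card_Plus pluecker_index_def)
  then obtain v where v: "\<exists>k\<in>{..<d}. v k \<noteq> 0" "\<forall>e\<in>?E. (\<Sum>k\<in>{..<d}. a e k * v k) = 0"
    using underdetermined_system[of ?E "{..<d}" a] fin by auto
  have up: "(\<Sum>k\<in>{..<d}. M $$ (i, k) * v k) = 0" if "i \<in> I" "i < d" for i
  proof -
    have "Inl i \<in> ?E" using that by auto
    then have "(\<Sum>k\<in>{..<d}. a (Inl i) k * v k) = 0" using v(2) by blast
    then show ?thesis by (simp add: a_def)
  qed
  have yv: "(\<Sum>k\<in>{..<d}. y p k * v k) = 0" if "p < t" for p
  proof -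
    have "Inr p \<in> ?E" using that by auto
    then have "(\<Sum>k\<in>{..<d}. a (Inr p) k * v k) = 0" using v(2) by blast
    then show ?thesis by (simp add: a_def)
  qed
  have "(\<Sum>k\<in>{..<d}. M $$ (i, k) * v k) = 0" if "i \<in> I" for i
  proof (cases "i < d")
    case False
    then have i: "i - d < m" "d + (i - d) = i" using I(1) that by (auto simp: pluecker_index_def)
    have "M $$ (i, k) = (\<Sum>p<t. x (i - d) p * y p k)" if "k < d" for k
      using xy[OF i(1) that] i that by (simp add: lower_rows_def)
    then have "(\<Sum>k\<in>{..<d}. M $$ (i, k) * v k) = (\<Sum>k<d. \<Sum>p<t. x (i - d) p * (y p k * v k))"
      by (simp add: sum_distrib_right mult.assoc)
    also have "\<dots> = (\<Sum>p<t. x (i - d) p * (\<Sum>k<d. y p k * v k))"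
      by (subst sum.swap) (simp add: sum_distrib_left)
    finally show ?thesis using yv by simp
  qed (use up that in blast)
  then show False using nonsingD[OF ns] v(1) by blast
qed

text \<open>Steinitz exchange: \<open>d + 1\<close> rows of length \<open>d\<close> are dependent, with a nonzero coefficient at
  \<open>r\<close> as the rows in \<open>I\<close> are independent. Every row with a nonzero coefficient is a combination
  of the others, so \<open>r\<close> can take its place.\<close>

lemma row_exchange:
  assumes ns: "nonsing M I {..<d}" and I: "finite I" "card I = d" and r: "r \<notin> I"
  shows "\<exists>c. (\<forall>j<d. M $$ (r, j) = (\<Sum>i\<in>I. c i * M $$ (i, j))) \<and>
    (\<forall>i\<in>I. c i \<noteq> 0 \<longrightarrow> nonsing M (insert r (I - {i})) {..<d})"
proof -
  \<comment> \<open>the rows in \<open>I\<close> are independent: without a dependent row \<open>i0\<close> they still would have the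
    same kernel, which is nonzero for \<open>d - 1\<close> rows\<close>
  have dep: False if c: "\<And>j. j < d \<Longrightarrow> (\<Sum>i\<in>I. c i * M $$ (i, j)) = 0" and i0: "i0 \<in> I" "c i0 \<noteq> 0" for c i0
  proof -
    have "card (I - {i0}) < card {..<d}" using I i0(1) by (metis card_Diff1_less card_lessThan)
    then obtain v where v: "\<exists>k\<in>{..<d}. v k \<noteq> 0" "\<forall>i\<in>I - {i0}. (\<Sum>k\<in>{..<d}. M $$ (i, k) * v k) = 0"
      using underdetermined_system[of "I - {i0}" "{..<d}" "\<lambda>i k. M $$ (i, k)"] I by auto
    have "0 = (\<Sum>k<d. (\<Sum>i\<in>I. c i * M $$ (i, k)) * v k)" using c by simp
    also have "\<dots> = (\<Sum>k<d. \<Sum>i\<in>I. c i * (M $$ (i, k) * v k))" by (simp add: sum_distrib_right mult.assoc)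
    also have "\<dots> = (\<Sum>i\<in>I. c i * (\<Sum>k<d. M $$ (i, k) * v k))" by (subst sum.swap) (simp add: sum_distrib_left)
    also have "\<dots> = c i0 * (\<Sum>k<d. M $$ (i0, k) * v k)"
      using v(2) by (subst sum.remove[OF I(1) i0(1)]) simp
    finally have "(\<Sum>k<d. M $$ (i, k) * v k) = 0" if "i \<in> I" for i using v(2) i0 that by (cases "i = i0") auto
    then show False using nonsingD[OF ns] v(1) by blast
  qed
  have "card {..<d} < card (insert r I)" using I r by simp
  then obtain c where c: "\<exists>k\<in>insert r I. c k \<noteq> 0" "\<forall>j\<in>{..<d}. (\<Sum>k\<in>insert r I. M $$ (k, j) * c k) = 0"
    using underdetermined_system[of "{..<d}" "insert r I" "\<lambda>j k. M $$ (k, j)"] I by auto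
  have c': "M $$ (r, j) * c r + (\<Sum>i\<in>I. c i * M $$ (i, j)) = 0" if "j < d" for j
    using c(2) that I(1) r by (simp add: mult.commute)
  have cr: "c r \<noteq> 0"
  proof
    assume "c r = 0"
    then show False using dep[of c] c(1) c' by auto
  qed
  define b where "b = (\<lambda>i. - c i / c r)"
  have b: "M $$ (r, j) = (\<Sum>i\<in>I. b i * M $$ (i, j))" if "j < d" for j
  proof -
    have "M $$ (r, j) = - (\<Sum>i\<in>I. c i * M $$ (i, j)) / c r" using c'[OF that] cr by (simp add: field_simps eq_neg_iff_add_eq_0)
    also have "\<dots> = (\<Sum>i\<in>I. b i * M $$ (i, j))" by (simp add: b_def sum_negf sum_divide_distrib)
    finally show ?thesis .
  qed
  moreover have "nonsing M (insert r (I - {i0})) {..<d}" if i0: "i0 \<in> I" "b i0 \<noteq> 0" for i0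
    unfolding nonsing_def
  proof (intro allI impI)
    fix v assume v: "\<forall>i\<in>insert r (I - {i0}). (\<Sum>l\<in>{..<d}. M $$ (i, l) * v l) = 0"
    have "0 = (\<Sum>k<d. M $$ (r, k) * v k)" using v by simp
    also have "\<dots> = (\<Sum>k<d. \<Sum>i\<in>I. b i * (M $$ (i, k) * v k))" by (simp add: b sum_distrib_right mult.assoc)
    also have "\<dots> = (\<Sum>i\<in>I. b i * (\<Sum>k<d. M $$ (i, k) * v k))" by (subst sum.swap) (simp add: sum_distrib_left)
    also have "\<dots> = b i0 * (\<Sum>k<d. M $$ (i0, k) * v k)" using v by (subst sum.remove[OF I(1) i0(1)]) simp
    finally have "(\<Sum>k<d. M $$ (i, k) * v k) = 0" if "i \<in> I" for i using v i0 that by (cases "i = i0") auto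
    then show "\<forall>l\<in>{..<d}. v l = 0" using nonsingD[OF ns] by blast
  qed
  ultimately show ?thesis by blast
qed

text \<open>Take a nonsingular set of \<open>d\<close> rows with as many lower rows as possible. By exchange, every
  other lower row is a combination of the lower rows of the set only; if there were at most \<open>t\<close>
  of them, the lower part would factor through \<open>t\<close>.\<close>

lemma many_independent_lower_rows:
  assumes M: "nonsing M {..<d + m} {..<d}" and nf: "\<not> factors m d t (lower_rows d m M)"
  shows "\<exists>I \<in> pluecker_index d (d + m). t < card (I - {..<d}) \<and> nonsing M I {..<d}"
proof -
  let ?P = "{I \<in> pluecker_index d (d + m). nonsing M I {..<d}}"
  let ?c = "\<lambda>I. card (I - {..<d})"
  have "finite (pluecker_index d (d + m))"
    by (rule finite_subset[of _ "Pow {..<d + m}"]) (auto simp: pluecker_index_def)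
  then have fin: "finite ?P" by simp
  have d0: "0 < d"
  proof (rule ccontr)
    assume "\<not> 0 < d"
    then show False using nf by (auto simp: factors_def)
  qed
  have "?P \<noteq> {}"
  proof -
    have "\<not> factors (d + m) d (d - 1) M" using nonsing_imp_not_factors[OF M] d0 by simp
    from not_factors_imp_nonsing[OF this] obtain K L where
      "K \<subseteq> {..<d + m}" "L \<subseteq> {..<d}" "card K = Suc (d - 1)" "card L = Suc (d - 1)" "nonsing M K L"
      by (elim exE conjE)
    moreover from this have "L = {..<d}" using card_subset_eq[of "{..<d}" L] d0 by simp
    ultimately show ?thesis using d0 unfolding pluecker_index_def by auto
  qed
  then have "Max (?c ` ?P) \<in> ?c ` ?P" using fin by (intro Max_in) auto
  then obtain I where I: "I \<in> ?P" and Imax: "Max (?c ` ?P) = ?c I" by (rule imageE)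
  have max: "?c J \<le> ?c I" if "J \<in> ?P" for J
    unfolding Imax[symmetric] using fin that by (intro Max_ge) auto
  have ns: "nonsing M I {..<d}" and Ii: "I \<in> pluecker_index d (d + m)" using I by blast+
  have Ip: "I \<subseteq> {..<d + m}" "card I = d" "finite I"
    using Ii pluecker_index_finite[OF Ii] by (auto simp: pluecker_index_def)
  have "t < ?c I"
  proof (rule ccontr)
    assume "\<not> t < ?c I"
    have "\<exists>c. \<forall>j<d. M $$ (d + r, j) = (\<Sum>i\<in>I - {..<d}. c i * M $$ (i, j))" if r: "r < m" for r
    proof (cases "d + r \<in> I")
      case True
      have "M $$ (d + r, j) = (\<Sum>i\<in>I - {..<d}. (if i = d + r then 1 else 0) * M $$ (i, j))" for j
      proof -
        have "(\<Sum>i\<in>I - {..<d}. (if i = d + r then 1 else 0) * M $$ (i, j))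
            = (\<Sum>i\<in>I - {..<d}. if i = d + r then M $$ (i, j) else 0)" by (rule sum.cong) auto
        then show ?thesis using True Ip(3) by simp
      qed
      then show ?thesis by (intro exI[of _ "\<lambda>i. if i = d + r then 1 else 0"] allI impI)
    next
      case False
      from row_exchange[OF ns Ip(3,2) this] obtain c where
        c: "\<And>j. j < d \<Longrightarrow> M $$ (d + r, j) = (\<Sum>i\<in>I. c i * M $$ (i, j))"
          "\<And>i. i \<in> I \<Longrightarrow> c i \<noteq> 0 \<Longrightarrow> nonsing M (insert (d + r) (I - {i})) {..<d}" by blast
      have c0: "c i = 0" if "i \<in> I" "i < d" for i
      proof (rule ccontr)
        assume "c i \<noteq> 0"
        let ?J = "insert (d + r) (I - {i})"
        have "nonsing M ?J {..<d}" using c(2) that \<open>c i \<noteq> 0\<close> by blast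
        moreover have "?J \<in> pluecker_index d (d + m)"
          using Ip False that(1) r d0 by (auto simp: pluecker_index_def)
        ultimately have "?c ?J \<le> ?c I" using max by blast
        moreover have "?J - {..<d} = insert (d + r) (I - {..<d})" using that(2) by auto
        ultimately show False using False Ip(3) by simp
      qed
      have "(\<Sum>i\<in>I. c i * M $$ (i, j)) = (\<Sum>i\<in>I - {..<d}. c i * M $$ (i, j))" for j
        by (rule sum.mono_neutral_right) (use Ip(3) c0 in auto)
      then show ?thesis using c(1) by auto
    qed
    then obtain c where c: "\<And>r j. r < m \<Longrightarrow> j < d \<Longrightarrow> M $$ (d + r, j) = (\<Sum>i\<in>I - {..<d}. c r i * M $$ (i, j))"
      by metis
    have "factors m d t (lower_rows d m M)"
      by (rule factors_through_columns[of "I - {..<d}", where c = c and y = "\<lambda>i j. M $$ (i, j)"])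
        (use Ip(3) \<open>\<not> t < ?c I\<close> c in \<open>auto simp: lower_rows_def\<close>)
    then show False using nf by blast
  qed
  then show ?thesis using I by blast
qed

text \<open>The locus is the common zero set of the Pluecker coordinates with more than \<open>t\<close> lower
  rows.\<close>

lemma rank_locus_closed: "closedin (zariski_gr d (d + m)) (rank_locus d m t)"
  unfolding closedin_def
proof (intro conjI)
  let ?T = "zariski_gr d (d + m)" and ?Z = "rank_locus d m t"
  show "?Z \<subseteq> topspace ?T" using rank_locus_grassmannian by simp
  show "openin ?T (topspace ?T - ?Z)"
  proof (subst openin_subopen, intro ballI)
    fix W assume "W \<in> topspace ?T - ?Z"
    then have W: "W \<in> grassmannian d (d + m)" "W \<notin> ?Z" by auto
    obtain M where M: "M \<in> carrier_mat (d + m) d" "nonsing M {..<d + m} {..<d}" "W = vec_space.col_space (d + m) M"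
      using grassmannian_col_space[OF W(1)] .
    have "\<not> factors m d t (lower_rows d m M)" using W(2) rank_locus_iff[OF M(1,2)] M(3) by simp
    then obtain I where I: "I \<in> pluecker_index d (d + m)" "t < card (I - {..<d})" "nonsing M I {..<d}"
      using many_independent_lower_rows[OF M(2)] by blast
    let ?U = "gr_basic d (d + m) (\<lambda>p. p I)"
    note h = homogeneous_coordinate[OF I(1)]
    have "W \<in> ?U" using gr_basic_iff[OF h M(1,2)] pluecker_nonzero_iff[OF M(1) I(1)] I(3) M(3) by simp
    moreover have "A \<notin> ?U" if AZ: "A \<in> ?Z" for A
    proof -
      obtain B where B: "B \<in> carrier_mat (d + m) d" "nonsing B {..<d + m} {..<d}" "factors m d t (lower_rows d m B)"
          "A = vec_space.col_space (d + m) B"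
        using AZ unfolding rank_locus_def by blast
      have "pluecker d (d + m) B I = 0"
        using pluecker_nonzero_iff[OF B(1) I(1)] many_lower_rows_dependent[OF B(3) I(1,2)] by metis
      then show ?thesis unfolding B(4) using gr_basic_iff[OF h B(1,2)] by metis
    qed
    moreover have "?U \<subseteq> topspace ?T" by (rule openin_subset[OF openin_gr_basic[OF h]])
    ultimately have "W \<in> ?U \<and> ?U \<subseteq> topspace ?T - ?Z" by (meson Diff_iff subsetD subsetI)
    then show "\<exists>U. openin ?T U \<and> W \<in> U \<and> U \<subseteq> topspace ?T - ?Z"
      by (intro exI[of _ ?U] conjI openin_gr_basic[OF h]) (elim conjE, assumption)+
  qed
qed

section \<open>Coordinate subspaces\<close>

definition coordinate_matrix :: "nat \<Rightarrow> nat \<Rightarrow> (nat \<Rightarrow> nat) \<Rightarrow> complex mat" where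
  "coordinate_matrix N d \<sigma> = mat N d (\<lambda>(i, j). if i = \<sigma> j then 1 else 0)"

lemma coordinate_matrix_carrier [simp]: "coordinate_matrix N d \<sigma> \<in> carrier_mat N d"
  "dim_row (coordinate_matrix N d \<sigma>) = N" "dim_col (coordinate_matrix N d \<sigma>) = d"
  by (simp_all add: coordinate_matrix_def)

lemma coordinate_matrix_nonsing:
  assumes "inj_on \<sigma> {..<d}" "\<sigma> ` {..<d} \<subseteq> {..<N}"
  shows "nonsing (coordinate_matrix N d \<sigma>) {..<N} {..<d}"
  unfolding nonsing_def
proof (intro allI impI ballI)
  fix v l assume v: "\<forall>i\<in>{..<N}. (\<Sum>l\<in>{..<d}. coordinate_matrix N d \<sigma> $$ (i, l) * v l) = 0" and l: "l \<in> {..<d}"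
  have sl: "\<sigma> l < N" using assms(2) l by auto
  have "(\<Sum>k\<in>{..<d}. coordinate_matrix N d \<sigma> $$ (\<sigma> l, k) * v k) = (\<Sum>k\<in>{..<d}. if k = l then v k else 0)"
    by (rule sum.cong) (use sl l assms(1) in \<open>auto simp: coordinate_matrix_def inj_on_def\<close>)
  then show "v l = 0" using v sl l by simp
qed

lemma coordinate_matrix_lower_factors:
  assumes "card {j. j < d \<and> d \<le> \<sigma> j} \<le> t"
  shows "factors m d t (lower_rows d m (coordinate_matrix (d + m) d \<sigma>))"
proof (rule factors_through_columns[OF _ assms, where c = "\<lambda>i l. if d + i = \<sigma> l then 1 else 0"
      and y = "\<lambda>l j. if l = j then 1 else 0"])
  fix i j assume ij: "i < m" "j < d"
  have "(\<Sum>l | l < d \<and> d \<le> \<sigma> l. (if d + i = \<sigma> l then 1 else 0) * (if l = j then 1 else (0 :: complex)))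
      = (\<Sum>l | l < d \<and> d \<le> \<sigma> l. if l = j then if d + i = \<sigma> l then 1 else 0 else 0)"
    by (rule sum.cong) auto
  then show "lower_rows d m (coordinate_matrix (d + m) d \<sigma>) $$ (i, j)
      = (\<Sum>l | l < d \<and> d \<le> \<sigma> l. (if d + i = \<sigma> l then 1 else 0) * (if l = j then 1 else 0))"
    using ij by (auto simp: lower_rows_def coordinate_matrix_def)
qed auto

lemma mult_coordinate_matrix:
  assumes g: "g \<in> carrier_mat N N" and "i < N" "j < d" "\<sigma> j < N"
  shows "(g * coordinate_matrix N d \<sigma>) $$ (i, j) = g $$ (i, \<sigma> j)"
proof -
  have "(g * coordinate_matrix N d \<sigma>) $$ (i, j) = (\<Sum>l<N. g $$ (i, l) * coordinate_matrix N d \<sigma> $$ (l, j))"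
    by (rule mat_mult_entry[OF g coordinate_matrix_carrier(1) assms(2,3)])
  also have "\<dots> = (\<Sum>l<N. if l = \<sigma> j then g $$ (i, l) else 0)"
    by (rule sum.cong) (use assms in \<open>auto simp: coordinate_matrix_def\<close>)
  finally show ?thesis using assms(4) by simp
qed

lemma coordinate_point_matrix:
  assumes "(\<lambda>l. l - 1) ` set w = \<sigma> ` {..<d}" "\<sigma> ` {..<d} \<subseteq> {..<N}"
  shows "coordinate_point N w = vec_space.col_space N (coordinate_matrix N d \<sigma>)"
proof -
  have "set (cols (mat_of_cols N (map (\<lambda>l. unit_vec N (l - 1)) w))) = (\<lambda>l. unit_vec N (l - 1) :: complex vec) ` set w"
    by (subst cols_mat_of_cols) auto
  also have "\<dots> = unit_vec N ` (\<lambda>l. l - 1) ` set w" by (simp add: image_image)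
  also have "\<dots> = (\<lambda>j. unit_vec N (\<sigma> j)) ` {..<d}" unfolding assms(1) by (simp add: image_image)
  also have "\<dots> = (\<lambda>j. col (coordinate_matrix N d \<sigma>) j) ` {..<d}"
  proof (rule image_cong[OF HOL.refl])
    fix j assume "j \<in> {..<d}"
    moreover from this have "\<sigma> j < N" using assms(2) by auto
    ultimately show "unit_vec N (\<sigma> j) = col (coordinate_matrix N d \<sigma>) j"
      by (intro eq_vecI) (auto simp: coordinate_matrix_def)
  qed
  also have "\<dots> = set (cols (coordinate_matrix N d \<sigma>))"
    by (auto simp: cols_def coordinate_matrix_def)
  finally show ?thesis unfolding coordinate_point_def vec_space.col_space_def by simp
qed

section \<open>The opposite big cell\<close>

lemma triangular_det:
  fixes g :: "complex mat"
  assumes g: "g \<in> carrier_mat N N" and low: "\<And>i j. i < N \<Longrightarrow> j < N \<Longrightarrow> i < j \<Longrightarrow> g $$ (i, j) = 0"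
  shows "det g \<noteq> 0 \<longleftrightarrow> (\<forall>i<N. g $$ (i, i) \<noteq> 0)"
proof -
  have gt: "transpose_mat g \<in> carrier_mat N N" using g by simp
  have "upper_triangular (transpose_mat g)" using low g by (auto simp: upper_triangular_def)
  then have "det (transpose_mat g) \<noteq> 0 \<longleftrightarrow> 0 \<notin> set (diag_mat (transpose_mat g))"
    using upper_triangular_imp_det_eq_0_iff[OF gt] by simp
  also have "\<dots> \<longleftrightarrow> (\<forall>i<N. g $$ (i, i) \<noteq> 0)" using g by (auto simp: diag_mat_def)
  finally show ?thesis using det_transpose[OF g] by simp
qed

text \<open>Multiplication from the right does not increase the rank of the lower rows, so the chart
  coordinate inherits every bound on it.\<close>

lemma invertible_top_in_chart:
  assumes M: "M \<in> carrier_mat (d + m) d" and top: "det (mat d d (\<lambda>(i, j). M $$ (i, j))) \<noteq> 0"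
  shows "\<exists>A \<in> carrier_mat m d. vec_space.col_space (d + m) M = cell_chart d (d + m) A \<and>
    (\<forall>t. factors m d t (lower_rows d m M) \<longrightarrow> factors m d t A)"
proof -
  let ?P = "mat d d (\<lambda>(i, j). M $$ (i, j))"
  let ?Q = "inv\<^bsub>GL d\<^esub> ?P"
  have Pc: "?P \<in> carrier_mat d d" by simp
  have PGL: "?P \<in> carrier (GL d)" using top by (simp add: GL_carrier)
  note Q = GL_inv[OF PGL]
  have Ac: "lower_rows d m M * ?Q \<in> carrier_mat m d" by (rule mult_carrier_mat[OF lower_rows_carrier Q(1)])
  have "lower_rows d m M * ?Q * ?P = lower_rows d m M"
    unfolding assoc_mult_mat[OF lower_rows_carrier Q(1) Pc] Q(3) by (rule right_mult_one_mat[OF lower_rows_carrier])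
  then have "vec_space.col_space (d + m) M = cell_chart d (d + m) (lower_rows d m M * ?Q)"
    by (intro col_space_cell[OF M Pc top _ Ac]) auto
  moreover have "factors m d t (lower_rows d m M * ?Q)" if "factors m d t (lower_rows d m M)" for t
    by (rule factors_mult_right[OF lower_rows_carrier Q(1) that])
  ultimately show ?thesis using Ac by blast
qed

lemma gr_action_coordinate:
  assumes "g \<in> carrier (GL N)" "inj_on \<sigma> {..<d}" "\<sigma> ` {..<d} \<subseteq> {..<N}"
  shows "gr_action d N g (vec_space.col_space N (coordinate_matrix N d \<sigma>))
    = vec_space.col_space N (g * coordinate_matrix N d \<sigma>)"
  by (rule gr_action_col_space[OF assms(1) coordinate_matrix_carrier(1) coordinate_matrix_nonsing[OF assms(2,3)]])

text \<open>A lower triangular invertible matrix has an invertible upper left block, and conversely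
  \<open>(1; A)\<close> can be completed to a lower unitriangular matrix.\<close>

lemma opposite_big_cell_chart: "opposite_big_cell d (d + m) = cell_chart d (d + m) ` carrier_mat m d"
proof -
  let ?N = "d + m" and ?E = "coordinate_matrix (d + m) d (\<lambda>j. j)"
  have pt: "coordinate_point ?N [1..<d + 1] = vec_space.col_space ?N ?E"
  proof (rule coordinate_point_matrix)
    have "(\<lambda>l. l - 1) ` {1..<d + 1} = {..<d}"
    proof
      show "{..<d} \<subseteq> (\<lambda>l. l - 1) ` {1..<d + 1}" by (intro subsetI, rule_tac x = "Suc x" in image_eqI) auto
    qed auto
    then show "(\<lambda>l. l - 1) ` set [1..<d + 1] = (\<lambda>j. j) ` {..<d}" by (simp only: set_upt image_ident)
  qed auto
  have inj: "inj_on (\<lambda>j. j :: nat) {..<d}" and rg: "(\<lambda>j. j) ` {..<d} \<subseteq> {..<?N}" by auto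
  have act: "gr_action d ?N g (vec_space.col_space ?N ?E) = vec_space.col_space ?N (g * ?E)"
    if "g \<in> lower_borel ?N" for g
    using gr_action_coordinate[OF _ inj rg] that by (simp add: lower_borel_def)
  have ent: "(g * ?E) $$ (i, j) = g $$ (i, j)" if "g \<in> carrier_mat ?N ?N" "i < ?N" "j < d" for g i j
    using mult_coordinate_matrix[OF that(1,2,3), of "\<lambda>j. j"] that(3) by simp
  have lowB: "g $$ (i, j) = 0" if "g \<in> lower_borel ?N" "i < ?N" "j < ?N" "i < j" for g i j
    using that by (auto simp: lower_borel_def GL_carrier upper_triangular_def)
  have "orbit (GL_sub ?N (lower_borel ?N)) (gr_action d ?N) (vec_space.col_space ?N ?E)
      = cell_chart d ?N ` carrier_mat m d"
  proof
    show "orbit (GL_sub ?N (lower_borel ?N)) (gr_action d ?N) (vec_space.col_space ?N ?E) \<subseteq> cell_chart d ?N ` carrier_mat m d"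
    proof
      fix W assume "W \<in> orbit (GL_sub ?N (lower_borel ?N)) (gr_action d ?N) (vec_space.col_space ?N ?E)"
      then obtain g where g: "g \<in> lower_borel ?N" "W = vec_space.col_space ?N (g * ?E)"
        unfolding orbit_def using act by auto
      have gc: "g \<in> carrier_mat ?N ?N" "det g \<noteq> 0" using g(1) by (auto simp: lower_borel_def GL_carrier)
      have diag: "g $$ (i, i) \<noteq> 0" if "i < ?N" for i
        using triangular_det[OF gc(1) lowB[OF g(1)]] gc(2) that by blast
      have gE: "g * ?E \<in> carrier_mat ?N d" by (rule mult_carrier_mat[OF gc(1) coordinate_matrix_carrier(1)])
      have "det (mat d d (\<lambda>(i, j). (g * ?E) $$ (i, j))) \<noteq> 0"
        by (subst triangular_det[of _ d]) (use ent[OF gc(1)] lowB[OF g(1)] diag in auto)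
      from invertible_top_in_chart[OF gE this] show "W \<in> cell_chart d ?N ` carrier_mat m d" unfolding g(2) by blast
    qed
  next
    show "cell_chart d ?N ` carrier_mat m d \<subseteq> orbit (GL_sub ?N (lower_borel ?N)) (gr_action d ?N) (vec_space.col_space ?N ?E)"
    proof (rule image_subsetI)
      fix A :: "complex mat" assume A: "A \<in> carrier_mat m d"
      define g where "g = mat ?N ?N (\<lambda>(i, j). if j < d then (1\<^sub>m d @\<^sub>r A) $$ (i, j) else if i = j then 1 else 0)"
      have gc: "g \<in> carrier_mat ?N ?N" by (simp add: g_def)
      have low: "g $$ (i, j) = 0" if "i < ?N" "j < ?N" "i < j" for i j
        using that append_one_entry[OF A, of i j] by (auto simp: g_def)
      have "g $$ (i, i) \<noteq> 0" if "i < ?N" for i using that append_one_entry[OF A, of i i] by (auto simp: g_def)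
      then have "det g \<noteq> 0" using triangular_det[OF gc low] by blast
      then have gB: "g \<in> lower_borel ?N" using gc low by (auto simp: lower_borel_def GL_carrier upper_triangular_def)
      have "g * ?E = 1\<^sub>m d @\<^sub>r A"
      proof (rule eq_matI)
        fix i j assume "i < dim_row (1\<^sub>m d @\<^sub>r A)" "j < dim_col (1\<^sub>m d @\<^sub>r A)"
        then have "i < ?N" "j < d" using append_one_carrier[OF A] by auto
        then show "(g * ?E) $$ (i, j) = (1\<^sub>m d @\<^sub>r A) $$ (i, j)" using ent[OF gc] by (simp add: g_def)
      qed (use append_one_carrier[OF A] gc coordinate_matrix_carrier(1)[of ?N d "\<lambda>j. j"] in auto)
      then have "cell_chart d ?N A = gr_action d ?N g (vec_space.col_space ?N ?E)"
        using act[OF gB] by (simp add: cell_chart_def)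
      then show "cell_chart d ?N A \<in> orbit (GL_sub ?N (lower_borel ?N)) (gr_action d ?N) (vec_space.col_space ?N ?E)"
        unfolding orbit_def using gB by auto
    qed
  qed
  then show ?thesis unfolding opposite_big_cell_def pt .
qed

section \<open>The Schubert variety\<close>

abbreviation parabolic_pattern :: "nat \<Rightarrow> nat \<Rightarrow> nat \<Rightarrow> bool" where
  "parabolic_pattern d i j \<equiv> j < d \<longrightarrow> i < d"

abbreviation parabolic :: "nat \<Rightarrow> nat \<Rightarrow> complex mat set" where
  "parabolic d m \<equiv> pattern_group (d + m) (parabolic_pattern d)"

lemma upper_borel_pattern: "upper_borel N = pattern_group N (\<le>)"
  by (auto simp: upper_borel_def pattern_group_def GL_carrier upper_triangular_def)

lemma upper_borel_subgroup: "subgroup (upper_borel N) (GL N)"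
  unfolding upper_borel_pattern by (rule pattern_group_subgroup) auto

lemma upper_borel_parabolic: "upper_borel (d + m) \<subseteq> parabolic d m"
  unfolding upper_borel_pattern by (auto simp: pattern_group_def)

lemma levi_borel_upper_borel: "levi_borel d m \<subseteq> upper_borel (d + m)"
  unfolding upper_borel_pattern by (auto simp: pattern_group_def)

text \<open>For a block upper triangular \<open>g\<close> the lower rows of \<open>g M\<close> are \<open>g\<^sub>2\<close> times the lower rows of
  \<open>M\<close>.\<close>

lemma parabolic_rank_locus:
  assumes g: "g \<in> parabolic d m" and W: "W \<in> rank_locus d m t"
  shows "gr_action d (d + m) g W \<in> rank_locus d m t"
proof -
  have gG: "g \<in> carrier (GL (d + m))" by (rule pattern_group_GL[OF g])
  note gc = GL_carrier_mat[OF gG]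
  obtain M where M: "M \<in> carrier_mat (d + m) d" "nonsing M {..<d + m} {..<d}" "factors m d t (lower_rows d m M)"
      "W = vec_space.col_space (d + m) M"
    using W unfolding rank_locus_def by blast
  have gM: "g * M \<in> carrier_mat (d + m) d" by (rule mult_carrier_mat[OF gc M(1)])
  have "lower_rows d m (g * M) = lower_block d m g * lower_rows d m M"
  proof (rule eq_matI)
    fix i j assume "i < dim_row (lower_block d m g * lower_rows d m M)" "j < dim_col (lower_block d m g * lower_rows d m M)"
    then have ij: "i < m" "j < d" by (auto simp: lower_block_def lower_rows_def)
    have "(g * M) $$ (d + i, j) = (\<Sum>l<d. g $$ (d + i, l) * M $$ (l, j)) + (\<Sum>l<m. g $$ (d + i, d + l) * M $$ (d + l, j))"
      using mat_mult_entry[OF gc M(1)] ij by (simp add: sum_split_add)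
    also have "(\<Sum>l<d. g $$ (d + i, l) * M $$ (l, j)) = 0"
      by (intro sum.neutral ballI) (use pattern_groupD[OF g] ij in auto)
    finally show "lower_rows d m (g * M) $$ (i, j) = (lower_block d m g * lower_rows d m M) $$ (i, j)"
      unfolding mat_mult_entry[OF block_carrier(2) lower_rows_carrier ij] using ij by (simp add: lower_rows_def lower_block_def)
  qed (auto simp: lower_rows_def lower_block_def)
  then have "factors m d t (lower_rows d m (g * M))"
    using factors_mult_left[OF block_carrier(2) lower_rows_carrier M(3)] by simp
  then show ?thesis
    unfolding M(4) gr_action_col_space[OF gG M(1,2)] rank_locus_iff[OF gM GL_mult_nonsing[OF gG M(1,2)]] .
qed

text \<open>The positions of the ones in a basis matrix of \<open>e\<^sub>w\<close>. A column space does not depend on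
  the order of the columns; this order starts with the lower positions, from bottom to top, to
  match the antidiagonal of \<open>corner_matrix\<close>.\<close>

definition schubert_index :: "nat \<Rightarrow> nat \<Rightarrow> nat \<Rightarrow> nat" where
  "schubert_index N t = (\<lambda>j. if j < t then N - 1 - j else j)"

abbreviation schubert_word :: "nat \<Rightarrow> nat \<Rightarrow> nat \<Rightarrow> nat list" where
  "schubert_word d N t \<equiv> [t + 1..<d + 1] @ [N - t + 1..<N + 1]"

lemma schubert_index_image:
  assumes "t \<le> d" "d \<le> N"
  shows "schubert_index N t ` {..<d} = {t..<d} \<union> {N - t..<N}"
proof
  show "schubert_index N t ` {..<d} \<subseteq> {t..<d} \<union> {N - t..<N}" using assms by (auto simp: schubert_index_def)
  have "i \<in> schubert_index N t ` {..<d}" if "N - t \<le> i" "i < N" for i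
    by (rule image_eqI[of _ _ "N - 1 - i"]) (use that assms in \<open>auto simp: schubert_index_def\<close>)
  moreover have "i \<in> schubert_index N t ` {..<d}" if "t \<le> i" "i < d" for i
    by (rule image_eqI[of _ _ i]) (use that in \<open>auto simp: schubert_index_def\<close>)
  ultimately show "{t..<d} \<union> {N - t..<N} \<subseteq> schubert_index N t ` {..<d}" by auto
qed

lemma schubert_point:
  assumes t: "t \<le> d" "t \<le> m"
  shows "coordinate_point (d + m) (schubert_word d (d + m) t)
    = vec_space.col_space (d + m) (coordinate_matrix (d + m) d (schubert_index (d + m) t))"
proof (rule coordinate_point_matrix)
  have shift: "(\<lambda>l. l - 1) ` {a + 1..<b + 1} = {a..<b}" for a b :: nat
  proof
    show "{a..<b} \<subseteq> (\<lambda>l. l - 1) ` {a + 1..<b + 1}" by (intro subsetI, rule_tac x = "Suc x" in image_eqI) auto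
  qed auto
  have "set (schubert_word d (d + m) t) = {t + 1..<d + 1} \<union> {(d + m - t) + 1..<(d + m) + 1}"
    by (simp only: set_append set_upt)
  then show "(\<lambda>l. l - 1) ` set (schubert_word d (d + m) t) = schubert_index (d + m) t ` {..<d}"
    unfolding schubert_index_image[OF t(1) le_add1] by (simp only: image_Un shift)
  show "schubert_index (d + m) t ` {..<d} \<subseteq> {..<d + m}" unfolding schubert_index_image[OF t(1) le_add1] by auto
qed

lemma schubert_index_inj:
  assumes "t \<le> d" "t \<le> m"
  shows "inj_on (schubert_index (d + m) t) {..<d}" "schubert_index (d + m) t ` {..<d} \<subseteq> {..<d + m}"
proof -
  show "inj_on (schubert_index (d + m) t) {..<d}"
  proof (rule inj_onI)
    fix i j assume "i \<in> {..<d}" "j \<in> {..<d}" "schubert_index (d + m) t i = schubert_index (d + m) t j"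
    then show "i = j" using assms by (simp add: schubert_index_def split: if_splits)
  qed
  show "schubert_index (d + m) t ` {..<d} \<subseteq> {..<d + m}" unfolding schubert_index_image[OF assms(1) le_add1] by auto
qed

lemma schubert_point_rank_locus:
  assumes "t \<le> d" "t \<le> m"
  shows "coordinate_point (d + m) (schubert_word d (d + m) t) \<in> rank_locus d m t"
proof -
  have "{j. j < d \<and> d \<le> schubert_index (d + m) t j} \<subseteq> {..<t}" by (auto simp: schubert_index_def split: if_splits)
  then have "card {j. j < d \<and> d \<le> schubert_index (d + m) t j} \<le> t"
    using card_mono[of "{..<t}"] by fastforce
  then show ?thesis
    unfolding schubert_point[OF assms] rank_locus_iff[OF coordinate_matrix_carrier(1) coordinate_matrix_nonsing[OF schubert_index_inj[OF assms]]]
    by (rule coordinate_matrix_lower_factors)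
qed

text \<open>The base point of the open orbit in the chart is obtained from \<open>e\<^sub>w\<close> by adding each of the
  \<open>t\<close> last rows to its mirror image among the \<open>t\<close> first rows, which is an upper triangular
  operation.\<close>

lemma corner_matrix_borel_orbit:
  assumes t: "t \<le> d" "t \<le> m"
  shows "\<exists>b \<in> upper_borel (d + m). cell_chart d (d + m) (corner_matrix d m t)
    = gr_action d (d + m) b (coordinate_point (d + m) (schubert_word d (d + m) t))"
proof -
  let ?N = "d + m" and ?\<sigma> = "schubert_index (d + m) t"
  \<comment> \<open>\<open>b\<close> adds row \<open>N - 1 - i\<close> to row \<open>i\<close> for \<open>i < t\<close>; these are upper triangular operations as
    \<open>i < N - 1 - i\<close>\<close>
  define b :: "complex mat" where "b = mat ?N ?N (\<lambda>(i, j). if i = j \<or> i + j = ?N - 1 \<and> i < t then 1 else 0)"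
  have bc: "b \<in> carrier_mat ?N ?N" by (simp add: b_def)
  have up: "upper_triangular b" using t by (auto simp: upper_triangular_def b_def)
  have "0 \<notin> set (diag_mat b)" by (auto simp: diag_mat_def b_def)
  then have "det b \<noteq> 0" using upper_triangular_imp_det_eq_0_iff[OF bc up] by simp
  then have bB: "b \<in> upper_borel ?N" and bG: "b \<in> carrier (GL ?N)"
    using bc up by (auto simp: upper_borel_def GL_carrier)
  note inj = schubert_index_inj[OF t]
  have cc: "1\<^sub>m d @\<^sub>r corner_matrix d m t \<in> carrier_mat ?N d" by (rule append_one_carrier[OF corner_matrix_carrier])
  have "b * coordinate_matrix ?N d ?\<sigma> = 1\<^sub>m d @\<^sub>r corner_matrix d m t"
  proof (rule eq_matI)
    fix i j assume "i < dim_row (1\<^sub>m d @\<^sub>r corner_matrix d m t)" "j < dim_col (1\<^sub>m d @\<^sub>r corner_matrix d m t)"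
    then have ij: "i < ?N" "j < d" using carrier_matD[OF cc] by auto
    have s: "?\<sigma> j < ?N" using inj(2) ij(2) by auto
    have "(i = ?\<sigma> j \<or> i + ?\<sigma> j = ?N - 1 \<and> i < t) = (if i < d then i = j else i - d + j = m - 1 \<and> j < t)"
      using ij t by (cases "j < t") (simp add: schubert_index_def; linarith)+
    moreover have "i - d < m" if "\<not> i < d" using ij(1) that by simp
    ultimately show "(b * coordinate_matrix ?N d ?\<sigma>) $$ (i, j) = (1\<^sub>m d @\<^sub>r corner_matrix d m t) $$ (i, j)"
      unfolding mult_coordinate_matrix[OF bc ij, of ?\<sigma>, OF s] append_one_entry[OF corner_matrix_carrier ij]
      using ij s by (simp add: b_def corner_matrix_def)
  qed (use carrier_matD[OF cc] carrier_matD[OF bc] in simp_all)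
  then have "cell_chart d ?N (corner_matrix d m t) = gr_action d ?N b (coordinate_point ?N (schubert_word d ?N t))"
    unfolding schubert_point[OF t] gr_action_coordinate[OF bG inj] cell_chart_def by simp
  then show ?thesis using bB by blast
qed

lemma corner_orbit_borel_orbit:
  assumes t: "t \<le> d" "t \<le> m" and A: "A \<in> corner_orbit d m t"
  shows "cell_chart d (d + m) A \<in> orbit (GL_sub (d + m) (upper_borel (d + m))) (gr_action d (d + m))
    (coordinate_point (d + m) (schubert_word d (d + m) t))"
proof -
  let ?N = "d + m" and ?e = "coordinate_point (d + m) (schubert_word d (d + m) t)"
  obtain h where h: "h \<in> levi_borel d m" "A = levi_act d m h (corner_matrix d m t)"
    using A unfolding corner_orbit_def by blast
  obtain b where b: "b \<in> upper_borel ?N" "cell_chart d ?N (corner_matrix d m t) = gr_action d ?N b ?e"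
    using corner_matrix_borel_orbit[OF t] by blast
  have hL: "h \<in> levi d m" and hB: "h \<in> upper_borel ?N"
    using h(1) levi_borel_levi levi_borel_upper_borel by blast+
  have G: "h \<in> carrier (GL ?N)" "b \<in> carrier (GL ?N)"
    using hB b(1) by (auto simp: upper_borel_def)
  have e: "?e \<in> grassmannian d ?N" using schubert_point_rank_locus[OF t] rank_locus_grassmannian by blast
  have "cell_chart d ?N A = gr_action d ?N (h * b) ?e"
    unfolding h(2) gr_action_chart[OF hL corner_matrix_carrier, symmetric] b(2) gr_action_mult[OF G e] ..
  moreover have "h * b \<in> upper_borel ?N" using subgroup.m_closed[OF upper_borel_subgroup hB b(1)] by simp
  ultimately show ?thesis unfolding orbit_def by auto
qed

lemma pluecker_polynomial:
  assumes f: "f \<in> homogeneous_polynomials d N" and M: "\<And>u. M u \<in> carrier_mat N d"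
    and entries: "\<And>i j. i < N \<Longrightarrow> j < d \<Longrightarrow> (\<lambda>u. M u $$ (i, j)) \<in> function_algebra C"
  shows "(\<lambda>u. f (pluecker d N (M u))) \<in> function_algebra C"
proof (rule fa_subst[where f = f and \<phi> = "\<lambda>u. pluecker d N (M u)"])
  show "f \<in> function_algebra ((\<lambda>I p. p I) ` pluecker_index d N)"
    using f by (simp add: homogeneous_polynomials_def)
  fix c :: "(nat set \<Rightarrow> complex) \<Rightarrow> complex" assume "c \<in> (\<lambda>I p. p I) ` pluecker_index d N"
  then obtain I where I: "I \<in> pluecker_index d N" "c = (\<lambda>p. p I)" by blast
  show "(\<lambda>u. c (pluecker d N (M u))) \<in> function_algebra C"
    unfolding I(2) pluecker_minor[OF M I(1)] by (rule fa_det) (rule entries, rule pick_less[OF I(1)])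
qed

lemma affine_line_common_nonzero:
  fixes f g :: "complex \<Rightarrow> complex"
  assumes f: "f \<in> function_algebra {\<lambda>s. s}" "f a \<noteq> 0" and g: "g \<in> function_algebra {\<lambda>s. s}" "g b \<noteq> 0"
  shows "\<exists>s. f s \<noteq> 0 \<and> g s \<noteq> 0"
proof -
  have id: "\<exists>p. \<forall>\<tau>. c \<tau> = poly p \<tau>" if "c \<in> {\<lambda>s :: complex. s}" for c
    using that by (intro exI[of _ "[:0, 1:]"]) simp
  obtain p where p: "\<And>s. f s = poly p s" using fa_along_polynomial_curve[OF f(1) id] by blast
  obtain q where q: "\<And>s. g s = poly q s" using fa_along_polynomial_curve[OF g(1) id] by blast
  have "p \<noteq> 0" "q \<noteq> 0" using f(2) g(2) p q by auto
  then have "p * q \<noteq> 0" by simp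
  then obtain s where "poly (p * q) s \<noteq> 0" using poly_all_0_iff_0 by blast
  then show ?thesis using p q by auto
qed

text \<open>On the line through a basis matrix \<open>M\<close> of \<open>W\<close> and \<open>(1; 0)\<close> the rank of the lower rows
  stays bounded, because they are only rescaled. All but finitely many matrices on it have an
  invertible upper block and give points where \<open>f\<close> does not vanish, as each of the two
  conditions holds at one of the two given matrices.\<close>

lemma rank_locus_meets_chart:
  assumes f: "f \<in> homogeneous_polynomials d (d + m)" and W: "W \<in> rank_locus d m t" "W \<in> gr_basic d (d + m) f"
  shows "\<exists>A \<in> det_variety d m t. f (pluecker d (d + m) (1\<^sub>m d @\<^sub>r A)) \<noteq> 0"
proof -
  let ?N = "d + m"
  obtain M where M: "M \<in> carrier_mat ?N d" "nonsing M {..<?N} {..<d}" "factors m d t (lower_rows d m M)"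
      "W = vec_space.col_space ?N M"
    using W(1) unfolding rank_locus_def by blast
  have fM: "f (pluecker d ?N M) \<noteq> 0" using W(2) gr_basic_iff[OF f M(1,2)] M(4) by simp
  define L where "L = (\<lambda>s. mat ?N d (\<lambda>(i, j). (1 - s) * M $$ (i, j) + s * (if i = j then 1 else 0)))"
  have Lc: "L s \<in> carrier_mat ?N d" for s by (simp add: L_def)
  have ent: "(\<lambda>s. L s $$ (i, j)) \<in> function_algebra {\<lambda>s. s}" if "i < ?N" "j < d" for i j
  proof -
    have "(\<lambda>s. (1 - s) * M $$ (i, j) + s * (if i = j then 1 else 0)) \<in> function_algebra {\<lambda>s. s}"
      by (intro function_algebra.add function_algebra.mult fa_diff function_algebra.const function_algebra.coord) auto
    then show ?thesis using that by (simp add: L_def)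
  qed
  have "L 0 = M" using M(1) by (auto simp: L_def)
  then have f0: "f (pluecker d ?N (L 0)) \<noteq> 0" using fM by simp
  have "mat d d (\<lambda>(i, j). L 1 $$ (i, j)) = 1\<^sub>m d" by (auto simp: L_def)
  then have d1: "det (mat d d (\<lambda>(i, j). L 1 $$ (i, j))) \<noteq> 0" by simp
  have detp: "(\<lambda>s. det (mat d d (\<lambda>(i, j). L s $$ (i, j)))) \<in> function_algebra {\<lambda>s. s}"
    by (rule fa_det) (rule ent, simp_all)
  obtain s where s: "f (pluecker d ?N (L s)) \<noteq> 0" "det (mat d d (\<lambda>(i, j). L s $$ (i, j))) \<noteq> 0"
    using affine_line_common_nonzero[OF pluecker_polynomial[OF f Lc ent] f0 detp d1] by blast
  obtain x y where xy: "\<And>i j. i < m \<Longrightarrow> j < d \<Longrightarrow> lower_rows d m M $$ (i, j) = (\<Sum>p<t. x i p * y p j)"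
    using M(3) unfolding factors_def by blast
  have "factors m d t (lower_rows d m (L s))"
  proof (rule factorsI[where x = "\<lambda>i p. (1 - s) * x i p" and y = y])
    fix i j assume ij: "i < m" "j < d"
    have "lower_rows d m (L s) $$ (i, j) = (1 - s) * lower_rows d m M $$ (i, j)" using ij by (simp add: lower_rows_def L_def)
    then show "lower_rows d m (L s) $$ (i, j) = (\<Sum>p<t. (1 - s) * x i p * y p j)"
      using xy[OF ij] by (simp add: sum_distrib_left mult.assoc)
  qed
  then obtain A where A: "A \<in> carrier_mat m d" "vec_space.col_space ?N (L s) = cell_chart d ?N A" "factors m d t A"
    using invertible_top_in_chart[OF Lc s(2)] by blast
  note Ac = append_one_carrier[OF A(1)] and An = append_one_nonsing[OF A(1)]
  have "vec_space.col_space ?N (1\<^sub>m d @\<^sub>r A) \<in> gr_basic d ?N f"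
    using A cell_chart_grassmannian[OF A(1)] Lc[of s] s(1) unfolding gr_basic_def cell_chart_def by auto
  then show ?thesis using gr_basic_iff[OF f Ac An] A det_variety_iff by blast
qed

text \<open>One inclusion holds because the locus is closed, contains \<open>e\<^sub>w\<close> and is stable under block
  upper triangular matrices. Conversely, a basic neighbourhood of a point of the locus contains
  a point of the chart, hence a point of the dense orbit in the determinantal variety, and this
  orbit lies in the Borel orbit of \<open>e\<^sub>w\<close>.\<close>

lemma schubert_variety_rank_locus:
  assumes t: "t \<le> d" "t \<le> m"
  shows "schubert_variety d (d + m) (schubert_word d (d + m) t) = rank_locus d m t"
proof
  let ?N = "d + m" and ?e = "coordinate_point (d + m) (schubert_word d (d + m) t)"
  let ?O = "orbit (GL_sub ?N (upper_borel ?N)) (gr_action d ?N) ?e"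
  have "?O \<subseteq> rank_locus d m t"
  proof
    fix W assume "W \<in> ?O"
    then obtain b where "b \<in> upper_borel ?N" "W = gr_action d ?N b ?e" unfolding orbit_def by auto
    then show "W \<in> rank_locus d m t"
      using parabolic_rank_locus[OF _ schubert_point_rank_locus[OF t]] upper_borel_parabolic by blast
  qed
  then show "schubert_variety d ?N (schubert_word d ?N t) \<subseteq> rank_locus d m t"
    unfolding schubert_variety_def by (rule closure_of_minimal[OF _ rank_locus_closed])
  show "rank_locus d m t \<subseteq> schubert_variety d ?N (schubert_word d ?N t)"
    unfolding schubert_variety_def
  proof (intro subsetI)
    fix W assume W: "W \<in> rank_locus d m t"
    have "\<exists>Y. Y \<in> ?O \<and> Y \<in> T" if T: "W \<in> T" "openin (zariski_gr d ?N) T" for T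
    proof -
      obtain f where f: "f \<in> homogeneous_polynomials d ?N" "W \<in> gr_basic d ?N f" "gr_basic d ?N f \<subseteq> T"
        using zariski_gr_base[OF T(2,1)] by blast
      obtain A where A: "A \<in> det_variety d m t" "f (pluecker d ?N (1\<^sub>m d @\<^sub>r A)) \<noteq> 0"
        using rank_locus_meets_chart[OF f(1) W f(2)] by blast
      define S where "S = (\<lambda>B :: complex mat. mat ?N d (\<lambda>(i, j). if i < d then if i = j then 1 else 0 else B $$ (i - d, j)))"
      have Sc: "S B \<in> carrier_mat ?N d" for B by (simp add: S_def)
      have SB: "S B = 1\<^sub>m d @\<^sub>r B" if "B \<in> carrier_mat m d" for B
        using append_one_carrier[OF that] append_one_entry[OF that] by (intro eq_matI) (auto simp: S_def)
      have ent: "(\<lambda>B. S B $$ (i, j)) \<in> function_algebra (mat_coords m d)" if "i < ?N" "j < d" for i j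
      proof (cases "i < d")
        case False
        then show ?thesis using that mat_coord_fa[of "i - d" m j d] by (auto simp: S_def)
      qed (use that in \<open>auto simp: S_def intro: function_algebra.const\<close>)
      have F: "(\<lambda>B. f (pluecker d ?N (S B))) \<in> function_algebra (mat_coords m d)"
        by (rule pluecker_polynomial[OF f(1) Sc ent])
      let ?V = "det_variety d m t"
      let ?U = "{B \<in> carrier_mat m d. f (pluecker d ?N (S B)) \<noteq> 0} \<inter> ?V"
      have Ac: "A \<in> carrier_mat m d" by (rule det_variety_carrier[OF A(1)])
      have AU: "A \<in> ?U" using A SB[OF Ac] Ac by simp
      have oU: "openin (subtopology (zariski_mat m d) ?V) ?U"
        using openin_zariski_mat_basic[OF F] unfolding openin_subtopology by blast
      have "A \<in> (subtopology (zariski_mat m d) ?V) closure_of (corner_orbit d m t)"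
        using corner_orbit_dense[OF t(2,1)] A(1) by simp
      then have "\<And>U. A \<in> U \<and> openin (subtopology (zariski_mat m d) ?V) U \<Longrightarrow> \<exists>B. B \<in> corner_orbit d m t \<and> B \<in> U"
        unfolding in_closure_of by blast
      from this[OF conjI[OF AU oU]] obtain B where B: "B \<in> corner_orbit d m t" "B \<in> ?U" by (elim exE conjE)
      then have Bc: "B \<in> carrier_mat m d" and fB: "f (pluecker d ?N (1\<^sub>m d @\<^sub>r B)) \<noteq> 0" using SB by auto
      have "cell_chart d ?N B \<in> gr_basic d ?N f"
        unfolding cell_chart_def gr_basic_iff[OF f(1) append_one_carrier[OF Bc] append_one_nonsing[OF Bc]] by (rule fB)
      then show ?thesis using corner_orbit_borel_orbit[OF t B(1)] f(3) by blast
    qed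
    then show "W \<in> zariski_gr d ?N closure_of ?O"
      unfolding in_closure_of topspace_zariski_gr using subsetD[OF rank_locus_grassmannian W] by blast
  qed
qed

lemma opposite_cell_det_variety:
  assumes t: "t \<le> d" "t \<le> m"
  shows "opposite_cell d (d + m) (schubert_word d (d + m) t) = cell_chart d (d + m) ` det_variety d m t"
proof -
  have "cell_chart d (d + m) A \<in> rank_locus d m t \<longleftrightarrow> A \<in> det_variety d m t" if A: "A \<in> carrier_mat m d" for A
    unfolding cell_chart_def rank_locus_iff[OF append_one_carrier[OF A] append_one_nonsing[OF A]]
      lower_rows_append_one[OF A] det_variety_iff using A by simp
  then show ?thesis
    unfolding opposite_cell_def opposite_big_cell_chart schubert_variety_rank_locus[OF t]
    using det_variety_carrier by blast
qed

section \<open>The stabilizer and its Levi subgroup\<close>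

text \<open>The \<open>m\<close> last rows of an invertible matrix are independent: multiplied by the inverse they
  become unit vectors.\<close>

lemma invertible_rows_not_factors:
  assumes g: "g \<in> carrier (GL (d + m))" and t: "t < m"
  shows "\<not> factors m (d + m) t (mat m (d + m) (\<lambda>(i, j). g $$ (d + i, j)))"
proof
  let ?N = "d + m" and ?G = "mat m (d + m) (\<lambda>(i, j). g $$ (d + i, j))" and ?h = "inv\<^bsub>GL (d + m)\<^esub> g"
  assume "factors m ?N t ?G"
  have Gc: "?G \<in> carrier_mat m ?N" by simp
  note h = GL_inv[OF g]
  have "factors m ?N t (?G * ?h)" by (rule factors_mult_right[OF Gc h(1) \<open>factors m ?N t ?G\<close>])
  then have "det (mat (Suc t) (Suc t) (\<lambda>(p, q). (?G * ?h) $$ (p, d + q))) = 0"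
    by (rule det_factors_0) (use t in auto)
  moreover have "mat (Suc t) (Suc t) (\<lambda>(p, q). (?G * ?h) $$ (p, d + q)) = 1\<^sub>m (Suc t)"
  proof (rule eq_matI)
    fix p q assume "p < dim_row (1\<^sub>m (Suc t) :: complex mat)" "q < dim_col (1\<^sub>m (Suc t) :: complex mat)"
    then have pq: "p < Suc t" "q < Suc t" "p < m" "d + q < ?N" "d + p < ?N" using t by auto
    have "(?G * ?h) $$ (p, d + q) = (g * ?h) $$ (d + p, d + q)"
      unfolding mat_mult_entry[OF Gc h(1) pq(3,4)] mat_mult_entry[OF GL_carrier_mat[OF g] h(1) pq(5,4)] using pq by simp
    then show "mat (Suc t) (Suc t) (\<lambda>(p, q). (?G * ?h) $$ (p, d + q)) $$ (p, q) = 1\<^sub>m (Suc t) $$ (p, q)"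
      unfolding h(2) using pq by simp
  qed auto
  ultimately show False by simp
qed

text \<open>Suppose a lower row of \<open>g\<close> has a nonzero entry in a column \<open>j0 < d\<close>. This entry extends to
  a nonsingular block of size \<open>t + 1\<close> in the lower rows of \<open>g\<close>. The basis vectors of its columns
  and further ones among the first \<open>d\<close> span a coordinate subspace with at most \<open>t\<close> lower basis
  vectors, since \<open>j0\<close> is not one; it lies in the locus, but its image under \<open>g\<close> does not.\<close>

lemma rank_locus_stabilizer_parabolic:
  assumes t: "t < d" "t < m" and g: "g \<in> carrier (GL (d + m))"
    and stab: "\<And>W. W \<in> rank_locus d m t \<Longrightarrow> gr_action d (d + m) g W \<in> rank_locus d m t"
    and ij: "d \<le> i0" "i0 < d + m" "j0 < d"
  shows "g $$ (i0, j0) = 0"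
proof (rule ccontr)
  assume nz: "g $$ (i0, j0) \<noteq> 0"
  let ?N = "d + m" and ?G = "mat m (d + m) (\<lambda>(i, j). g $$ (d + i, j))"
  have ns0: "nonsing ?G {i0 - d} {j0}" using nz ij by (auto simp: nonsing_def)
  have "\<exists>K L. K \<subseteq> {..<m} \<and> L \<subseteq> {..<?N} \<and> {j0} \<subseteq> L \<and> card K = Suc t \<and> card L = Suc t \<and> nonsing ?G K L"
    by (rule nonsing_block_extension[OF invertible_rows_not_factors[OF g t(2)] _ _ _ _ ns0]) (use ij in auto)
  then obtain K L where KL: "K \<subseteq> {..<m}" "L \<subseteq> {..<?N}" "j0 \<in> L" "card K = Suc t" "card L = Suc t" "nonsing ?G K L"
    by auto
  have fin: "finite K" "finite L" using KL(1,2) finite_subset by blast+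
  \<comment> \<open>fill up \<open>L\<close> to \<open>d\<close> indices by upper ones\<close>
  have "d - Suc t \<le> card ({..<d} - L)" using diff_card_le_card_Diff[OF fin(2), of "{..<d}"] KL(5) by simp
  then obtain R where R: "R \<subseteq> {..<d} - L" "card R = d - Suc t" "finite R" using obtain_subset_with_card_n by metis
  let ?S = "L \<union> R"
  have "card ?S = d" using card_Un_disjoint[OF fin(2) R(3)] R(1,2) KL(5) t(1) by auto
  then obtain \<sigma> where \<sigma>: "bij_betw \<sigma> {..<d} ?S"
    using ex_bij_betw_nat_finite[of ?S] fin(2) R(3) by (auto simp: atLeast0LessThan)
  have inj: "inj_on \<sigma> {..<d}" and im: "\<sigma> ` {..<d} = ?S" using \<sigma> by (auto simp: bij_betw_def)
  have rg: "\<sigma> ` {..<d} \<subseteq> {..<?N}" unfolding im using KL(2) R(1) by auto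
  have "card {j. j < d \<and> d \<le> \<sigma> j} \<le> t"
  proof -
    have "\<sigma> ` {j. j < d \<and> d \<le> \<sigma> j} \<subseteq> L - {j0}" using im R(1) ij(3) by fastforce
    then have "card (\<sigma> ` {j. j < d \<and> d \<le> \<sigma> j}) \<le> card (L - {j0})" using fin(2) by (intro card_mono) auto
    moreover have "card (L - {j0}) = t" using KL(3,5) fin(2) by simp
    moreover have "inj_on \<sigma> {j. j < d \<and> d \<le> \<sigma> j}" using inj by (rule inj_on_subset) auto
    ultimately show ?thesis by (simp add: card_image)
  qed
  note lf = coordinate_matrix_lower_factors[OF this, of m]
  let ?E = "coordinate_matrix ?N d \<sigma>"
  note En = coordinate_matrix_nonsing[OF inj rg]
  have gE: "g * ?E \<in> carrier_mat ?N d" by (rule mult_carrier_mat[OF GL_carrier_mat[OF g] coordinate_matrix_carrier(1)])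
  have "vec_space.col_space ?N ?E \<in> rank_locus d m t"
    unfolding rank_locus_iff[OF coordinate_matrix_carrier(1) En] by (rule lf)
  then have "vec_space.col_space ?N (g * ?E) \<in> rank_locus d m t"
    using stab gr_action_coordinate[OF g inj rg] by metis
  then have fac: "factors m d t (lower_rows d m (g * ?E))"
    using rank_locus_iff[OF gE GL_mult_nonsing[OF g coordinate_matrix_carrier(1) En]] by simp
  obtain \<kappa> where \<kappa>: "bij_betw \<kappa> {..<Suc t} K"
    using ex_bij_betw_nat_finite[OF fin(1)] KL(4) by (auto simp: atLeast0LessThan)
  obtain \<mu> where \<mu>: "bij_betw \<mu> {..<Suc t} L"
    using ex_bij_betw_nat_finite[OF fin(2)] KL(5) by (auto simp: atLeast0LessThan)
  define \<nu> where "\<nu> = (\<lambda>q. the_inv_into {..<d} \<sigma> (\<mu> q))"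
  have \<kappa>m: "\<kappa> p < m" if "p < Suc t" for p using \<kappa> KL(1) that by (auto simp: bij_betw_def)
  have \<mu>S: "\<mu> q \<in> \<sigma> ` {..<d}" if "q < Suc t" for q unfolding im using \<mu> that by (auto simp: bij_betw_def)
  have \<nu>: "\<nu> q < d" "\<sigma> (\<nu> q) = \<mu> q" if "q < Suc t" for q
    using the_inv_into_into[OF inj \<mu>S[OF that] order_refl] f_the_inv_into_f[OF inj \<mu>S[OF that]]
    by (auto simp: \<nu>_def)
  have "det (mat (Suc t) (Suc t) (\<lambda>(p, q). lower_rows d m (g * ?E) $$ (\<kappa> p, \<nu> q))) = 0"
    by (rule det_factors_0[OF fac]) (use \<kappa>m \<nu> in auto)
  moreover have "mat (Suc t) (Suc t) (\<lambda>(p, q). lower_rows d m (g * ?E) $$ (\<kappa> p, \<nu> q))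
      = mat (Suc t) (Suc t) (\<lambda>(p, q). ?G $$ (\<kappa> p, \<mu> q))"
  proof (rule eq_matI)
    fix p q assume "p < dim_row (mat (Suc t) (Suc t) (\<lambda>(p, q). ?G $$ (\<kappa> p, \<mu> q)))"
      "q < dim_col (mat (Suc t) (Suc t) (\<lambda>(p, q). ?G $$ (\<kappa> p, \<mu> q)))"
    then have pq: "p < Suc t" "q < Suc t" by auto
    have \<mu>N: "\<mu> q < ?N" using \<mu>S[OF pq(2)] rg by auto
    have "(g * ?E) $$ (d + \<kappa> p, \<nu> q) = g $$ (d + \<kappa> p, \<sigma> (\<nu> q))"
      by (rule mult_coordinate_matrix[OF GL_carrier_mat[OF g]]) (use \<kappa>m[OF pq(1)] \<nu>[OF pq(2)] \<mu>N in auto)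
    then show "mat (Suc t) (Suc t) (\<lambda>(p, q). lower_rows d m (g * ?E) $$ (\<kappa> p, \<nu> q)) $$ (p, q)
        = mat (Suc t) (Suc t) (\<lambda>(p, q). ?G $$ (\<kappa> p, \<mu> q)) $$ (p, q)"
      using pq \<kappa>m[OF pq(1)] \<nu>[OF pq(2)] \<mu>N by (simp add: lower_rows_def)
  qed auto
  moreover have "det (mat (Suc t) (Suc t) (\<lambda>(p, q). ?G $$ (\<kappa> p, \<mu> q))) \<noteq> 0"
    by (rule nonsing_imp_det[OF KL(6) \<kappa> \<mu>])
  ultimately show False by simp
qed

lemma schubert_stabilizer_parabolic:
  assumes t: "t < d" "t < m"
  shows "schubert_stabilizer d (d + m) (schubert_word d (d + m) t) = parabolic d m"
proof -
  let ?N = "d + m" and ?Z = "rank_locus d m t"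
  have X: "schubert_variety d ?N (schubert_word d ?N t) = ?Z" using t by (intro schubert_variety_rank_locus) auto
  have eq: "schubert_stabilizer d ?N (schubert_word d ?N t) = {g \<in> carrier (GL ?N). gr_action d ?N g ` ?Z = ?Z}"
    unfolding schubert_stabilizer_def stabilizer_def X ..
  have sup: "gr_action d ?N g ` ?Z = ?Z" if g: "g \<in> parabolic d m" for g
  proof
    have gG: "g \<in> carrier (GL ?N)" by (rule pattern_group_GL[OF g])
    have ig: "inv\<^bsub>GL ?N\<^esub> g \<in> parabolic d m" by (rule pattern_group_inverse[OF _ _ g]) auto
    have iG: "inv\<^bsub>GL ?N\<^esub> g \<in> carrier (GL ?N)" by (rule pattern_group_GL[OF ig])
    show "gr_action d ?N g ` ?Z \<subseteq> ?Z" using parabolic_rank_locus[OF g] by blast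
    show "?Z \<subseteq> gr_action d ?N g ` ?Z"
    proof
      fix W assume W: "W \<in> ?Z"
      then have WG: "W \<in> grassmannian d ?N" using rank_locus_grassmannian by blast
      have "gr_action d ?N g (gr_action d ?N (inv\<^bsub>GL ?N\<^esub> g) W) = W"
        using gr_action_mult[OF gG iG WG] GL_inv(2)[OF gG] gr_action_one[OF WG] by simp
      then show "W \<in> gr_action d ?N g ` ?Z" using parabolic_rank_locus[OF ig W] by (metis imageI)
    qed
  qed
  have sub: "g \<in> parabolic d m" if g: "g \<in> carrier (GL ?N)" "gr_action d ?N g ` ?Z = ?Z" for g
    unfolding pattern_group_def
  proof (intro CollectI conjI allI impI g(1))
    fix i j assume "i < ?N" "j < ?N" "\<not> (j < d \<longrightarrow> i < d)"
    then show "g $$ (i, j) = 0" by (intro rank_locus_stabilizer_parabolic[OF t g(1)]) (use g(2) in auto)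
  qed
  show ?thesis unfolding eq
  proof (intro equalityI subsetI)
    fix g assume "g \<in> {g \<in> carrier (GL ?N). gr_action d ?N g ` ?Z = ?Z}"
    then show "g \<in> parabolic d m" by (elim CollectE conjE) (rule sub)
  next
    fix g assume g: "g \<in> parabolic d m"
    show "g \<in> {g \<in> carrier (GL ?N). gr_action d ?N g ` ?Z = ?Z}"
      by (intro CollectI conjI pattern_group_GL[OF g] sup[OF g])
  qed
qed

text \<open>The only block boundary is \<open>d\<close>: for \<open>k \<noteq> d\<close> the elementary matrix \<open>1 + E\<^bsub>k,k-1\<^esub>\<close> is block
  upper triangular and has a nonzero entry in row \<open>k\<close> and column \<open>k - 1\<close>.\<close>

lemma schubert_levi_eq:
  assumes t: "t < d" "t < m"
  shows "schubert_levi d (d + m) (schubert_word d (d + m) t) = levi d m"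
proof -
  let ?N = "d + m"
  have "block_boundaries ?N (parabolic d m) = {d}"
  proof (intro equalityI subsetI)
    fix k assume "k \<in> block_boundaries ?N (parabolic d m)"
    then have k: "0 < k" "k < ?N" "\<And>g. g \<in> parabolic d m \<Longrightarrow> g $$ (k, k - 1) = 0"
      unfolding block_boundaries_def by auto
    show "k \<in> {d}"
    proof (rule ccontr)
      assume "k \<notin> {d}"
      let ?r = "row_transvection ?N k (\<lambda>q. if q = k - 1 then 1 else 0)"
      have "?r \<in> parabolic d m"
        by (rule row_transvection_pattern) (use k(1,2) \<open>k \<notin> {d}\<close> in auto)
      then have "?r $$ (k, k - 1) = 0" by (rule k(3))
      then show False using k(1,2) by (auto simp: row_transvection_def split: if_splits)
    qed
  next
    fix k assume "k \<in> {d}"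
    then show "k \<in> block_boundaries ?N (parabolic d m)"
      unfolding block_boundaries_def using t pattern_groupD[of _ ?N "parabolic_pattern d"] by auto
  qed
  then show ?thesis
    unfolding schubert_levi_def block_diagonal_levi_def schubert_stabilizer_parabolic[OF t] pattern_group_def
    by auto
qed

theorem corollary4p1p6:
  fixes d N t :: nat and w :: "nat list"
  assumes "0 < d" and "d < N"
    and "1 \<le> t" and "t < min d (N - d)"
    and "w = [t + 1..<d + 1] @ [N - t + 1..<N + 1]"
  shows "bij_betw (cell_chart d N) (determinantal_variety (N - d) d t) (opposite_cell d N w) \<and>
    (\<forall>g \<in> schubert_levi d N w. gr_action d N g ` opposite_cell d N w \<subseteq> opposite_cell d N w) \<and>
    spherical_variety N (schubert_levi d N w) (N - d) d (determinantal_variety (N - d) d t)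
      (cell_action d N (determinantal_variety (N - d) d t))"
proof -
  obtain m where N: "N = d + m" using assms(2) less_imp_add_positive by blast
  have t: "t < d" "t < m" using assms(4) N by auto
  have w: "w = schubert_word d (d + m) t" using assms(5) N by simp
  have cell: "opposite_cell d N w = cell_chart d N ` det_variety d m t"
    unfolding N w using t by (intro opposite_cell_det_variety) auto
  have lv: "schubert_levi d N w = levi d m" unfolding N w by (rule schubert_levi_eq[OF t])
  have "inj_on (cell_chart d N) (det_variety d m t)"
    unfolding N by (rule inj_onI) (rule cell_chart_inj[OF det_variety_carrier det_variety_carrier])
  then have bij: "bij_betw (cell_chart d N) (det_variety d m t) (opposite_cell d N w)"
    unfolding cell bij_betw_def by simp
  have stable: "gr_action d N g ` opposite_cell d N w \<subseteq> opposite_cell d N w" if g: "g \<in> levi d m" for g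
    unfolding cell unfolding N using gr_action_chart[OF g det_variety_carrier] levi_act_det_variety by fastforce
  have "spherical_variety N (levi d m) m d (det_variety d m t) (cell_action d N (det_variety d m t))"
    unfolding N using t by (intro determinantal_spherical) auto
  then show ?thesis using bij stable lv N by simp
qed

end
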